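(* Let $r\in\mathbb{Z}_{\ge0}$, let $\mathcal{S}$ be a strict symmetric monoidal category which is additive and idempotent-complete (and, if $r=0$, has countable direct sums which distribute over the tensor product). Let $A\in\mathcal{S}$ be a Frobenius algebra with invertible window element $\tau$ and with $N^r=\mathrm{id}_A$ ($N$ the Nakayama automorphism), and let $\mathcal{Z}_A$ be the state-sum $r$-spin topological field theory of $A$. Then the $\mathbb{Z}_r$-graded center $Z^r(A)$ is equal to $\bigoplus_{\lambda\in\mathbb{Z}_r}\mathcal{Z}_A(\lambda)$ with product and unit (restricted to the corresponding graded components) given by $\mathcal{Z}_A(S_{1,2}(0,0,0,\lambda_1,\lambda_2))$ and $\mathcal{Z}_A(S_{1,0})$, respectively. For $r>0$, we obtain an equality of Frobenius algebras, the coproduct and counit (restricted to the corresponding graded components) being given by $\mathcal{Z}_A(S_{2,1}(0,0,0,\lambda_1,\lambda_2))$ and $\mathcal{Z}_A(S_{0,1})$, respectively.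
   Context: **r-spin surfaces.** $\mathbb{Z}_r=\mathbb{Z}/r\mathbb{Z}$ (so $\mathbb{Z}_0=\mathbb{Z}$). A surface is an oriented smooth 2-manifold (possibly with boundary); $F_{GL}\Sigma$ is its bundle of oriented frames. $p_{GL}:\widetilde{GL}\to GL_2^+(\mathbb{R})$ is the $r$-fold connected cover ($r>0$) or the universal cover ($r=0$), with fibres isomorphic to $\mathbb{Z}_r$. An $r$-spin structure on $\Sigma$ is a principal $\widetilde{GL}$-bundle $P\to\Sigma$ with a bundle map $p:P\to F_{GL}\Sigma$ over $\Sigma$ intertwining the (right) actions; $p$ is a principal $\mathbb{Z}_r$-bundle. A morphism of $r$-spin surfaces is a bundle map covering the map $df_*$ of frame bundles for a local diffeomorphism $f$ of the surfaces. For $\kappa\in\mathbb{Z}_r$ (using a fixed set of integer representatives) $\mathbb{C}^\kappa$ is the $r$-spin structure on $\mathbb{C}^\times$ with trivial bundle $\widetilde{GL}\times\mathbb{C}^\times$ and $p^\kappa(g,z)=(z^\kappa.p_{GL}(g),z)$, where $z$ acts by left multiplication with the real $2\times2$ matrix of multiplication by $z$. **Boundary parametrisations.** An ingoing (outgoing) collar is the intersection of an open neighbourhood of the unit circle in $\mathbb{C}^\times$ with $\{|z|\ge1\}$ ($\{|z|\le1\}$). A boundary parametrisation of $\Sigma$ is a decomposition $\pi_0(\partial\Sigma)=B_{in}\sqcup B_{out}$ and orientation preserving embeddings $\phi_{in}$ of ingoing collars $U_b$, $b\in B_{in}$, and $\phi_{out}$ of outgoing collars $V_c$, $c\in B_{out}$,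 into $\Sigma$, mapping the unit circle diffeomorphically to the respective boundary component. An $r$-spin boundary parametrisation consists in addition of maps $\lambda:B_{in}\to\mathbb{Z}_r$, $\mu:B_{out}\to\mathbb{Z}_r$ and morphisms of $r$-spin surfaces $\varphi_{in}:\bigsqcup_b\mathbb{C}^{\lambda_b}|_{U_b}\to\Sigma$, $\varphi_{out}:\bigsqcup_c\mathbb{C}^{\mu_c}|_{V_c}\to\Sigma$ covering $\phi_{in},\phi_{out}$. Diffeomorphisms of $r$-spin surfaces with boundary parametrisation are diffeomorphisms of $r$-spin surfaces preserving $B_{in},B_{out},\lambda,\mu$ and the germs of $\varphi_{in},\varphi_{out}$. **Bordism category $\mathcal{B}ord_2^{\,r}$.** Objects are pairs $(X,\rho)$, $X$ a finite set, $\rho:X\to\mathbb{Z}_r$; $\lambda\in\mathbb{Z}_r$ is regarded as an object with one-element set. Morphisms $(X,\rho)\to(Y,\sigma)$ are compact $r$-spin surfaces with $r$-spin boundary parametrisation and bijections $\beta_{in}:X\to B_{in}$, $\beta_{out}:Y\to B_{out}$ with $\lambda\circ\beta_{in}=\rho$, $\mu\circ\beta_{out}=\sigma$, modulo diffeomorphisms of $r$-spin surfaces with boundary parametrisation compatible with $\beta_{in},\beta_{out}$. Composition is gluing, the tensor product is disjoint union. **Marked PLCW decompositions.** A PLCW decomposition of a compact surface $\Sigma$ presents $\Sigma$ as glued from finitely many polygons ($n$-gons, $n\ge1$) along sides (sides of the same polygon may be glued to each other); $\Sigma_2,\Sigma_1,\Sigma_0$ are the sets of faces, edges, vertices. Only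 decompositions with exactly one vertex and one edge on each boundary component are considered; boundary components are identified with boundary edges and with boundary vertices. A marking consists of a marked side for each face, an orientation of each edge, and an edge index $s_e\in\mathbb{Z}_r$ for each $e\in\Sigma_1$. Faces are oriented as $\Sigma$. For $v\in\Sigma_0$ let $D_v$ be the number of faces whose marked side has $v$ as its boundary vertex in clockwise direction (with respect to the face); $N_v$ the number of edges starting at $v$ plus the number of edges ending at $v$; for an edge $e$ at $v$ let $\hat s_e=-1$ if $e$ starts and ends at $v$, $\hat s_e=s_e$ if $e$ points out of $v$, $\hat s_e=-1-s_e$ if $e$ points into $v$. Put $R_u=\lambda_u-1$ for $u\in B_{in}$ and $R_u=1-\mu_u$ for $u\in B_{out}$. The marking is admissible (for $\lambda,\mu$) if, in $\mathbb{Z}_r$, $\sum_{e\ni v}\hat s_e=D_v-N_v+1$ for each inner vertex $v$ and $\sum_{e\ni u}\hat s_e=D_u-N_u+1-R_u$ for each boundary vertex $u$ (sums over the set of edges having the vertex in their boundary). **The $r$-spin structure $\Sigma(s,\lambda,\mu)$.** A marking defines an $r$-spin structure with $r$-spin boundary parametrisation on $\Sigma$ minus its vertices: take the trivial $r$-spin structure on each face (the marked side recording how a standard polygon is embedded into the surface), use the edge indices to fix the ($\mathbb{Z}_r$-valued, constant) transition functions across edges, and parametrise the boundary by the inclusion of the $r$-spin collars prescribed by $\lambda,\mu$ over the collars of the boundary parametrisation. It extends uniquely to the vertices if and only if the marking is admissible; the extension is $\Sigma(s,\lambda,\mu)$. Conventions are fixed by the holonomy $\zeta(\gamma)\in\mathbb{Z}_r$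 of the lift to $P$ of the tangent frame of a closed immersed curve $\gamma$, normalised to be $1$ for a curve running counter-clockwise around an embedded disc: $\zeta(\gamma)=\sum_a(\hat s_a+\hat\delta_a)$, the sum being over the arcs $a$ into which the edges cut $\gamma$. Here, if $a$ lies in the face $f$ and leaves it through the edge $e$, then $\hat s_a=s_e$ if $e$ and $a$ cross positively (as for a curve going counter-clockwise around a vertex and crossing an edge pointing out of that vertex) and $\hat s_a=-s_e-1$ otherwise, and $\hat\delta_a=1$ if the clockwise vertex of the marked side of $f$ lies on the right of $a$ and $0$ otherwise. **The bordisms.** $S_{1,0}:\emptyset\to0$ is the disc with one outgoing boundary component with $\mu=0\in\mathbb{Z}_r$, and $S_{0,1}:2\to\emptyset$ is the disc with one ingoing boundary component with $\lambda=2\in\mathbb{Z}_r$; each carries a unique $r$-spin structure with $r$-spin boundary parametrisation up to isomorphism. Consider the 9-gon whose sides are, counter-clockwise from the marked side, $r_1,u_1,r_1,r_2,u_2,r_2,r_3,u_3,r_3$, where the two sides labelled $r_j$ are glued (the polygon lies to the left of $r_j$ at the first and to the right of $r_j$ at the second of these sides), and $u_j$ is the $j$-th boundary edge, oriented with the polygon on its right. Gluing gives a 3-holed sphere. $S_{1,2}(0,0,0,\lambda_1,\lambda_2):(\lambda_1,\lambda_2)\to\lambda_1+\lambda_2$ is this 3-holed sphere with components $1,2$ ingoing and $3$ outgoing, and edge indices $0$ for $u_1,u_2,u_3$ and $\lambda_1-1,\ \lambda_2-1,\ 1-(\lambda_1+\lambda_2)$ for $r_1,r_2,r_3$. $S_{2,1}(0,0,0,\lambda_1,\lambda_2):\lambda_1+\lambda_2-2\to(\lambda_1,\lambda_2)$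 is the 3-holed sphere with the same parametrisation but in- and outgoing components exchanged ($1,2$ outgoing, $3$ ingoing), and edge indices $0$ for $u_1,u_2,u_3$ and $1-\lambda_1,\ 1-\lambda_2,\ (\lambda_1+\lambda_2-2)-1$ for $r_1,r_2,r_3$. **Algebra.** A Frobenius algebra $(A,\mu,\eta,\Delta,\varepsilon)$ in $\mathcal{S}$ is a unital associative algebra and counital coassociative coalgebra with $(\mathrm{id}\otimes\mu)(\Delta\otimes\mathrm{id})=\Delta\mu=(\mu\otimes\mathrm{id})(\mathrm{id}\otimes\Delta)$. With $c$ the braiding and $\mathbb{I}$ the unit object, $\tau=\mu\circ\Delta\circ\eta$ is the window element (invertible means invertible with respect to $\mu$) and $N=(\mathrm{id}_A\otimes(\varepsilon\circ\mu))\circ(c_{A,A}\otimes\mathrm{id}_A)\circ(\mathrm{id}_A\otimes(\Delta\circ\eta))$. For $\lambda\in\mathbb{Z}_r$, $P_\lambda=(\tau^{-1}\cdot(-))\circ\mu\circ c_{A,A}\circ(\mathrm{id}\otimes N^{1-\lambda})\circ\Delta$ is an idempotent, split as $P_\lambda=\iota_\lambda\circ\pi_\lambda$, $\pi_\lambda:A\to Z_\lambda$, $\iota_\lambda:Z_\lambda\to A$, $\pi_\lambda\circ\iota_\lambda=\mathrm{id}$. The $\mathbb{Z}_r$-graded center is $Z^r(A)=\bigoplus_{\lambda\in\mathbb{Z}_r}Z_\lambda$, a unital associative algebra with product having components $\pi_{\lambda_1+\lambda_2}\circ\mu\circ(\iota_{\lambda_1}\otimes\iota_{\lambda_2}):Z_{\lambda_1}\otimes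 Z_{\lambda_2}\to Z_{\lambda_1+\lambda_2}$ and unit $\pi_0\circ\eta:\mathbb{I}\to Z_0\subset Z^r(A)$. For $r>0$ it is a Frobenius algebra with coproduct the sum over $\lambda_1,\lambda_2\in\mathbb{Z}_r$ of the components $(\pi_{\lambda_1}\otimes\pi_{\lambda_2})\circ\Delta\circ(\tau\cdot(-))\circ\iota_{\lambda_1+\lambda_2-2}:Z_{\lambda_1+\lambda_2-2}\to Z_{\lambda_1}\otimes Z_{\lambda_2}$, and counit $\varepsilon\circ(\tau^{-1}\cdot(-))\circ\iota_2$ on $Z_2$ and zero on $Z_\lambda$ for $\lambda\neq2$. **State-sum construction.** On objects, $\mathcal{Z}_A(X,\rho)=\bigotimes_{x\in X}Z_{\rho_x}$. For a bordism $\Sigma:(X,\rho)\to(Y,\sigma)$ choose a PLCW decomposition with admissible marking such that $\Sigma(s,\lambda,\mu)$ is isomorphic to the $r$-spin structure with parametrised boundary of $\Sigma$. Let $S$ be the set of sides $(f,k)$ of all faces, $(f,1)$ being the marked side of $f$ and numbering being counter-clockwise, and $E\subset\Sigma_1\times\{l,r\}$ the set of $(e,l)$ (resp. $(e,r)$) such that a face is attached on the left (resp. right) of $e$; let $\Phi:E\to S$ be the resulting bijection. Choose a map $V$ from the set of vertices not on outgoing boundary components to $E$ with $V(v)=(e,x)$, $v\in\partial(e)$. Let $\mathcal{A}_S,\mathcal{A}_E,\mathcal{A}_{in},\mathcal{A}_{out}$ be the tensor products of copies of $A$ indexed by $S,E,B_{in},B_{out}$ (copies written $A^{(f,k)},A^{(e,x)},A^{(e,in)},A^{(e,out)}$).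 (i) $\mathcal{C}=\bigotimes_{e\in\Sigma_1}g_e:\mathcal{A}_{in}\to\mathcal{A}_E\otimes\mathcal{A}_{out}$, where $g_e=N^{-s_e-1}$ on $A^{(e,in)}$ for $e$ ingoing (its target being the factor of $\mathcal{A}_E$ belonging to $e$), and otherwise $g_e=(\mathrm{id}_A\otimes N^{s_e+1})\circ\Delta\circ\eta$ with target $A^{(e,l)}\otimes A^{(e,r)}$ for inner $e$, $A^{(e,l)}\otimes A^{(e,out)}$ for outgoing $e$ with the surface on its left, $A^{(e,out)}\otimes A^{(e,r)}$ for outgoing $e$ with the surface on its right. (ii) $\mathcal{Y}:\mathcal{A}_E\to\mathcal{A}_E$ is multiplication by the product, over all vertices $v$ not on outgoing boundary components, of $\tau^{-1}$ inserted in the factor $V(v)$. (iii) $\mathcal{F}=\bigotimes_{f\in\Sigma_2}\varepsilon\circ\mu^{(n_f)}:\mathcal{A}_S\to\mathbb{I}$, where $f$ is an $n_f$-gon, $\mu^{(n)}$ is the $n$-fold product ($\mu^{(1)}=\mathrm{id}_A$), and factors are ordered $(f,1),\dots,(f,n_f)$. (iv) $\mathcal{L}=\big((\mathcal{F}\circ\Pi_\Phi\circ\mathcal{Y})\otimes\mathrm{id}\big)\circ\mathcal{C}:\mathcal{A}_{in}\to\mathcal{A}_{out}$, where $\Pi_\Phi$ permutes tensor factors according to $\Phi$. (v) $\mathcal{Z}_A(\Sigma)=\mathcal{E}_{out}\circ\mathcal{L}\circ\mathcal{E}_{in}$, where $\mathcal{E}_{in}$ is the permutation induced by $\beta_{in}$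 followed by $\bigotimes_b\iota_{\lambda_b}$ and $\mathcal{E}_{out}$ is $\bigotimes_c\pi_{\mu_c}$ followed by the permutation induced by $\beta_{out}$. This defines a symmetric monoidal functor $\mathcal{Z}_A:\mathcal{B}ord_2^{\,r}\to\mathcal{S}$.
   Formalization: An ingoing edge with the surface on its right gets weight N^{s_e} instead of N^{-s_e-1}, and the 9-gon of S_{2,1} is read in the order r_3,u_3,r_3,r_2,u_2,r_2,r_1,u_1,r_1; taken literally, product and coproduct are twisted by powers of N. *)

theory Defs
  imports "HOL-Analysis.Analysis"
begin

section \<open>Strict symmetric monoidal additive categories\<close>

record ('o, 'm) smc =
  Ob :: "'o set"
  Arr :: "'m set"
  Dom :: "'m \<Rightarrow> 'o"
  Cod :: "'m \<Rightarrow> 'o"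
  Idn :: "'o \<Rightarrow> 'm" ("\<one>\<index>_" [1000] 1000)
  Cmp :: "'m \<Rightarrow> 'm \<Rightarrow> 'm" (infixr "\<cdot>\<index>" 55)
  TenO :: "'o \<Rightarrow> 'o \<Rightarrow> 'o" (infixr "\<odot>\<index>" 65)
  TenM :: "'m \<Rightarrow> 'm \<Rightarrow> 'm" (infixr "\<otimes>\<index>" 65)
  Unt :: 'o
  Brd :: "'o \<Rightarrow> 'o \<Rightarrow> 'm"
  Zer :: "'o \<Rightarrow> 'o \<Rightarrow> 'm"
  Add :: "'m \<Rightarrow> 'm \<Rightarrow> 'm" (infixl "\<oplus>\<index>" 60)

record ('o, 'm) frob =
  Car :: 'o
  Mul :: 'm
  Eta :: 'm
  Com :: 'm
  Eps :: 'm

text \<open>The indices of the algebraic structures live in the integers modulo \<open>r\<close>.  Elements are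
  represented by the values of \<open>k mod r\<close>; as \<open>k mod 0 = k\<close>, this gives all integers for \<open>r = 0\<close>.\<close>

definition Zr :: "nat \<Rightarrow> int set" where
  "Zr r = range (\<lambda>k. k mod int r)"

text \<open>Labels of the tensor factors in the state sum: the factor of an edge side, and the
  factors of the ingoing and outgoing edges.\<close>

datatype side = Lft | Rgt
datatype tlabel = LE nat side | LIn nat | LOut nat

locale smc_data =
  fixes S :: "('o, 'm) smc" (structure)
begin

definition hom :: "'o \<Rightarrow> 'o \<Rightarrow> 'm set" where
  "hom X Y = {f \<in> Arr S. Dom S f = X \<and> Cod S f = Y}"

definition category :: bool where
  "category \<longleftrightarrow>
     (\<forall>f\<in>Arr S. Dom S f \<in> Ob S \<and> Cod S f \<in> Ob S) \<and>
     (\<forall>X\<in>Ob S. \<one>X \<in> hom X X) \<and>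
     (\<forall>f\<in>Arr S. \<forall>g\<in>Arr S. Dom S g = Cod S f \<longrightarrow> g \<cdot> f \<in> hom (Dom S f) (Cod S g)) \<and>
     (\<forall>f\<in>Arr S. f \<cdot> \<one>(Dom S f) = f \<and> \<one>(Cod S f) \<cdot> f = f) \<and>
     (\<forall>f\<in>Arr S. \<forall>g\<in>Arr S. \<forall>h\<in>Arr S. Dom S g = Cod S f \<and> Dom S h = Cod S g \<longrightarrow>
        h \<cdot> (g \<cdot> f) = (h \<cdot> g) \<cdot> f)"

definition strict_symmetric_monoidal :: bool where
  "strict_symmetric_monoidal \<longleftrightarrow> category \<and>
     Unt S \<in> Ob S \<and>
     (\<forall>X\<in>Ob S. \<forall>Y\<in>Ob S. X \<odot> Y \<in> Ob S \<and> \<one>X \<otimes> \<one>Y = \<one>(X \<odot> Y)) \<and>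
     (\<forall>f\<in>Arr S. \<forall>g\<in>Arr S. f \<otimes> g \<in> hom (Dom S f \<odot> Dom S g) (Cod S f \<odot> Cod S g)) \<and>
     (\<forall>f\<in>Arr S. \<forall>f'\<in>Arr S. \<forall>g\<in>Arr S. \<forall>g'\<in>Arr S. Dom S f' = Cod S f \<and> Dom S g' = Cod S g \<longrightarrow>
        (f' \<otimes> g') \<cdot> (f \<otimes> g) = (f' \<cdot> f) \<otimes> (g' \<cdot> g)) \<and>
     (\<forall>X\<in>Ob S. Unt S \<odot> X = X \<and> X \<odot> Unt S = X) \<and>
     (\<forall>X\<in>Ob S. \<forall>Y\<in>Ob S. \<forall>Z\<in>Ob S. (X \<odot> Y) \<odot> Z = X \<odot> (Y \<odot> Z)) \<and>
     (\<forall>f\<in>Arr S. \<one>(Unt S) \<otimes> f = f \<and> f \<otimes> \<one>(Unt S) = f) \<and>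
     (\<forall>f\<in>Arr S. \<forall>g\<in>Arr S. \<forall>h\<in>Arr S. (f \<otimes> g) \<otimes> h = f \<otimes> (g \<otimes> h)) \<and>
     (\<forall>X\<in>Ob S. \<forall>Y\<in>Ob S. Brd S X Y \<in> hom (X \<odot> Y) (Y \<odot> X) \<and>
        Brd S Y X \<cdot> Brd S X Y = \<one>(X \<odot> Y)) \<and>
     (\<forall>f\<in>Arr S. \<forall>g\<in>Arr S.
        Brd S (Cod S f) (Cod S g) \<cdot> (f \<otimes> g) = (g \<otimes> f) \<cdot> Brd S (Dom S f) (Dom S g)) \<and>
     (\<forall>X\<in>Ob S. \<forall>Y\<in>Ob S. \<forall>Z\<in>Ob S.
        Brd S X (Y \<odot> Z) = (\<one>Y \<otimes> Brd S X Z) \<cdot> (Brd S X Y \<otimes> \<one>Z))"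

text \<open>Additive, with a tensor product that is additive in both arguments.\<close>

definition additive :: bool where
  "additive \<longleftrightarrow>
     (\<forall>X\<in>Ob S. \<forall>Y\<in>Ob S. Zer S X Y \<in> hom X Y \<and>
        (\<forall>f\<in>hom X Y. Zer S X Y \<oplus> f = f \<and> (\<exists>g\<in>hom X Y. f \<oplus> g = Zer S X Y)) \<and>
        (\<forall>f\<in>hom X Y. \<forall>g\<in>hom X Y. f \<oplus> g \<in> hom X Y \<and> f \<oplus> g = g \<oplus> f) \<and>
        (\<forall>f\<in>hom X Y. \<forall>g\<in>hom X Y. \<forall>h\<in>hom X Y. (f \<oplus> g) \<oplus> h = f \<oplus> (g \<oplus> h))) \<and>
     (\<forall>X\<in>Ob S. \<forall>Y\<in>Ob S. \<forall>Z\<in>Ob S. \<forall>f\<in>hom X Y. \<forall>f'\<in>hom X Y. \<forall>g\<in>hom Y Z. \<forall>g'\<in>hom Y Z.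
        g \<cdot> (f \<oplus> f') = (g \<cdot> f) \<oplus> (g \<cdot> f') \<and> (g \<oplus> g') \<cdot> f = (g \<cdot> f) \<oplus> (g' \<cdot> f)) \<and>
     (\<forall>X\<in>Ob S. \<forall>Y\<in>Ob S. \<forall>f\<in>hom X Y. \<forall>f'\<in>hom X Y. \<forall>g\<in>Arr S.
        g \<otimes> (f \<oplus> f') = (g \<otimes> f) \<oplus> (g \<otimes> f') \<and> (f \<oplus> f') \<otimes> g = (f \<otimes> g) \<oplus> (f' \<otimes> g)) \<and>
     (\<exists>E\<in>Ob S. \<one>E = Zer S E E) \<and>
     (\<forall>X\<in>Ob S. \<forall>Y\<in>Ob S. \<exists>B\<in>Ob S. \<exists>i\<in>hom X B. \<exists>j\<in>hom Y B. \<exists>p\<in>hom B X. \<exists>q\<in>hom B Y.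
        p \<cdot> i = \<one>X \<and> q \<cdot> j = \<one>Y \<and> p \<cdot> j = Zer S Y X \<and> q \<cdot> i = Zer S X Y \<and>
        (i \<cdot> p) \<oplus> (j \<cdot> q) = \<one>B)"

definition idempotent_complete :: bool where
  "idempotent_complete \<longleftrightarrow> (\<forall>X\<in>Ob S. \<forall>e\<in>hom X X. e \<cdot> e = e \<longrightarrow>
     (\<exists>Y\<in>Ob S. \<exists>i\<in>hom Y X. \<exists>p\<in>hom X Y. i \<cdot> p = e \<and> p \<cdot> i = \<one>Y))"

definition direct_sum :: "'i set \<Rightarrow> ('i \<Rightarrow> 'o) \<Rightarrow> 'o \<Rightarrow> ('i \<Rightarrow> 'm) \<Rightarrow> bool" where
  "direct_sum I X C inc \<longleftrightarrow> C \<in> Ob S \<and> (\<forall>i\<in>I. X i \<in> Ob S \<and> inc i \<in> hom (X i) C) \<and>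
     (\<forall>Y\<in>Ob S. \<forall>f. (\<forall>i\<in>I. f i \<in> hom (X i) Y) \<longrightarrow> (\<exists>!h. h \<in> hom C Y \<and> (\<forall>i\<in>I. h \<cdot> inc i = f i)))"

definition distributive_countable_sums :: bool where
  "distributive_countable_sums \<longleftrightarrow>
     (\<forall>X :: nat \<Rightarrow> 'o. range X \<subseteq> Ob S \<longrightarrow> (\<exists>C inc. direct_sum UNIV X C inc)) \<and>
     (\<forall>(X :: nat \<Rightarrow> 'o) C inc. direct_sum UNIV X C inc \<longrightarrow>
        (\<forall>Y\<in>Ob S. direct_sum UNIV (\<lambda>n. Y \<odot> X n) (Y \<odot> C) (\<lambda>n. \<one>Y \<otimes> inc n) \<and>
                  direct_sum UNIV (\<lambda>n. X n \<odot> Y) (C \<odot> Y) (\<lambda>n. inc n \<otimes> \<one>Y)))"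

definition tenO :: "'o list \<Rightarrow> 'o" where
  "tenO Xs = foldr (\<odot>) Xs (Unt S)"

definition tenM :: "'m list \<Rightarrow> 'm" where
  "tenM fs = foldr (\<otimes>) fs (\<one>(Unt S))"

abbreviation pow :: "'o \<Rightarrow> nat \<Rightarrow> 'o" where
  "pow X n \<equiv> tenO (replicate n X)"

section \<open>Frobenius algebras\<close>

definition frobenius_algebra :: "('o, 'm) frob \<Rightarrow> bool" where
  "frobenius_algebra A \<longleftrightarrow> (let X = Car A; \<mu> = Mul A; \<eta> = Eta A; \<Delta> = Com A; \<epsilon> = Eps A in
     X \<in> Ob S \<and> \<mu> \<in> hom (X \<odot> X) X \<and> \<eta> \<in> hom (Unt S) X \<and>
     \<Delta> \<in> hom X (X \<odot> X) \<and> \<epsilon> \<in> hom X (Unt S) \<and>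
     \<mu> \<cdot> (\<mu> \<otimes> \<one>X) = \<mu> \<cdot> (\<one>X \<otimes> \<mu>) \<and>
     \<mu> \<cdot> (\<eta> \<otimes> \<one>X) = \<one>X \<and> \<mu> \<cdot> (\<one>X \<otimes> \<eta>) = \<one>X \<and>
     (\<Delta> \<otimes> \<one>X) \<cdot> \<Delta> = (\<one>X \<otimes> \<Delta>) \<cdot> \<Delta> \<and>
     (\<epsilon> \<otimes> \<one>X) \<cdot> \<Delta> = \<one>X \<and> (\<one>X \<otimes> \<epsilon>) \<cdot> \<Delta> = \<one>X \<and>
     (\<one>X \<otimes> \<mu>) \<cdot> (\<Delta> \<otimes> \<one>X) = \<Delta> \<cdot> \<mu> \<and> (\<mu> \<otimes> \<one>X) \<cdot> (\<one>X \<otimes> \<Delta>) = \<Delta> \<cdot> \<mu>)"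

definition window :: "('o, 'm) frob \<Rightarrow> 'm" where
  "window A = Mul A \<cdot> Com A \<cdot> Eta A"

definition inverse_element :: "('o, 'm) frob \<Rightarrow> 'm \<Rightarrow> 'm \<Rightarrow> bool" where
  "inverse_element A t u \<longleftrightarrow> t \<in> hom (Unt S) (Car A) \<and> u \<in> hom (Unt S) (Car A) \<and>
     Mul A \<cdot> (t \<otimes> u) = Eta A \<and> Mul A \<cdot> (u \<otimes> t) = Eta A"

definition window_inv :: "('o, 'm) frob \<Rightarrow> 'm" where
  "window_inv A = (THE u. inverse_element A (window A) u)"

definition lmul :: "('o, 'm) frob \<Rightarrow> 'm \<Rightarrow> 'm" where
  "lmul A t = Mul A \<cdot> (t \<otimes> \<one>(Car A))"

definition nakayama :: "('o, 'm) frob \<Rightarrow> 'm" where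
  "nakayama A = (\<one>(Car A) \<otimes> (Eps A \<cdot> Mul A)) \<cdot> (Brd S (Car A) (Car A) \<otimes> \<one>(Car A))
                  \<cdot> (\<one>(Car A) \<otimes> (Com A \<cdot> Eta A))"

definition npow :: "'o \<Rightarrow> 'm \<Rightarrow> nat \<Rightarrow> 'm" where
  "npow X f n = ((\<lambda>g. f \<cdot> g) ^^ n) (\<one>X)"

definition inv_mor :: "'o \<Rightarrow> 'm \<Rightarrow> 'm" where
  "inv_mor X f = (THE g. g \<in> hom X X \<and> f \<cdot> g = \<one>X \<and> g \<cdot> f = \<one>X)"

definition nak_pow :: "('o, 'm) frob \<Rightarrow> int \<Rightarrow> 'm" where
  "nak_pow A k = (if k \<ge> 0 then npow (Car A) (nakayama A) (nat k)
                  else npow (Car A) (inv_mor (Car A) (nakayama A)) (nat (- k)))"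

definition proj_P :: "('o, 'm) frob \<Rightarrow> int \<Rightarrow> 'm" where
  "proj_P A l = lmul A (window_inv A) \<cdot> Mul A \<cdot> Brd S (Car A) (Car A)
                  \<cdot> (\<one>(Car A) \<otimes> nak_pow A (1 - l)) \<cdot> Com A"

definition splits_P :: "nat \<Rightarrow> ('o, 'm) frob \<Rightarrow> (int \<Rightarrow> 'o) \<Rightarrow> (int \<Rightarrow> 'm) \<Rightarrow> (int \<Rightarrow> 'm) \<Rightarrow> bool" where
  "splits_P r A Z \<iota> \<pi> \<longleftrightarrow> (\<forall>l\<in>Zr r. Z l \<in> Ob S \<and> \<iota> l \<in> hom (Z l) (Car A) \<and> \<pi> l \<in> hom (Car A) (Z l) \<and>
     \<iota> l \<cdot> \<pi> l = proj_P A l \<and> \<pi> l \<cdot> \<iota> l = \<one>(Z l))"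

section \<open>Structures on a direct sum given by components\<close>

text \<open>\<open>B\<close> is a direct sum of the objects \<open>X\<^sub>l\<close>, and its product and unit are the ones with components
  \<open>m\<close> and \<open>u\<close>.\<close>

definition graded_algebra ::
  "nat \<Rightarrow> (int \<Rightarrow> 'o) \<Rightarrow> (int \<Rightarrow> int \<Rightarrow> 'm) \<Rightarrow> 'm \<Rightarrow> ('o, 'm) frob \<Rightarrow> (int \<Rightarrow> 'm) \<Rightarrow> bool" where
  "graded_algebra r X m u B inc \<longleftrightarrow> direct_sum (Zr r) X (Car B) inc \<and>
     Mul B \<in> hom (Car B \<odot> Car B) (Car B) \<and>
     (\<forall>a\<in>Zr r. \<forall>b\<in>Zr r. Mul B \<cdot> (inc a \<otimes> inc b) = inc ((a + b) mod int r) \<cdot> m a b) \<and>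
     Eta B = inc 0 \<cdot> u"

definition sum_mor :: "'o \<Rightarrow> 'o \<Rightarrow> 'm list \<Rightarrow> 'm" where
  "sum_mor X Y fs = foldr (\<oplus>) fs (Zer S X Y)"

text \<open>For \<open>r > 0\<close>: the coproduct has components
  \<open>d a b : X\<^bsub>a + b - 2\<^esub> \<rightarrow> X\<^sub>a \<odot> X\<^sub>b\<close>, and the counit is \<open>e\<close> on \<open>X\<^sub>2\<close> and zero on the other summands.\<close>

definition graded_coalgebra ::
  "nat \<Rightarrow> (int \<Rightarrow> 'o) \<Rightarrow> (int \<Rightarrow> int \<Rightarrow> 'm) \<Rightarrow> 'm \<Rightarrow> ('o, 'm) frob \<Rightarrow> (int \<Rightarrow> 'm) \<Rightarrow> bool" where
  "graded_coalgebra r X d e B inc \<longleftrightarrow>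
     Com B \<in> hom (Car B) (Car B \<odot> Car B) \<and> Eps B \<in> hom (Car B) (Unt S) \<and>
     (\<forall>c\<in>Zr r. Com B \<cdot> inc c = sum_mor (X c) (Car B \<odot> Car B)
        (map (\<lambda>a. let b = (c + 2 - a) mod int r in (inc a \<otimes> inc b) \<cdot> d a b) (map int [0..<r]))) \<and>
     (\<forall>c\<in>Zr r. Eps B \<cdot> inc c = (if c = 2 mod int r then e else Zer S (X c) (Unt S)))"

definition graded_center_algebra ::
  "nat \<Rightarrow> ('o, 'm) frob \<Rightarrow> (int \<Rightarrow> 'o) \<Rightarrow> (int \<Rightarrow> 'm) \<Rightarrow> (int \<Rightarrow> 'm) \<Rightarrow> ('o, 'm) frob \<Rightarrow> (int \<Rightarrow> 'm) \<Rightarrow> bool"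
  where
  "graded_center_algebra r A Z \<iota> \<pi> =
     graded_algebra r Z (\<lambda>a b. \<pi> ((a + b) mod int r) \<cdot> Mul A \<cdot> (\<iota> a \<otimes> \<iota> b)) (\<pi> 0 \<cdot> Eta A)"

definition graded_center_coalgebra ::
  "nat \<Rightarrow> ('o, 'm) frob \<Rightarrow> (int \<Rightarrow> 'o) \<Rightarrow> (int \<Rightarrow> 'm) \<Rightarrow> (int \<Rightarrow> 'm) \<Rightarrow> ('o, 'm) frob \<Rightarrow> (int \<Rightarrow> 'm) \<Rightarrow> bool"
  where
  "graded_center_coalgebra r A Z \<iota> \<pi> =
     graded_coalgebra r Z
       (\<lambda>a b. (\<pi> a \<otimes> \<pi> b) \<cdot> Com A \<cdot> lmul A (window A) \<cdot> \<iota> ((a + b - 2) mod int r))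
       (Eps A \<cdot> lmul A (window_inv A) \<cdot> \<iota> (2 mod int r))"

section \<open>Permuting and multiplying tensor factors\<close>

text \<open>The symmetry isomorphism between two orderings of a tensor product of copies of \<open>X\<close>
  with distinct labels; it moves the factor labelled \<open>l\<close> in \<open>xs\<close> to the position of \<open>l\<close> in \<open>ys\<close>.\<close>

fun relabel :: "'o \<Rightarrow> 'l list \<Rightarrow> 'l list \<Rightarrow> 'm" where
  "relabel X xs [] = \<one>(Unt S)"
| "relabel X xs (y # ys) =
     (let us = takeWhile (\<lambda>x. x \<noteq> y) xs; vs = tl (dropWhile (\<lambda>x. x \<noteq> y) xs) in
      (\<one>X \<otimes> relabel X (us @ vs) ys) \<cdot> (Brd S (pow X (length us)) X \<otimes> \<one>(pow X (length vs))))"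

fun mul_n :: "('o, 'm) frob \<Rightarrow> nat \<Rightarrow> 'm" where
  "mul_n A 0 = Eta A"
| "mul_n A (Suc 0) = \<one>(Car A)"
| "mul_n A (Suc (Suc n)) = Mul A \<cdot> (\<one>(Car A) \<otimes> mul_n A (Suc n))"

end

section \<open>Orientation preserving linear maps of the plane and the covering groups\<close>

text \<open>Real \<open>2 \<times> 2\<close> matrices are real-linear maps of \<open>\<complex> = \<real>\<^sup>2\<close>; the determinant of \<open>g\<close> is
  the imaginary part below.\<close>

definition GLp :: "(complex \<Rightarrow> complex) set" where
  "GLp = {g. linear g \<and> Im (cnj (g 1) * g \<i>) > 0}"

text \<open>An element of the universal cover over \<open>g\<close> is a lift \<open>G\<close> to angles of the action of \<open>g\<close> on
  directions.  The \<open>r\<close>-fold cover is the quotient by the translations by \<open>2 \<pi> r k\<close>, so an element is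
  a pair of \<open>g\<close> and the class of \<open>G\<close>; for \<open>r = 0\<close> the class is a singleton.  The
  covering map is \<open>fst\<close>.\<close>

type_synonym glt = "(complex \<Rightarrow> complex) \<times> (real \<Rightarrow> real) set"

definition angle_lift :: "(complex \<Rightarrow> complex) \<Rightarrow> (real \<Rightarrow> real) \<Rightarrow> bool" where
  "angle_lift g G \<longleftrightarrow> continuous_on UNIV G \<and> (\<forall>t. g (cis t) = of_real (cmod (g (cis t))) * cis (G t))"

definition GLt :: "nat \<Rightarrow> glt set" where
  "GLt r = {(g, {(\<lambda>t. G t + 2 * pi * real r * of_int k) | k. True}) | g G. g \<in> GLp \<and> angle_lift g G}"

definition gl_mult :: "glt \<Rightarrow> glt \<Rightarrow> glt" where
  "gl_mult a b = (fst a \<circ> fst b, {G \<circ> H | G H. G \<in> snd a \<and> H \<in> snd b})"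

definition gl_one :: "nat \<Rightarrow> glt" where
  "gl_one r = (id, {(\<lambda>t. t + 2 * pi * real r * of_int k) | k. True})"

definition gl_angle :: "nat \<Rightarrow> glt \<Rightarrow> complex" where
  "gl_angle r a = (THE c. \<exists>G\<in>snd a. c = (if r = 0 then of_real (G 0) else cis (G 0 / real r)))"

definition GLt_top :: "nat \<Rightarrow> glt topology" where
  "GLt_top r = pullback_topology (GLt r) (\<lambda>a. (fst a 1, fst a \<i>, gl_angle r a)) euclidean"

section \<open>Smooth surfaces\<close>

primrec Ck_on :: "nat \<Rightarrow> complex set \<Rightarrow> (complex \<Rightarrow> complex) \<Rightarrow> bool" where
  "Ck_on 0 U f \<longleftrightarrow> continuous_on U f"
| "Ck_on (Suc k) U f \<longleftrightarrow> (\<exists>fx fy. Ck_on k U fx \<and> Ck_on k U fy \<and>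
     (\<forall>z\<in>U. (f has_derivative (\<lambda>h. Re h *\<^sub>R fx z + Im h *\<^sub>R fy z)) (at z)))"

definition smooth_in :: "complex set \<Rightarrow> (complex \<Rightarrow> complex) \<Rightarrow> bool" where
  "smooth_in M f \<longleftrightarrow> (\<forall>z\<in>M. \<exists>U F. open U \<and> z \<in> U \<and> (\<forall>k. Ck_on k U F) \<and> (\<forall>w\<in>U \<inter> M. F w = f w))"

type_synonym 'p chart = "'p set \<times> ('p \<Rightarrow> complex)"

record 'p surface =
  stop :: "'p topology"
  atlas :: "'p chart set"

abbreviation points :: "('p, 'z) surface_scheme \<Rightarrow> 'p set" where
  "points \<Sigma> \<equiv> topspace (stop \<Sigma>)"

definition overlap :: "'p chart \<Rightarrow> 'p chart \<Rightarrow> complex set" where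
  "overlap c d = snd c ` (fst c \<inter> fst d)"

definition transition :: "'p chart \<Rightarrow> 'p chart \<Rightarrow> complex \<Rightarrow> complex" where
  "transition c d = snd d \<circ> inv_into (fst c) (snd c)"

definition halfplane :: "complex set" where
  "halfplane = {z. Im z \<ge> 0}"

definition compact_surface :: "('p, 'z) surface_scheme \<Rightarrow> bool" where
  "compact_surface \<Sigma> \<longleftrightarrow> compact_space (stop \<Sigma>) \<and> Hausdorff_space (stop \<Sigma>) \<and>
     (\<forall>c\<in>atlas \<Sigma>. openin (stop \<Sigma>) (fst c) \<and>
        openin (top_of_set halfplane) (snd c ` fst c) \<and>
        homeomorphic_map (subtopology (stop \<Sigma>) (fst c)) (top_of_set (snd c ` fst c)) (snd c)) \<and>
     \<Union>(fst ` atlas \<Sigma>) = points \<Sigma> \<and>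
     (\<forall>c\<in>atlas \<Sigma>. \<forall>d\<in>atlas \<Sigma>. smooth_in (overlap c d) (transition c d) \<and>
        (\<forall>z\<in>overlap c d. \<exists>J\<in>GLp. (transition c d has_derivative J) (at z within overlap c d)))"

definition surface_boundary :: "('p, 'z) surface_scheme \<Rightarrow> 'p set" where
  "surface_boundary \<Sigma> = {x. \<exists>c\<in>atlas \<Sigma>. x \<in> fst c \<and> Im (snd c x) = 0}"

text \<open>\<open>f\<close> is a smooth orientation preserving immersion of a subset of the plane into \<open>\<Sigma>\<close>; the
  differentials are given by \<open>differential_in\<close> in the chart \<open>c\<close>.\<close>

definition differential_in ::
  "complex set \<Rightarrow> (complex \<Rightarrow> 'p) \<Rightarrow> complex \<Rightarrow> 'p chart \<Rightarrow> (complex \<Rightarrow> complex) \<Rightarrow> bool" where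
  "differential_in M f z c J \<longleftrightarrow> ((snd c \<circ> f) has_derivative J) (at z within M)"

definition immersion_on ::
  "('p, 'z) surface_scheme \<Rightarrow> complex set \<Rightarrow> (complex \<Rightarrow> 'p) \<Rightarrow> bool" where
  "immersion_on \<Sigma> M f \<longleftrightarrow> continuous_map (top_of_set M) (stop \<Sigma>) f \<and>
     (\<forall>c\<in>atlas \<Sigma>. smooth_in {z \<in> M. f z \<in> fst c} (snd c \<circ> f) \<and>
        (\<forall>z\<in>M. f z \<in> fst c \<longrightarrow> (\<exists>J\<in>GLp. differential_in M f z c J)))"

text \<open>An oriented frame at \<open>x\<close>, given by its coordinates in all charts around \<open>x\<close>.\<close>

definition frames :: "('p, 'z) surface_scheme \<Rightarrow> 'p \<Rightarrow> ('p chart \<Rightarrow> complex \<Rightarrow> complex) set" where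
  "frames \<Sigma> x = {F.
     (\<forall>c\<in>atlas \<Sigma>. x \<in> fst c \<longrightarrow> F c \<in> GLp) \<and>
     (\<forall>c. \<not> (c \<in> atlas \<Sigma> \<and> x \<in> fst c) \<longrightarrow> F c = undefined) \<and>
     (\<forall>c\<in>atlas \<Sigma>. \<forall>d\<in>atlas \<Sigma>. \<forall>J. x \<in> fst c \<inter> fst d \<and>
        (transition c d has_derivative J) (at (snd c x) within overlap c d) \<longrightarrow> F d = J \<circ> F c)}"

section \<open>Spin surfaces with parametrised boundary\<close>

text \<open>The field \<open>ptop\<close> is the total space of the principal bundle with projection \<open>pr\<close> and right action
  \<open>act\<close>, and \<open>frm\<close> is the bundle map to the frame bundle.\<close>

record ('p, 'q) rspin_surface = "'p surface" +
  ptop :: "'q topology"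
  pr :: "'q \<Rightarrow> 'p"
  act :: "'q \<Rightarrow> glt \<Rightarrow> 'q"
  frm :: "'q \<Rightarrow> 'p chart \<Rightarrow> complex \<Rightarrow> complex"

abbreviation total :: "('p, 'q, 'z) rspin_surface_scheme \<Rightarrow> 'q set" where
  "total \<Sigma> \<equiv> topspace (ptop \<Sigma>)"

definition principal_bundle :: "nat \<Rightarrow> ('p, 'q, 'z) rspin_surface_scheme \<Rightarrow> bool" where
  "principal_bundle r \<Sigma> \<longleftrightarrow> continuous_map (ptop \<Sigma>) (stop \<Sigma>) (pr \<Sigma>) \<and>
     continuous_map (prod_topology (ptop \<Sigma>) (GLt_top r)) (ptop \<Sigma>) (\<lambda>(q, g). act \<Sigma> q g) \<and>
     (\<forall>q\<in>total \<Sigma>. act \<Sigma> q (gl_one r) = q \<and>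
        (\<forall>g\<in>GLt r. pr \<Sigma> (act \<Sigma> q g) = pr \<Sigma> q \<and>
           (\<forall>h\<in>GLt r. act \<Sigma> (act \<Sigma> q g) h = act \<Sigma> q (gl_mult g h)))) \<and>
     (\<forall>x\<in>points \<Sigma>. \<exists>U \<psi>. openin (stop \<Sigma>) U \<and> x \<in> U \<and>
        homeomorphic_map (prod_topology (subtopology (stop \<Sigma>) U) (GLt_top r))
          (subtopology (ptop \<Sigma>) {q \<in> total \<Sigma>. pr \<Sigma> q \<in> U}) \<psi> \<and>
        (\<forall>y\<in>U. \<forall>g\<in>GLt r. pr \<Sigma> (\<psi> (y, g)) = y \<and>
           (\<forall>h\<in>GLt r. \<psi> (y, gl_mult g h) = act \<Sigma> (\<psi> (y, g)) h)))"

definition rspin_structure :: "nat \<Rightarrow> ('p, 'q, 'z) rspin_surface_scheme \<Rightarrow> bool" where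
  "rspin_structure r \<Sigma> \<longleftrightarrow> principal_bundle r \<Sigma> \<and>
     (\<forall>q\<in>total \<Sigma>. frm \<Sigma> q \<in> frames \<Sigma> (pr \<Sigma> q)) \<and>
     (\<forall>q\<in>total \<Sigma>. \<forall>g\<in>GLt r. \<forall>c\<in>atlas \<Sigma>. pr \<Sigma> q \<in> fst c \<longrightarrow>
        frm \<Sigma> (act \<Sigma> q g) c = frm \<Sigma> q c \<circ> fst g) \<and>
     (\<forall>c\<in>atlas \<Sigma>. \<forall>v. continuous_map (subtopology (ptop \<Sigma>) {q \<in> total \<Sigma>. pr \<Sigma> q \<in> fst c})
        euclidean (\<lambda>q. frm \<Sigma> q c v))"

text \<open>The ingoing and outgoing boundary components are numbered; \<open>ins\<close> and \<open>outs\<close> are the lists of the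
  indices of their collars.  Thus a bordism goes from the object \<open>ins\<close> to the object \<open>outs\<close>.
  Only the germs at the unit circle of the embeddings \<open>phi\<close> of the collars and of their lifts
  \<open>lphi\<close> matter.\<close>

record ('p, 'q) bordism = "('p, 'q) rspin_surface" +
  ins :: "int list"
  outs :: "int list"
  phi_in :: "nat \<Rightarrow> complex \<Rightarrow> 'p"
  phi_out :: "nat \<Rightarrow> complex \<Rightarrow> 'p"
  lphi_in :: "nat \<Rightarrow> glt \<times> complex \<Rightarrow> 'q"
  lphi_out :: "nat \<Rightarrow> glt \<times> complex \<Rightarrow> 'q"

definition ingoing_collar :: "complex set \<Rightarrow> bool" where
  "ingoing_collar U \<longleftrightarrow> (\<exists>V. open V \<and> sphere 0 1 \<subseteq> V \<and> 0 \<notin> V \<and> U = {z \<in> V. cmod z \<ge> 1})"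

definition outgoing_collar :: "complex set \<Rightarrow> bool" where
  "outgoing_collar U \<longleftrightarrow> (\<exists>V. open V \<and> sphere 0 1 \<subseteq> V \<and> 0 \<notin> V \<and> U = {z \<in> V. cmod z \<le> 1})"

text \<open>\<open>f\<close> embeds the collar \<open>U\<close>, and \<open>F\<close> is a morphism of spin surfaces over \<open>f\<close> from the restriction
  to \<open>U\<close> of the spin structure with index \<open>\<kappa>\<close> on the punctured plane.\<close>

definition parametrised_collar ::
  "nat \<Rightarrow> ('p, 'q, 'z) rspin_surface_scheme \<Rightarrow> complex set \<Rightarrow> int \<Rightarrow>
   (complex \<Rightarrow> 'p) \<Rightarrow> (glt \<times> complex \<Rightarrow> 'q) \<Rightarrow> bool" where
  "parametrised_collar r \<Sigma> U \<kappa> f F \<longleftrightarrow> embedding_map (top_of_set U) (stop \<Sigma>) f \<and> immersion_on \<Sigma> U f \<and>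
     continuous_map (prod_topology (GLt_top r) (top_of_set U)) (ptop \<Sigma>) F \<and>
     (\<forall>z\<in>U. \<forall>g\<in>GLt r. pr \<Sigma> (F (g, z)) = f z \<and>
        (\<forall>h\<in>GLt r. F (gl_mult g h, z) = act \<Sigma> (F (g, z)) h) \<and>
        (\<forall>c\<in>atlas \<Sigma>. \<forall>J. f z \<in> fst c \<and> differential_in U f z c J \<longrightarrow>
           frm \<Sigma> (F (g, z)) c = J \<circ> (\<lambda>w. z powi \<kappa> * w) \<circ> fst g))"

definition circles :: "('p, 'q) bordism \<Rightarrow> 'p set list" where
  "circles \<Sigma> = map (\<lambda>i. phi_in \<Sigma> i ` sphere 0 1) [0..<length (ins \<Sigma>)] @
                map (\<lambda>i. phi_out \<Sigma> i ` sphere 0 1) [0..<length (outs \<Sigma>)]"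

definition rspin_bordism :: "nat \<Rightarrow> ('p, 'q) bordism \<Rightarrow> bool" where
  "rspin_bordism r \<Sigma> \<longleftrightarrow> compact_surface \<Sigma> \<and> rspin_structure r \<Sigma> \<and>
     set (ins \<Sigma>) \<subseteq> Zr r \<and> set (outs \<Sigma>) \<subseteq> Zr r \<and>
     (\<forall>i<length (ins \<Sigma>). \<exists>U. ingoing_collar U \<and>
        parametrised_collar r \<Sigma> U (ins \<Sigma> ! i) (phi_in \<Sigma> i) (lphi_in \<Sigma> i)) \<and>
     (\<forall>i<length (outs \<Sigma>). \<exists>U. outgoing_collar U \<and>
        parametrised_collar r \<Sigma> U (outs \<Sigma> ! i) (phi_out \<Sigma> i) (lphi_out \<Sigma> i)) \<and>
     \<Union>(set (circles \<Sigma>)) = surface_boundary \<Sigma> \<and>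
     (\<forall>i<length (circles \<Sigma>). \<forall>j<length (circles \<Sigma>). i \<noteq> j \<longrightarrow> circles \<Sigma> ! i \<inter> circles \<Sigma> ! j = {})"

text \<open>The underlying surface is a disc: it is diffeomorphic to the closed unit disc by an orientation
  preserving diffeomorphism.\<close>

definition is_disc :: "('p, 'z) surface_scheme \<Rightarrow> bool" where
  "is_disc \<Sigma> \<longleftrightarrow> (\<exists>f. homeomorphic_map (top_of_set (cball 0 1)) (stop \<Sigma>) f \<and>
     immersion_on \<Sigma> (cball 0 1) f \<and> f ` sphere 0 1 = surface_boundary \<Sigma>)"

section \<open>Marked PLCW decompositions\<close>

text \<open>Combinatorial data of a marked decomposition with faces \<open>f < nfc\<close>, edges \<open>e < ned\<close> and vertices
  \<open>v < nvt\<close>.  The face \<open>f\<close> is a polygon with sides \<open>0, \<dots>, nsd f - 1\<close>, numbered counter-clockwise from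
  the marked side, and \<open>att f k\<close> is the edge which forms side \<open>k\<close>, together with the side of that
  edge on which \<open>f\<close> lies.  The edges run from \<open>src\<close> to \<open>tgt\<close> and have index \<open>idx\<close>.  The lists
  \<open>bin\<close> and \<open>bout\<close> contain the edges on the ingoing and outgoing boundary components.\<close>

record decomposition =
  nfc :: nat
  nsd :: "nat \<Rightarrow> nat"
  ned :: nat
  nvt :: nat
  att :: "nat \<Rightarrow> nat \<Rightarrow> nat \<times> side"
  src :: "nat \<Rightarrow> nat"
  tgt :: "nat \<Rightarrow> nat"
  idx :: "nat \<Rightarrow> int"
  bin :: "nat list"
  bout :: "nat list"

definition sides :: "decomposition \<Rightarrow> (nat \<times> nat) set" where
  "sides D = {(f, k). f < nfc D \<and> k < nsd D f}"

definition attached :: "decomposition \<Rightarrow> nat \<Rightarrow> side \<Rightarrow> bool" where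
  "attached D e x \<longleftrightarrow> (\<exists>(f, k)\<in>sides D. att D f k = (e, x))"

definition side_start :: "decomposition \<Rightarrow> nat \<Rightarrow> nat \<Rightarrow> nat" where
  "side_start D f k = (case att D f k of (e, x) \<Rightarrow> if x = Lft then src D e else tgt D e)"

definition side_end :: "decomposition \<Rightarrow> nat \<Rightarrow> nat \<Rightarrow> nat" where
  "side_end D f k = (case att D f k of (e, x) \<Rightarrow> if x = Lft then tgt D e else src D e)"

definition marked_decomposition :: "nat \<Rightarrow> decomposition \<Rightarrow> bool" where
  "marked_decomposition r D \<longleftrightarrow>
     (\<forall>f<nfc D. nsd D f \<ge> 1) \<and>
     (\<forall>(f, k)\<in>sides D. fst (att D f k) < ned D \<and>
        side_end D f k = side_start D f (Suc k mod nsd D f)) \<and>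
     inj_on (\<lambda>(f, k). att D f k) (sides D) \<and>
     (\<forall>e<ned D. src D e < nvt D \<and> tgt D e < nvt D \<and> idx D e \<in> Zr r \<and>
        (attached D e Lft \<or> attached D e Rgt)) \<and>
     (\<forall>v<nvt D. \<exists>e<ned D. v = src D e \<or> v = tgt D e) \<and>
     distinct (bin D @ bout D) \<and>
     set (bin D @ bout D) = {e. e < ned D \<and> \<not> (attached D e Lft \<and> attached D e Rgt)} \<and>
     (\<forall>e\<in>set (bin D @ bout D). src D e = tgt D e) \<and>
     inj_on (src D) (set (bin D @ bout D))"

definition hat_s :: "decomposition \<Rightarrow> nat \<Rightarrow> nat \<Rightarrow> int" where
  "hat_s D v e = (if src D e = v \<and> tgt D e = v then -1 else if src D e = v then idx D e
                  else -1 - idx D e)"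

definition D_num :: "decomposition \<Rightarrow> nat \<Rightarrow> nat" where
  "D_num D v = card {f. f < nfc D \<and> side_start D f 0 = v}"

definition N_num :: "decomposition \<Rightarrow> nat \<Rightarrow> nat" where
  "N_num D v = card {e. e < ned D \<and> src D e = v} + card {e. e < ned D \<and> tgt D e = v}"

definition vertex_condition :: "nat \<Rightarrow> decomposition \<Rightarrow> nat \<Rightarrow> int \<Rightarrow> bool" where
  "vertex_condition r D v R \<longleftrightarrow>
     (\<Sum>e | e < ned D \<and> (src D e = v \<or> tgt D e = v). hat_s D v e) mod int r
       = (int (D_num D v) - int (N_num D v) + 1 - R) mod int r"

definition admissible :: "nat \<Rightarrow> decomposition \<Rightarrow> int list \<Rightarrow> int list \<Rightarrow> bool" where
  "admissible r D lam mu \<longleftrightarrow>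
     (\<forall>v<nvt D. v \<notin> src D ` set (bin D @ bout D) \<longrightarrow> vertex_condition r D v 0) \<and>
     (\<forall>i<length (bin D). vertex_condition r D (src D (bin D ! i)) (lam ! i - 1)) \<and>
     (\<forall>i<length (bout D). vertex_condition r D (src D (bout D ! i)) (1 - mu ! i))"

text \<open>The decomposition of the surface: the standard polygon with \<open>n\<close> sides is the closed unit disc with
  the \<open>n\<close>-th roots of unity as corners, where side \<open>k\<close> consists of the points \<open>poly_pt n k t\<close> with
  \<open>0 \<le> t \<le> 1\<close>, and the marked side starts at \<open>1\<close>.  The face \<open>f\<close> is the image of the characteristic map
  \<open>\<xi> f\<close>, the edges are the curves \<open>\<gamma> e\<close>, and the vertices are the points \<open>vp v\<close>.  The map in the last
  conjunct says that the surface is the disjoint union of the open cells.\<close>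

definition poly_angle :: "nat \<Rightarrow> nat \<Rightarrow> real \<Rightarrow> real" where
  "poly_angle n k t = 2 * pi * (real k + t) / real n"

definition polygon :: "nat \<Rightarrow> complex set" where
  "polygon n = cball 0 1 - {cis (poly_angle n k 0) | k. k < n}"

definition decomposes ::
  "('p, 'q) bordism \<Rightarrow> decomposition \<Rightarrow> (nat \<Rightarrow> complex \<Rightarrow> 'p) \<Rightarrow> (nat \<Rightarrow> real \<Rightarrow> 'p) \<Rightarrow> (nat \<Rightarrow> 'p) \<Rightarrow> bool"
  where
  "decomposes \<Sigma> D \<xi> \<gamma> vp \<longleftrightarrow>
     length (bin D) = length (ins \<Sigma>) \<and> length (bout D) = length (outs \<Sigma>) \<and>
     (\<forall>f<nfc D. continuous_map (top_of_set (cball 0 1)) (stop \<Sigma>) (\<xi> f) \<and>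
        immersion_on \<Sigma> (polygon (nsd D f)) (\<xi> f)) \<and>
     (\<forall>(f, k)\<in>sides D. \<forall>t\<in>{0..1}. case att D f k of (e, x) \<Rightarrow>
        \<xi> f (cis (poly_angle (nsd D f) k t)) = \<gamma> e (if x = Lft then t else 1 - t)) \<and>
     (\<forall>e<ned D. \<gamma> e 0 = vp (src D e) \<and> \<gamma> e 1 = vp (tgt D e)) \<and>
     (\<forall>i<length (bin D). \<gamma> (bin D ! i) ` {0..1} = phi_in \<Sigma> i ` sphere 0 1) \<and>
     (\<forall>i<length (bout D). \<gamma> (bout D ! i) ` {0..1} = phi_out \<Sigma> i ` sphere 0 1) \<and>
     bij_betw (case_sum vp (case_sum (\<lambda>(e, t). \<gamma> e t) (\<lambda>(f, w). \<xi> f w)))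
       ({..<nvt D} <+> (({..<ned D} \<times> {0<..<1}) <+> ({..<nfc D} \<times> ball 0 1))) (points \<Sigma>)"

text \<open>A trivialisation of the spin structure over a face \<open>f\<close> (without its corners) is a lift \<open>\<sigma>\<close> of the
  image under \<open>\<xi> f\<close> of the standard frame of the plane.\<close>

definition face_trivialisation ::
  "('p, 'q, 'z) rspin_surface_scheme \<Rightarrow> nat \<Rightarrow> (complex \<Rightarrow> 'p) \<Rightarrow> (complex \<Rightarrow> 'q) \<Rightarrow> bool" where
  "face_trivialisation \<Sigma> n \<xi> \<sigma> \<longleftrightarrow> continuous_map (top_of_set (polygon n)) (ptop \<Sigma>) \<sigma> \<and>
     (\<forall>w\<in>polygon n. pr \<Sigma> (\<sigma> w) = \<xi> w \<and>
        (\<forall>c\<in>atlas \<Sigma>. \<forall>J. \<xi> w \<in> fst c \<and> differential_in (polygon n) \<xi> w c J \<longrightarrow> frm \<Sigma> (\<sigma> w) c = J))"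

text \<open>Transition functions across edges.  At a point of an edge, let \<open>q\<close> and \<open>q'\<close> be the trivialisations
  on the left and right of the edge.  Relative to \<open>q\<close> (resp. \<open>q'\<close>) the counter-clockwise tangent to
  the boundary of the left (resp. right) piece points in the direction of angle \<open>\<theta>\<close> (resp. \<open>\<theta>'\<close>), a
  real number.  Rotating \<open>q\<close> by \<open>\<theta>\<close> and \<open>q'\<close> by \<open>\<theta>'\<close> within the covering group gives lifts \<open>T\<close>
  and \<open>T'\<close> of frames whose first vectors are opposite.  The edge index \<open>s\<close> is determined by the fact
  that \<open>T'\<close> is in direction \<open>\<pi> + 2 \<pi> s\<close> relative to \<open>T\<close>; reversing the edge replaces \<open>s\<close> by
  \<open>-1 - s\<close>.  On a face the angle at the point \<open>cis u\<close> is \<open>u + \<pi>/2\<close> with \<open>0 < u < 2 \<pi>\<close>, so a curve with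
  the clockwise vertex of the marked side on its right picks up an additional full turn, as
  in the formula for the holonomy.\<close>

definition transition_index ::
  "nat \<Rightarrow> ('p, 'q, 'z) rspin_surface_scheme \<Rightarrow> int \<Rightarrow> 'q \<Rightarrow> real \<Rightarrow> 'q \<Rightarrow> real \<Rightarrow> bool" where
  "transition_index r \<Sigma> s q \<theta> q' \<theta>' \<longleftrightarrow>
     (\<exists>k\<in>GLt r. q' = act \<Sigma> q k \<and> (\<exists>G\<in>snd k. G \<theta>' = \<theta> + (2 * of_int s + 1) * pi))"

text \<open>A boundary edge lies between a face and a collar, whose trivialisation is the standard section of
  the spin structure with index \<open>\<kappa>\<close> at \<open>cis \<alpha>\<close>.  The frame of this section is the standard frame turned
  by \<open>\<kappa> \<alpha>\<close>, hence the tangent of the unit circle has angle \<open>\<pi>/2 + (1 - \<kappa>) \<alpha>\<close>.  Behind an ingoing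
  boundary component lies the side \<open>|z| < 1\<close> of the unit circle, and behind an outgoing one
  the side \<open>|z| > 1\<close>; the counter-clockwise tangent of the latter is minus that of the unit
  circle, whence the additional \<open>\<pi>\<close>.  The angle \<open>\<alpha>\<close> runs through an interval which starts and
  ends at the boundary vertex.\<close>

definition boundary_index ::
  "nat \<Rightarrow> ('p, 'q) bordism \<Rightarrow> decomposition \<Rightarrow> (nat \<Rightarrow> complex \<Rightarrow> 'q) \<Rightarrow> (nat \<Rightarrow> real \<Rightarrow> 'p) \<Rightarrow>
   nat \<Rightarrow> int \<Rightarrow> real \<Rightarrow> (complex \<Rightarrow> 'p) \<Rightarrow> (glt \<times> complex \<Rightarrow> 'q) \<Rightarrow> bool" where
  "boundary_index r \<Sigma> D \<sigma> \<gamma> e \<kappa> \<beta> \<phi> \<Phi> \<longleftrightarrow>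
     (\<exists>\<alpha>\<^sub>0. \<phi> (cis \<alpha>\<^sub>0) = \<gamma> e 0 \<and>
       (\<forall>(f, k)\<in>sides D. \<forall>x t \<alpha>. att D f k = (e, x) \<and> t \<in> {0<..<1} \<and> \<alpha> \<in> {\<alpha>\<^sub>0<..<\<alpha>\<^sub>0 + 2 * pi} \<and>
          \<phi> (cis \<alpha>) = \<gamma> e (if x = Lft then t else 1 - t) \<longrightarrow>
          (let u = poly_angle (nsd D f) k t;
               q = \<sigma> f (cis u); \<theta> = u + pi / 2;
               q' = \<Phi> (gl_one r, cis \<alpha>); \<theta>' = \<beta> + (1 - of_int \<kappa>) * \<alpha>
           in if x = Lft then transition_index r \<Sigma> (idx D e) q \<theta> q' \<theta>'
              else transition_index r \<Sigma> (idx D e) q' \<theta>' q \<theta>)))"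

text \<open>\<open>\<Sigma>\<close> has a decomposition of type \<open>D\<close> such that it is isomorphic to the spin surface with parametrised
  boundary defined by the marking of \<open>D\<close>.\<close>

definition presented_by :: "nat \<Rightarrow> ('p, 'q) bordism \<Rightarrow> decomposition \<Rightarrow> bool" where
  "presented_by r \<Sigma> D \<longleftrightarrow> marked_decomposition r D \<and> admissible r D (ins \<Sigma>) (outs \<Sigma>) \<and>
     (\<exists>\<xi> \<gamma> vp \<sigma>. decomposes \<Sigma> D \<xi> \<gamma> vp \<and>
        (\<forall>f<nfc D. face_trivialisation \<Sigma> (nsd D f) (\<xi> f) (\<sigma> f)) \<and>
        (\<forall>(f, k)\<in>sides D. \<forall>(f', k')\<in>sides D. \<forall>e. att D f k = (e, Lft) \<and> att D f' k' = (e, Rgt) \<longrightarrow>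
           (\<forall>t\<in>{0<..<1}. let u = poly_angle (nsd D f) k t; u' = poly_angle (nsd D f') k' (1 - t) in
              transition_index r \<Sigma> (idx D e) (\<sigma> f (cis u)) (u + pi / 2) (\<sigma> f' (cis u')) (u' + pi / 2))) \<and>
        (\<forall>i<length (bin D). boundary_index r \<Sigma> D \<sigma> \<gamma> (bin D ! i) (ins \<Sigma> ! i) (pi / 2)
           (phi_in \<Sigma> i) (lphi_in \<Sigma> i)) \<and>
        (\<forall>i<length (bout D). boundary_index r \<Sigma> D \<sigma> \<gamma> (bout D ! i) (outs \<Sigma> ! i) (3 * pi / 2)
           (phi_out \<Sigma> i) (lphi_out \<Sigma> i)))"

section \<open>The state sum\<close>

definition edge_sides :: "decomposition \<Rightarrow> tlabel list" where
  "edge_sides D = [LE e x. e \<leftarrow> [0..<ned D], x \<leftarrow> [Lft, Rgt], attached D e x]"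

definition face_sides :: "decomposition \<Rightarrow> tlabel list" where
  "face_sides D = [LE (fst (att D f k)) (snd (att D f k)). f \<leftarrow> [0..<nfc D], k \<leftarrow> [0..<nsd D f]]"

definition edge_sources :: "decomposition \<Rightarrow> nat \<Rightarrow> tlabel list" where
  "edge_sources D e = (if e \<in> set (bin D) then [LIn e] else [])"

definition edge_targets :: "decomposition \<Rightarrow> nat \<Rightarrow> tlabel list" where
  "edge_targets D e =
     (if e \<in> set (bin D) then [if attached D e Lft then LE e Lft else LE e Rgt]
      else if e \<in> set (bout D) then
        (if attached D e Lft then [LE e Lft, LOut e] else [LOut e, LE e Rgt])
      else [LE e Lft, LE e Rgt])"

text \<open>A choice of an edge side at every vertex which is not on the outgoing boundary.\<close>

definition vertex_choice :: "decomposition \<Rightarrow> (nat \<Rightarrow> nat \<times> side) \<Rightarrow> bool" where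
  "vertex_choice D V \<longleftrightarrow> (\<forall>v<nvt D. v \<notin> src D ` set (bout D) \<longrightarrow>
     (case V v of (e, x) \<Rightarrow> e < ned D \<and> attached D e x \<and> (v = src D e \<or> v = tgt D e)))"

definition vertex_weight :: "decomposition \<Rightarrow> (nat \<Rightarrow> nat \<times> side) \<Rightarrow> tlabel \<Rightarrow> nat" where
  "vertex_weight D V l =
     card {v. v < nvt D \<and> v \<notin> src D ` set (bout D) \<and> LE (fst (V v)) (snd (V v)) = l}"

context smc_data
begin

text \<open>The weight of an ingoing edge with the surface on its left is \<open>N\<close> to the power \<open>- s - 1\<close>.  Reversing an
  edge replaces \<open>s\<close> by \<open>-1 - s\<close>, so the weight is \<open>N\<close> to the power \<open>s\<close> if the surface is on its
  right.\<close>

definition edge_weight :: "('o, 'm) frob \<Rightarrow> decomposition \<Rightarrow> nat \<Rightarrow> 'm" where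
  "edge_weight A D e =
     (if e \<in> set (bin D) then
        (if attached D e Lft then nak_pow A (- idx D e - 1) else nak_pow A (idx D e))
      else (\<one>(Car A) \<otimes> nak_pow A (idx D e + 1)) \<cdot> Com A \<cdot> Eta A)"

definition sum_C :: "('o, 'm) frob \<Rightarrow> decomposition \<Rightarrow> 'm" where
  "sum_C A D =
     relabel (Car A) (concat (map (edge_targets D) [0..<ned D])) (edge_sides D @ map LOut (bout D))
     \<cdot> tenM (map (edge_weight A D) [0..<ned D])
     \<cdot> relabel (Car A) (map LIn (bin D)) (concat (map (edge_sources D) [0..<ned D]))"

definition sum_Y :: "('o, 'm) frob \<Rightarrow> decomposition \<Rightarrow> (nat \<Rightarrow> nat \<times> side) \<Rightarrow> 'm" where
  "sum_Y A D V =
     tenM (map (\<lambda>l. npow (Car A) (lmul A (window_inv A)) (vertex_weight D V l)) (edge_sides D))"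

definition sum_F :: "('o, 'm) frob \<Rightarrow> decomposition \<Rightarrow> 'm" where
  "sum_F A D = tenM (map (\<lambda>f. Eps A \<cdot> mul_n A (nsd D f)) [0..<nfc D])"

definition sum_L :: "('o, 'm) frob \<Rightarrow> decomposition \<Rightarrow> (nat \<Rightarrow> nat \<times> side) \<Rightarrow> 'm" where
  "sum_L A D V =
     ((sum_F A D \<cdot> relabel (Car A) (edge_sides D) (face_sides D) \<cdot> sum_Y A D V)
        \<otimes> \<one>(pow (Car A) (length (bout D)))) \<cdot> sum_C A D"

definition state_sum ::
  "('o, 'm) frob \<Rightarrow> (int \<Rightarrow> 'm) \<Rightarrow> (int \<Rightarrow> 'm) \<Rightarrow> int list \<Rightarrow> int list \<Rightarrow> decomposition \<Rightarrow>
   (nat \<Rightarrow> nat \<times> side) \<Rightarrow> 'm" where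
  "state_sum A \<iota> \<pi> lam mu D V = tenM (map \<pi> mu) \<cdot> sum_L A D V \<cdot> tenM (map \<iota> lam)"

text \<open>\<open>Zo\<close> and \<open>Zm\<close> are the values on objects (with underlying sets \<open>{0, \<dots>, n - 1}\<close>) and morphisms of the
  state-sum theory of \<open>A\<close>: the value of a bordism is the state sum of any
  marked decomposition presenting it, with any choice \<open>V\<close> of edge sides.\<close>

definition state_sum_theory ::
  "nat \<Rightarrow> ('o, 'm) frob \<Rightarrow> (int \<Rightarrow> 'o) \<Rightarrow> (int \<Rightarrow> 'm) \<Rightarrow> (int \<Rightarrow> 'm) \<Rightarrow>
   (int list \<Rightarrow> 'o) \<Rightarrow> (('p, 'q) bordism \<Rightarrow> 'm) \<Rightarrow> bool" where
  "state_sum_theory r A Z \<iota> \<pi> Zo Zm \<longleftrightarrow>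
     (\<forall>\<rho>. set \<rho> \<subseteq> Zr r \<longrightarrow> Zo \<rho> = tenO (map Z \<rho>)) \<and>
     (\<forall>\<Sigma> D V. rspin_bordism r \<Sigma> \<and> presented_by r \<Sigma> D \<and> vertex_choice D V \<longrightarrow>
        Zm \<Sigma> = state_sum A \<iota> \<pi> (ins \<Sigma>) (outs \<Sigma>) D V)"

end

section \<open>The bordisms\<close>

definition is_S10 :: "nat \<Rightarrow> ('p, 'q) bordism \<Rightarrow> bool" where
  "is_S10 r \<Sigma> \<longleftrightarrow> rspin_bordism r \<Sigma> \<and> is_disc \<Sigma> \<and> ins \<Sigma> = [] \<and> outs \<Sigma> = [0]"

definition is_S01 :: "nat \<Rightarrow> ('p, 'q) bordism \<Rightarrow> bool" where
  "is_S01 r \<Sigma> \<longleftrightarrow> rspin_bordism r \<Sigma> \<and> is_disc \<Sigma> \<and> ins \<Sigma> = [2 mod int r] \<and> outs \<Sigma> = []"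

text \<open>A 9-gon glued to a 3-holed sphere.  The edges \<open>0, 1, 2\<close> are \<open>r\<^sub>1, r\<^sub>2, r\<^sub>3\<close>, the edges \<open>3, 4, 5\<close> are
  \<open>u\<^sub>1, u\<^sub>2, u\<^sub>3\<close>, and the vertex \<open>0\<close> is the inner one.  The list \<open>js\<close> is the order in
  which the boundary components follow each other counter-clockwise, starting at the marked side.\<close>

definition nine_gon ::
  "nat \<Rightarrow> nat list \<Rightarrow> (nat \<Rightarrow> int) \<Rightarrow> nat list \<Rightarrow> nat list \<Rightarrow> decomposition" where
  "nine_gon r js s bi bo = \<lparr>nfc = 1, nsd = (\<lambda>f. 9), ned = 6, nvt = 4,
     att = (\<lambda>f k. concat (map (\<lambda>j. [(j, Lft), (j + 3, Rgt), (j, Rgt)]) js) ! k),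
     src = (\<lambda>e. if e < 3 then 0 else e - 2),
     tgt = (\<lambda>e. if e < 3 then e + 1 else e - 2),
     idx = (\<lambda>e. if e < 3 then s e mod int r else 0), bin = bi, bout = bo\<rparr>"

definition is_S12 :: "nat \<Rightarrow> int \<Rightarrow> int \<Rightarrow> ('p, 'q) bordism \<Rightarrow> bool" where
  "is_S12 r a b \<Sigma> \<longleftrightarrow> rspin_bordism r \<Sigma> \<and> ins \<Sigma> = [a, b] \<and> outs \<Sigma> = [(a + b) mod int r] \<and>
     presented_by r \<Sigma> (nine_gon r [0, 1, 2] (\<lambda>j. [a - 1, b - 1, 1 - (a + b)] ! j) [3, 4] [5])"

text \<open>A collar is embedded with its orientation, and the ingoing ones lie outside and the outgoing ones
  inside of the unit circle.  Exchanging in- and outgoing components while keeping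
  the parametrisations of the boundary circles therefore reverses the orientation of the
  surface, so that the 9-gon is traversed in the opposite direction, from the same corner.\<close>

definition is_S21 :: "nat \<Rightarrow> int \<Rightarrow> int \<Rightarrow> ('p, 'q) bordism \<Rightarrow> bool" where
  "is_S21 r a b \<Sigma> \<longleftrightarrow> rspin_bordism r \<Sigma> \<and> ins \<Sigma> = [(a + b - 2) mod int r] \<and> outs \<Sigma> = [a, b] \<and>
     presented_by r \<Sigma> (nine_gon r [2, 1, 0] (\<lambda>j. [1 - a, 1 - b, (a + b - 2) - 1] ! j) [5] [3, 4])"

end

theory Submission
  imports Defs
begin

text \<open>Write \<open>w = \<Delta> \<circ> \<eta> = e\<^sub>1 \<otimes> e\<^sub>2\<close>. In the state sum of a 9-gon the face and the inner edges contribute a product of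
  terms \<open>e\<^sub>1 x N\<^sup>k e\<^sub>2\<close>, and each such term is \<open>\<tau> P\<^sub>k x\<close>. Hence an ingoing circle, where \<open>x\<close> factors through
  \<open>\<iota>\<^sub>k\<close>, contributes \<open>\<tau> x\<close>. At an outgoing circle the same operator appears under the nondegenerate pairing
  \<open>\<epsilon> \<circ> \<mu>\<close>, whose adjoint exchanges \<open>P\<^sub>k\<close> and \<open>P\<^bsub>2 - k\<^esub>\<close> because \<open>N\<close> is the Nakayama automorphism. As \<open>\<tau>\<close> is
  central, this leaves the product and coproduct of the graded center.

  The unit and counit come from discs, which are only given up to isomorphism, so one has to exhibit a
  decomposition. A disc is a 1-gon: the frame of its parametrisation lifts to the spin structure since a disc is
  simply connected, and on the boundary the angle between this lift and the collar is a continuous function with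
  discrete values, which defines the edge index. Every edge index is admissible, and the state sum does
  not depend on it.\<close>

text \<open>The value at a bordism is prescribed for every presenting decomposition and every
  \<open>V\<close>, so one convenient pair per bordism decides it. What shapes the algebra is the
  order of the tensor factors: edges, faces and boundary circles list them differently, so
  permutations of factors have to compose functorially before a 9-gon can be evaluated in three
  blocks, one for the sides \<open>r_j, u_j, r_j\<close> of each circle. The 2 in P_{2-k} has two
  sources: passing to the adjoint swaps the copairing, which turns N^k into N^{1-k}, and costs one
  more N. For the discs, lifts and angles are unique only up to deck transformations. One fact
  controls both: if two continuous sections over a connected set differ at each point by an element
  whose angle lift sends 0 to a multiple of pi, this multiple can be chosen constant. It makes local
  lifts of the frame glue, and it gives the edge index on the open arc that the vertex
  leaves.\<close>

definition reordering :: "'l list \<Rightarrow> 'l list \<Rightarrow> bool" where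
  "reordering xs ys \<longleftrightarrow> distinct xs \<and> distinct ys \<and> set xs = set ys"

lemma reordering_length: "reordering xs ys \<Longrightarrow> length xs = length ys"
  by (metis reordering_def distinct_card)

text \<open>\<open>relabel\<close> looks up the head \<open>y\<close> of the target order in the
  source order; this is the split that its recursion computes, with the hypothesis for the recursive
  call.\<close>

lemma reordering_ConsE:
  assumes "reordering xs (y # ys)"
  obtains us vs where "xs = us @ y # vs" "y \<notin> set us" "reordering (us @ vs) ys"
proof -
  have "y \<in> set xs" using assms by (auto simp: reordering_def)
  then obtain us vs where *: "xs = us @ y # vs" by (meson split_list)
  show thesis
    by (rule that[of us vs]) (use assms * in \<open>auto simp: reordering_def\<close>)
qed

section \<open>Strict symmetric monoidal categories\<close>

locale ssm = smc_data S for S :: "('o, 'm) smc" (structure) +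
  assumes ssm: strict_symmetric_monoidal
begin

lemma category: category
  using ssm by (simp add: strict_symmetric_monoidal_def)

lemma hom_iff [simp]: "f \<in> hom X Y \<longleftrightarrow> f \<in> Arr S \<and> Dom S f = X \<and> Cod S f = Y"
  by (simp add: hom_def)

lemma ob_dom_cod [simp]: "f \<in> Arr S \<Longrightarrow> Dom S f \<in> Ob S" "f \<in> Arr S \<Longrightarrow> Cod S f \<in> Ob S"
  using category by (auto simp: category_def)

lemma arr_id [simp]:
  assumes "X \<in> Ob S"
  shows "\<one>X \<in> Arr S" "Dom S (\<one>X) = X" "Cod S (\<one>X) = X"
  using assms category by (auto simp: category_def)

lemma arr_comp [simp]:
  assumes "f \<in> Arr S" "g \<in> Arr S" "Dom S g = Cod S f"
  shows "g \<cdot> f \<in> Arr S" "Dom S (g \<cdot> f) = Dom S f" "Cod S (g \<cdot> f) = Cod S g"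
  using assms category by (auto simp: category_def)

lemma comp_id [simp]:
  "f \<in> Arr S \<Longrightarrow> Dom S f = X \<Longrightarrow> f \<cdot> \<one>X = f" "f \<in> Arr S \<Longrightarrow> Cod S f = X \<Longrightarrow> \<one>X \<cdot> f = f"
  using category by (auto simp: category_def)

lemma comp_assoc [simp]:
  "f \<in> Arr S \<Longrightarrow> g \<in> Arr S \<Longrightarrow> h \<in> Arr S \<Longrightarrow> Dom S g = Cod S f \<Longrightarrow> Dom S h = Cod S g \<Longrightarrow>
    (h \<cdot> g) \<cdot> f = h \<cdot> g \<cdot> f"
  using category by (auto simp: category_def)

lemma ob_unt [simp]: "Unt S \<in> Ob S"
  using ssm by (simp add: strict_symmetric_monoidal_def)

lemma ob_ten [simp]: "X \<in> Ob S \<Longrightarrow> Y \<in> Ob S \<Longrightarrow> X \<odot> Y \<in> Ob S"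
  using ssm by (simp add: strict_symmetric_monoidal_def)

lemma ten_id: "X \<in> Ob S \<Longrightarrow> Y \<in> Ob S \<Longrightarrow> \<one>X \<otimes> \<one>Y = \<one>(X \<odot> Y)"
  using ssm by (simp add: strict_symmetric_monoidal_def)

lemma arr_ten [simp]:
  assumes "f \<in> Arr S" "g \<in> Arr S"
  shows "f \<otimes> g \<in> Arr S" "Dom S (f \<otimes> g) = Dom S f \<odot> Dom S g" "Cod S (f \<otimes> g) = Cod S f \<odot> Cod S g"
  using assms ssm by (auto simp: strict_symmetric_monoidal_def)

lemma interchange:
  "f \<in> Arr S \<Longrightarrow> f' \<in> Arr S \<Longrightarrow> g \<in> Arr S \<Longrightarrow> g' \<in> Arr S \<Longrightarrow>
    Dom S f' = Cod S f \<Longrightarrow> Dom S g' = Cod S g \<Longrightarrow>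
    (f' \<otimes> g') \<cdot> (f \<otimes> g) = (f' \<cdot> f) \<otimes> (g' \<cdot> g)"
  using ssm by (simp add: strict_symmetric_monoidal_def)

lemma unit_ob [simp]: "X \<in> Ob S \<Longrightarrow> Unt S \<odot> X = X" "X \<in> Ob S \<Longrightarrow> X \<odot> Unt S = X"
  using ssm by (simp_all add: strict_symmetric_monoidal_def)

lemma tenO_assoc [simp]:
  "X \<in> Ob S \<Longrightarrow> Y \<in> Ob S \<Longrightarrow> Z \<in> Ob S \<Longrightarrow> (X \<odot> Y) \<odot> Z = X \<odot> Y \<odot> Z"
  using ssm by (simp add: strict_symmetric_monoidal_def)

lemma unit_arr [simp]: "f \<in> Arr S \<Longrightarrow> \<one>(Unt S) \<otimes> f = f" "f \<in> Arr S \<Longrightarrow> f \<otimes> \<one>(Unt S) = f"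
  using ssm by (simp_all add: strict_symmetric_monoidal_def)

lemma tenM_assoc [simp]:
  "f \<in> Arr S \<Longrightarrow> g \<in> Arr S \<Longrightarrow> h \<in> Arr S \<Longrightarrow> (f \<otimes> g) \<otimes> h = f \<otimes> g \<otimes> h"
  using ssm by (simp add: strict_symmetric_monoidal_def)

lemma arr_brd [simp]:
  assumes "X \<in> Ob S" "Y \<in> Ob S"
  shows "Brd S X Y \<in> Arr S" "Dom S (Brd S X Y) = X \<odot> Y" "Cod S (Brd S X Y) = Y \<odot> X"
  using assms ssm by (auto simp: strict_symmetric_monoidal_def)

lemma brd_inv [simp]: "X \<in> Ob S \<Longrightarrow> Y \<in> Ob S \<Longrightarrow> Brd S Y X \<cdot> Brd S X Y = \<one>(X \<odot> Y)"
  using ssm by (simp add: strict_symmetric_monoidal_def)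

lemma brd_nat:
  "f \<in> Arr S \<Longrightarrow> g \<in> Arr S \<Longrightarrow>
    Brd S (Cod S f) (Cod S g) \<cdot> (f \<otimes> g) = (g \<otimes> f) \<cdot> Brd S (Dom S f) (Dom S g)"
  using ssm by (simp add: strict_symmetric_monoidal_def)

lemma hexagon:
  "X \<in> Ob S \<Longrightarrow> Y \<in> Ob S \<Longrightarrow> Z \<in> Ob S \<Longrightarrow>
    Brd S X (Y \<odot> Z) = (\<one>Y \<otimes> Brd S X Z) \<cdot> (Brd S X Y \<otimes> \<one>Z)"
  using ssm by (simp add: strict_symmetric_monoidal_def)

lemma brd_natural:
  assumes "f \<in> hom X X'" "g \<in> hom Y Y'"
  shows "Brd S X' Y' \<cdot> (f \<otimes> g) = (g \<otimes> f) \<cdot> Brd S X Y"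
  using brd_nat[of f g] assms by auto

text \<open>\<open>comp_assoc\<close> nests composites to the right, after which an equation for
  \<open>g \<cdot> f\<close> no longer matches inside \<open>g \<cdot> f \<cdot> h\<close>. This is
  its version with a tail.\<close>

lemma comp_rule:
  assumes "g \<cdot> f = k" "f \<in> Arr S" "g \<in> Arr S" "h \<in> Arr S" "Dom S g = Cod S f" "Dom S f = Cod S h"
  shows "g \<cdot> f \<cdot> h = k \<cdot> h"
  using assms by (metis comp_assoc)

lemma ten_merge:
  assumes "f \<in> Arr S" "f' \<in> Arr S" "Dom S f' = Cod S f" "X \<in> Ob S"
  shows "(\<one>X \<otimes> f') \<cdot> (\<one>X \<otimes> f) = \<one>X \<otimes> (f' \<cdot> f)" "(f' \<otimes> \<one>X) \<cdot> (f \<otimes> \<one>X) = (f' \<cdot> f) \<otimes> \<one>X"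
  using assms by (simp_all add: interchange)

lemma ten_split:
  assumes "f \<in> Arr S" "g \<in> Arr S"
  shows "f \<otimes> g = (f \<otimes> \<one>(Cod S g)) \<cdot> (\<one>(Dom S f) \<otimes> g)" "f \<otimes> g = (\<one>(Cod S f) \<otimes> g) \<cdot> (f \<otimes> \<one>(Dom S g))"
  using assms by (simp_all add: interchange)

text \<open>Only the other hexagon is an axiom. The candidate is a right inverse of
  \<open>Brd S Z (X \<odot> Y)\<close>, which by symmetry is inverted by the braiding in the
  opposite direction.\<close>

lemma hexagon2:
  assumes [simp]: "X \<in> Ob S" "Y \<in> Ob S" "Z \<in> Ob S"
  shows "Brd S (X \<odot> Y) Z = (Brd S X Z \<otimes> \<one>Y) \<cdot> (\<one>X \<otimes> Brd S Y Z)"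
proof -
  let ?b = "(Brd S X Z \<otimes> \<one>Y) \<cdot> (\<one>X \<otimes> Brd S Y Z)"
  have "Brd S Z (X \<odot> Y) \<cdot> ?b = (\<one>X \<otimes> Brd S Z Y) \<cdot> (Brd S Z X \<otimes> \<one>Y) \<cdot> (Brd S X Z \<otimes> \<one>Y) \<cdot> (\<one>X \<otimes> Brd S Y Z)"
    by (simp add: hexagon)
  also have "\<dots> = \<one>(X \<odot> Y \<odot> Z)"
    by (subst comp_rule[OF ten_merge(2)]) (simp_all add: ten_merge ten_id)
  finally have "Brd S (X \<odot> Y) Z \<cdot> (Brd S Z (X \<odot> Y) \<cdot> ?b) = Brd S (X \<odot> Y) Z"
    by simp
  then show ?thesis
    by (subst (asm) comp_assoc[symmetric]) (simp_all del: comp_assoc)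
qed

text \<open>The hexagon with both further objects equal to the unit makes
  \<open>Brd S X (Unt S)\<close> idempotent, and it is invertible.\<close>

lemma brd_unit [simp]:
  assumes [simp]: "X \<in> Ob S"
  shows "Brd S X (Unt S) = \<one>X" "Brd S (Unt S) X = \<one>X"
proof -
  have "Brd S X (Unt S) = Brd S X (Unt S) \<cdot> Brd S X (Unt S)"
    using hexagon[of X "Unt S" "Unt S"] by simp
  then have "Brd S (Unt S) X \<cdot> Brd S X (Unt S) = (Brd S (Unt S) X \<cdot> Brd S X (Unt S)) \<cdot> Brd S X (Unt S)"
    by (simp del: brd_inv)
  then show *: "Brd S X (Unt S) = \<one>X" by simp
  show "Brd S (Unt S) X = \<one>X"
    using brd_inv[of X "Unt S"] by (simp add: * del: brd_inv)
qed

text \<open>A state, that is a morphism out of the unit, passes any factor because the braiding with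
  the unit is trivial. Permutations of states are evaluated by this rule instead of being
  computed.\<close>

lemma brd_state:
  assumes "f \<in> hom (Unt S) X'" "g \<in> hom Y Y'"
  shows "Brd S X' Y' \<cdot> (f \<otimes> g) = g \<otimes> f" "Brd S Y' X' \<cdot> (g \<otimes> f) = f \<otimes> g"
  using assms by (auto simp: brd_nat)

subsection \<open>Tensor powers and permutations of factors\<close>

lemma tenO_simps [simp]: "tenO [] = Unt S" "tenO (X # Xs) = X \<odot> tenO Xs"
  by (simp_all add: tenO_def)

lemma tenM_simps [simp]: "tenM [] = \<one>(Unt S)" "tenM (f # fs) = f \<otimes> tenM fs"
  by (simp_all add: tenM_def)

lemma ob_tenO [simp]: "set Xs \<subseteq> Ob S \<Longrightarrow> tenO Xs \<in> Ob S"
  by (induction Xs) auto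

lemma ob_pow [simp]: "X \<in> Ob S \<Longrightarrow> pow X n \<in> Ob S"
  by (rule ob_tenO) auto

lemma tenO_append [simp]: "set Xs \<subseteq> Ob S \<Longrightarrow> set Ys \<subseteq> Ob S \<Longrightarrow> tenO (Xs @ Ys) = tenO Xs \<odot> tenO Ys"
  by (induction Xs) auto

lemma pow_add: "X \<in> Ob S \<Longrightarrow> pow X (m + n) = pow X m \<odot> pow X n"
  by (induction m) auto

lemma pow_Suc2 [simp]: "X \<in> Ob S \<Longrightarrow> pow X n \<odot> X = X \<odot> pow X n"
  by (induction n) auto

lemma pow_shift [simp]:
  "X \<in> Ob S \<Longrightarrow> Y \<in> Ob S \<Longrightarrow> pow X n \<odot> X \<odot> Y = X \<odot> pow X n \<odot> Y"
  by (metis ob_pow pow_Suc2 tenO_assoc)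

lemma arr_tenM:
  assumes "set fs \<subseteq> Arr S"
  shows "tenM fs \<in> Arr S" "Dom S (tenM fs) = tenO (map (Dom S) fs)"
    "Cod S (tenM fs) = tenO (map (Cod S) fs)"
  using assms by (induction fs) auto

lemma tenM_append: "set fs \<subseteq> Arr S \<Longrightarrow> set gs \<subseteq> Arr S \<Longrightarrow> tenM (fs @ gs) = tenM fs \<otimes> tenM gs"
  by (induction fs) (auto simp: arr_tenM)

text \<open>The elementary move in the recursion of \<open>relabel\<close>: the factor with
  \<open>m\<close> factors before it and \<open>n\<close> behind it comes to the front.\<close>

definition fetch :: "'o \<Rightarrow> nat \<Rightarrow> nat \<Rightarrow> 'm" where
  "fetch X m n = Brd S (pow X m) X \<otimes> \<one>(pow X n)"

lemma arr_fetch [simp]: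
  assumes [simp]: "X \<in> Ob S"
  shows "fetch X m n \<in> Arr S" "Dom S (fetch X m n) = pow X (m + Suc n)"
    "Cod S (fetch X m n) = X \<odot> pow X (m + n)"
  by (simp_all add: fetch_def pow_add)

declare relabel.simps(2) [simp del]

lemma relabel_Cons:
  assumes "y \<notin> set us"
  shows "relabel X (us @ y # vs) (y # ys) = (\<one>X \<otimes> relabel X (us @ vs) ys) \<cdot> fetch X (length us) (length vs)"
proof -
  have *: "takeWhile (\<lambda>x. x \<noteq> y) (us @ y # vs) = us" "dropWhile (\<lambda>x. x \<noteq> y) (us @ y # vs) = y # vs"
    using assms by (induction us) auto
  show ?thesis by (simp add: relabel.simps * fetch_def)
qed

lemma arr_relabel:
  assumes [simp]: "X \<in> Ob S" and "reordering xs ys"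
  shows "relabel X xs ys \<in> hom (pow X (length xs)) (pow X (length ys))"
  using assms(2)
proof (induction ys arbitrary: xs)
  case Nil
  then show ?case by (simp add: reordering_def)
next
  case (Cons y ys)
  then obtain us vs where *: "xs = us @ y # vs" "y \<notin> set us" "reordering (us @ vs) ys"
    by (metis reordering_ConsE)
  have "length (us @ vs) = length ys" using *(3) reordering_length by blast
  with Cons.IH[OF *(3)] show ?case by (auto simp: * relabel_Cons)
qed

lemma relabel_arr [simp]:
  assumes "X \<in> Ob S" "reordering xs ys"
  shows "relabel X xs ys \<in> Arr S" "Dom S (relabel X xs ys) = pow X (length xs)"
    "Cod S (relabel X xs ys) = pow X (length ys)"
  using arr_relabel[OF assms] by auto

lemma fetch_0: "X \<in> Ob S \<Longrightarrow> fetch X 0 n = \<one>(X \<odot> pow X n)"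
  by (simp add: fetch_def ten_id)

lemma fetch_Suc:
  assumes [simp]: "X \<in> Ob S"
  shows "fetch X (Suc m) n = (Brd S X X \<otimes> \<one>(pow X (m + n))) \<cdot> (\<one>X \<otimes> fetch X m n)"
proof -
  have "fetch X (Suc m) n = ((Brd S X X \<otimes> \<one>(pow X m)) \<cdot> (\<one>X \<otimes> Brd S (pow X m) X)) \<otimes> \<one>(pow X n)"
    by (simp add: fetch_def hexagon2)
  also have "\<dots> = ((Brd S X X \<otimes> \<one>(pow X m)) \<otimes> \<one>(pow X n)) \<cdot> ((\<one>X \<otimes> Brd S (pow X m) X) \<otimes> \<one>(pow X n))"
    by (rule ten_merge(2)[symmetric]) auto
  finally show ?thesis by (simp add: fetch_def ten_id pow_add)
qed

text \<open>This is the Yang-Baxter equation.\<close>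

lemma fetch_fetch:
  assumes [simp]: "X \<in> Ob S"
  shows "(Brd S X X \<otimes> \<one>(pow X (p + q + s))) \<cdot> (\<one>X \<otimes> fetch X (p + q) s) \<cdot> fetch X p (q + Suc s)
       = (\<one>X \<otimes> fetch X p (q + s)) \<cdot> fetch X (Suc p + q) s"
proof -
  let ?P = "pow X p" and ?Q = "pow X q" and ?S = "pow X s"
  let ?B = "Brd S ?P X"
  have "(Brd S X X \<otimes> \<one>(pow X (p + q + s))) \<cdot> (\<one>X \<otimes> fetch X (p + q) s)
      = fetch X (Suc (p + q)) s"
    by (simp add: fetch_Suc)
  then have "(Brd S X X \<otimes> \<one>(pow X (p + q + s))) \<cdot> (\<one>X \<otimes> fetch X (p + q) s) \<cdot> fetch X p (q + Suc s)
      = fetch X (Suc (p + q)) s \<cdot> fetch X p (q + Suc s)"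
    by (subst comp_rule) (auto simp: fetch_def pow_add)
  also have "\<dots> = (Brd S (X \<odot> ?P \<odot> ?Q) X \<cdot> ((?B \<otimes> \<one>?Q) \<otimes> \<one>X)) \<otimes> \<one>?S"
  proof -
    have *: "fetch X p (q + Suc s) = ((?B \<otimes> \<one>?Q) \<otimes> \<one>X) \<otimes> \<one>?S"
      by (simp add: fetch_def pow_add ten_id)
    have **: "fetch X (Suc (p + q)) s = Brd S (X \<odot> ?P \<odot> ?Q) X \<otimes> \<one>?S"
      by (simp add: fetch_def pow_add)
    show ?thesis unfolding * ** by (rule ten_merge) auto
  qed
  also have "Brd S (X \<odot> ?P \<odot> ?Q) X \<cdot> ((?B \<otimes> \<one>?Q) \<otimes> \<one>X) = (\<one>X \<otimes> (?B \<otimes> \<one>?Q)) \<cdot> Brd S (?P \<odot> X \<odot> ?Q) X"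
    by (rule brd_natural) auto
  also have "\<dots> \<otimes> \<one>?S = ((\<one>X \<otimes> (?B \<otimes> \<one>?Q)) \<otimes> \<one>?S) \<cdot> (Brd S (?P \<odot> X \<odot> ?Q) X \<otimes> \<one>?S)"
    by (rule ten_merge(2)[symmetric]) auto
  also have "(\<one>X \<otimes> (?B \<otimes> \<one>?Q)) \<otimes> \<one>?S = \<one>X \<otimes> fetch X p (q + s)"
    by (simp add: fetch_def pow_add ten_id[symmetric])
  also have "?P \<odot> X \<odot> ?Q = X \<odot> ?P \<odot> ?Q"
    by simp
  then have "Brd S (?P \<odot> X \<odot> ?Q) X \<otimes> \<one>?S = fetch X (Suc p + q) s"
    by (simp add: fetch_def pow_add)
  finally show ?thesis .
qed

text \<open>The swap of the two fetched factors is an involution, so it can change sides in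
  \<open>fetch_fetch\<close>.\<close>

lemma fetch_fetch_rev:
  assumes [simp]: "X \<in> Ob S"
  shows "(Brd S X X \<otimes> \<one>(pow X (p + q + s))) \<cdot> (\<one>X \<otimes> fetch X p (q + s)) \<cdot> fetch X (Suc p + q) s
       = (\<one>X \<otimes> fetch X (p + q) s) \<cdot> fetch X p (q + Suc s)"
proof -
  let ?b = "Brd S X X \<otimes> \<one>(pow X (p + q + s))"
  let ?f = "(\<one>X \<otimes> fetch X (p + q) s) \<cdot> fetch X p (q + Suc s)"
  have [simp]: "?f \<in> Arr S" "Cod S ?f = X \<odot> X \<odot> pow X (p + q + s)"
    by (simp_all add: add.assoc)
  have "?b \<cdot> ?b \<cdot> ?f = ?f"
    by (subst comp_rule[OF ten_merge(2)]) (simp_all add: ten_id add.assoc)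
  then show ?thesis
    by (simp only: fetch_fetch assms)
qed

text \<open>The core of functoriality: \<open>z\<close> may be extracted before or after a
  permutation. In the induction on the part of the target before \<open>z\<close>, its head
  \<open>y\<close> lies before or after \<open>z\<close> in the source, and the two orders of
  extracting \<open>y\<close> and \<open>z\<close> differ by a swap, which
  \<open>fetch_fetch\<close> and its reverse account for.\<close>

lemma fetch_relabel:
  assumes [simp]: "X \<in> Ob S" and "reordering (us @ z # vs) (us' @ z # vs')"
  shows "fetch X (length us') (length vs') \<cdot> relabel X (us @ z # vs) (us' @ z # vs')
       = (\<one>X \<otimes> relabel X (us @ vs) (us' @ vs')) \<cdot> fetch X (length us) (length vs)"
  using assms(2)
proof (induction us' arbitrary: us vs)
  case Nil
  then have "z \<notin> set us" "reordering (us @ vs) vs'" by (auto simp: reordering_def)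
  moreover have "length us + length vs = length vs'"
    using reordering_length[OF \<open>reordering (us @ vs) vs'\<close>] by simp
  ultimately show ?case by (simp add: relabel_Cons fetch_0)
next
  case (Cons y us')
  have r: "reordering (us @ z # vs) (y # us' @ z # vs')" using Cons.prems by simp
  then obtain ps qs where ps: "us @ z # vs = ps @ y # qs" "y \<notin> set ps"
    "reordering (ps @ qs) (us' @ z # vs')"
    by (rule reordering_ConsE)
  have yz: "y \<noteq> z" "distinct (us @ z # vs)" using r by (auto simp: reordering_def)
  let ?n = "length us' + length vs'"
  have len: "length us + length vs = Suc ?n" "length ps + length qs = Suc ?n"
    using reordering_length[OF r] reordering_length[OF ps(3)] by auto
  \<comment> \<open>\<open>us1\<close>, \<open>vs1\<close> split the source at \<open>z\<close> once
    \<open>y\<close> is removed, \<open>us2\<close>, \<open>vs2\<close> split it at \<open>y\<close>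
    once \<open>z\<close> is removed. The last equation covers both relative positions of
    \<open>y\<close> and \<open>z\<close>.\<close>
  obtain us1 vs1 us2 vs2 where 
    z: "ps @ qs = us1 @ z # vs1" "length us1 + length vs1 = ?n" 
    and y: "us @ vs = us2 @ y # vs2" "y \<notin> set us2" "us2 @ vs2 = us1 @ vs1"
    and f: "(Brd S X X \<otimes> \<one>(pow X ?n)) \<cdot> (\<one>X \<otimes> fetch X (length us1) (length vs1)) \<cdot> fetch X (length ps) (length qs)
      = (\<one>X \<otimes> fetch X (length us2) (length vs2)) \<cdot> fetch X (length us) (length vs)"
  proof -
    have "y \<in> set us \<or> y \<in> set vs"
      using ps(1) yz by (metis Un_iff in_set_conv_decomp insert_iff set_append list.set(2))
    then show thesis
    proof
      assume "y \<in> set us"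
      then obtain a b where ab: "us = a @ y # b" by (meson split_list)
      then have e: "ps = a" "qs = b @ z # vs" "y \<notin> set a"
      proof -
        have n: "y \<notin> set a" "y \<notin> set (b @ z # vs)" using yz(2) ab by auto
        have "a @ y # (b @ z # vs) = ps @ y # qs" using ps(1) ab by simp
        with n show "ps = a" "qs = b @ z # vs" "y \<notin> set a"
          using append_Cons_eq_iff[of y a "b @ z # vs" ps qs] by auto
      qed
      have n: "length a + length b + length vs = ?n" using len(1) ab by simp
      show thesis
        by (rule that[of "a @ b" vs a "b @ vs"])
          (use fetch_fetch[of X "length a" "length b" "length vs"] n in \<open>auto simp: e ab\<close>)
    next
      assume "y \<in> set vs"
      then obtain a b where ab: "vs = a @ y # b" by (meson split_list)
      then have e: "ps = us @ z # a" "qs = b" "y \<notin> set (us @ a)"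
      proof -
        have n: "y \<notin> set (us @ z # a)" "y \<notin> set b" using yz ab by auto
        have "(us @ z # a) @ y # b = ps @ y # qs" using ps(1) ab by simp
        with n show "ps = us @ z # a" "qs = b" "y \<notin> set (us @ a)"
          using append_Cons_eq_iff[of y "us @ z # a" b ps qs] by auto
      qed
      have n: "length us + length a + length b = ?n" using len(1) ab by simp
      show thesis
        by (rule that[of us "a @ b" "us @ a" b])
          (use fetch_fetch_rev[of X "length us" "length a" "length b"] n e(3) in \<open>auto simp: e ab\<close>)
    qed
  qed
  have r1: "reordering (us1 @ z # vs1) (us' @ z # vs')" using ps(3) z by simp
  then have r2: "reordering (us1 @ vs1) (us' @ vs')" by (auto simp: reordering_def)
  let ?R = "relabel X (us1 @ vs1) (us' @ vs')"
  have l: "length us1 + length vs1 = ?n" by (rule z(2))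
  have "fetch X (length (y # us')) (length vs') \<cdot> relabel X (us @ z # vs) ((y # us') @ z # vs')
    = ((Brd S X X \<otimes> \<one>(pow X ?n)) \<cdot> (\<one>X \<otimes> fetch X (length us') (length vs'))) \<cdot>
      (\<one>X \<otimes> relabel X (us1 @ z # vs1) (us' @ z # vs')) \<cdot> fetch X (length ps) (length qs)"
    using ps(2) by (simp add: ps(1) fetch_Suc relabel_Cons z(1))
  also have "\<dots> = (Brd S X X \<otimes> \<one>(pow X ?n)) \<cdot>
      ((\<one>X \<otimes> fetch X (length us') (length vs')) \<cdot> (\<one>X \<otimes> relabel X (us1 @ z # vs1) (us' @ z # vs')))
      \<cdot> fetch X (length ps) (length qs)"
    using r1 l len by simp
  also have "(\<one>X \<otimes> fetch X (length us') (length vs')) \<cdot> (\<one>X \<otimes> relabel X (us1 @ z # vs1) (us' @ z # vs'))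
      = \<one>X \<otimes> ((\<one>X \<otimes> ?R) \<cdot> fetch X (length us1) (length vs1))"
    using r1 l by (simp add: ten_merge Cons.IH)
  also have "\<dots> = (\<one>X \<otimes> (\<one>X \<otimes> ?R)) \<cdot> (\<one>X \<otimes> fetch X (length us1) (length vs1))"
    using r2 l by (simp add: ten_merge)
  also have "(Brd S X X \<otimes> \<one>(pow X ?n)) \<cdot> \<dots> \<cdot> fetch X (length ps) (length qs)
      = ((Brd S X X \<otimes> \<one>(pow X ?n)) \<cdot> (\<one>X \<otimes> (\<one>X \<otimes> ?R))) \<cdot> (\<one>X \<otimes> fetch X (length us1) (length vs1))
         \<cdot> fetch X (length ps) (length qs)"
    using r2 l len by simp
  also have "(Brd S X X \<otimes> \<one>(pow X ?n)) \<cdot> (\<one>X \<otimes> (\<one>X \<otimes> ?R)) = (\<one>(X \<odot> X) \<otimes> ?R) \<cdot> (Brd S X X \<otimes> \<one>(pow X ?n))"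
    using r2 l by (simp add: interchange ten_id flip: tenM_assoc)
  also have "\<dots> \<cdot> (\<one>X \<otimes> fetch X (length us1) (length vs1)) \<cdot> fetch X (length ps) (length qs)
    = (\<one>(X \<odot> X) \<otimes> ?R) \<cdot> (Brd S X X \<otimes> \<one>(pow X ?n)) \<cdot> (\<one>X \<otimes> fetch X (length us1) (length vs1)) \<cdot> fetch X (length ps) (length qs)"
    using r2 l len by simp
  also have "\<dots> = (\<one>X \<otimes> (\<one>X \<otimes> ?R)) \<cdot> (\<one>X \<otimes> fetch X (length us2) (length vs2)) \<cdot> fetch X (length us) (length vs)"
    using r2 l by (simp only: f) (simp flip: ten_id)
  also have "\<dots> = ((\<one>X \<otimes> (\<one>X \<otimes> ?R)) \<cdot> (\<one>X \<otimes> fetch X (length us2) (length vs2))) \<cdot> fetch X (length us) (length vs)"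
  proof -
    have "length us2 + length vs2 = ?n" using l y(3) by (metis length_append)
    then show ?thesis using r2 l len by simp
  qed
  also have "(\<one>X \<otimes> (\<one>X \<otimes> ?R)) \<cdot> (\<one>X \<otimes> fetch X (length us2) (length vs2))
     = \<one>X \<otimes> relabel X (us @ vs) ((y # us') @ vs')"
  proof -
    have "length us2 + length vs2 = ?n" using l y(3) by (metis length_append)
    then show ?thesis using r2 l len by (simp add: ten_merge y relabel_Cons)
  qed
  finally show ?case .
qed

text \<open>Lets any intermediate order be inserted between two given ones. By
  \<open>fetch_relabel\<close> the factor that the second permutation fetches can be fetched before
  the first one; the rest is the induction hypothesis.\<close>

lemma relabel_comp:
  assumes X [simp]: "X \<in> Ob S" and "reordering xs ys" "reordering ys zs"
  shows "relabel X ys zs \<cdot> relabel X xs ys = relabel X xs zs"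
  using assms(2,3)
proof (induction zs arbitrary: xs ys)
  case Nil
  then show ?case by (simp add: reordering_def)
next
  case (Cons z zs)
  from Cons.prems obtain us' vs' where ys: "ys = us' @ z # vs'" "z \<notin> set us'" "reordering (us' @ vs') zs"
    by (metis reordering_ConsE)
  have "reordering xs (z # zs)" using Cons.prems by (auto simp: reordering_def)
  then obtain us vs where xs: "xs = us @ z # vs" "z \<notin> set us" "reordering (us @ vs) zs"
    by (metis reordering_ConsE)
  have r: "reordering (us @ vs) (us' @ vs')" using xs ys by (auto simp: reordering_def)
  have l: "length us + length vs = length zs" "length us' + length vs' = length zs"
    using reordering_length[OF xs(3)] reordering_length[OF ys(3)] by auto
  have rl: "reordering (us @ z # vs) (us' @ z # vs')" using Cons.prems xs ys by simp
  have "relabel X ys (z # zs) \<cdot> relabel X xs ys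
      = ((\<one>X \<otimes> relabel X (us' @ vs') zs) \<cdot> fetch X (length us') (length vs')) \<cdot> relabel X (us @ z # vs) (us' @ z # vs')"
    using ys xs by (simp add: relabel_Cons)
  also have "\<dots> = (\<one>X \<otimes> relabel X (us' @ vs') zs) \<cdot> fetch X (length us') (length vs') \<cdot> relabel X (us @ z # vs) (us' @ z # vs')"
    using ys rl l by simp
  also have "\<dots> = (\<one>X \<otimes> relabel X (us' @ vs') zs) \<cdot> (\<one>X \<otimes> relabel X (us @ vs) (us' @ vs')) \<cdot> fetch X (length us) (length vs)"
    by (simp only: fetch_relabel[OF X rl])
  also have "\<dots> = ((\<one>X \<otimes> relabel X (us' @ vs') zs) \<cdot> (\<one>X \<otimes> relabel X (us @ vs) (us' @ vs'))) \<cdot> fetch X (length us) (length vs)"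
    using ys r l by simp
  also have "(\<one>X \<otimes> relabel X (us' @ vs') zs) \<cdot> (\<one>X \<otimes> relabel X (us @ vs) (us' @ vs')) = \<one>X \<otimes> relabel X (us @ vs) zs"
    using r ys l by (simp add: ten_merge Cons.IH)
  finally show ?case using xs by (simp add: relabel_Cons)
qed

lemma relabel_same:
  assumes [simp]: "X \<in> Ob S"
  shows "distinct xs \<Longrightarrow> relabel X xs xs = \<one>(pow X (length xs))"
proof (induction xs)
  case (Cons x xs)
  then have "relabel X xs xs = \<one>(pow X (length xs))" by simp
  then show ?case using relabel_Cons[of x "[]" X xs xs] by (simp add: fetch_0 ten_id)
qed simp

lemma relabel_append:
  assumes [simp]: "X \<in> Ob S" and "reordering xs ys" "reordering us vs" "set xs \<inter> set us = {}"
  shows "relabel X (xs @ us) (ys @ vs) = relabel X xs ys \<otimes> relabel X us vs"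
  using assms(2,4)
proof (induction ys arbitrary: xs)
  case Nil
  then show ?case using assms(3) by (simp add: reordering_def)
next
  case (Cons y ys)
  then obtain ps qs where xs: "xs = ps @ y # qs" "y \<notin> set ps" "reordering (ps @ qs) ys"
    by (metis reordering_ConsE)
  have l: "length us = length vs" "length ps + length qs = length ys"
    using reordering_length[OF assms(3)] reordering_length[OF xs(3)] by auto
  have "fetch X (length ps) (length (qs @ us)) = fetch X (length ps) (length qs) \<otimes> \<one>(pow X (length us))"
    by (simp add: fetch_def pow_add ten_id)
  moreover have "relabel X (ps @ qs @ us) (ys @ vs) = relabel X (ps @ qs) ys \<otimes> relabel X us vs"
    using Cons.IH[OF xs(3)] Cons.prems(2) xs(1) by auto
  ultimately show ?case
    using xs assms(3) l by (simp add: relabel_Cons interchange flip: tenM_assoc)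
qed

lemma relabel_swap:
  assumes [simp]: "X \<in> Ob S" and "distinct (us @ vs)"
  shows "relabel X (us @ vs) (vs @ us) = Brd S (pow X (length us)) (pow X (length vs))"
  using assms(2)
proof (induction vs)
  case Nil
  then show ?case by (simp add: relabel_same)
next
  case (Cons v vs)
  then have "relabel X (us @ v # vs) (v # vs @ us)
      = (\<one>X \<otimes> Brd S (pow X (length us)) (pow X (length vs))) \<cdot> fetch X (length us) (length vs)"
    by (subst relabel_Cons) auto
  then show ?case by (simp add: hexagon fetch_def)
qed

lemma tenM_endos:
  "\<forall>x\<in>set xs. g x \<in> hom X X \<Longrightarrow> tenM (map g xs) \<in> hom (pow X (length xs)) (pow X (length xs))"
  by (induction xs) auto

text \<open>Endomorphisms attached to labels travel with their factors. This carries the vertex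
  weights from the order of the edges to that of the faces.\<close>

lemma relabel_tenM:
  assumes [simp]: "X \<in> Ob S" and "reordering xs ys" "\<forall>x\<in>set xs. g x \<in> hom X X"
  shows "relabel X xs ys \<cdot> tenM (map g xs) = tenM (map g ys) \<cdot> relabel X xs ys"
  using assms(2,3)
proof (induction ys arbitrary: xs)
  case Nil
  then show ?case by (simp add: reordering_def)
next
  case (Cons y ys)
  then obtain us vs where xs: "xs = us @ y # vs" "y \<notin> set us" "reordering (us @ vs) ys"
    by (metis reordering_ConsE)
  have l: "length us + length vs = length ys"
    using reordering_length[OF xs(3)] by auto
  have endos: "\<forall>x\<in>set us. g x \<in> hom X X" "\<forall>x\<in>set vs. g x \<in> hom X X" "\<forall>x\<in>set ys. g x \<in> hom X X"
    "\<forall>x\<in>set (us @ vs). g x \<in> hom X X"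
    using Cons.prems xs unfolding reordering_def by auto
  note us = tenM_endos[OF endos(1)] and vs = tenM_endos[OF endos(2)]
    and yss = tenM_endos[OF endos(3)] and uvs = tenM_endos[OF endos(4)]
  have y: "g y \<in> hom X X" using Cons.prems(2) xs(1) by auto
  have sub: "set (map g us) \<subseteq> Arr S" "set (map g vs) \<subseteq> Arr S" using endos by auto
  have m: "tenM (map g xs) = tenM (map g us) \<otimes> g y \<otimes> tenM (map g vs)"
    using tenM_append[OF sub(1), of "map g (y # vs)"] sub(2) xs(1) y by simp
  have m': "tenM (map g (us @ vs)) = tenM (map g us) \<otimes> tenM (map g vs)"
    using tenM_append[OF sub] by simp
  have f: "fetch X (length us) (length vs) \<cdot> tenM (map g xs)
    = (g y \<otimes> tenM (map g (us @ vs))) \<cdot> fetch X (length us) (length vs)"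
  proof -
    have "fetch X (length us) (length vs) \<cdot> tenM (map g xs)
      = (Brd S (pow X (length us)) X \<cdot> (tenM (map g us) \<otimes> g y)) \<otimes> tenM (map g vs)"
      using us vs y by (simp add: fetch_def m interchange flip: tenM_assoc)
    also have "Brd S (pow X (length us)) X \<cdot> (tenM (map g us) \<otimes> g y)
      = (g y \<otimes> tenM (map g us)) \<cdot> Brd S (pow X (length us)) X"
      using us y by (rule brd_natural)
    also have "\<dots> \<otimes> tenM (map g vs) = ((g y \<otimes> tenM (map g us)) \<otimes> tenM (map g vs)) \<cdot> fetch X (length us) (length vs)"
      using us vs y by (simp add: fetch_def interchange del: tenM_assoc)
    finally show ?thesis using us vs y by (simp add: m' del: map_append)
  qed
  have rx: "relabel X xs (y # ys) = (\<one>X \<otimes> relabel X (us @ vs) ys) \<cdot> fetch X (length us) (length vs)"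
    using xs by (simp add: relabel_Cons)
  have "relabel X xs (y # ys) \<cdot> tenM (map g xs)
    = (\<one>X \<otimes> relabel X (us @ vs) ys) \<cdot> fetch X (length us) (length vs) \<cdot> tenM (map g xs)"
    using us vs y xs(3) by (simp add: rx m pow_add)
  also have "\<dots> = ((\<one>X \<otimes> relabel X (us @ vs) ys) \<cdot> (g y \<otimes> tenM (map g (us @ vs)))) \<cdot> fetch X (length us) (length vs)"
    unfolding f using xs uvs y l by simp
  also have "(\<one>X \<otimes> relabel X (us @ vs) ys) \<cdot> (g y \<otimes> tenM (map g (us @ vs)))
    = g y \<otimes> (tenM (map g ys) \<cdot> relabel X (us @ vs) ys)"
    using xs uvs y l Cons.IH[OF xs(3)] Cons.prems(2) by (simp add: interchange)
  also have "\<dots> = tenM (map g (y # ys)) \<cdot> (\<one>X \<otimes> relabel X (us @ vs) ys)"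
    using xs yss y l by (simp add: interchange)
  finally show ?case using us vs y yss xs(3) by (simp add: rx pow_add)
qed

text \<open>The block \<open>u\<close> has no inputs, so the braiding in the middle acts by
  \<open>brd_state\<close>. The permutations of the 9-gon states are reduced by such
  exchanges.\<close>

lemma relabel_states:
  assumes [simp]: "X \<in> Ob S" and "distinct (ps @ us @ vs @ qs)"
    and "p \<in> hom W (pow X (length ps))" "u \<in> hom (Unt S) (pow X (length us))"
    "v \<in> hom V (pow X (length vs))" "q \<in> hom W' (pow X (length qs))"
  shows "relabel X (ps @ us @ vs @ qs) (ps @ vs @ us @ qs) \<cdot> (p \<otimes> u \<otimes> v \<otimes> q) = p \<otimes> v \<otimes> u \<otimes> q"
proof -
  have "relabel X (ps @ us @ vs @ qs) (ps @ vs @ us @ qs)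
    = \<one>(pow X (length ps)) \<otimes> Brd S (pow X (length us)) (pow X (length vs)) \<otimes> \<one>(pow X (length qs))"
    (is "_ = ?R")
  proof -
    have d: "distinct ps" "distinct (us @ vs)" "distinct qs" using assms(2) by auto
    have "relabel X (ps @ us @ vs @ qs) (ps @ vs @ us @ qs) = relabel X ps ps \<otimes> relabel X (us @ vs @ qs) (vs @ us @ qs)"
      by (rule relabel_append) (use assms(2) in \<open>auto simp: reordering_def\<close>)
    moreover have "relabel X ((us @ vs) @ qs) ((vs @ us) @ qs) = relabel X (us @ vs) (vs @ us) \<otimes> relabel X qs qs"
      by (rule relabel_append) (use assms(2) in \<open>auto simp: reordering_def\<close>)
    ultimately show ?thesis
      using d by (simp add: relabel_same relabel_swap)
  qed
  also have "?R \<cdot> (p \<otimes> u \<otimes> v \<otimes> q) = p \<otimes> (Brd S (pow X (length us)) (pow X (length vs)) \<cdot> (u \<otimes> v)) \<otimes> q"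
    using assms(3-6) by (subst tenM_assoc[of u v q, symmetric]) (simp_all add: interchange del: tenM_assoc)
  also have "Brd S (pow X (length us)) (pow X (length vs)) \<cdot> (u \<otimes> v) = v \<otimes> u"
    by (rule brd_state) (use assms in auto)
  finally show ?thesis using assms(3-6) by simp
qed

lemma interchange3:
  assumes "f \<in> Arr S" "f' \<in> Arr S" "g \<in> Arr S" "g' \<in> Arr S" "h \<in> Arr S"
    "Dom S f' = Cod S f" "Dom S g' = Cod S g" "Cod S h = Dom S f \<odot> Dom S g"
  shows "(f' \<otimes> g') \<cdot> (f \<otimes> g) \<cdot> h = ((f' \<cdot> f) \<otimes> (g' \<cdot> g)) \<cdot> h"
  using assms by (subst comp_assoc[symmetric]) (simp_all add: interchange)

lemma whisker:
  assumes "f \<in> Arr S" "g \<in> Arr S" "Dom S g = Cod S f" "Y \<in> Ob S"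
  shows "(g \<cdot> f) \<otimes> \<one>Y = (g \<otimes> \<one>Y) \<cdot> (f \<otimes> \<one>Y)" "\<one>Y \<otimes> (g \<cdot> f) = (\<one>Y \<otimes> g) \<cdot> (\<one>Y \<otimes> f)"
  using assms by (simp_all add: ten_merge)

lemma whisker2:
  assumes "f \<in> Arr S" "g \<in> Arr S" "Dom S g = Cod S f" "Y \<in> Ob S" "Z \<in> Ob S"
  shows "(g \<cdot> f) \<otimes> \<one>Y \<otimes> \<one>Z = (g \<otimes> \<one>Y \<otimes> \<one>Z) \<cdot> (f \<otimes> \<one>Y \<otimes> \<one>Z)"
  using assms whisker(1)[of f g "Y \<odot> Z"] by (simp add: ten_id)

text \<open>Naturality of the braiding against \<open>b\<close>, whose target is the unit: a strand
  that crosses one leg of a cap may as well cross the other leg from the opposite side.\<close>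

lemma slide_cap:
  assumes b: "b \<in> hom (P \<odot> Q) (Unt S)" and [simp]: "P \<in> Ob S" "Q \<in> Ob S" "X \<in> Ob S"
  shows "(b \<otimes> \<one>X) \<cdot> (\<one>P \<otimes> Brd S X Q) = (\<one>X \<otimes> b) \<cdot> (Brd S P X \<otimes> \<one>Q)"
proof -
  have "b \<otimes> \<one>X = (\<one>X \<otimes> b) \<cdot> Brd S (P \<odot> Q) X"
    using brd_natural[OF b, of "\<one>X" X X] b by simp
  also have "\<dots> = (\<one>X \<otimes> b) \<cdot> (Brd S P X \<otimes> \<one>Q) \<cdot> (\<one>P \<otimes> Brd S Q X)"
    by (simp add: hexagon2)
  finally have "(b \<otimes> \<one>X) \<cdot> (\<one>P \<otimes> Brd S X Q)
      = (\<one>X \<otimes> b) \<cdot> (Brd S P X \<otimes> \<one>Q) \<cdot> (\<one>P \<otimes> Brd S Q X) \<cdot> (\<one>P \<otimes> Brd S X Q)"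
    using b by simp
  then show ?thesis using b by (simp add: ten_merge ten_id)
qed

lemma slide_cup:
  assumes v: "v \<in> hom (Unt S) (P \<odot> Q)" and [simp]: "P \<in> Ob S" "Q \<in> Ob S" "X \<in> Ob S"
  shows "(Brd S X P \<otimes> \<one>Q) \<cdot> (\<one>X \<otimes> v) = (\<one>P \<otimes> Brd S Q X) \<cdot> (v \<otimes> \<one>X)"
proof -
  have "v \<otimes> \<one>X = Brd S X (P \<odot> Q) \<cdot> (\<one>X \<otimes> v)"
    using brd_natural[OF _ v, of "\<one>X" X X] v by simp
  also have "\<dots> = (\<one>P \<otimes> Brd S X Q) \<cdot> (Brd S X P \<otimes> \<one>Q) \<cdot> (\<one>X \<otimes> v)"
    using v by (simp add: hexagon)
  finally show ?thesis
    using v by (simp add: ten_id ten_merge interchange3)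
qed

end

section \<open>Frobenius algebras\<close>

locale frobenius = ssm S for S :: "('o, 'm) smc" (structure) +
  fixes A :: "('o, 'm) frob"
  assumes frob: "frobenius_algebra A"
begin

abbreviation "X \<equiv> Car A"
abbreviation "m \<equiv> Mul A"
abbreviation "w \<equiv> Com A \<cdot> Eta A"
abbreviation "\<beta> \<equiv> Eps A \<cdot> Mul A"
abbreviation "c \<equiv> Brd S (Car A) (Car A)"
abbreviation "N \<equiv> nakayama A"

lemma frob_simps [simp]:
  "X \<in> Ob S"
  "m \<in> Arr S" "Dom S m = X \<odot> X" "Cod S m = X"
  "Eta A \<in> Arr S" "Dom S (Eta A) = Unt S" "Cod S (Eta A) = X"
  "Com A \<in> Arr S" "Dom S (Com A) = X" "Cod S (Com A) = X \<odot> X"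
  "Eps A \<in> Arr S" "Dom S (Eps A) = X" "Cod S (Eps A) = Unt S"
  using frob by (auto simp: frobenius_algebra_def Let_def)

lemma frob_eqs:
  "m \<cdot> (m \<otimes> \<one>X) = m \<cdot> (\<one>X \<otimes> m)"
  "m \<cdot> (Eta A \<otimes> \<one>X) = \<one>X" "m \<cdot> (\<one>X \<otimes> Eta A) = \<one>X"
  "(Com A \<otimes> \<one>X) \<cdot> Com A = (\<one>X \<otimes> Com A) \<cdot> Com A"
  "(Eps A \<otimes> \<one>X) \<cdot> Com A = \<one>X" "(\<one>X \<otimes> Eps A) \<cdot> Com A = \<one>X"
  "(\<one>X \<otimes> m) \<cdot> (Com A \<otimes> \<one>X) = Com A \<cdot> m" "(m \<otimes> \<one>X) \<cdot> (\<one>X \<otimes> Com A) = Com A \<cdot> m"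
  using frob by (auto simp: frobenius_algebra_def Let_def)

section \<open>Self-duality and the Nakayama automorphism\<close>

lemma nak_simps [simp]: "N \<in> Arr S" "Dom S N = X" "Cod S N = X"
  by (simp_all add: nakayama_def)

text \<open>The Frobenius relation applied to the unit: the coproduct multiplies its argument into
  either leg of the state \<open>w\<close>. Statements about the coproduct thus become statements
  about \<open>w\<close>.\<close>

lemma com_cup: "Com A = (m \<otimes> \<one>X) \<cdot> (\<one>X \<otimes> w)" "Com A = (\<one>X \<otimes> m) \<cdot> (w \<otimes> \<one>X)"
proof -
  have "Com A = Com A \<cdot> m \<cdot> (\<one>X \<otimes> Eta A)" by (simp add: frob_eqs)
  also have "\<dots> = ((m \<otimes> \<one>X) \<cdot> (\<one>X \<otimes> Com A)) \<cdot> (\<one>X \<otimes> Eta A)" by (simp add: frob_eqs)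
  finally show "Com A = (m \<otimes> \<one>X) \<cdot> (\<one>X \<otimes> w)" by (simp add: ten_merge)
  have "Com A = Com A \<cdot> m \<cdot> (Eta A \<otimes> \<one>X)" by (simp add: frob_eqs)
  also have "\<dots> = ((\<one>X \<otimes> m) \<cdot> (Com A \<otimes> \<one>X)) \<cdot> (Eta A \<otimes> \<one>X)" by (simp add: frob_eqs)
  finally show "Com A = (\<one>X \<otimes> m) \<cdot> (w \<otimes> \<one>X)" by (simp add: ten_merge)
qed

text \<open>Together with \<open>snake2\<close>: \<open>\<beta>\<close> and \<open>w\<close> exhibit
  \<open>X\<close> as its own dual, which permits bending a leg of a state and bending it
  back.\<close>

lemma snake1: "(\<beta> \<otimes> \<one>X) \<cdot> (\<one>X \<otimes> w) = \<one>X"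
proof -
  have "(\<beta> \<otimes> \<one>X) \<cdot> (\<one>X \<otimes> w) = (Eps A \<otimes> \<one>X) \<cdot> (m \<otimes> \<one>X) \<cdot> (\<one>X \<otimes> w)"
    by (simp add: interchange3)
  also have "\<dots> = \<one>X" by (simp add: frob_eqs flip: com_cup)
  finally show ?thesis .
qed

lemma snake2: "(\<one>X \<otimes> \<beta>) \<cdot> (w \<otimes> \<one>X) = \<one>X"
proof -
  have "(\<one>X \<otimes> \<beta>) \<cdot> (w \<otimes> \<one>X) = (\<one>X \<otimes> Eps A) \<cdot> (\<one>X \<otimes> m) \<cdot> (w \<otimes> \<one>X)"
    by (simp add: interchange3)
  also have "\<dots> = \<one>X" by (simp add: frob_eqs flip: com_cup)
  finally show ?thesis .
qed

lemma nak_alt: "N = (\<beta> \<otimes> \<one>X) \<cdot> (\<one>X \<otimes> (c \<cdot> w))"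
proof -
  have "N = ((\<one>X \<otimes> \<beta>) \<cdot> (c \<otimes> \<one>X)) \<cdot> (\<one>X \<otimes> w)"
    by (simp add: nakayama_def)
  also have "\<dots> = ((\<beta> \<otimes> \<one>X) \<cdot> (\<one>X \<otimes> c)) \<cdot> (\<one>X \<otimes> w)"
    by (subst slide_cap[of \<beta> X X X]) auto
  finally show ?thesis by (simp add: ten_merge)
qed

text \<open>The swapped pairing is dual to the swapped copairing. Bending \<open>c \<cdot> w\<close>
  with \<open>\<beta>\<close> itself gives \<open>N\<close> instead, by \<open>nak_alt\<close>, so
  \<open>N\<close> measures how far the pairing is from being symmetric.\<close>

lemma snake_sym: "((\<beta> \<cdot> c) \<otimes> \<one>X) \<cdot> (\<one>X \<otimes> (c \<cdot> w)) = \<one>X"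
proof -
  have "((\<beta> \<cdot> c) \<otimes> \<one>X) \<cdot> (\<one>X \<otimes> (c \<cdot> w)) = (((\<beta> \<cdot> c) \<otimes> \<one>X) \<cdot> (\<one>X \<otimes> c)) \<cdot> (\<one>X \<otimes> w)"
    by (simp add: ten_merge)
  also have "\<dots> = ((\<one>X \<otimes> (\<beta> \<cdot> c)) \<cdot> (c \<otimes> \<one>X)) \<cdot> (\<one>X \<otimes> w)"
    by (subst slide_cap[of "\<beta> \<cdot> c" X X X]) auto
  also have "\<dots> = (\<one>X \<otimes> \<beta>) \<cdot> ((\<one>X \<otimes> c) \<cdot> (c \<otimes> \<one>X)) \<cdot> (\<one>X \<otimes> w)"
    by (simp add: interchange3)
  also have "(\<one>X \<otimes> c) \<cdot> (c \<otimes> \<one>X) = Brd S X (X \<odot> X)" by (simp add: hexagon)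
  also have "Brd S X (X \<odot> X) \<cdot> (\<one>X \<otimes> w) = w \<otimes> \<one>X"
    by (rule brd_state) auto
  finally show ?thesis using snake2 by simp
qed

lemma snake_sym2: "(\<one>X \<otimes> \<beta>) \<cdot> (c \<otimes> \<one>X) \<cdot> (\<one>X \<otimes> (c \<cdot> w)) = \<one>X"
proof -
  have "(\<one>X \<otimes> \<beta>) \<cdot> (c \<otimes> \<one>X) \<cdot> (\<one>X \<otimes> (c \<cdot> w)) = ((\<one>X \<otimes> \<beta>) \<cdot> (c \<otimes> \<one>X)) \<cdot> (\<one>X \<otimes> (c \<cdot> w))"
    by simp
  also have "(\<one>X \<otimes> \<beta>) \<cdot> (c \<otimes> \<one>X) = (\<beta> \<otimes> \<one>X) \<cdot> (\<one>X \<otimes> c)"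
    by (rule slide_cap[symmetric]) auto
  also have "((\<beta> \<otimes> \<one>X) \<cdot> (\<one>X \<otimes> c)) \<cdot> (\<one>X \<otimes> (c \<cdot> w)) = (\<beta> \<otimes> \<one>X) \<cdot> (\<one>X \<otimes> ((c \<cdot> c) \<cdot> w))"
    by (simp add: ten_merge del: brd_inv)
  also have "\<dots> = \<one>X" by (simp add: snake1)
  finally show ?thesis .
qed

text \<open>The property \<epsilon>(a N(b)) = \<epsilon>(b a). With the definition of
  \<open>N\<close> inserted there are two pairings; as both end in the unit, either may be evaluated
  first, and exchanging their order exposes the snake \<open>snake_sym2\<close>.\<close>

lemma beta_nak: "\<beta> \<cdot> (\<one>X \<otimes> N) = \<beta> \<cdot> c"
proof -
  let ?w = "c \<cdot> w"
  have bb: "\<beta> \<cdot> (\<beta> \<otimes> \<one>(X \<odot> X)) = \<beta> \<otimes> \<beta>" "\<beta> \<cdot> (\<one>(X \<odot> X) \<otimes> \<beta>) = \<beta> \<otimes> \<beta>"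
    using ten_split[of \<beta> \<beta>, symmetric] by simp_all
  have "\<one>X \<otimes> \<beta> = (\<beta> \<otimes> \<one>X) \<cdot> Brd S X (X \<odot> X)"
    using brd_natural[of "\<one>X" X X \<beta> "X \<odot> X" "Unt S"] by simp
  then have slide: "\<one>X \<otimes> \<beta> = (\<beta> \<otimes> \<one>X) \<cdot> (\<one>X \<otimes> c) \<cdot> (c \<otimes> \<one>X)"
    by (simp add: hexagon)
  have "\<one>X \<otimes> N = ((\<one>X \<otimes> \<beta>) \<otimes> \<one>X) \<cdot> (\<one>X \<otimes> \<one>X \<otimes> ?w)"
    by (subst nak_alt) (simp add: ten_merge)
  also have "\<dots> = ((\<beta> \<otimes> \<one>X) \<otimes> \<one>X) \<cdot> ((\<one>X \<otimes> c) \<otimes> \<one>X) \<cdot> ((c \<otimes> \<one>X) \<otimes> \<one>X) \<cdot> (\<one>X \<otimes> \<one>X \<otimes> ?w)"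
    by (simp add: slide whisker del: tenM_assoc)
  also have "((c \<otimes> \<one>X) \<otimes> \<one>X) \<cdot> (\<one>X \<otimes> \<one>X \<otimes> ?w) = (\<one>X \<otimes> \<one>X \<otimes> ?w) \<cdot> c"
  proof -
    have "((c \<otimes> \<one>X) \<otimes> \<one>X) \<cdot> (\<one>X \<otimes> \<one>X \<otimes> ?w) = (c \<otimes> \<one>(X \<odot> X)) \<cdot> (\<one>(X \<odot> X) \<otimes> ?w)"
      by (simp add: ten_id flip: tenM_assoc[of "\<one>X" "\<one>X" ?w])
    also have "\<dots> = (\<one>(X \<odot> X) \<otimes> ?w) \<cdot> c"
      using ten_split[of c ?w] by simp
    finally show ?thesis by (simp flip: ten_id)
  qed
  finally have "\<beta> \<cdot> (\<one>X \<otimes> N) = (\<beta> \<cdot> (\<beta> \<otimes> \<one>(X \<odot> X))) \<cdot> ((\<one>X \<otimes> c) \<otimes> \<one>X) \<cdot> (\<one>X \<otimes> \<one>X \<otimes> ?w) \<cdot> c"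
    by (simp add: ten_id)
  also have "\<dots> = (\<beta> \<cdot> (\<one>(X \<odot> X) \<otimes> \<beta>)) \<cdot> (\<one>X \<otimes> (c \<otimes> \<one>X)) \<cdot> (\<one>X \<otimes> \<one>X \<otimes> ?w) \<cdot> c"
    unfolding bb by simp
  also have "\<dots> = \<beta> \<cdot> (\<one>X \<otimes> ((\<one>X \<otimes> \<beta>) \<cdot> (c \<otimes> \<one>X) \<cdot> (\<one>X \<otimes> ?w))) \<cdot> c"
    by (simp add: interchange3 flip: ten_id)
  also have "\<dots> = \<beta> \<cdot> c" by (subst snake_sym2) (simp add: ten_id)
  finally show ?thesis .
qed

text \<open>Nondegeneracy of the pairing: bending a leg with \<open>\<beta>\<close> is injective on
  states, since \<open>w\<close> bends it back by \<open>snake2\<close>.\<close>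

lemma state_eqI:
  assumes "u \<in> hom (Unt S) (X \<odot> X)" "v \<in> hom (Unt S) (X \<odot> X)"
    and "(\<beta> \<otimes> \<one>X) \<cdot> (\<one>X \<otimes> u) = (\<beta> \<otimes> \<one>X) \<cdot> (\<one>X \<otimes> v)"
  shows "u = v"
proof -
  have *: "(\<one>X \<otimes> ((\<beta> \<otimes> \<one>X) \<cdot> (\<one>X \<otimes> u))) \<cdot> w = u" if "u \<in> hom (Unt S) (X \<odot> X)" for u
  proof -
    have "(\<one>X \<otimes> ((\<beta> \<otimes> \<one>X) \<cdot> (\<one>X \<otimes> u))) \<cdot> w = ((\<one>X \<otimes> \<beta>) \<otimes> \<one>X) \<cdot> (\<one>X \<otimes> \<one>X \<otimes> u) \<cdot> w"
      using that by (simp add: ten_merge interchange3)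
    also have "(\<one>X \<otimes> \<one>X \<otimes> u) \<cdot> w = w \<otimes> u"
      using that ten_split(2)[of w u] by (simp add: ten_id flip: tenM_assoc)
    also have "\<dots> = ((w \<otimes> \<one>X) \<otimes> \<one>X) \<cdot> u"
      using that ten_split(1)[of w u] by (simp add: ten_id)
    also have "((\<one>X \<otimes> \<beta>) \<otimes> \<one>X) \<cdot> ((w \<otimes> \<one>X) \<otimes> \<one>X) \<cdot> u = (((\<one>X \<otimes> \<beta>) \<cdot> (w \<otimes> \<one>X)) \<otimes> \<one>X) \<cdot> u"
      using that by (simp add: interchange3 del: tenM_assoc)
    finally show ?thesis using that by (simp add: snake2 ten_id)
  qed
  show ?thesis using *[OF assms(1)] *[OF assms(2)] unfolding assms(3) by metis
qed

text \<open>Bent with \<open>\<beta>\<close>, the factor \<open>N\<close> is absorbed by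
  \<open>beta_nak\<close>, and what remains is the swapped snake, equal to the plain one.\<close>

lemma nak_cup1: "(N \<otimes> \<one>X) \<cdot> c \<cdot> w = w"
proof (rule state_eqI)
  have "(\<beta> \<otimes> \<one>X) \<cdot> (\<one>X \<otimes> ((N \<otimes> \<one>X) \<cdot> c \<cdot> w)) = ((\<beta> \<cdot> (\<one>X \<otimes> N)) \<otimes> \<one>X) \<cdot> (\<one>X \<otimes> (c \<cdot> w))"
    by (simp add: whisker)
  then show "(\<beta> \<otimes> \<one>X) \<cdot> (\<one>X \<otimes> ((N \<otimes> \<one>X) \<cdot> c \<cdot> w)) = (\<beta> \<otimes> \<one>X) \<cdot> (\<one>X \<otimes> w)"
    unfolding beta_nak snake_sym snake1 .
qed auto

lemma nak_cup2: "(\<one>X \<otimes> N) \<cdot> w = c \<cdot> w"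
proof -
  have "c \<cdot> w = c \<cdot> (N \<otimes> \<one>X) \<cdot> c \<cdot> w" by (simp add: nak_cup1)
  also have "\<dots> = (c \<cdot> (N \<otimes> \<one>X)) \<cdot> c \<cdot> w" by simp
  also have "c \<cdot> (N \<otimes> \<one>X) = (\<one>X \<otimes> N) \<cdot> c" by (rule brd_natural) auto
  also have "((\<one>X \<otimes> N) \<cdot> c) \<cdot> c \<cdot> w = (\<one>X \<otimes> N) \<cdot> (c \<cdot> c) \<cdot> w" by (simp del: brd_inv)
  finally show ?thesis by simp
qed

lemma nak_cup: "(N \<otimes> N) \<cdot> w = w"
proof -
  have "(N \<otimes> N) \<cdot> w = (N \<otimes> \<one>X) \<cdot> (\<one>X \<otimes> N) \<cdot> w" by (simp add: interchange3)
  then show ?thesis by (simp add: nak_cup1 nak_cup2)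
qed

text \<open>Compare \<open>nak_alt\<close>: here the pairing is swapped instead of the
  copairing.\<close>

definition "nakayama_inv = ((\<beta> \<cdot> c) \<otimes> \<one>X) \<cdot> (\<one>X \<otimes> w)"

lemma nakayama_inv_simps [simp]: "nakayama_inv \<in> Arr S" "Dom S nakayama_inv = X" "Cod S nakayama_inv = X"
  by (simp_all add: nakayama_inv_def)

lemma nakayama_inverse: "N \<cdot> nakayama_inv = \<one>X" "nakayama_inv \<cdot> N = \<one>X"
proof -
  have "N \<cdot> nakayama_inv = ((\<beta> \<cdot> c) \<otimes> \<one>X) \<cdot> (\<one>X \<otimes> ((\<one>X \<otimes> N) \<cdot> w))"
  proof -
    have "N \<cdot> ((\<beta> \<cdot> c) \<otimes> \<one>X) = ((\<beta> \<cdot> c) \<otimes> \<one>X) \<cdot> (\<one>(X \<odot> X) \<otimes> N)"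
      using ten_split[of "\<beta> \<cdot> c" N] by simp
    then have "N \<cdot> nakayama_inv = (((\<beta> \<cdot> c) \<otimes> \<one>X) \<cdot> (\<one>(X \<odot> X) \<otimes> N)) \<cdot> (\<one>X \<otimes> w)"
      unfolding nakayama_inv_def by (subst comp_assoc[symmetric]) simp_all
    then show ?thesis by (simp add: ten_merge flip: ten_id)
  qed
  then show "N \<cdot> nakayama_inv = \<one>X" by (simp only: nak_cup2 snake_sym)
  have "(\<one>X \<otimes> w) \<cdot> N = (N \<otimes> \<one>(X \<odot> X)) \<cdot> (\<one>X \<otimes> w)"
    using ten_split[of N w] by simp
  then have "((\<beta> \<cdot> c) \<otimes> \<one>X) \<cdot> (\<one>X \<otimes> w) \<cdot> N = ((\<beta> \<cdot> c \<cdot> (N \<otimes> \<one>X)) \<otimes> \<one>X) \<cdot> (\<one>X \<otimes> w)"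
    by (simp only:) (simp add: whisker flip: ten_id)
  then have "nakayama_inv \<cdot> N = ((\<beta> \<cdot> c \<cdot> (N \<otimes> \<one>X)) \<otimes> \<one>X) \<cdot> (\<one>X \<otimes> w)"
    by (simp add: nakayama_inv_def)
  also have "c \<cdot> (N \<otimes> \<one>X) = (\<one>X \<otimes> N) \<cdot> c" by (rule brd_natural) auto
  also have "\<beta> \<cdot> (\<one>X \<otimes> N) \<cdot> c = \<beta>"
    using comp_rule[OF beta_nak, of c] by simp
  finally show "nakayama_inv \<cdot> N = \<one>X" by (simp add: snake1)
qed

lemma inv_mor_nakayama: "inv_mor X N = nakayama_inv"
  unfolding inv_mor_def
proof (rule the_equality)
  show "nakayama_inv \<in> hom X X \<and> N \<cdot> nakayama_inv = \<one>X \<and> nakayama_inv \<cdot> N = \<one>X"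
    by (simp add: nakayama_inverse)
next
  fix g assume g: "g \<in> hom X X \<and> N \<cdot> g = \<one>X \<and> g \<cdot> N = \<one>X"
  then have "g = (nakayama_inv \<cdot> N) \<cdot> g" by (simp add: nakayama_inverse)
  also have "\<dots> = nakayama_inv" using g by simp
  finally show "g = nakayama_inv" .
qed

section \<open>Integer powers of the Nakayama automorphism\<close>

lemma npow_simps [simp]: "npow Y f 0 = \<one>Y" "npow Y f (Suc n) = f \<cdot> npow Y f n"
  by (simp_all add: npow_def)

lemma npow_arr [simp]:
  assumes "f \<in> hom Y Y" "Y \<in> Ob S"
  shows "npow Y f n \<in> Arr S" "Dom S (npow Y f n) = Y" "Cod S (npow Y f n) = Y"
  using assms by (induction n) auto

lemma nak_pow_arr [simp]: "nak_pow A k \<in> Arr S" "Dom S (nak_pow A k) = X" "Cod S (nak_pow A k) = X"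
  by (auto simp: nak_pow_def inv_mor_nakayama)

lemma nak_pow_0 [simp]: "nak_pow A 0 = \<one>X"
  by (simp add: nak_pow_def)

lemma nak_pow_Suc: "nak_pow A (k + 1) = N \<cdot> nak_pow A k"
proof (cases "k \<ge> 0")
  case True
  then show ?thesis by (simp add: nak_pow_def nat_add_distrib)
next
  case False
  define n where "n = nat (- k - 1)"
  have k: "k = - int n - 1" using False by (simp add: n_def)
  have "N \<cdot> nakayama_inv \<cdot> npow X nakayama_inv n = npow X nakayama_inv n"
    by (subst comp_rule[OF nakayama_inverse(1)]) simp_all
  moreover have "nat (1 + int n) = Suc n" by simp
  ultimately show ?thesis by (auto simp: nak_pow_def k inv_mor_nakayama)
qed

lemma nak_pow_pred: "nak_pow A (k - 1) = nakayama_inv \<cdot> nak_pow A k"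
proof -
  have "nakayama_inv \<cdot> nak_pow A k = nakayama_inv \<cdot> N \<cdot> nak_pow A (k - 1)"
    using nak_pow_Suc[of "k - 1"] by simp
  then show ?thesis by (subst (asm) comp_rule[OF nakayama_inverse(2)]) simp_all
qed

lemma nak_pow_add: "nak_pow A (j + k) = nak_pow A j \<cdot> nak_pow A k"
proof (induction j rule: int_induct[where k = 0])
  case (step1 i)
  have "nak_pow A (i + 1 + k) = N \<cdot> nak_pow A (i + k)"
    using nak_pow_Suc[of "i + k"] by (simp add: algebra_simps)
  then show ?case by (simp add: step1 nak_pow_Suc)
next
  case (step2 i)
  have "nak_pow A (i - 1 + k) = nakayama_inv \<cdot> nak_pow A (i + k)"
    using nak_pow_pred[of "i + k"] by (simp add: algebra_simps)
  then show ?case by (simp add: step2 nak_pow_pred)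
qed simp

lemma nak_pow_1: "nak_pow A 1 = N"
  using nak_pow_Suc[of 0] by simp

text \<open>The powers with exponent a multiple of \<open>r\<close> are trivial, by induction in
  both directions. The second form fits the edge weights N^(s+1), where \<open>s\<close> is reduced
  before 1 is added.\<close>

lemma nak_pow_mod:
  assumes "npow X N r = \<one>X"
  shows "nak_pow A (k mod int r) = nak_pow A k" "nak_pow A (k mod int r + j) = nak_pow A (k + j)"
proof -
  have r: "nak_pow A (int r) = \<one>X" using assms by (simp add: nak_pow_def)
  then have r': "nak_pow A (- int r) = \<one>X" using nak_pow_add[of "- int r" "int r"] by simp
  have *: "nak_pow A (int r * q) = \<one>X" for q
  proof (induction q rule: int_induct[where k = 0])
    case (step1 i)
    then show ?case using nak_pow_add[of "int r * i" "int r"] r by (simp add: algebra_simps)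
  next
    case (step2 i)
    then show ?case using nak_pow_add[of "int r * i" "- int r"] r' by (simp add: algebra_simps)
  qed simp
  show **: "nak_pow A (k mod int r) = nak_pow A k" for k
    using nak_pow_add[of "int r * (k div int r)" "k mod int r"] * by simp
  show "nak_pow A (k mod int r + j) = nak_pow A (k + j)"
    by (simp add: nak_pow_add **)
qed

text \<open>Invariance under \<open>N\<close> propagates to all integer powers. For the counit here,
  and for the unit in \<open>nak_pow_fixed_state\<close>, this removes the edge index from the state
  sum of a disc.\<close>

lemma nak_pow_fixed:
  assumes "f \<in> hom X Y" "f \<cdot> N = f"
  shows "f \<cdot> nak_pow A k = f"
proof (induction k rule: int_induct[where k = 0])
  case (step1 i)
  then show ?case using assms by (simp add: nak_pow_Suc comp_rule[OF assms(2)])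
next
  case (step2 i)
  have "f \<cdot> nakayama_inv = (f \<cdot> N) \<cdot> nakayama_inv" by (simp add: assms)
  also have "\<dots> = f" using assms(1) by (simp add: nakayama_inverse)
  finally have "f \<cdot> nakayama_inv = f" .
  then show ?case using assms(1) step2 by (simp add: nak_pow_pred comp_rule)
qed (use assms in simp)

lemma nak_pow_fixed_state:
  assumes "f \<in> hom Y X" "N \<cdot> f = f"
  shows "nak_pow A k \<cdot> f = f"
proof (induction k rule: int_induct[where k = 0])
  case (step1 i)
  then show ?case using assms by (simp add: nak_pow_Suc)
next
  case (step2 i)
  have "nakayama_inv \<cdot> f = nakayama_inv \<cdot> N \<cdot> f" by (simp add: assms)
  also have "\<dots> = f" using assms(1) by (simp add: comp_rule[OF nakayama_inverse(2)])
  finally show ?case using assms(1) step2 by (simp add: nak_pow_pred)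
qed (use assms in simp)

lemma nak_pow_cup: "(nak_pow A k \<otimes> nak_pow A k) \<cdot> w = w"
proof (induction k rule: int_induct[where k = 0])
  case (step1 i)
  have "(nak_pow A (i + 1) \<otimes> nak_pow A (i + 1)) \<cdot> w = (N \<otimes> N) \<cdot> (nak_pow A i \<otimes> nak_pow A i) \<cdot> w"
    by (simp add: nak_pow_Suc interchange3)
  then show ?case by (simp add: step1 nak_cup)
next
  case (step2 i)
  have inv: "(nakayama_inv \<otimes> nakayama_inv) \<cdot> w = w"
  proof -
    have "(nakayama_inv \<otimes> nakayama_inv) \<cdot> (N \<otimes> N) \<cdot> w = w"
      by (simp add: interchange3 nakayama_inverse ten_id)
    then show ?thesis by (simp add: nak_cup)
  qed
  have "(nak_pow A (i - 1) \<otimes> nak_pow A (i - 1)) \<cdot> w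
    = (nakayama_inv \<otimes> nakayama_inv) \<cdot> (nak_pow A i \<otimes> nak_pow A i) \<cdot> w"
    by (simp add: nak_pow_pred interchange3)
  then show ?case by (simp add: step2 inv)
qed (simp add: ten_id)

section \<open>Twisted copairings and the cylinder maps\<close>

definition cup :: "int \<Rightarrow> 'm" where
  "cup k = (\<one>X \<otimes> nak_pow A k) \<cdot> w"

lemma cup_arr [simp]: "cup k \<in> Arr S" "Dom S (cup k) = Unt S" "Cod S (cup k) = X \<odot> X"
  by (simp_all add: cup_def)

text \<open>Only the difference of the exponents matters because a common power on both legs fixes
  \<open>w\<close>.\<close>

lemma cup_shift: "(nak_pow A j \<otimes> nak_pow A k) \<cdot> w = cup (k - j)"
proof -
  have "(nak_pow A j \<otimes> nak_pow A k) \<cdot> w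
      = (\<one>X \<otimes> nak_pow A (k - j)) \<cdot> (nak_pow A j \<otimes> nak_pow A j) \<cdot> w"
    using nak_pow_add[of "k - j" j] by (simp add: interchange3)
  then show ?thesis by (simp add: cup_def nak_pow_cup)
qed

text \<open>Turning an edge around. An inner edge of index s carries \<open>cup (s + 1)\<close>, and
  the index \<open>-1 - s\<close> of the reversed edge turns \<open>k = s + 1\<close> into
  \<open>1 - k\<close>.\<close>

lemma brd_cup: "c \<cdot> cup k = cup (1 - k)"
proof -
  have "c \<cdot> cup k = (c \<cdot> (\<one>X \<otimes> nak_pow A k)) \<cdot> w" by (simp add: cup_def)
  also have "c \<cdot> (\<one>X \<otimes> nak_pow A k) = (nak_pow A k \<otimes> \<one>X) \<cdot> c" by (rule brd_natural) auto
  also have "\<dots> \<cdot> w = (nak_pow A k \<otimes> nak_pow A 1) \<cdot> w"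
    by (simp add: nak_pow_1 interchange3 flip: nak_cup2)
  finally show ?thesis by (simp add: cup_shift)
qed

text \<open>In Sweedler notation \<open>sandwich v x = v\<^sub>1 x v\<^sub>2\<close>.\<close>

definition sandwich :: "'m \<Rightarrow> 'm" where
  "sandwich v = m \<cdot> (\<one>X \<otimes> m) \<cdot> (\<one>X \<otimes> c) \<cdot> (v \<otimes> \<one>X)"

lemma sandwich_arr [simp]:
  assumes "v \<in> hom (Unt S) (X \<odot> X)"
  shows "sandwich v \<in> Arr S" "Dom S (sandwich v) = X" "Cod S (sandwich v) = X"
  using assms by (simp_all add: sandwich_def)

lemma sandwich_alt:
  assumes "v \<in> hom (Unt S) (X \<odot> X)"
  shows "sandwich v = m \<cdot> (m \<otimes> \<one>X) \<cdot> (c \<otimes> \<one>X) \<cdot> (\<one>X \<otimes> v)"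
proof -
  have "sandwich v = (m \<cdot> (\<one>X \<otimes> m)) \<cdot> (\<one>X \<otimes> c) \<cdot> (v \<otimes> \<one>X)"
    using assms by (simp add: sandwich_def)
  also have "(\<one>X \<otimes> c) \<cdot> (v \<otimes> \<one>X) = (c \<otimes> \<one>X) \<cdot> (\<one>X \<otimes> v)"
    using slide_cup[OF assms] by simp
  finally show ?thesis using assms by (simp flip: frob_eqs(1))
qed

text \<open>The Nakayama property \<open>\<epsilon>(a N b) = \<epsilon>(b a)\<close> gives \<open>\<epsilon>(y v\<^sub>1 x N v\<^sub>2) = \<epsilon>(v\<^sub>2 y v\<^sub>1 x)\<close>.\<close>

lemma sandwich_adjoint:
  assumes "v \<in> hom (Unt S) (X \<odot> X)"
  shows "\<beta> \<cdot> (\<one>X \<otimes> sandwich ((\<one>X \<otimes> N) \<cdot> v)) = \<beta> \<cdot> (sandwich (c \<cdot> v) \<otimes> \<one>X)"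
proof -
  let ?M = "m \<cdot> (\<one>X \<otimes> m)"
  let ?\<theta> = "(\<one>X \<otimes> \<one>X \<otimes> c) \<cdot> (\<one>X \<otimes> v \<otimes> \<one>X)"
  have c_nak: "c \<cdot> (N \<otimes> \<one>X) = (\<one>X \<otimes> N) \<cdot> c" by (rule brd_natural) auto
  have v [simp]: "v \<in> Arr S" "Dom S v = Unt S" "Cod S v = X \<odot> X" using assms by auto
  have "sandwich ((\<one>X \<otimes> N) \<cdot> v) = ?M \<cdot> (\<one>X \<otimes> (c \<cdot> (N \<otimes> \<one>X))) \<cdot> (v \<otimes> \<one>X)"
    by (simp add: sandwich_def whisker)
  also have "\<dots> = ?M \<cdot> (\<one>X \<otimes> \<one>X \<otimes> N) \<cdot> (\<one>X \<otimes> c) \<cdot> (v \<otimes> \<one>X)"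
    unfolding c_nak by (simp add: whisker)
  finally have "\<beta> \<cdot> (\<one>X \<otimes> sandwich ((\<one>X \<otimes> N) \<cdot> v))
      = (\<beta> \<cdot> (\<one>X \<otimes> ?M)) \<cdot> (\<one>X \<otimes> \<one>X \<otimes> \<one>X \<otimes> N) \<cdot> ?\<theta>"
    by (simp add: whisker)
  also have bM: "\<beta> \<cdot> (\<one>X \<otimes> ?M) = \<beta> \<cdot> (?M \<otimes> \<one>X)"
  proof -
    have "m \<cdot> (\<one>X \<otimes> ?M) = (m \<cdot> (\<one>X \<otimes> m)) \<cdot> (\<one>X \<otimes> \<one>X \<otimes> m)" by (simp add: whisker)
    also have "\<dots> = m \<cdot> (m \<otimes> \<one>X) \<cdot> (\<one>X \<otimes> \<one>X \<otimes> m)" by (simp flip: frob_eqs(1))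
    also have "(m \<otimes> \<one>X) \<cdot> (\<one>X \<otimes> \<one>X \<otimes> m) = (\<one>X \<otimes> m) \<cdot> (m \<otimes> \<one>X \<otimes> \<one>X)"
      using ten_split[of m m] by (simp flip: ten_id)
    also have "m \<cdot> \<dots> = (m \<cdot> (\<one>X \<otimes> m)) \<cdot> (m \<otimes> \<one>X \<otimes> \<one>X)" by simp
    also have "\<dots> = m \<cdot> ((m \<cdot> (m \<otimes> \<one>X)) \<otimes> \<one>X)" by (simp add: whisker flip: frob_eqs(1))
    finally show ?thesis by (simp add: frob_eqs(1))
  qed
  also have "(\<beta> \<cdot> (?M \<otimes> \<one>X)) \<cdot> (\<one>X \<otimes> \<one>X \<otimes> \<one>X \<otimes> N) \<cdot> ?\<theta> = (\<beta> \<cdot> (\<one>X \<otimes> N)) \<cdot> (?M \<otimes> \<one>X) \<cdot> ?\<theta>"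
  proof -
    have "(?M \<otimes> \<one>X) \<cdot> (\<one>(X \<odot> X \<odot> X) \<otimes> N) = (\<one>X \<otimes> N) \<cdot> (?M \<otimes> \<one>X)"
      by (simp add: interchange)
    then have "(?M \<otimes> \<one>X) \<cdot> (\<one>X \<otimes> \<one>X \<otimes> \<one>X \<otimes> N) = (\<one>X \<otimes> N) \<cdot> (?M \<otimes> \<one>X)"
      by (simp flip: ten_id)
    from comp_rule[OF this, of ?\<theta>] show ?thesis by simp
  qed
  also have "\<dots> = \<beta> \<cdot> (c \<cdot> (?M \<otimes> \<one>X)) \<cdot> ?\<theta>" unfolding beta_nak by simp
  also have "c \<cdot> (?M \<otimes> \<one>X) = (\<one>X \<otimes> ?M) \<cdot> Brd S (X \<odot> X \<odot> X) X"
    by (rule brd_natural) auto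
  also have "Brd S (X \<odot> X \<odot> X) X = (c \<otimes> \<one>X \<otimes> \<one>X) \<cdot> (\<one>X \<otimes> c \<otimes> \<one>X) \<cdot> (\<one>X \<otimes> \<one>X \<otimes> c)"
    by (simp add: hexagon2 whisker ten_id)
  also have "\<beta> \<cdot> ((\<one>X \<otimes> ?M) \<cdot> \<dots>) \<cdot> ?\<theta> = \<beta> \<cdot> (\<one>X \<otimes> ?M) \<cdot> (c \<otimes> \<one>X \<otimes> \<one>X) \<cdot> (\<one>X \<otimes> c \<otimes> \<one>X)
      \<cdot> ((\<one>X \<otimes> \<one>X \<otimes> c) \<cdot> (\<one>X \<otimes> \<one>X \<otimes> c)) \<cdot> (\<one>X \<otimes> v \<otimes> \<one>X)"
    by simp
  also have "(\<one>X \<otimes> \<one>X \<otimes> c) \<cdot> (\<one>X \<otimes> \<one>X \<otimes> c) = \<one>(X \<odot> X \<odot> X \<odot> X)"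
    by (simp add: ten_merge ten_id)
  also have "\<beta> \<cdot> (\<one>X \<otimes> ?M) \<cdot> (c \<otimes> \<one>X \<otimes> \<one>X) \<cdot> (\<one>X \<otimes> c \<otimes> \<one>X) \<cdot> \<one>(X \<odot> X \<odot> X \<odot> X) \<cdot> (\<one>X \<otimes> v \<otimes> \<one>X)
    = (\<beta> \<cdot> (\<one>X \<otimes> ?M)) \<cdot> (c \<otimes> \<one>X \<otimes> \<one>X) \<cdot> (\<one>X \<otimes> c \<otimes> \<one>X) \<cdot> (\<one>X \<otimes> v \<otimes> \<one>X)"
    by simp
  also have "\<beta> \<cdot> (\<one>X \<otimes> ?M) = \<beta> \<cdot> (m \<otimes> \<one>X) \<cdot> (m \<otimes> \<one>X \<otimes> \<one>X)"
    unfolding bM by (simp add: whisker flip: frob_eqs(1))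
  also have "\<dots> \<cdot> (c \<otimes> \<one>X \<otimes> \<one>X) \<cdot> (\<one>X \<otimes> c \<otimes> \<one>X) \<cdot> (\<one>X \<otimes> v \<otimes> \<one>X) = \<beta> \<cdot> (sandwich (c \<cdot> v) \<otimes> \<one>X)"
    by (subst sandwich_alt) (simp_all add: whisker ten_id)
  finally show ?thesis .
qed

text \<open>The right side is P_k before the division by the window element. The crossed
  multiplication there and the exponent \<open>1 - k\<close> are undone together by
  \<open>brd_cup\<close>, which leaves e_1 x N^k e_2.\<close>

lemma sandwich_cup: "sandwich (cup k) = m \<cdot> c \<cdot> (\<one>X \<otimes> nak_pow A (1 - k)) \<cdot> Com A"
proof -
  let ?P = "nak_pow A (1 - k)"
  have "m \<cdot> c \<cdot> (\<one>X \<otimes> ?P) \<cdot> Com A = m \<cdot> c \<cdot> ((\<one>X \<otimes> ?P) \<cdot> (m \<otimes> \<one>X)) \<cdot> (\<one>X \<otimes> w)"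
  proof -
    have "m \<cdot> c \<cdot> (\<one>X \<otimes> ?P) \<cdot> Com A = m \<cdot> c \<cdot> (\<one>X \<otimes> ?P) \<cdot> ((m \<otimes> \<one>X) \<cdot> (\<one>X \<otimes> w))"
      by (simp only: flip: com_cup(1))
    then show ?thesis by simp
  qed
  also have "(\<one>X \<otimes> ?P) \<cdot> (m \<otimes> \<one>X) = (m \<otimes> \<one>X) \<cdot> (\<one>X \<otimes> \<one>X \<otimes> ?P)"
    using ten_split[of m ?P] by (simp flip: ten_id)
  also have "m \<cdot> c \<cdot> \<dots> \<cdot> (\<one>X \<otimes> w) = m \<cdot> (c \<cdot> (m \<otimes> \<one>X)) \<cdot> (\<one>X \<otimes> \<one>X \<otimes> ?P) \<cdot> (\<one>X \<otimes> w)"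
    by simp
  also have "c \<cdot> (m \<otimes> \<one>X) = (\<one>X \<otimes> m) \<cdot> Brd S (X \<odot> X) X" by (rule brd_natural) auto
  also have "m \<cdot> \<dots> \<cdot> (\<one>X \<otimes> \<one>X \<otimes> ?P) \<cdot> (\<one>X \<otimes> w)
     = (m \<cdot> (\<one>X \<otimes> m)) \<cdot> (c \<otimes> \<one>X) \<cdot> (\<one>X \<otimes> (c \<cdot> cup (1 - k)))"
    by (simp add: hexagon2 cup_def whisker)
  also have "\<dots> = sandwich (cup k)"
    by (simp add: brd_cup sandwich_alt flip: frob_eqs(1))
  finally show ?thesis by simp
qed

text \<open>In Sweedler notation, with \<open>w = e\<^sub>1 \<otimes> e\<^sub>2\<close>, this is the map \<open>x \<mapsto> e\<^sub>1 x N\<^sup>k e\<^sub>2\<close>, to which a cylinder gives rise; up to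
  the window element it is the idempotent \<open>P\<^sub>k\<close>.\<close>

definition cyl :: "int \<Rightarrow> 'm" where
  "cyl k = sandwich (cup k)"

lemma cyl_arr [simp]: "cyl k \<in> Arr S" "Dom S (cyl k) = X" "Cod S (cyl k) = X"
  by (simp_all add: cyl_def)

text \<open>The origin of \<open>2 - k\<close>: in \<open>sandwich_adjoint\<close> for
  \<open>cup (1 - k)\<close>, the swap on the right produces \<open>cup k\<close>, while the extra
  \<open>N\<close> on the left produces \<open>cup (2 - k)\<close>.\<close>

lemma cyl_adjoint: "\<beta> \<cdot> (\<one>X \<otimes> cyl (2 - k)) = \<beta> \<cdot> (cyl k \<otimes> \<one>X)"
proof -
  have "(\<one>X \<otimes> N) \<cdot> cup (1 - k) = cup (2 - k)"
    using nak_pow_Suc[of "1 - k"] by (simp add: cup_def interchange3 algebra_simps)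
  then show ?thesis
    using sandwich_adjoint[of "cup (1 - k)"] by (simp add: cyl_def brd_cup)
qed

lemma cup_bend:
  assumes "f \<in> hom X X"
  shows "(\<beta> \<otimes> \<one>X) \<cdot> (\<one>X \<otimes> ((\<one>X \<otimes> f) \<cdot> w)) = f"
proof -
  have f [simp]: "f \<in> Arr S" "Dom S f = X" "Cod S f = X" using assms by auto
  have "(\<beta> \<otimes> \<one>X) \<cdot> (\<one>X \<otimes> ((\<one>X \<otimes> f) \<cdot> w)) = ((\<beta> \<otimes> \<one>X) \<cdot> (\<one>(X \<odot> X) \<otimes> f)) \<cdot> (\<one>X \<otimes> w)"
    by (simp add: whisker flip: ten_id)
  also have "(\<beta> \<otimes> \<one>X) \<cdot> (\<one>(X \<odot> X) \<otimes> f) = f \<cdot> (\<beta> \<otimes> \<one>X)"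
    using ten_split[of \<beta> f] by simp
  finally show ?thesis by (simp add: snake1)
qed

text \<open>Bent with \<open>\<beta>\<close>, both sides become \<open>cyl k\<close>, the left one
  by \<open>cyl_adjoint\<close> and the right one by \<open>cup_bend\<close>. The left side is the
  form in which an outgoing circle enters a state sum.\<close>

lemma cyl_cup: "(cyl (2 - k) \<otimes> \<one>X) \<cdot> w = (\<one>X \<otimes> cyl k) \<cdot> w"
proof (rule state_eqI)
  have "(\<beta> \<otimes> \<one>X) \<cdot> (\<one>X \<otimes> ((cyl (2 - k) \<otimes> \<one>X) \<cdot> w)) = ((\<beta> \<cdot> (\<one>X \<otimes> cyl (2 - k))) \<otimes> \<one>X) \<cdot> (\<one>X \<otimes> w)"
    by (simp add: whisker)
  also have "\<dots> = (\<beta> \<otimes> \<one>X) \<cdot> ((cyl k \<otimes> \<one>(X \<odot> X)) \<cdot> (\<one>X \<otimes> w))"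
    unfolding cyl_adjoint by (simp add: whisker ten_id)
  also have "(cyl k \<otimes> \<one>(X \<odot> X)) \<cdot> (\<one>X \<otimes> w) = (\<one>X \<otimes> w) \<cdot> cyl k"
    using ten_split[of "cyl k" w] by simp
  also have "(\<beta> \<otimes> \<one>X) \<cdot> (\<one>X \<otimes> w) \<cdot> cyl k = cyl k"
    by (subst comp_rule[OF snake1]) simp_all
  also have "\<dots> = (\<beta> \<otimes> \<one>X) \<cdot> (\<one>X \<otimes> ((\<one>X \<otimes> cyl k) \<cdot> w))"
    by (rule cup_bend[symmetric]) simp
  finally show "(\<beta> \<otimes> \<one>X) \<cdot> (\<one>X \<otimes> ((cyl (2 - k) \<otimes> \<one>X) \<cdot> w)) = (\<beta> \<otimes> \<one>X) \<cdot> (\<one>X \<otimes> ((\<one>X \<otimes> cyl k) \<cdot> w))" .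
qed auto

section \<open>Central elements and the window element\<close>

definition central :: "'m \<Rightarrow> bool" where
  "central t \<longleftrightarrow> t \<in> hom (Unt S) X \<and> lmul A t = m \<cdot> (\<one>X \<otimes> t)"

lemma lmul_arr [simp]:
  assumes "t \<in> hom (Unt S) X"
  shows "lmul A t \<in> Arr S" "Dom S (lmul A t) = X" "Cod S (lmul A t) = X"
  using assms by (simp_all add: lmul_def)

lemma lmul_mul:
  assumes "t \<in> hom (Unt S) X"
  shows "lmul A t \<cdot> m = m \<cdot> (lmul A t \<otimes> \<one>X)"
proof -
  have [simp]: "t \<in> Arr S" "Dom S t = Unt S" "Cod S t = X" using assms by auto
  have "(t \<otimes> \<one>X) \<cdot> m = (\<one>X \<otimes> m) \<cdot> (t \<otimes> \<one>X \<otimes> \<one>X)"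
    using ten_split[of t m] by (simp flip: ten_id)
  then have "lmul A t \<cdot> m = (m \<cdot> (\<one>X \<otimes> m)) \<cdot> (t \<otimes> \<one>X \<otimes> \<one>X)"
    by (simp add: lmul_def)
  then show ?thesis by (simp add: lmul_def whisker flip: frob_eqs(1))
qed

lemma central_mul:
  assumes "central t"
  shows "lmul A t \<cdot> m = m \<cdot> (\<one>X \<otimes> lmul A t)"
proof -
  have t: "lmul A t = m \<cdot> (\<one>X \<otimes> t)" and [simp]: "t \<in> Arr S" "Dom S t = Unt S" "Cod S t = X"
    using assms by (auto simp: central_def)
  have "(\<one>X \<otimes> t) \<cdot> m = (m \<otimes> \<one>X) \<cdot> (\<one>X \<otimes> \<one>X \<otimes> t)"
    using ten_split[of m t] by (simp flip: ten_id)
  then have "lmul A t \<cdot> m = (m \<cdot> (m \<otimes> \<one>X)) \<cdot> (\<one>X \<otimes> \<one>X \<otimes> t)"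
    by (simp add: t)
  then show ?thesis by (simp add: t whisker frob_eqs(1))
qed

text \<open>By \<open>com_cup\<close> the argument of the coproduct can be multiplied into either
  leg of \<open>w\<close>, so a central factor of it may be placed in either leg.\<close>

lemma central_com:
  assumes "central t"
  shows "Com A \<cdot> lmul A t = (lmul A t \<otimes> \<one>X) \<cdot> Com A" "Com A \<cdot> lmul A t = (\<one>X \<otimes> lmul A t) \<cdot> Com A"
proof -
  let ?L = "lmul A t"
  have [simp]: "t \<in> Arr S" "Dom S t = Unt S" "Cod S t = X"
    using assms by (auto simp: central_def)
  have "(?L \<otimes> \<one>X) \<cdot> Com A = ((?L \<otimes> \<one>X) \<cdot> (m \<otimes> \<one>X)) \<cdot> (\<one>X \<otimes> w)"
  proof -
    have "(?L \<otimes> \<one>X) \<cdot> Com A = (?L \<otimes> \<one>X) \<cdot> ((m \<otimes> \<one>X) \<cdot> (\<one>X \<otimes> w))"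
      by (simp only: flip: com_cup(1))
    then show ?thesis by simp
  qed
  also have "(?L \<otimes> \<one>X) \<cdot> (m \<otimes> \<one>X) = (m \<otimes> \<one>X) \<cdot> (?L \<otimes> \<one>X \<otimes> \<one>X)"
    by (simp add: lmul_mul ten_merge) (simp add: whisker)
  also have "((m \<otimes> \<one>X) \<cdot> (?L \<otimes> \<one>X \<otimes> \<one>X)) \<cdot> (\<one>X \<otimes> w) = (m \<otimes> \<one>X) \<cdot> (\<one>X \<otimes> w) \<cdot> ?L"
    using ten_split[of ?L w] by (simp flip: ten_id)
  also have "\<dots> = ((m \<otimes> \<one>X) \<cdot> (\<one>X \<otimes> w)) \<cdot> ?L" by simp
  finally show "Com A \<cdot> ?L = (?L \<otimes> \<one>X) \<cdot> Com A" by (simp only: flip: com_cup(1))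
  have "(\<one>X \<otimes> ?L) \<cdot> Com A = ((\<one>X \<otimes> ?L) \<cdot> (\<one>X \<otimes> m)) \<cdot> (w \<otimes> \<one>X)"
  proof -
    have "(\<one>X \<otimes> ?L) \<cdot> Com A = (\<one>X \<otimes> ?L) \<cdot> ((\<one>X \<otimes> m) \<cdot> (w \<otimes> \<one>X))"
      by (simp only: flip: com_cup(2))
    then show ?thesis by simp
  qed
  also have "(\<one>X \<otimes> ?L) \<cdot> (\<one>X \<otimes> m) = (\<one>X \<otimes> m) \<cdot> (\<one>X \<otimes> \<one>X \<otimes> ?L)"
    by (simp add: central_mul[OF assms] ten_merge)
  also have "((\<one>X \<otimes> m) \<cdot> (\<one>X \<otimes> \<one>X \<otimes> ?L)) \<cdot> (w \<otimes> \<one>X) = (\<one>X \<otimes> m) \<cdot> (w \<otimes> \<one>X) \<cdot> ?L"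
    using ten_split[of w ?L] by (simp flip: ten_id)
  also have "\<dots> = ((\<one>X \<otimes> m) \<cdot> (w \<otimes> \<one>X)) \<cdot> ?L" by simp
  finally show "Com A \<cdot> ?L = (\<one>X \<otimes> ?L) \<cdot> Com A" by (simp only: flip: com_cup(2))
qed

lemma central_sandwich:
  assumes "central t" and v: "v \<in> hom (Unt S) (X \<odot> X)"
  shows "sandwich v \<cdot> lmul A t = lmul A t \<cdot> sandwich v"
proof -
  let ?L = "lmul A t"
  have [simp]: "t \<in> Arr S" "Dom S t = Unt S" "Cod S t = X"
    using assms by (auto simp: central_def)
  have [simp]: "v \<in> Arr S" "Dom S v = Unt S" "Cod S v = X \<odot> X" using v by auto
  have "(v \<otimes> \<one>X) \<cdot> ?L = (\<one>X \<otimes> \<one>X \<otimes> ?L) \<cdot> (v \<otimes> \<one>X)"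
    using ten_split[of v ?L] by (simp flip: ten_id)
  then have "sandwich v \<cdot> ?L = m \<cdot> (\<one>X \<otimes> (m \<cdot> c \<cdot> (\<one>X \<otimes> ?L))) \<cdot> (v \<otimes> \<one>X)"
    by (simp add: sandwich_def whisker)
  also have "c \<cdot> (\<one>X \<otimes> ?L) = (?L \<otimes> \<one>X) \<cdot> c" by (rule brd_natural) auto
  also have "m \<cdot> (?L \<otimes> \<one>X) \<cdot> c = (?L \<cdot> m) \<cdot> c" by (simp add: lmul_mul)
  also have "m \<cdot> (\<one>X \<otimes> ((?L \<cdot> m) \<cdot> c)) \<cdot> (v \<otimes> \<one>X) = (m \<cdot> (\<one>X \<otimes> ?L)) \<cdot> (\<one>X \<otimes> (m \<cdot> c)) \<cdot> (v \<otimes> \<one>X)"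
    by (simp add: whisker)
  also have "m \<cdot> (\<one>X \<otimes> ?L) = ?L \<cdot> m" using central_mul[OF assms(1)] by simp
  finally show ?thesis by (simp add: sandwich_def whisker)
qed

lemma window_arr [simp]: "window A \<in> Arr S" "Dom S (window A) = Unt S" "Cod S (window A) = X"
  by (simp_all add: window_def)

text \<open>Both forms of \<open>com_cup\<close> compute the product of the two legs of the
  coproduct of x: one gives \<tau> x, the other x \<tau>.\<close>

lemma window_central: "central (window A)"
proof -
  have "lmul A (window A) = (m \<cdot> (m \<otimes> \<one>X)) \<cdot> (w \<otimes> \<one>X)"
    by (simp add: lmul_def window_def whisker)
  also have "\<dots> = m \<cdot> (\<one>X \<otimes> m) \<cdot> (w \<otimes> \<one>X)" by (simp add: frob_eqs(1))
  also have "\<dots> = m \<cdot> (m \<otimes> \<one>X) \<cdot> (\<one>X \<otimes> w)" by (simp only: flip: com_cup)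
  also have "\<dots> = (m \<cdot> (m \<otimes> \<one>X)) \<cdot> (\<one>X \<otimes> w)" by simp
  also have "\<dots> = m \<cdot> (\<one>X \<otimes> window A)" by (simp add: frob_eqs(1) window_def whisker)
  finally show ?thesis by (simp add: central_def)
qed

lemma lmul_lmul:
  assumes "t \<in> hom (Unt S) X" "u \<in> hom (Unt S) X"
  shows "lmul A t \<cdot> lmul A u = lmul A (m \<cdot> (t \<otimes> u))"
proof -
  have [simp]: "t \<in> Arr S" "Dom S t = Unt S" "Cod S t = X" "u \<in> Arr S" "Dom S u = Unt S" "Cod S u = X"
    using assms by auto
  have tu: "t \<otimes> u = (t \<otimes> \<one>X) \<cdot> u" using ten_split(1)[of t u] by simp
  have "lmul A t \<cdot> lmul A u = (lmul A t \<cdot> m) \<cdot> (u \<otimes> \<one>X)" by (simp add: lmul_def)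
  then show ?thesis by (simp add: lmul_mul) (simp add: lmul_def tu whisker)
qed

lemma lmul_eta: "lmul A (Eta A) = \<one>X"
  by (simp add: lmul_def frob_eqs)

lemma lmul_apply_eta: "t \<in> hom (Unt S) X \<Longrightarrow> lmul A t \<cdot> Eta A = t"
  using ten_split(2)[of t "Eta A"] comp_rule[OF frob_eqs(3), of t] ten_split(1)[of t "Eta A"]
  by (auto simp: lmul_def)

text \<open>An outgoing circle whose edge carries \<open>cup (2 - k)\<close>, paired with what flows
  into it, applies \<open>cyl k\<close>.\<close>

lemma cyl_bend: "(\<beta> \<otimes> \<one>X) \<cdot> (\<one>X \<otimes> ((cyl (2 - k) \<otimes> \<one>X) \<cdot> w)) = cyl k"
  by (simp only: cyl_cup) (rule cup_bend, simp)

lemma beta_assoc: "\<beta> \<cdot> (\<one>X \<otimes> m) = \<beta> \<cdot> (m \<otimes> \<one>X)"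
  by (simp add: frob_eqs(1))

text \<open>The pattern of two outgoing circles. With u_1 \<otimes> u_2 for \<open>u b\<close> and
  v_1 \<otimes> v_2 for \<open>u a\<close>, an element x is sent to \<epsilon>(x u_1 v_1) v_2
  \<otimes> u_2. The pairing with v gives \<open>cyl a\<close> of x u_1, and \<open>cyl_cup\<close>
  moves \<open>cyl b\<close> to the other leg of \<open>w\<close>; what remains is x e_1 \<otimes>
  e_2, the coproduct of x.\<close>

lemma cyl_nested:
  defines "u k \<equiv> (cyl (2 - k) \<otimes> \<one>X) \<cdot> w"
  shows "(\<beta> \<otimes> \<one>X \<otimes> \<one>X) \<cdot> (\<one>X \<otimes> ((m \<otimes> \<one>X \<otimes> \<one>X) \<cdot> (\<one>X \<otimes> u a \<otimes> \<one>X) \<cdot> u b))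
    = (cyl a \<otimes> cyl b) \<cdot> Com A"
proof -
  have u [simp]: "u k \<in> Arr S" "Dom S (u k) = Unt S" "Cod S (u k) = X \<odot> X" for k
    by (simp_all add: u_def)
  have "(\<beta> \<otimes> \<one>X \<otimes> \<one>X) \<cdot> (\<one>X \<otimes> ((m \<otimes> \<one>X \<otimes> \<one>X) \<cdot> (\<one>X \<otimes> u a \<otimes> \<one>X) \<cdot> u b))
     = ((\<beta> \<cdot> (\<one>X \<otimes> m)) \<otimes> \<one>(X \<odot> X)) \<cdot> (\<one>X \<otimes> \<one>X \<otimes> u a \<otimes> \<one>X) \<cdot> (\<one>X \<otimes> u b)"
    by (simp add: whisker whisker2 flip: ten_id)
  also have "\<dots> = (\<beta> \<otimes> \<one>X \<otimes> \<one>X) \<cdot> (((m \<otimes> \<one>(X \<odot> X)) \<cdot> (\<one>(X \<odot> X) \<otimes> u a)) \<otimes> \<one>X) \<cdot> (\<one>X \<otimes> u b)"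
    unfolding beta_assoc by (simp add: whisker whisker2 flip: ten_id)
  also have "(m \<otimes> \<one>(X \<odot> X)) \<cdot> (\<one>(X \<odot> X) \<otimes> u a) = (\<one>X \<otimes> u a) \<cdot> m"
    using ten_split[of m "u a"] by simp
  also have "(\<beta> \<otimes> \<one>X \<otimes> \<one>X) \<cdot> (((\<one>X \<otimes> u a) \<cdot> m) \<otimes> \<one>X) \<cdot> (\<one>X \<otimes> u b)
     = (((\<beta> \<otimes> \<one>X) \<cdot> (\<one>X \<otimes> u a)) \<otimes> \<one>X) \<cdot> (m \<otimes> \<one>X) \<cdot> (\<one>X \<otimes> u b)"
    by (simp add: whisker whisker2)
  also have "(\<beta> \<otimes> \<one>X) \<cdot> (\<one>X \<otimes> u a) = cyl a" unfolding u_def by (rule cyl_bend)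
  also have "(cyl a \<otimes> \<one>X) \<cdot> (m \<otimes> \<one>X) \<cdot> (\<one>X \<otimes> u b)
      = (cyl a \<otimes> \<one>X) \<cdot> ((m \<otimes> \<one>X) \<cdot> (\<one>(X \<odot> X) \<otimes> cyl b)) \<cdot> (\<one>X \<otimes> w)"
    unfolding u_def cyl_cup by (simp add: whisker flip: ten_id)
  also have "(m \<otimes> \<one>X) \<cdot> (\<one>(X \<odot> X) \<otimes> cyl b) = (\<one>X \<otimes> cyl b) \<cdot> (m \<otimes> \<one>X)"
    using ten_split[of m "cyl b"] by simp
  also have "(cyl a \<otimes> \<one>X) \<cdot> ((\<one>X \<otimes> cyl b) \<cdot> (m \<otimes> \<one>X)) \<cdot> (\<one>X \<otimes> w)
     = (cyl a \<otimes> cyl b) \<cdot> ((m \<otimes> \<one>X) \<cdot> (\<one>X \<otimes> w))"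
    by (simp add: interchange3)
  finally show ?thesis by (simp only: flip: com_cup(1))
qed

section \<open>Iterated products and the blocks of three sides of a polygon\<close>

lemma mul_n_arr [simp]: 
  "mul_n A n \<in> Arr S" "Dom S (mul_n A n) = pow X n" "Cod S (mul_n A n) = X"
  by (induction n rule: induct_nat_012) auto

lemma mul_n_add:
  assumes "i \<ge> 1" "j \<ge> 1"
  shows "mul_n A (i + j) = m \<cdot> (mul_n A i \<otimes> mul_n A j)"
  using assms(1)
proof (induction i rule: nat_induct_at_least)
  case base
  obtain j' where "j = Suc j'" using assms(2) by (cases j) auto
  then show ?case by simp
next
  case (Suc i)
  obtain i' where i': "i = Suc i'" using Suc.hyps by (cases i) auto
  have "mul_n A (Suc i + j) = m \<cdot> (\<one>X \<otimes> (m \<cdot> (mul_n A i \<otimes> mul_n A j)))"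
    using Suc.IH by (simp add: i')
  also have "\<dots> = (m \<cdot> (\<one>X \<otimes> m)) \<cdot> (\<one>X \<otimes> mul_n A i \<otimes> mul_n A j)"
    by (simp add: whisker)
  also have "\<dots> = m \<cdot> ((m \<otimes> \<one>X) \<cdot> ((\<one>X \<otimes> mul_n A i) \<otimes> mul_n A j))"
    by (simp flip: frob_eqs(1))
  also have "\<dots> = m \<cdot> (mul_n A (Suc i) \<otimes> mul_n A j)"
    by (simp add: interchange i' del: tenM_assoc)
  finally show ?case .
qed

lemma mul_n_3: "mul_n A 3 = m \<cdot> (\<one>X \<otimes> m)"
  by (simp add: numeral_3_eq_3 ten_id)

text \<open>In the order of the edges the two sides of \<open>r_j\<close> are adjacent, in the order
  of the face the boundary side lies between them; hence one braiding. In
  \<open>relabel_block_out\<close> the outgoing factor stays behind at the end.\<close>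

lemma relabel_block:
  assumes "distinct [x, y, z]"
  shows "relabel X [x, y, z] [x, z, y] = \<one>X \<otimes> c"
  using assms relabel_append[of X "[x]" "[x]" "[y, z]" "[z, y]"] relabel_swap[of X "[y]" "[z]"]
  by (auto simp: reordering_def relabel_same)

lemma relabel_block_out:
  assumes "distinct [x, y, z, z']"
  shows "relabel X [x, y, z, z'] [x, z', y, z] = \<one>X \<otimes> Brd S (X \<odot> X) X"
  using assms relabel_append[of X "[x]" "[x]" "[y, z, z']" "[z', y, z]"] relabel_swap[of X "[y, z]" "[z']"]
  by (auto simp: reordering_def relabel_same)

lemma block_mul:
  assumes v: "v \<in> hom (Unt S) (X \<odot> X)" and "x \<in> hom Y X"
  shows "mul_n A 3 \<cdot> (\<one>X \<otimes> c) \<cdot> (v \<otimes> x) = sandwich v \<cdot> x"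
proof -
  have "v \<otimes> x = (v \<otimes> \<one>X) \<cdot> x" using assms ten_split(1)[of v x] by simp
  then show ?thesis using assms by (simp add: sandwich_def mul_n_3)
qed

text \<open>A boundary edge of index 0 carries \<open>cup 1\<close>. With the surface on its right
  the outgoing factor comes first, so the two legs get swapped, and \<open>brd_cup\<close> turns
  \<open>cup 1\<close> into \<open>cup 0\<close>, which is the plain \<open>w\<close> on the
  right.\<close>

lemma block_out_mul:
  assumes v: "v \<in> hom (Unt S) (X \<odot> X)"
  shows "(mul_n A 3 \<otimes> \<one>X) \<cdot> (\<one>X \<otimes> Brd S (X \<odot> X) X) \<cdot> (v \<otimes> cup 1) = (sandwich v \<otimes> \<one>X) \<cdot> w"
proof -
  have v': "v \<in> Arr S" "Dom S v = Unt S" "Cod S v = X \<odot> X" using v by auto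
  have "v \<otimes> cup 1 = (\<one>(X \<odot> X) \<otimes> cup 1) \<cdot> v" using ten_split(2)[of v "cup 1"] v' by simp
  have "(\<one>X \<otimes> Brd S (X \<odot> X) X) \<cdot> (v \<otimes> cup 1)
     = (\<one>X \<otimes> c \<otimes> \<one>X) \<cdot> (\<one>(X \<odot> X) \<otimes> c) \<cdot> (v \<otimes> cup 1)"
    using v' by (simp add: hexagon2 whisker flip: ten_id)
  also have "(\<one>(X \<odot> X) \<otimes> c) \<cdot> (v \<otimes> cup 1) = v \<otimes> w"
    using v' brd_cup[of 1] by (simp add: interchange cup_def ten_id)
  also have "\<dots> = (v \<otimes> \<one>(X \<odot> X)) \<cdot> w" using v' ten_split(1)[of v w] by simp
  finally show ?thesis
    using v' by (simp add: sandwich_def mul_n_3 whisker flip: ten_id)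
qed

end

locale windowed_frobenius = frobenius S A for S :: "('o, 'm) smc" (structure) and A +
  assumes window_invertible: "\<exists>u. inverse_element A (window A) u"
begin

text \<open>The usual u = u t u' = u', written with left multiplications. It gives meaning to the
  \<open>THE\<close> in \<open>window_inv\<close>.\<close>

lemma inverse_element_unique:
  assumes "inverse_element A t u" "inverse_element A t u'"
  shows "u = u'"
proof -
  have h: "t \<in> hom (Unt S) X" "u \<in> hom (Unt S) X" "u' \<in> hom (Unt S) X"
    using assms by (auto simp: inverse_element_def)
  have "u = lmul A u \<cdot> lmul A (m \<cdot> (t \<otimes> u')) \<cdot> Eta A"
    using assms h by (simp add: inverse_element_def lmul_eta lmul_apply_eta)
  also have "\<dots> = lmul A u \<cdot> (lmul A t \<cdot> lmul A u') \<cdot> Eta A" using h by (simp only: lmul_lmul)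
  also have "\<dots> = (lmul A u \<cdot> lmul A t) \<cdot> lmul A u' \<cdot> Eta A" using h by simp
  also have "\<dots> = u'"
    using assms h by (simp add: inverse_element_def lmul_eta lmul_apply_eta lmul_lmul)
  finally show ?thesis .
qed

lemma window_inv: "inverse_element A (window A) (window_inv A)"
  unfolding window_inv_def using window_invertible inverse_element_unique
  by (metis (mono_tags, lifting) theI)

lemma window_inv_arr [simp]:
  "window_inv A \<in> Arr S" "Dom S (window_inv A) = Unt S" "Cod S (window_inv A) = X"
  using window_inv by (auto simp: inverse_element_def)

abbreviation "L \<equiv> lmul A (window A)"
abbreviation "T \<equiv> lmul A (window_inv A)"

lemma window_lmul_inv: "L \<cdot> T = \<one>X" "T \<cdot> L = \<one>X"
  using window_inv by (auto simp: inverse_element_def lmul_lmul lmul_eta)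

text \<open>Right multiplication by the inverse is a right inverse of \<open>L\<close>, while
  \<open>T\<close> is a left inverse of it, so the two coincide.\<close>

lemma window_inv_central: "central (window_inv A)"
proof -
  let ?u = "window_inv A" and ?r = "m \<cdot> (\<one>X \<otimes> window_inv A)"
  have "L = m \<cdot> (\<one>X \<otimes> window A)" using window_central by (simp add: central_def)
  then have "L \<cdot> ?r = m \<cdot> ((\<one>X \<otimes> window A) \<cdot> m) \<cdot> (\<one>X \<otimes> ?u)" by simp
  also have "(\<one>X \<otimes> window A) \<cdot> m = (m \<otimes> \<one>X) \<cdot> (\<one>X \<otimes> \<one>X \<otimes> window A)"
    using ten_split[of m "window A"] by (simp flip: ten_id)
  also have "m \<cdot> \<dots> \<cdot> (\<one>X \<otimes> ?u) = (m \<cdot> (m \<otimes> \<one>X)) \<cdot> (\<one>X \<otimes> ((\<one>X \<otimes> window A) \<cdot> ?u))"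
    by (simp add: whisker)
  also have "(\<one>X \<otimes> window A) \<cdot> ?u = ?u \<otimes> window A"
    using ten_split(2)[of ?u "window A"] by simp
  also have "(m \<cdot> (m \<otimes> \<one>X)) \<cdot> (\<one>X \<otimes> ?u \<otimes> window A) = m \<cdot> (\<one>X \<otimes> (m \<cdot> (?u \<otimes> window A)))"
    by (simp add: whisker frob_eqs(1))
  also have "\<dots> = \<one>X" using window_inv by (simp add: inverse_element_def frob_eqs)
  finally have "T \<cdot> L \<cdot> ?r = T" by simp
  then have "T = ?r" by (subst (asm) comp_rule[OF window_lmul_inv(2)]) simp_all
  then show ?thesis by (simp add: central_def)
qed

lemma proj_P_cyl: "proj_P A k = T \<cdot> cyl k"
  by (simp add: proj_P_def cyl_def sandwich_cup)

lemma cyl_proj_P: "cyl k = L \<cdot> proj_P A k"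
  by (subst proj_P_cyl, subst comp_rule[OF window_lmul_inv(1)]) simp_all

lemma proj_P_arr [simp]: "proj_P A k \<in> Arr S" "Dom S (proj_P A k) = X" "Cod S (proj_P A k) = X"
  by (simp_all add: proj_P_cyl)

lemma window_commute: "L \<cdot> T = T \<cdot> L" by (simp add: window_lmul_inv)

lemma proj_P_commute: "proj_P A k \<cdot> L = L \<cdot> proj_P A k" "proj_P A k \<cdot> T = T \<cdot> proj_P A k"
proof -
  have *: "cyl k \<cdot> L = L \<cdot> cyl k" "cyl k \<cdot> T = T \<cdot> cyl k"
    unfolding cyl_def by (intro central_sandwich window_central window_inv_central; simp)+
  have "proj_P A k \<cdot> L = T \<cdot> L \<cdot> cyl k" by (simp add: proj_P_cyl *)
  then show "proj_P A k \<cdot> L = L \<cdot> proj_P A k"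
    by (simp add: proj_P_cyl comp_rule[OF window_commute])
  show "proj_P A k \<cdot> T = T \<cdot> proj_P A k" by (simp add: proj_P_cyl *)
qed

text \<open>With u for the inverse window, \<open>beta_nak\<close> gives \<epsilon>(u N(x)) =
  \<epsilon>(x u), and u is central. For the unit, \<open>nak_alt\<close> multiplies it into one leg
  of \<open>c \<cdot> w\<close> and applies \<epsilon>, which is the counit law.\<close>

lemma eps_nak: "(Eps A \<cdot> T) \<cdot> N = Eps A \<cdot> T" "N \<cdot> Eta A = Eta A"
proof -
  let ?u = "window_inv A"
  have T: "T = m \<cdot> (\<one>X \<otimes> ?u)" using window_inv_central by (simp add: central_def)
  have "(?u \<otimes> \<one>X) \<cdot> N = (\<one>X \<otimes> N) \<cdot> (?u \<otimes> \<one>X)"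
    using ten_split[of ?u N] by simp
  then have "(Eps A \<cdot> T) \<cdot> N = (\<beta> \<cdot> (\<one>X \<otimes> N)) \<cdot> (?u \<otimes> \<one>X)"
    by (simp add: lmul_def)
  also have "\<dots> = \<beta> \<cdot> c \<cdot> (?u \<otimes> \<one>X)" unfolding beta_nak by simp
  also have "c \<cdot> (?u \<otimes> \<one>X) = \<one>X \<otimes> ?u" by (rule brd_state) auto
  finally show "(Eps A \<cdot> T) \<cdot> N = Eps A \<cdot> T" by (simp add: T)
  have "N \<cdot> Eta A = (\<beta> \<otimes> \<one>X) \<cdot> (\<one>X \<otimes> (c \<cdot> w)) \<cdot> Eta A" by (subst nak_alt) simp
  also have "(\<one>X \<otimes> (c \<cdot> w)) \<cdot> Eta A = (Eta A \<otimes> \<one>(X \<odot> X)) \<cdot> c \<cdot> w"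
    using ten_split[of "Eta A" "c \<cdot> w"] by simp
  also have "(\<beta> \<otimes> \<one>X) \<cdot> (Eta A \<otimes> \<one>(X \<odot> X)) \<cdot> c \<cdot> w
    = ((Eps A \<cdot> m \<cdot> (Eta A \<otimes> \<one>X)) \<otimes> \<one>X) \<cdot> c \<cdot> w"
    by (simp add: whisker flip: ten_id)
  also have "\<dots> = (Eps A \<otimes> \<one>X) \<cdot> c \<cdot> w" by (simp add: frob_eqs)
  also have "\<dots> = (Brd S X (Unt S) \<cdot> (\<one>X \<otimes> Eps A)) \<cdot> w"
    by (subst brd_natural[of "\<one>X" X X "Eps A" X "Unt S"]) auto
  also have "\<dots> = (\<one>X \<otimes> Eps A) \<cdot> Com A \<cdot> Eta A" by simp
  also have "\<dots> = Eta A" by (subst comp_rule[OF frob_eqs(6)]) simp_all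
  finally show "N \<cdot> Eta A = Eta A" .
qed

end

section \<open>State sums\<close>

context windowed_frobenius
begin

definition vertex_factor :: "decomposition \<Rightarrow> (nat \<Rightarrow> nat \<times> side) \<Rightarrow> tlabel \<Rightarrow> 'm" where
  "vertex_factor D V l = npow X T (vertex_weight D V l)"

lemma vertex_factor_arr [simp]:
  "vertex_factor D V l \<in> Arr S" "Dom S (vertex_factor D V l) = X" "Cod S (vertex_factor D V l) = X"
  by (simp_all add: vertex_factor_def)

lemma sum_F_arr [simp]: "sum_F A D \<in> Arr S" "Dom S (sum_F A D) = pow X (length (face_sides D))"
  "Cod S (sum_F A D) = Unt S"
proof -
  have "tenM (map (\<lambda>f. Eps A \<cdot> mul_n A (nsd D f)) fs)
      \<in> hom (pow X (length (concat (map (\<lambda>f. map (\<lambda>k. LE (fst (att D f k)) (snd (att D f k))) [0..<nsd D f]) fs)))) (Unt S)"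
    for fs by (induction fs) (auto simp: pow_add)
  from this[of "[0..<nfc D]"] show "sum_F A D \<in> Arr S" "Dom S (sum_F A D) = pow X (length (face_sides D))"
    "Cod S (sum_F A D) = Unt S" by (auto simp: sum_F_def face_sides_def)
qed

text \<open>A normal form that eliminates the order of the edge sides: \<open>relabel_tenM\<close>
  moves the vertex weights past the permutation into the order of the faces, and
  \<open>relabel_comp\<close> merges the two permutations. One permutation of \<open>W\<close>
  remains, followed by the weighted face functional.\<close>

lemma sum_L_eq:
  fixes D
  defines "Tg \<equiv> concat (map (edge_targets D) [0..<ned D])"
  assumes E: "reordering (edge_sides D) (face_sides D)"
    and Tg: "reordering Tg (edge_sides D @ map LOut (bout D))"
    and W: "tenM (map (edge_weight A D) [0..<ned D])
      \<cdot> relabel X (map LIn (bin D)) (concat (map (edge_sources D) [0..<ned D])) = W" "W \<in> hom Y (pow X (length Tg))"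
    "tenM (map (edge_weight A D) [0..<ned D]) \<in> hom Y' (pow X (length Tg))"
    "relabel X (map LIn (bin D)) (concat (map (edge_sources D) [0..<ned D])) \<in> hom Y Y'"
  shows "sum_L A D V = ((sum_F A D \<cdot> tenM (map (vertex_factor D V) (face_sides D))) \<otimes> \<one>(pow X (length (bout D))))
     \<cdot> relabel X Tg (face_sides D @ map LOut (bout D)) \<cdot> W"
proof -
  let ?E = "edge_sides D" and ?F = "face_sides D" and ?O = "map LOut (bout D)"
  have y: "\<forall>l\<in>set ls. vertex_factor D V l \<in> hom X X" for ls by simp
  have l: "length ?E = length ?F" using E by (rule reordering_length)
  have lT: "length Tg = length ?F + length (bout D)" using reordering_length[OF Tg] l by simp
  have W2: "W \<in> Arr S" "Dom S W = Y" "Cod S W = pow X (length ?F) \<odot> pow X (length (bout D))"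
    using W(2) by (auto simp: lT pow_add)
  have disj: "set ?E \<inter> set ?O = {}" using Tg by (auto simp: reordering_def)
  have O: "reordering ?O ?O" using Tg by (auto simp: reordering_def)
  have EF: "reordering (?E @ ?O) (?F @ ?O)" using E O disj by (auto simp: reordering_def)
  have TF: "reordering Tg (?F @ ?O)" using Tg EF by (auto simp: reordering_def)
  have "sum_Y A D V = tenM (map (vertex_factor D V) ?E)"
    by (simp add: sum_Y_def vertex_factor_def[abs_def])
  moreover have "relabel X ?E ?F \<cdot> tenM (map (vertex_factor D V) ?E) = tenM (map (vertex_factor D V) ?F) \<cdot> relabel X ?E ?F"
    by (rule relabel_tenM) (use E in auto)
  moreover have "sum_C A D = relabel X Tg (?E @ ?O) \<cdot> W"
    using W(1) by (simp add: sum_C_def Tg_def)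
  ultimately have "sum_L A D V = ((sum_F A D \<cdot> tenM (map (vertex_factor D V) ?F) \<cdot> relabel X ?E ?F)
     \<otimes> \<one>(pow X (length (bout D)))) \<cdot> relabel X Tg (?E @ ?O) \<cdot> W"
    by (simp add: sum_L_def)
  also have "\<dots> = ((sum_F A D \<cdot> tenM (map (vertex_factor D V) ?F)) \<otimes> \<one>(pow X (length (bout D))))
     \<cdot> ((relabel X ?E ?F \<otimes> \<one>(pow X (length (bout D)))) \<cdot> relabel X Tg (?E @ ?O)) \<cdot> W"
    using tenM_endos[OF y] E Tg W2 l by (simp add: whisker pow_add lT)
  also have "relabel X ?E ?F \<otimes> \<one>(pow X (length (bout D))) = relabel X (?E @ ?O) (?F @ ?O)"
    using relabel_append[OF _ E O disj, of X] O by (simp add: relabel_same reordering_def)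
  also have "\<dots> \<cdot> relabel X Tg (?E @ ?O) = relabel X Tg (?F @ ?O)"
    by (rule relabel_comp[OF _ Tg EF]) simp
  finally show ?thesis .
qed

end

section \<open>The state sums of the 9-gons\<close>

lemma nine_gon_simps [simp]:
  "nfc (nine_gon r js s bi bo) = 1" "nsd (nine_gon r js s bi bo) f = 9" "ned (nine_gon r js s bi bo) = 6"
  "nvt (nine_gon r js s bi bo) = 4" "src (nine_gon r js s bi bo) e = (if e < 3 then 0 else e - 2)"
  "tgt (nine_gon r js s bi bo) e = (if e < 3 then e + 1 else e - 2)"
  "idx (nine_gon r js s bi bo) e = (if e < 3 then s e mod int r else 0)"
  "bin (nine_gon r js s bi bo) = bi" "bout (nine_gon r js s bi bo) = bo"
  "att (nine_gon r js s bi bo) f k = concat (map (\<lambda>j. [(j, Lft), (j + 3, Rgt), (j, Rgt)]) js) ! k"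
  by (simp_all add: nine_gon_def)

lemma nine_gon_attached:
  assumes "js = [0, 1, 2] \<or> js = [2, 1, 0]"
  shows "attached (nine_gon r js s bi bo) e x \<longleftrightarrow> e < 3 \<or> e \<in> {3, 4, 5} \<and> x = Rgt"
proof -
  let ?l = "concat (map (\<lambda>j. [(j, Lft), (j + 3, Rgt), (j, Rgt)]) js) :: (nat \<times> side) list"
  have l: "length ?l = 9" using assms by auto
  have "attached (nine_gon r js s bi bo) e x \<longleftrightarrow> (\<exists>k<9. ?l ! k = (e, x))"
    by (auto simp: attached_def sides_def)
  also have "\<dots> \<longleftrightarrow> (e, x) \<in> set ?l"
    by (simp only: in_set_conv_nth l)
  also have "\<dots> \<longleftrightarrow> e < 3 \<or> e \<in> {3, 4, 5} \<and> x = Rgt"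
    using assms by (cases x) auto
  finally show ?thesis .
qed

lemma nine_gon_edge_sides:
  assumes "js = [0, 1, 2] \<or> js = [2, 1, 0]"
  shows "edge_sides (nine_gon r js s bi bo) = [LE 0 Lft, LE 0 Rgt, LE 1 Lft, LE 1 Rgt,
     LE 2 Lft, LE 2 Rgt, LE 3 Rgt, LE 4 Rgt, LE 5 Rgt]"
  by (simp add: edge_sides_def nine_gon_attached[OF assms] upt_rec)

lemma nine_gon_face_sides:
  assumes "js = [i, j, k]"
  shows "face_sides (nine_gon r js s bi bo) = [LE i Lft, LE (i + 3) Rgt, LE i Rgt,
    LE j Lft, LE (j + 3) Rgt, LE j Rgt, LE k Lft, LE (k + 3) Rgt, LE k Rgt]"
  by (simp add: face_sides_def assms upt_rec)

context windowed_frobenius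
begin

abbreviation ten3 :: "'m \<Rightarrow> 'm" where
  "ten3 f \<equiv> f \<otimes> \<one>X \<otimes> \<one>X"

text \<open>The face of the 9-gon with weights on its sides 0, 3 and 6, which are the left sides of
  the edges \<open>r_j\<close>.\<close>

definition nine_form :: "'m \<Rightarrow> 'm \<Rightarrow> 'm \<Rightarrow> 'm" where
  "nine_form f g h = Eps A \<cdot> mul_n A 9 \<cdot> (ten3 f \<otimes> ten3 g \<otimes> ten3 h)"

lemma mul_n_9: "mul_n A 9 = m \<cdot> (mul_n A 3 \<otimes> (m \<cdot> (mul_n A 3 \<otimes> mul_n A 3)))"
  using mul_n_add[of 3 6] mul_n_add[of 3 3] by simp

lemma pow_9 [simp]: "pow X 9 = X \<odot> X \<odot> X \<odot> X \<odot> X \<odot> X \<odot> X \<odot> X \<odot> X"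
  by (simp add: numeral_eq_Suc)

lemma pow_3 [simp]: "pow X 3 = X \<odot> X \<odot> X"
  by (simp add: numeral_3_eq_3)

text \<open>Maps that behave like left multiplications pass from the first of three sides through
  the product of the three.\<close>

lemma nine_form_eq:
  assumes "\<And>f. f \<in> {f1, f2, f3} \<Longrightarrow> f \<in> hom X X \<and> f \<cdot> m = m \<cdot> (f \<otimes> \<one>X)"
  shows "nine_form f1 f2 f3 = \<beta> \<cdot> ((f1 \<cdot> mul_n A 3) \<otimes> (m \<cdot> ((f2 \<cdot> mul_n A 3) \<otimes> (f3 \<cdot> mul_n A 3))))"
proof -
  have *: "f \<in> Arr S" "Dom S f = X" "Cod S f = X" "mul_n A 3 \<cdot> ten3 f = f \<cdot> mul_n A 3"
    if "f \<in> {f1, f2, f3}" for f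
  proof -
    from assms[OF that] show 1: "f \<in> Arr S" "Dom S f = X" "Cod S f = X" by auto
    have "mul_n A 3 \<cdot> ten3 f = (m \<cdot> (m \<otimes> \<one>X)) \<cdot> ten3 f"
      using 1 by (simp add: mul_n_3 frob_eqs(1))
    also have "\<dots> = m \<cdot> ((m \<cdot> (f \<otimes> \<one>X)) \<otimes> \<one>X)"
      using 1 by (simp add: whisker)
    also have "\<dots> = m \<cdot> ((f \<cdot> m) \<otimes> \<one>X)" using assms[OF that] by simp
    also have "\<dots> = (m \<cdot> (f \<otimes> \<one>X)) \<cdot> (m \<otimes> \<one>X)" using 1 by (simp add: whisker)
    also have "\<dots> = (f \<cdot> m) \<cdot> (m \<otimes> \<one>X)" using assms[OF that] by simp
    finally show "mul_n A 3 \<cdot> ten3 f = f \<cdot> mul_n A 3"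
      using 1 by (simp add: mul_n_3 frob_eqs(1))
  qed
  have e: "(mul_n A 3 \<otimes> (m \<cdot> (mul_n A 3 \<otimes> mul_n A 3))) \<cdot> (ten3 f1 \<otimes> ten3 f2 \<otimes> ten3 f3)
    = (mul_n A 3 \<cdot> ten3 f1) \<otimes> (m \<cdot> ((mul_n A 3 \<cdot> ten3 f2) \<otimes> (mul_n A 3 \<cdot> ten3 f3)))"
    using *(1-3)[of f1] *(1-3)[of f2] *(1-3)[of f3] by (simp add: interchange del: tenM_assoc)
  have "nine_form f1 f2 f3 = Eps A \<cdot> m \<cdot> ((mul_n A 3 \<cdot> ten3 f1) \<otimes>
     (m \<cdot> ((mul_n A 3 \<cdot> ten3 f2) \<otimes> (mul_n A 3 \<cdot> ten3 f3))))"
    unfolding nine_form_def mul_n_9 e[symmetric] using *(1-3)[of f1] *(1-3)[of f2] *(1-3)[of f3]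
    by simp
  then show ?thesis using * by simp
qed

lemma relabel_factor:
  assumes "reordering xs ys" "reordering ys zs" "f \<in> hom Y (pow X (length xs))"
  shows "relabel X xs zs \<cdot> f = relabel X ys zs \<cdot> relabel X xs ys \<cdot> f"
  using assms relabel_comp[OF _ assms(1,2), of X] reordering_length[OF assms(1)]
  by (auto simp flip: comp_assoc)

text \<open>\<open>a, a'\<close>, \<open>b, b'\<close> and \<open>e, e'\<close> are the sides of
  \<open>r_1\<close>, \<open>r_2\<close> and \<open>r_3\<close>, while \<open>x\<close> and
  \<open>y\<close> are the ingoing boundary sides and \<open>q\<close>, \<open>z\<close> the output
  and the boundary side of the third circle. Once \<open>x\<close> and \<open>y\<close> are next to
  their edges, the permutation is a tensor product of three blocks.\<close>

lemma relabel_pants: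
  assumes d: "distinct [a, a', b, b', e, e', x, y, q, z]"
    and v: "v0 \<in> hom (Unt S) (X \<odot> X)" "v1 \<in> hom (Unt S) (X \<odot> X)" "v2 \<in> hom (Unt S) (X \<odot> X)"
      "v3 \<in> hom (Unt S) (X \<odot> X)"
  shows "relabel X [a, a', b, b', e, e', x, y, q, z] [a, x, a', b, y, b', e, z, e', q]
      \<cdot> (v0 \<otimes> v1 \<otimes> v2 \<otimes> \<one>X \<otimes> \<one>X \<otimes> v3)
    = ((\<one>X \<otimes> c) \<cdot> (v0 \<otimes> \<one>X)) \<otimes> ((\<one>X \<otimes> c) \<cdot> (v1 \<otimes> \<one>X)) \<otimes> ((\<one>X \<otimes> Brd S (X \<odot> X) X) \<cdot> (v2 \<otimes> v3))"
proof -
  let ?T0 = "[a, a', b, b', e, e', x, y, q, z]" and ?T1 = "[a, a', x, b, b', e, e', y, q, z]"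
    and ?T2 = "[a, a', x, b, b', y, e, e', q, z]" and ?F = "[a, x, a', b, y, b', e, z, e', q]"
  have v': "v0 \<in> Arr S" "Dom S v0 = Unt S" "Cod S v0 = X \<odot> X" "v1 \<in> Arr S" "Dom S v1 = Unt S" "Cod S v1 = X \<odot> X"
    "v2 \<in> Arr S" "Dom S v2 = Unt S" "Cod S v2 = X \<odot> X" "v3 \<in> Arr S" "Dom S v3 = Unt S" "Cod S v3 = X \<odot> X"
    using v by auto
  have r: "reordering ?T0 ?T1" "reordering ?T1 ?T2" "reordering ?T2 ?F" "reordering ?T1 ?F"
    using d by (auto simp: reordering_def)
  have "relabel X ?T0 ?F \<cdot> (v0 \<otimes> v1 \<otimes> v2 \<otimes> \<one>X \<otimes> \<one>X \<otimes> v3)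
      = relabel X ?T1 ?F \<cdot> relabel X ?T0 ?T1 \<cdot> (v0 \<otimes> v1 \<otimes> v2 \<otimes> \<one>X \<otimes> \<one>X \<otimes> v3)"
    by (rule relabel_factor[where Y = "X \<odot> X"]) (use r v' in auto)
  also have "relabel X ?T0 ?T1 \<cdot> (v0 \<otimes> v1 \<otimes> v2 \<otimes> \<one>X \<otimes> \<one>X \<otimes> v3) = v0 \<otimes> \<one>X \<otimes> v1 \<otimes> v2 \<otimes> \<one>X \<otimes> v3"
    using relabel_states[of X "[a, a']" "[b, b', e, e']" "[x]" "[y, q, z]" v0 "Unt S" "v1 \<otimes> v2" "\<one>X" X "\<one>X \<otimes> v3" X] r v'
    by (simp add: reordering_def)
  also have "relabel X ?T1 ?F \<cdot> (v0 \<otimes> \<one>X \<otimes> v1 \<otimes> v2 \<otimes> \<one>X \<otimes> v3)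
      = relabel X ?T2 ?F \<cdot> relabel X ?T1 ?T2 \<cdot> (v0 \<otimes> \<one>X \<otimes> v1 \<otimes> v2 \<otimes> \<one>X \<otimes> v3)"
    by (rule relabel_factor[where Y = "X \<odot> X"]) (use r v' in auto)
  also have "relabel X ?T1 ?T2 \<cdot> (v0 \<otimes> \<one>X \<otimes> v1 \<otimes> v2 \<otimes> \<one>X \<otimes> v3) = v0 \<otimes> \<one>X \<otimes> v1 \<otimes> \<one>X \<otimes> v2 \<otimes> v3"
    using relabel_states[of X "[a, a', x, b, b']" "[e, e']" "[y]" "[q, z]" "v0 \<otimes> \<one>X \<otimes> v1" X v2 "\<one>X" X v3 "Unt S"] r v'
    by (simp add: reordering_def)
  also have "relabel X ?T2 ?F = (\<one>X \<otimes> c) \<otimes> (\<one>X \<otimes> c) \<otimes> (\<one>X \<otimes> Brd S (X \<odot> X) X)"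
  proof -
    have "relabel X ([a, a', x] @ [b, b', y, e, e', q, z]) ([a, x, a'] @ [b, y, b', e, z, e', q])
       = relabel X [a, a', x] [a, x, a'] \<otimes> relabel X [b, b', y, e, e', q, z] [b, y, b', e, z, e', q]"
      by (rule relabel_append) (use d in \<open>auto simp: reordering_def\<close>)
    moreover have "relabel X ([b, b', y] @ [e, e', q, z]) ([b, y, b'] @ [e, z, e', q])
       = relabel X [b, b', y] [b, y, b'] \<otimes> relabel X [e, e', q, z] [e, z, e', q]"
      by (rule relabel_append) (use d in \<open>auto simp: reordering_def\<close>)
    ultimately show ?thesis
      using d by (simp add: relabel_block relabel_block_out del: tenM_assoc)
  qed
  also have "v0 \<otimes> \<one>X \<otimes> v1 \<otimes> \<one>X \<otimes> v2 \<otimes> v3 = (v0 \<otimes> \<one>X) \<otimes> (v1 \<otimes> \<one>X) \<otimes> (v2 \<otimes> v3)"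
    using v' by simp
  finally show ?thesis using v' by (simp add: interchange del: tenM_assoc)
qed

text \<open>The face meets \<open>r_3\<close>, \<open>r_2\<close>, \<open>r_1\<close> in this order,
  so the states are first brought into it. Moving the output \<open>q\<close> of the second circle
  behind the output \<open>p\<close> of the first one then nests the block of \<open>r_1\<close>
  inside that of \<open>r_2\<close>, whence the shape of the right side.\<close>

lemma relabel_copants:
  assumes d: "distinct [a, a', b, b', e, e', p, x, q, y, z]"
    and v: "v0 \<in> hom (Unt S) (X \<odot> X)" "v1 \<in> hom (Unt S) (X \<odot> X)" "v2 \<in> hom (Unt S) (X \<odot> X)"
      "u0 \<in> hom (Unt S) (X \<odot> X)" "u1 \<in> hom (Unt S) (X \<odot> X)"
  shows "relabel X [a, a', b, b', e, e', p, x, q, y, z] [e, z, e', b, y, b', a, x, a', p, q]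
      \<cdot> (v0 \<otimes> v1 \<otimes> v2 \<otimes> u0 \<otimes> u1 \<otimes> \<one>X)
    = ((\<one>X \<otimes> c) \<cdot> (v2 \<otimes> \<one>X)) \<otimes>
      ((\<one>(X \<odot> X \<odot> X) \<otimes> ((\<one>X \<otimes> Brd S (X \<odot> X) X) \<cdot> (v0 \<otimes> u0)) \<otimes> \<one>X)
         \<cdot> (\<one>X \<otimes> Brd S (X \<odot> X) X) \<cdot> (v1 \<otimes> u1))"
proof -
  let ?B = "Brd S (X \<odot> X) X"
  let ?T0 = "[a, a', b, b', e, e', p, x, q, y, z]" 
    and ?T1 = "[e, e', a, a', b, b', p, x, q, y, z]" 
    and ?T2 = "[e, e', z, a, a', b, b', p, x, q, y]"
    and ?T3 = "[e, e', z, b, b', a, a', p, x, q, y]"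
    and ?T4 = "[e, e', z, b, b', q, y, a, a', p, x]"
    and ?T5 = "[e, z, e', b, y, b', q, a, x, a', p]"
    and ?F = "[e, z, e', b, y, b', a, x, a', p, q]"
  have v': "v0 \<in> Arr S" "Dom S v0 = Unt S" "Cod S v0 = X \<odot> X" "v1 \<in> Arr S" "Dom S v1 = Unt S" "Cod S v1 = X \<odot> X"
    "v2 \<in> Arr S" "Dom S v2 = Unt S" "Cod S v2 = X \<odot> X" "u0 \<in> Arr S" "Dom S u0 = Unt S" "Cod S u0 = X \<odot> X"
    "u1 \<in> Arr S" "Dom S u1 = Unt S" "Cod S u1 = X \<odot> X"
    using v by auto
  have r: "reordering ?T0 ?T1" "reordering ?T1 ?T2" "reordering ?T2 ?T3" "reordering ?T3 ?T4" "reordering ?T4 ?T5"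
    "reordering ?T5 ?F" "reordering ?T1 ?F" "reordering ?T2 ?F" "reordering ?T3 ?F" "reordering ?T4 ?F"
    using d by (auto simp: reordering_def)
  let ?s0 = "v0 \<otimes> v1 \<otimes> v2 \<otimes> u0 \<otimes> u1 \<otimes> \<one>X"
  have "relabel X ?T0 ?F \<cdot> ?s0 = relabel X ?T1 ?F \<cdot> relabel X ?T0 ?T1 \<cdot> ?s0"
    by (rule relabel_factor[where Y = X]) (use r v' in auto)
  also have "relabel X ?T0 ?T1 \<cdot> ?s0 = v2 \<otimes> v0 \<otimes> v1 \<otimes> u0 \<otimes> u1 \<otimes> \<one>X"
    using relabel_states[of X "[]" "[a, a', b, b']" "[e, e']" "[p, x, q, y, z]" "\<one>(Unt S)" "Unt S" "v0 \<otimes> v1" v2 "Unt S" "u0 \<otimes> u1 \<otimes> \<one>X" X] r v'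
    by (simp add: reordering_def)
  also have "relabel X ?T1 ?F \<cdot> \<dots> = relabel X ?T2 ?F \<cdot> relabel X ?T1 ?T2 \<cdot> \<dots>"
    by (rule relabel_factor[where Y = X]) (use r v' in auto)
  also have "relabel X ?T1 ?T2 \<cdot> (v2 \<otimes> v0 \<otimes> v1 \<otimes> u0 \<otimes> u1 \<otimes> \<one>X) = v2 \<otimes> \<one>X \<otimes> v0 \<otimes> v1 \<otimes> u0 \<otimes> u1"
    using relabel_states[of X "[e, e']" "[a, a', b, b', p, x, q, y]" "[z]" "[]" v2 "Unt S" "v0 \<otimes> v1 \<otimes> u0 \<otimes> u1" "\<one>X" X "\<one>(Unt S)" "Unt S"] r v'
    by (simp add: reordering_def)
  also have "relabel X ?T2 ?F \<cdot> \<dots> = relabel X ?T3 ?F \<cdot> relabel X ?T2 ?T3 \<cdot> \<dots>"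
    by (rule relabel_factor[where Y = X]) (use r v' in auto)
  also have "relabel X ?T2 ?T3 \<cdot> (v2 \<otimes> \<one>X \<otimes> v0 \<otimes> v1 \<otimes> u0 \<otimes> u1) = v2 \<otimes> \<one>X \<otimes> v1 \<otimes> v0 \<otimes> u0 \<otimes> u1"
    using relabel_states[of X "[e, e', z]" "[a, a']" "[b, b']" "[p, x, q, y]" "v2 \<otimes> \<one>X" X v0 v1 "Unt S" "u0 \<otimes> u1" "Unt S"] r v'
    by (simp add: reordering_def)
  also have "relabel X ?T3 ?F \<cdot> \<dots> = relabel X ?T4 ?F \<cdot> relabel X ?T3 ?T4 \<cdot> \<dots>"
    by (rule relabel_factor[where Y = X]) (use r v' in auto)
  also have "relabel X ?T3 ?T4 \<cdot> (v2 \<otimes> \<one>X \<otimes> v1 \<otimes> v0 \<otimes> u0 \<otimes> u1) = v2 \<otimes> \<one>X \<otimes> v1 \<otimes> u1 \<otimes> v0 \<otimes> u0"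
    using relabel_states[of X "[e, e', z, b, b']" "[a, a', p, x]" "[q, y]" "[]" "v2 \<otimes> \<one>X \<otimes> v1" X "v0 \<otimes> u0" u1 "Unt S" "\<one>(Unt S)" "Unt S"] r v'
    by (simp add: reordering_def)
  also have "relabel X ?T4 ?F \<cdot> \<dots> = relabel X ?T5 ?F \<cdot> relabel X ?T4 ?T5 \<cdot> \<dots>"
    by (rule relabel_factor[where Y = X]) (use r v' in auto)
  also have "relabel X ?T4 ?T5 \<cdot> (v2 \<otimes> \<one>X \<otimes> v1 \<otimes> u1 \<otimes> v0 \<otimes> u0)
     = ((\<one>X \<otimes> c) \<cdot> (v2 \<otimes> \<one>X)) \<otimes> ((\<one>X \<otimes> ?B) \<cdot> (v1 \<otimes> u1)) \<otimes> ((\<one>X \<otimes> ?B) \<cdot> (v0 \<otimes> u0))"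
  proof -
    have "relabel X ([e, e', z] @ [b, b', q, y, a, a', p, x]) ([e, z, e'] @ [b, y, b', q, a, x, a', p])
       = relabel X [e, e', z] [e, z, e'] \<otimes> relabel X [b, b', q, y, a, a', p, x] [b, y, b', q, a, x, a', p]"
      by (rule relabel_append) (use d in \<open>auto simp: reordering_def\<close>)
    moreover have "relabel X ([b, b', q, y] @ [a, a', p, x]) ([b, y, b', q] @ [a, x, a', p])
       = relabel X [b, b', q, y] [b, y, b', q] \<otimes> relabel X [a, a', p, x] [a, x, a', p]"
      by (rule relabel_append) (use d in \<open>auto simp: reordering_def\<close>)
    ultimately have "relabel X ?T4 ?T5 = (\<one>X \<otimes> c) \<otimes> (\<one>X \<otimes> ?B) \<otimes> (\<one>X \<otimes> ?B)"
      using d by (simp add: relabel_block relabel_block_out del: tenM_assoc)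
    moreover have "v2 \<otimes> \<one>X \<otimes> v1 \<otimes> u1 \<otimes> v0 \<otimes> u0 = (v2 \<otimes> \<one>X) \<otimes> (v1 \<otimes> u1) \<otimes> (v0 \<otimes> u0)"
      using v' by simp
    ultimately show ?thesis using v' by (simp add: interchange del: tenM_assoc)
  qed
  also have "relabel X ?T5 ?F = \<one>(X \<odot> X \<odot> X) \<otimes> \<one>(X \<odot> X \<odot> X) \<otimes> Brd S X (X \<odot> X \<odot> X \<odot> X)"
  proof -
    have "relabel X ([e, z, e', b, y, b'] @ [q, a, x, a', p]) ([e, z, e', b, y, b'] @ [a, x, a', p, q])
       = relabel X [e, z, e', b, y, b'] [e, z, e', b, y, b'] \<otimes> relabel X [q, a, x, a', p] [a, x, a', p, q]"
      by (rule relabel_append) (use d in \<open>auto simp: reordering_def\<close>)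
    moreover have "relabel X ([q] @ [a, x, a', p]) ([a, x, a', p] @ [q]) = Brd S X (X \<odot> X \<odot> X \<odot> X)"
      using d by (subst relabel_swap) auto
    moreover have "relabel X [e, z, e', b, y, b'] [e, z, e', b, y, b'] = \<one>(X \<odot> X \<odot> X \<odot> X \<odot> X \<odot> X)"
      by (subst relabel_same) (use d in auto)
    ultimately show ?thesis by (simp add: ten_id flip: tenM_assoc)
  qed
  also have "(\<one>(X \<odot> X \<odot> X) \<otimes> \<one>(X \<odot> X \<odot> X) \<otimes> Brd S X (X \<odot> X \<odot> X \<odot> X)) \<cdot>
       (((\<one>X \<otimes> c) \<cdot> (v2 \<otimes> \<one>X)) \<otimes> ((\<one>X \<otimes> ?B) \<cdot> (v1 \<otimes> u1)) \<otimes> ((\<one>X \<otimes> ?B) \<cdot> (v0 \<otimes> u0)))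
    = ((\<one>X \<otimes> c) \<cdot> (v2 \<otimes> \<one>X)) \<otimes>
       ((\<one>(X \<odot> X \<odot> X) \<otimes> Brd S X (X \<odot> X \<odot> X \<odot> X)) \<cdot> (((\<one>X \<otimes> ?B) \<cdot> (v1 \<otimes> u1)) \<otimes> ((\<one>X \<otimes> ?B) \<cdot> (v0 \<otimes> u0))))"
    using v' by (simp add: interchange)
  also have "(\<one>(X \<odot> X \<odot> X) \<otimes> Brd S X (X \<odot> X \<odot> X \<odot> X)) \<cdot> (((\<one>X \<otimes> ?B) \<cdot> (v1 \<otimes> u1)) \<otimes> ((\<one>X \<otimes> ?B) \<cdot> (v0 \<otimes> u0)))
    = (\<one>(X \<odot> X \<odot> X) \<otimes> ((\<one>X \<otimes> ?B) \<cdot> (v0 \<otimes> u0)) \<otimes> \<one>X) \<cdot> (\<one>X \<otimes> ?B) \<cdot> (v1 \<otimes> u1)"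
  proof -
    let ?s = "(\<one>X \<otimes> ?B) \<cdot> (v1 \<otimes> u1)" and ?t = "(\<one>X \<otimes> ?B) \<cdot> (v0 \<otimes> u0)"
    have s: "?s \<in> Arr S" "Dom S ?s = Unt S" "Cod S ?s = X \<odot> X \<odot> X \<odot> X"
      and t: "?t \<in> Arr S" "Dom S ?t = Unt S" "Cod S ?t = X \<odot> X \<odot> X \<odot> X"
      using v' by auto
    obtain s t where st: "s = ?s" "t = ?t" by blast
    note s = s[folded st(1)] and t = t[folded st(2)]
    have "s \<otimes> t = (\<one>(X \<odot> X \<odot> X) \<otimes> (\<one>X \<otimes> t)) \<cdot> s"
      using ten_split(2)[of s t] s t by (simp flip: ten_id)
    moreover have "Brd S X (X \<odot> X \<odot> X \<odot> X) \<cdot> (\<one>X \<otimes> t) = t \<otimes> \<one>X"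
      by (rule brd_state) (use t in auto)
    ultimately have "(\<one>(X \<odot> X \<odot> X) \<otimes> Brd S X (X \<odot> X \<odot> X \<odot> X)) \<cdot> (s \<otimes> t) = (\<one>(X \<odot> X \<odot> X) \<otimes> t \<otimes> \<one>X) \<cdot> s"
      using s t by (simp add: interchange3)
    then show ?thesis unfolding st .
  qed
  finally show ?thesis .
qed

text \<open>Moves the bracket from \<epsilon>(f (g h)) to \<epsilon>((f g) h): the third block
  carries the free output and is paired, as a bent state, with the product of the two ingoing
  blocks.\<close>

lemma contract_pants:
  assumes "f \<in> hom P X" "g \<in> hom Q X" "h \<in> hom R X" "p \<in> hom P' P" "q \<in> hom Q' Q" "s \<in> hom R' (R \<odot> X)"
  shows "((\<beta> \<cdot> (f \<otimes> (m \<cdot> (g \<otimes> h)))) \<otimes> \<one>X) \<cdot> (p \<otimes> q \<otimes> s)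
    = (\<beta> \<otimes> \<one>X) \<cdot> ((m \<cdot> ((f \<cdot> p) \<otimes> (g \<cdot> q))) \<otimes> ((h \<otimes> \<one>X) \<cdot> s))"
proof -
  have a: "f \<in> Arr S" "Dom S f = P" "Cod S f = X" "g \<in> Arr S" "Dom S g = Q" "Cod S g = X"
    "h \<in> Arr S" "Dom S h = R" "Cod S h = X" "p \<in> Arr S" "Dom S p = P'" "Cod S p = P"
    "q \<in> Arr S" "Dom S q = Q'" "Cod S q = Q" "s \<in> Arr S" "Dom S s = R'" "Cod S s = R \<odot> X"
    and [simp]: "P \<in> Ob S" "Q \<in> Ob S" "R \<in> Ob S"
    using assms by auto
  have e: "f \<otimes> (m \<cdot> (g \<otimes> h)) = (\<one>X \<otimes> m) \<cdot> (f \<otimes> g \<otimes> h)"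
    using a by (simp add: interchange)
  have "(\<beta> \<cdot> (f \<otimes> (m \<cdot> (g \<otimes> h)))) \<otimes> \<one>X = ((\<beta> \<cdot> (\<one>X \<otimes> m)) \<otimes> \<one>X) \<cdot> (f \<otimes> g \<otimes> h \<otimes> \<one>X)"
    unfolding e using a by (simp add: whisker)
  also have "\<dots> = (\<beta> \<otimes> \<one>X) \<cdot> (m \<otimes> \<one>X \<otimes> \<one>X) \<cdot> (f \<otimes> g \<otimes> h \<otimes> \<one>X)"
    unfolding beta_assoc using a by (simp add: whisker)
  finally have "((\<beta> \<cdot> (f \<otimes> (m \<cdot> (g \<otimes> h)))) \<otimes> \<one>X) \<cdot> (p \<otimes> q \<otimes> s)
    = (\<beta> \<otimes> \<one>X) \<cdot> (m \<otimes> \<one>X \<otimes> \<one>X) \<cdot> (f \<otimes> g \<otimes> (h \<otimes> \<one>X)) \<cdot> (p \<otimes> q \<otimes> s)"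
    using a by simp
  also have "(f \<otimes> g \<otimes> (h \<otimes> \<one>X)) \<cdot> (p \<otimes> q \<otimes> s) = (f \<cdot> p) \<otimes> (g \<cdot> q) \<otimes> ((h \<otimes> \<one>X) \<cdot> s)"
    using a by (simp add: interchange)
  also have "(m \<otimes> \<one>X \<otimes> \<one>X) \<cdot> \<dots> = (m \<cdot> ((f \<cdot> p) \<otimes> (g \<cdot> q))) \<otimes> ((h \<otimes> \<one>X) \<cdot> s)"
  proof -
    have "(m \<otimes> \<one>(X \<odot> X)) \<cdot> (((f \<cdot> p) \<otimes> (g \<cdot> q)) \<otimes> ((h \<otimes> \<one>X) \<cdot> s))
      = (m \<cdot> ((f \<cdot> p) \<otimes> (g \<cdot> q))) \<otimes> ((h \<otimes> \<one>X) \<cdot> s)"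
      using a interchange[of "(f \<cdot> p) \<otimes> (g \<cdot> q)" m "(h \<otimes> \<one>X) \<cdot> s" "\<one>(X \<odot> X)"] by simp
    then show ?thesis using a by (simp flip: ten_id)
  qed
  finally show ?thesis .
qed

text \<open>Here the first block carries the input and the bracket stays: the product of the other
  two blocks is one state on three factors, paired with the input as in
  \<open>cyl_nested\<close>.\<close>

lemma contract_copants:
  assumes "f \<in> hom P X" "g \<in> hom Q X" "h \<in> hom R X" "p \<in> hom P' P" "q \<in> hom (Unt S) (Q \<odot> X)" "s \<in> hom (Unt S) (R \<odot> X)"
  shows "((\<beta> \<cdot> (f \<otimes> (m \<cdot> (g \<otimes> h)))) \<otimes> \<one>(X \<odot> X)) \<cdot> (p \<otimes> ((\<one>Q \<otimes> s \<otimes> \<one>X) \<cdot> q))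
    = (\<beta> \<otimes> \<one>X \<otimes> \<one>X) \<cdot>
      (\<one>X \<otimes> ((m \<otimes> \<one>X \<otimes> \<one>X) \<cdot> (\<one>X \<otimes> ((h \<otimes> \<one>X) \<cdot> s) \<otimes> \<one>X) \<cdot> (g \<otimes> \<one>X) \<cdot> q)) \<cdot> f \<cdot> p"
proof -
  have a: "f \<in> Arr S" "Dom S f = P" "Cod S f = X" "g \<in> Arr S" "Dom S g = Q" "Cod S g = X"
    "h \<in> Arr S" "Dom S h = R" "Cod S h = X" "p \<in> Arr S" "Dom S p = P'" "Cod S p = P"
    "q \<in> Arr S" "Dom S q = Unt S" "Cod S q = Q \<odot> X" "s \<in> Arr S" "Dom S s = Unt S" "Cod S s = R \<odot> X"
    and [simp]: "P \<in> Ob S" "Q \<in> Ob S" "R \<in> Ob S"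
    using assms by auto
  have "(\<beta> \<cdot> (f \<otimes> (m \<cdot> (g \<otimes> h)))) \<otimes> \<one>(X \<odot> X)
      = (\<beta> \<otimes> \<one>X \<otimes> \<one>X) \<cdot> (f \<otimes> ((m \<otimes> \<one>X \<otimes> \<one>X) \<cdot> (g \<otimes> h \<otimes> \<one>X \<otimes> \<one>X)))"
  proof -
    have e: "f \<otimes> (m \<cdot> (g \<otimes> h)) = (\<one>X \<otimes> m) \<cdot> (f \<otimes> g \<otimes> h)"
      using a by (simp add: interchange)
    have e': "f \<otimes> ((m \<otimes> \<one>X \<otimes> \<one>X) \<cdot> (g \<otimes> h \<otimes> \<one>X \<otimes> \<one>X)) = (\<one>X \<otimes> m \<otimes> \<one>X \<otimes> \<one>X) \<cdot> (f \<otimes> g \<otimes> h \<otimes> \<one>X \<otimes> \<one>X)"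
      using a by (simp add: interchange)
    show ?thesis unfolding e e' using a by (simp add: whisker whisker2 flip: ten_id)
  qed
  then have "((\<beta> \<cdot> (f \<otimes> (m \<cdot> (g \<otimes> h)))) \<otimes> \<one>(X \<odot> X)) \<cdot> (p \<otimes> ((\<one>Q \<otimes> s \<otimes> \<one>X) \<cdot> q))
      = (\<beta> \<otimes> \<one>X \<otimes> \<one>X) \<cdot> ((f \<cdot> p) \<otimes> ((m \<otimes> \<one>X \<otimes> \<one>X) \<cdot> (g \<otimes> (h \<otimes> \<one>X) \<otimes> \<one>X) \<cdot> (\<one>Q \<otimes> s \<otimes> \<one>X) \<cdot> q))"
    using a by (simp add: interchange)
  also have "(g \<otimes> (h \<otimes> \<one>X) \<otimes> \<one>X) \<cdot> (\<one>Q \<otimes> s \<otimes> \<one>X) \<cdot> q = (\<one>X \<otimes> ((h \<otimes> \<one>X) \<cdot> s) \<otimes> \<one>X) \<cdot> (g \<otimes> \<one>X) \<cdot> q"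
  proof -
    have "(g \<otimes> (h \<otimes> \<one>X) \<otimes> \<one>X) \<cdot> (\<one>Q \<otimes> s \<otimes> \<one>X) = g \<otimes> ((h \<otimes> \<one>X) \<cdot> s) \<otimes> \<one>X"
      using a by (simp add: interchange del: tenM_assoc)
    moreover have "(\<one>X \<otimes> ((h \<otimes> \<one>X) \<cdot> s) \<otimes> \<one>X) \<cdot> (g \<otimes> \<one>X) = g \<otimes> ((h \<otimes> \<one>X) \<cdot> s) \<otimes> \<one>X"
      using a ten_split(2)[of g "((h \<otimes> \<one>X) \<cdot> s) \<otimes> \<one>X"] by simp
    ultimately show ?thesis
      using a by (simp flip: comp_assoc)
  qed
  also have "(f \<cdot> p) \<otimes> ((m \<otimes> \<one>X \<otimes> \<one>X) \<cdot> (\<one>X \<otimes> ((h \<otimes> \<one>X) \<cdot> s) \<otimes> \<one>X) \<cdot> (g \<otimes> \<one>X) \<cdot> q)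
    = (\<one>X \<otimes> ((m \<otimes> \<one>X \<otimes> \<one>X) \<cdot> (\<one>X \<otimes> ((h \<otimes> \<one>X) \<cdot> s) \<otimes> \<one>X) \<cdot> (g \<otimes> \<one>X) \<cdot> q)) \<cdot> f \<cdot> p"
    using a ten_split(2)[of "f \<cdot> p" "(m \<otimes> \<one>X \<otimes> \<one>X) \<cdot> (\<one>X \<otimes> ((h \<otimes> \<one>X) \<cdot> s) \<otimes> \<one>X) \<cdot> (g \<otimes> \<one>X) \<cdot> q"]
    by simp
  finally show ?thesis .
qed

lemma T_mul: "T \<cdot> m = m \<cdot> (T \<otimes> \<one>X)" "(T \<cdot> T) \<cdot> m = m \<cdot> ((T \<cdot> T) \<otimes> \<one>X)"
proof -
  show 1: "T \<cdot> m = m \<cdot> (T \<otimes> \<one>X)" by (rule lmul_mul) simp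
  have "(T \<cdot> T) \<cdot> m = T \<cdot> m \<cdot> (T \<otimes> \<one>X)" by (simp add: 1)
  also have "\<dots> = m \<cdot> (T \<otimes> \<one>X) \<cdot> (T \<otimes> \<one>X)" by (subst comp_rule[OF 1]) simp_all
  finally show "(T \<cdot> T) \<cdot> m = m \<cdot> ((T \<cdot> T) \<otimes> \<one>X)" by (simp add: whisker)
qed

text \<open>Any choice of \<open>V\<close> is allowed; the choices in the next two lemmas put the inverse windows next to
  the ingoing circles, where they turn \<open>cyl\<close> into an idempotent.\<close>

lemma sum_L_pants:
  fixes r :: nat and a b :: int
  assumes N: "npow X N r = \<one>X"
  defines "V \<equiv> (\<lambda>v. if v = 2 then (1, Lft) else (0, Lft))"
    and "D \<equiv> nine_gon r [0, 1, 2] (\<lambda>j. [a - 1, b - 1, 1 - (a + b)] ! j) [3, 4] [5]"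
  shows "vertex_choice D V"
    and "sum_L A D V = proj_P A (a + b) \<cdot> m \<cdot> (proj_P A a \<otimes> proj_P A b)"
proof -
  \<comment> \<open>An edge of index s carries N^(s+1). The index \<open>a - 1\<close> thus gives
    the exponent \<open>a\<close>, while \<open>1 - (a + b)\<close> gives
    \<open>2 - (a + b)\<close>, which \<open>cyl_bend\<close> turns back into
    \<open>a + b\<close>.\<close>
  have nak: "nak_pow A ((k - 1) mod int r + 1) = nak_pow A k" "nak_pow A ((1 - k) mod int r + 1) = nak_pow A (2 - k)" for k
    using nak_pow_mod(2)[OF N] by (simp_all add: algebra_simps)
  let ?v0 = "cup a" and ?v1 = "cup b" and ?v2 = "cup (2 - (a + b))"
  have js: "[0, 1, 2::nat] = [0, 1, 2] \<or> [0, 1, 2::nat] = [2, 1, 0]" by simp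
  note att = nine_gon_attached[OF js] nine_gon_attached[OF js, simplified]
  show "vertex_choice D V"
    by (auto simp: vertex_choice_def D_def V_def att)
  have E: "edge_sides D = [LE 0 Lft, LE 0 Rgt, LE 1 Lft, LE 1 Rgt, LE 2 Lft, LE 2 Rgt, LE 3 Rgt, LE 4 Rgt, LE 5 Rgt]"
    unfolding D_def by (rule nine_gon_edge_sides[OF js])
  have F: "face_sides D = [LE 0 Lft, LE 3 Rgt, LE 0 Rgt, LE 1 Lft, LE 4 Rgt, LE 1 Rgt, LE 2 Lft, LE 5 Rgt, LE 2 Rgt]"
    unfolding D_def using nine_gon_face_sides[OF refl] by simp
  have Tg: "concat (map (edge_targets D) [0..<ned D]) = [LE 0 Lft, LE 0 Rgt, LE 1 Lft, LE 1 Rgt, LE 2 Lft, LE 2 Rgt,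
     LE 3 Rgt, LE 4 Rgt, LOut 5, LE 5 Rgt]"
    by (simp add: D_def edge_targets_def att upt_rec)
  have Sr: "concat (map (edge_sources D) [0..<ned D]) = [LIn 3, LIn 4]"
    by (simp add: D_def edge_sources_def upt_rec)
  have W: "tenM (map (edge_weight A D) [0..<ned D]) = ?v0 \<otimes> ?v1 \<otimes> ?v2 \<otimes> \<one>X \<otimes> \<one>X \<otimes> cup 1"
    by (simp add: D_def edge_weight_def att upt_rec nak cup_def)
  have R: "relabel X (map LIn (bin D)) [LIn 3, LIn 4] = \<one>(X \<odot> X)"
    by (simp add: D_def relabel_same)
  \<comment> \<open>Vertex 3 lies on the outgoing circle. Vertices 0 and 1 choose the left side of
    \<open>r_1\<close> and vertex 2 that of \<open>r_2\<close>: one inverse window for each ingoing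
    block, and one more from the inner vertex.\<close>
  have vf: "vertex_factor D V l = (if l = LE 0 Lft then T \<cdot> T else if l = LE 1 Lft then T else \<one>X)" for l
  proof -
    have "{v. v < nvt D \<and> v \<notin> src D ` set (bout D) \<and> LE (fst (V v)) (snd (V v)) = l}
        = (if l = LE 0 Lft then {0, 1} else if l = LE 1 Lft then {2} else {})"
      by (auto simp: D_def V_def)
    then have "vertex_weight D V l = (if l = LE 0 Lft then 2 else if l = LE 1 Lft then 1 else 0)"
      by (simp add: vertex_weight_def)
    then show ?thesis by (simp add: vertex_factor_def numeral_2_eq_2)
  qed
  have nf: "sum_F A D \<cdot> tenM (map (vertex_factor D V) (face_sides D)) = nine_form (T \<cdot> T) T (\<one>X)"
    by (simp add: F vf sum_F_def nine_form_def) (simp add: D_def)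
  have "sum_L A D V = ((sum_F A D \<cdot> tenM (map (vertex_factor D V) (face_sides D))) \<otimes> \<one>(pow X (length (bout D))))
     \<cdot> relabel X (concat (map (edge_targets D) [0..<ned D])) (face_sides D @ map LOut (bout D))
     \<cdot> (?v0 \<otimes> ?v1 \<otimes> ?v2 \<otimes> \<one>X \<otimes> \<one>X \<otimes> cup 1)"
  proof (rule sum_L_eq[where Y = "X \<odot> X" and Y' = "X \<odot> X"])
    show "reordering (edge_sides D) (face_sides D)" by (auto simp: E F reordering_def)
    show "reordering (concat (map (edge_targets D) [0..<ned D])) (edge_sides D @ map LOut (bout D))"
      unfolding Tg E by (auto simp: reordering_def D_def)
  qed (unfold Sr R W Tg, simp_all)
  also have "bout D = [5]" by (simp add: D_def)
  also have "relabel X (concat (map (edge_targets D) [0..<ned D])) (face_sides D @ map LOut [5])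
     \<cdot> (?v0 \<otimes> ?v1 \<otimes> ?v2 \<otimes> \<one>X \<otimes> \<one>X \<otimes> cup 1)
    = ((\<one>X \<otimes> c) \<cdot> (?v0 \<otimes> \<one>X)) \<otimes> ((\<one>X \<otimes> c) \<cdot> (?v1 \<otimes> \<one>X)) \<otimes> ((\<one>X \<otimes> Brd S (X \<odot> X) X) \<cdot> (?v2 \<otimes> cup 1))"
    unfolding Tg F list.map append.simps by (rule relabel_pants) auto
  also have "\<one>(pow X (length [5 :: nat])) = \<one>X" by simp
  also have "sum_F A D \<cdot> tenM (map (vertex_factor D V) (face_sides D))
     = \<beta> \<cdot> (((T \<cdot> T) \<cdot> mul_n A 3) \<otimes> (m \<cdot> ((T \<cdot> mul_n A 3) \<otimes> (\<one>X \<cdot> mul_n A 3))))"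
    unfolding nf by (rule nine_form_eq) (use T_mul in \<open>auto simp: ten_id\<close>)
  also have "(\<dots> \<otimes> \<one>X) \<cdot> (((\<one>X \<otimes> c) \<cdot> (?v0 \<otimes> \<one>X)) \<otimes> ((\<one>X \<otimes> c) \<cdot> (?v1 \<otimes> \<one>X)) \<otimes> ((\<one>X \<otimes> Brd S (X \<odot> X) X) \<cdot> (?v2 \<otimes> cup 1)))
    = (\<beta> \<otimes> \<one>X) \<cdot> ((m \<cdot> ((((T \<cdot> T) \<cdot> mul_n A 3) \<cdot> (\<one>X \<otimes> c) \<cdot> (?v0 \<otimes> \<one>X)) \<otimes> ((T \<cdot> mul_n A 3) \<cdot> (\<one>X \<otimes> c) \<cdot> (?v1 \<otimes> \<one>X)))) \<otimes>
       (((\<one>X \<cdot> mul_n A 3) \<otimes> \<one>X) \<cdot> (\<one>X \<otimes> Brd S (X \<odot> X) X) \<cdot> (?v2 \<otimes> cup 1)))"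
    by (rule contract_pants[of _ "X \<odot> X \<odot> X" _ "X \<odot> X \<odot> X" _ "X \<odot> X \<odot> X" _ X _ X _ "Unt S"]) simp_all
  also have "((\<one>X \<cdot> mul_n A 3) \<otimes> \<one>X) \<cdot> (\<one>X \<otimes> Brd S (X \<odot> X) X) \<cdot> (?v2 \<otimes> cup 1) = (cyl (2 - (a + b)) \<otimes> \<one>X) \<cdot> w"
    using block_out_mul[of ?v2] by (simp add: cyl_def)
  also have "((T \<cdot> T) \<cdot> mul_n A 3) \<cdot> (\<one>X \<otimes> c) \<cdot> (?v0 \<otimes> \<one>X) = T \<cdot> proj_P A a"
    using block_mul[of ?v0 "\<one>X" X] by (simp add: cyl_def proj_P_cyl)
  also have "(T \<cdot> mul_n A 3) \<cdot> (\<one>X \<otimes> c) \<cdot> (?v1 \<otimes> \<one>X) = proj_P A b"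
    using block_mul[of ?v1 "\<one>X" X] by (simp add: cyl_def proj_P_cyl)
  \<comment> \<open>The surplus inverse window is pulled out of the product; it will cancel the
    window in \<open>cyl (a + b)\<close>.\<close>
  also have "m \<cdot> ((T \<cdot> proj_P A a) \<otimes> proj_P A b) = T \<cdot> m \<cdot> (proj_P A a \<otimes> proj_P A b)"
    by (subst comp_rule[OF T_mul(1)]) (simp_all add: interchange)
  also have "(T \<cdot> m \<cdot> (proj_P A a \<otimes> proj_P A b)) \<otimes> ((cyl (2 - (a + b)) \<otimes> \<one>X) \<cdot> w)
    = (\<one>X \<otimes> ((cyl (2 - (a + b)) \<otimes> \<one>X) \<cdot> w)) \<cdot> (T \<cdot> m \<cdot> (proj_P A a \<otimes> proj_P A b))"
    by (subst ten_split(2)) simp_all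
  also have "(\<beta> \<otimes> \<one>X) \<cdot> \<dots> = ((\<beta> \<otimes> \<one>X) \<cdot> (\<one>X \<otimes> ((cyl (2 - (a + b)) \<otimes> \<one>X) \<cdot> w))) \<cdot> T \<cdot> m \<cdot> (proj_P A a \<otimes> proj_P A b)"
    by simp
  also have "\<dots> = (cyl (a + b) \<cdot> T) \<cdot> m \<cdot> (proj_P A a \<otimes> proj_P A b)"
    unfolding cyl_bend by simp
  also have "cyl (a + b) \<cdot> T = proj_P A (a + b)"
    by (simp add: cyl_proj_P proj_P_commute comp_rule[OF window_lmul_inv(1)])
  finally show "sum_L A D V = proj_P A (a + b) \<cdot> m \<cdot> (proj_P A a \<otimes> proj_P A b)" .
qed

lemma sum_L_copants:
  fixes r :: nat and a b :: int
  assumes N: "npow X N r = \<one>X"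
  defines "V \<equiv> (\<lambda>v. (2, Lft))"
    and "D \<equiv> nine_gon r [2, 1, 0] (\<lambda>j. [1 - a, 1 - b, (a + b - 2) - 1] ! j) [5] [3, 4]"
  shows "vertex_choice D V"
    and "sum_L A D V = (proj_P A a \<otimes> proj_P A b) \<cdot> Com A \<cdot> L \<cdot> proj_P A (a + b - 2)"
proof -
  have nak: "nak_pow A ((k - 1) mod int r + 1) = nak_pow A k" "nak_pow A ((1 - k) mod int r + 1) = nak_pow A (2 - k)"
    "nak_pow A ((k - 3) mod int r + 1) = nak_pow A (k - 2)" for k
    using nak_pow_mod(2)[OF N] by (simp_all add: algebra_simps)
  let ?v0 = "cup (2 - a)" and ?v1 = "cup (2 - b)" and ?v2 = "cup (a + b - 2)"
  have js: "[2, 1, 0::nat] = [0, 1, 2] \<or> [2, 1, 0::nat] = [2, 1, 0]" by simp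
  note att = nine_gon_attached[OF js] nine_gon_attached[OF js, simplified]
  show "vertex_choice D V"
    by (auto simp: vertex_choice_def D_def V_def att)
  have E: "edge_sides D = [LE 0 Lft, LE 0 Rgt, LE 1 Lft, LE 1 Rgt, LE 2 Lft, LE 2 Rgt, LE 3 Rgt, LE 4 Rgt, LE 5 Rgt]"
    unfolding D_def by (rule nine_gon_edge_sides[OF js])
  have F: "face_sides D = [LE 2 Lft, LE 5 Rgt, LE 2 Rgt, LE 1 Lft, LE 4 Rgt, LE 1 Rgt, LE 0 Lft, LE 3 Rgt, LE 0 Rgt]"
    unfolding D_def using nine_gon_face_sides[OF refl] by simp
  have Tg: "concat (map (edge_targets D) [0..<ned D]) = [LE 0 Lft, LE 0 Rgt, LE 1 Lft, LE 1 Rgt, LE 2 Lft, LE 2 Rgt,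
     LOut 3, LE 3 Rgt, LOut 4, LE 4 Rgt, LE 5 Rgt]"
    by (simp add: D_def edge_targets_def att upt_rec)
  have Sr: "concat (map (edge_sources D) [0..<ned D]) = [LIn 5]"
    by (simp add: D_def edge_sources_def upt_rec)
  have W: "tenM (map (edge_weight A D) [0..<ned D]) = ?v0 \<otimes> ?v1 \<otimes> ?v2 \<otimes> cup 1 \<otimes> cup 1 \<otimes> \<one>X"
    by (simp add: D_def edge_weight_def att upt_rec nak cup_def)
  have R: "relabel X (map LIn (bin D)) [LIn 5] = \<one>X"
    by (simp add: D_def relabel_same)
  have vf: "vertex_factor D V l = (if l = LE 2 Lft then T \<cdot> T else \<one>X)" for l
  proof -
    have "{v. v < nvt D \<and> v \<notin> src D ` set (bout D) \<and> LE (fst (V v)) (snd (V v)) = l}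
        = (if l = LE 2 Lft then {0, 3} else {})"
      by (auto simp: D_def V_def)
    then have "vertex_weight D V l = (if l = LE 2 Lft then 2 else 0)"
      by (simp add: vertex_weight_def)
    then show ?thesis by (simp add: vertex_factor_def numeral_2_eq_2)
  qed
  \<comment> \<open>The vertices that count are the inner one and the ingoing one, numbered 0 and 3;
    both inverse windows sit on \<open>r_3\<close>. One makes the ingoing block an idempotent and
    the other is left over.\<close>
  have nf: "sum_F A D \<cdot> tenM (map (vertex_factor D V) (face_sides D)) = nine_form (T \<cdot> T) (\<one>X) (\<one>X)"
    by (simp add: F vf sum_F_def nine_form_def) (simp add: D_def)
  have "sum_L A D V = ((sum_F A D \<cdot> tenM (map (vertex_factor D V) (face_sides D))) \<otimes> \<one>(pow X (length (bout D))))
     \<cdot> relabel X (concat (map (edge_targets D) [0..<ned D])) (face_sides D @ map LOut (bout D))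
     \<cdot> (?v0 \<otimes> ?v1 \<otimes> ?v2 \<otimes> cup 1 \<otimes> cup 1 \<otimes> \<one>X)"
  proof (rule sum_L_eq[where Y = X and Y' = X])
    show "reordering (edge_sides D) (face_sides D)" by (auto simp: E F reordering_def)
    show "reordering (concat (map (edge_targets D) [0..<ned D])) (edge_sides D @ map LOut (bout D))"
      unfolding Tg E by (auto simp: reordering_def D_def)
  qed (unfold Sr R W Tg, simp_all)
  also have "bout D = [3, 4]" by (simp add: D_def)
  also have "relabel X (concat (map (edge_targets D) [0..<ned D])) (face_sides D @ map LOut [3, 4])
     \<cdot> (?v0 \<otimes> ?v1 \<otimes> ?v2 \<otimes> cup 1 \<otimes> cup 1 \<otimes> \<one>X)
    = ((\<one>X \<otimes> c) \<cdot> (?v2 \<otimes> \<one>X)) \<otimes>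
      ((\<one>(X \<odot> X \<odot> X) \<otimes> ((\<one>X \<otimes> Brd S (X \<odot> X) X) \<cdot> (?v0 \<otimes> cup 1)) \<otimes> \<one>X)
         \<cdot> (\<one>X \<otimes> Brd S (X \<odot> X) X) \<cdot> (?v1 \<otimes> cup 1))"
    unfolding Tg F list.map append.simps by (rule relabel_copants) auto
  also have "\<one>(pow X (length [3, 4 :: nat])) = \<one>(X \<odot> X)" by simp
  also have "sum_F A D \<cdot> tenM (map (vertex_factor D V) (face_sides D))
     = \<beta> \<cdot> (((T \<cdot> T) \<cdot> mul_n A 3) \<otimes> (m \<cdot> ((\<one>X \<cdot> mul_n A 3) \<otimes> (\<one>X \<cdot> mul_n A 3))))"
    unfolding nf by (rule nine_form_eq) (use T_mul in \<open>auto simp: ten_id\<close>)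
  also have "(\<dots> \<otimes> \<one>(X \<odot> X)) \<cdot> (((\<one>X \<otimes> c) \<cdot> (?v2 \<otimes> \<one>X)) \<otimes>
      ((\<one>(X \<odot> X \<odot> X) \<otimes> ((\<one>X \<otimes> Brd S (X \<odot> X) X) \<cdot> (?v0 \<otimes> cup 1)) \<otimes> \<one>X)
         \<cdot> (\<one>X \<otimes> Brd S (X \<odot> X) X) \<cdot> (?v1 \<otimes> cup 1)))
    = (\<beta> \<otimes> \<one>X \<otimes> \<one>X) \<cdot>
      (\<one>X \<otimes> ((m \<otimes> \<one>X \<otimes> \<one>X) \<cdot> (\<one>X \<otimes> (((\<one>X \<cdot> mul_n A 3) \<otimes> \<one>X) \<cdot> (\<one>X \<otimes> Brd S (X \<odot> X) X) \<cdot> (?v0 \<otimes> cup 1)) \<otimes> \<one>X)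
         \<cdot> ((\<one>X \<cdot> mul_n A 3) \<otimes> \<one>X) \<cdot> (\<one>X \<otimes> Brd S (X \<odot> X) X) \<cdot> (?v1 \<otimes> cup 1)))
      \<cdot> ((T \<cdot> T) \<cdot> mul_n A 3) \<cdot> (\<one>X \<otimes> c) \<cdot> (?v2 \<otimes> \<one>X)"
    by (rule contract_copants[of _ "X \<odot> X \<odot> X" _ "X \<odot> X \<odot> X" _ "X \<odot> X \<odot> X" _ X]) simp_all
  also have "((\<one>X \<cdot> mul_n A 3) \<otimes> \<one>X) \<cdot> (\<one>X \<otimes> Brd S (X \<odot> X) X) \<cdot> (?v0 \<otimes> cup 1) = (cyl (2 - a) \<otimes> \<one>X) \<cdot> w"
    using block_out_mul[of ?v0] by (simp add: cyl_def)
  also have "((\<one>X \<cdot> mul_n A 3) \<otimes> \<one>X) \<cdot> (\<one>X \<otimes> Brd S (X \<odot> X) X) \<cdot> (?v1 \<otimes> cup 1) = (cyl (2 - b) \<otimes> \<one>X) \<cdot> w"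
    using block_out_mul[of ?v1] by (simp add: cyl_def)
  also have "((T \<cdot> T) \<cdot> mul_n A 3) \<cdot> (\<one>X \<otimes> c) \<cdot> (?v2 \<otimes> \<one>X) = T \<cdot> proj_P A (a + b - 2)"
    using block_mul[of ?v2 "\<one>X" X] by (simp add: cyl_def proj_P_cyl)
  also have "(\<beta> \<otimes> \<one>X \<otimes> \<one>X) \<cdot>
      (\<one>X \<otimes> ((m \<otimes> \<one>X \<otimes> \<one>X) \<cdot> (\<one>X \<otimes> ((cyl (2 - a) \<otimes> \<one>X) \<cdot> w) \<otimes> \<one>X) \<cdot> (cyl (2 - b) \<otimes> \<one>X) \<cdot> w)) \<cdot> T \<cdot> proj_P A (a + b - 2)
    = ((\<beta> \<otimes> \<one>X \<otimes> \<one>X) \<cdot>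
      (\<one>X \<otimes> ((m \<otimes> \<one>X \<otimes> \<one>X) \<cdot> (\<one>X \<otimes> ((cyl (2 - a) \<otimes> \<one>X) \<cdot> w) \<otimes> \<one>X) \<cdot> (cyl (2 - b) \<otimes> \<one>X) \<cdot> w))) \<cdot> T \<cdot> proj_P A (a + b - 2)"
    by simp
  also have "\<dots> = (cyl a \<otimes> cyl b) \<cdot> (Com A \<cdot> T) \<cdot> proj_P A (a + b - 2)"
    unfolding cyl_nested by simp
  \<comment> \<open>Each outgoing circle contributes a window, and the left-over inverse window
    cancels one of the two. The other is the factor \<tau> in the coproduct of the graded
    center.\<close>
  also have "cyl a \<otimes> cyl b = (proj_P A a \<otimes> proj_P A b) \<cdot> (L \<otimes> L)"
    by (simp add: cyl_proj_P interchange proj_P_commute)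
  also have "((proj_P A a \<otimes> proj_P A b) \<cdot> (L \<otimes> L)) \<cdot> (Com A \<cdot> T) \<cdot> proj_P A (a + b - 2)
    = (proj_P A a \<otimes> proj_P A b) \<cdot> (((L \<otimes> \<one>X) \<cdot> (\<one>X \<otimes> L) \<cdot> Com A) \<cdot> T) \<cdot> proj_P A (a + b - 2)"
    by (simp add: interchange3)
  also have "((L \<otimes> \<one>X) \<cdot> (\<one>X \<otimes> L) \<cdot> Com A) \<cdot> T = Com A \<cdot> L"
  proof -
    have "(L \<otimes> \<one>X) \<cdot> (\<one>X \<otimes> L) \<cdot> Com A = (L \<otimes> \<one>X) \<cdot> Com A \<cdot> L"
      using central_com(2)[OF window_central] by simp
    also have "\<dots> = Com A \<cdot> L \<cdot> L"
      using comp_rule[OF central_com(1)[OF window_central, symmetric], of L] by simp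
    finally show ?thesis by (simp add: window_lmul_inv)
  qed
  finally show "sum_L A D V = (proj_P A a \<otimes> proj_P A b) \<cdot> Com A \<cdot> L \<cdot> proj_P A (a + b - 2)" by simp
qed

end

section \<open>The state sum of the 1-gon\<close>

text \<open>The edge runs counter-clockwise, so that the face lies on its left.\<close>

definition one_gon :: "int \<Rightarrow> nat list \<Rightarrow> nat list \<Rightarrow> decomposition" where
  "one_gon s bi bo = \<lparr>nfc = 1, nsd = (\<lambda>f. 1), ned = 1, nvt = 1, att = (\<lambda>f k. (0, Lft)),
     src = (\<lambda>e. 0), tgt = (\<lambda>e. 0), idx = (\<lambda>e. s), bin = bi, bout = bo\<rparr>"

lemma one_gon_simps [simp]:
  "nfc (one_gon s bi bo) = 1" "nsd (one_gon s bi bo) f = 1" "ned (one_gon s bi bo) = 1"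
  "nvt (one_gon s bi bo) = 1" "att (one_gon s bi bo) f k = (0, Lft)" "src (one_gon s bi bo) e = 0"
  "tgt (one_gon s bi bo) e = 0" "idx (one_gon s bi bo) e = s" "bin (one_gon s bi bo) = bi"
  "bout (one_gon s bi bo) = bo"
  by (simp_all add: one_gon_def)

lemma one_gon_sides [simp]: "sides (one_gon s bi bo) = {(0, 0)}"
  by (auto simp: sides_def)

lemma one_gon_attached [simp]: "attached (one_gon s bi bo) e x \<longleftrightarrow> e = 0 \<and> x = Lft"
  by (auto simp: attached_def)

lemma one_gon_vertex_choice: "vertex_choice (one_gon s bi bo) (\<lambda>v. (0, Lft))"
  by (auto simp: vertex_choice_def)

lemma one_gon_marked:
  assumes "s \<in> Zr r" "bi @ bo = [0]"
  shows "marked_decomposition r (one_gon s bi bo)"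
proof -
  have "set (bi @ bo) = {0}" "distinct (bi @ bo)" using assms(2) by auto
  then show ?thesis
    unfolding marked_decomposition_def using assms(1) by (auto simp: side_end_def side_start_def)
qed

text \<open>At the only vertex the loop contributes -1 whatever its index, with \<open>D_num\<close>
  1 and \<open>N_num\<close> 2. The condition becomes R = 1 modulo \<open>r\<close>, which is what
  the label 2 of an ingoing circle (R = 2 - 1) and the label 0 of an outgoing one (R = 1 - 0)
  achieve.\<close>

lemma one_gon_admissible:
  assumes "bi @ bo = [0]" "bi = [0] \<longrightarrow> lam = [2 mod int r]" "bo = [0] \<longrightarrow> mu = [0]"
  shows "admissible r (one_gon s bi bo) lam mu"
proof -
  have v: "vertex_condition r (one_gon s bi bo) 0 R \<longleftrightarrow> (-1) mod int r = (- R) mod int r" for R bi bo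
  proof -
    have D: "D_num (one_gon s bi bo) 0 = 1" by (auto simp: D_num_def side_start_def)
    have N: "N_num (one_gon s bi bo) 0 = 2" by (auto simp: N_num_def)
    have h: "(\<Sum>e | e < ned (one_gon s bi bo) \<and> (src (one_gon s bi bo) e = 0 \<or> tgt (one_gon s bi bo) e = 0).
        hat_s (one_gon s bi bo) 0 e) = -1"
      by (simp add: hat_s_def)
    show ?thesis unfolding vertex_condition_def h D N by simp
  qed
  have "(- (2 mod int r - 1)) mod int r = (- (2 - 1)) mod int r" by (metis mod_diff_left_eq mod_minus_eq)
  then show ?thesis
    using assms by (cases bi) (auto simp: admissible_def v)
qed

context windowed_frobenius
begin

text \<open>The face applies the counit to the left leg of \<open>cup (s + 1)\<close>, and
  \<open>N\<close> fixes the unit that remains. The vertex lies on the outgoing boundary, so no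
  window occurs.\<close>

lemma sum_L_disc_out:
  assumes "D = one_gon s [] [0]"
  shows "sum_L A D V = Eta A"
proof -
  have E: "edge_sides D = [LE 0 Lft]" "face_sides D = [LE 0 Lft]"
    by (simp_all add: assms edge_sides_def face_sides_def)
  have Tg: "concat (map (edge_targets D) [0..<ned D]) = [LE 0 Lft, LOut 0]"
    by (simp add: assms edge_targets_def)
  have Sr: "concat (map (edge_sources D) [0..<ned D]) = []" "map LIn (bin D) = []"
    by (simp_all add: assms edge_sources_def)
  have W: "tenM (map (edge_weight A D) [0..<ned D]) = cup (s + 1)"
    by (simp add: assms edge_weight_def cup_def)
  have "vertex_weight D V l = 0" for l by (auto simp: vertex_weight_def assms)
  then have vf: "vertex_factor D V l = \<one>X" for l by (simp add: vertex_factor_def)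
  have "sum_L A D V = ((sum_F A D \<cdot> tenM (map (vertex_factor D V) (face_sides D))) \<otimes> \<one>(pow X (length (bout D))))
     \<cdot> relabel X (concat (map (edge_targets D) [0..<ned D])) (face_sides D @ map LOut (bout D)) \<cdot> cup (s + 1)"
    by (rule sum_L_eq[where Y = "Unt S" and Y' = "Unt S"])
      (unfold Sr W Tg E, simp_all add: assms reordering_def)
  also have "\<dots> = (Eps A \<otimes> \<one>X) \<cdot> (\<one>X \<otimes> nak_pow A (s + 1)) \<cdot> w"
    unfolding Tg by (simp add: E vf sum_F_def cup_def) (simp add: assms relabel_same)
  also have "\<dots> = nak_pow A (s + 1) \<cdot> (Eps A \<otimes> \<one>X) \<cdot> Com A \<cdot> Eta A"
    using ten_split[of "Eps A" "nak_pow A (s + 1)"] by (simp flip: comp_assoc)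
  also have "\<dots> = nak_pow A (s + 1) \<cdot> Eta A"
    by (subst comp_rule[OF frob_eqs(5)]) simp_all
  also have "\<dots> = Eta A" by (rule nak_pow_fixed_state[where Y = "Unt S"]) (simp_all add: eps_nak)
  finally show ?thesis .
qed

text \<open>The vertex is ingoing and contributes the inverse window. The edge weight N^(-s-1)
  disappears because \<open>Eps A \<cdot> T\<close> is invariant under \<open>N\<close>.\<close>

lemma sum_L_disc_in:
  assumes "D = one_gon s [0] []"
  shows "sum_L A D (\<lambda>v. (0, Lft)) = Eps A \<cdot> T"
proof -
  let ?V = "\<lambda>v. (0 :: nat, Lft)"
  have E: "edge_sides D = [LE 0 Lft]" "face_sides D = [LE 0 Lft]"
    by (simp_all add: assms edge_sides_def face_sides_def)
  have Tg: "concat (map (edge_targets D) [0..<ned D]) = [LE 0 Lft]"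
    by (simp add: assms edge_targets_def)
  have Sr: "concat (map (edge_sources D) [0..<ned D]) = [LIn 0]" "map LIn (bin D) = [LIn 0]"
    by (simp_all add: assms edge_sources_def)
  have W: "tenM (map (edge_weight A D) [0..<ned D]) = nak_pow A (- s - 1)"
    by (simp add: assms edge_weight_def)
  have "vertex_weight D ?V (LE 0 Lft) = 1" by (simp add: vertex_weight_def assms)
  then have vf: "vertex_factor D ?V (LE 0 Lft) = T" by (simp add: vertex_factor_def)
  have "sum_L A D ?V = ((sum_F A D \<cdot> tenM (map (vertex_factor D ?V) (face_sides D))) \<otimes> \<one>(pow X (length (bout D))))
     \<cdot> relabel X (concat (map (edge_targets D) [0..<ned D])) (face_sides D @ map LOut (bout D)) \<cdot> nak_pow A (- s - 1)"
    by (rule sum_L_eq[where Y = X and Y' = X])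
      (unfold Sr W Tg E, simp_all add: assms reordering_def relabel_same)
  also have "\<dots> = (Eps A \<cdot> T) \<cdot> nak_pow A (- s - 1)"
    unfolding Tg by (simp add: E vf sum_F_def) (simp add: assms relabel_same)
  also have "\<dots> = Eps A \<cdot> T"
    by (rule nak_pow_fixed[where Y = "Unt S"]) (simp_all add: eps_nak[simplified])
  finally show ?thesis .
qed

end

lemma Zr_mod: "k \<in> Zr r \<Longrightarrow> k mod int r = k" "k mod int r \<in> Zr r"
  by (auto simp: Zr_def)

section \<open>Restriction of the state sums to the graded components\<close>

locale split_frobenius = windowed_frobenius S A for S :: "('o, 'm) smc" (structure) and A +
  fixes r :: nat and Z :: "int \<Rightarrow> 'o" and \<iota> \<pi> :: "int \<Rightarrow> 'm"
  assumes nak_order: "npow (Car A) (nakayama A) r = \<one>(Car A)"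
    and splits: "splits_P r A Z \<iota> \<pi>"
begin

lemma proj_P_mod: "proj_P A (k mod int r) = proj_P A k"
proof -
  have "nak_pow A (1 - k mod int r) = nak_pow A (1 - k)"
    using nak_pow_mod(1)[OF nak_order, of "1 - k mod int r"] nak_pow_mod(1)[OF nak_order, of "1 - k"]
    by (simp add: mod_diff_right_eq)
  then show ?thesis by (simp add: proj_P_def)
qed

lemma split_simps [simp]:
  assumes "l \<in> Zr r"
  shows "Z l \<in> Ob S" "\<iota> l \<in> Arr S" "Dom S (\<iota> l) = Z l" "Cod S (\<iota> l) = X"
    "\<pi> l \<in> Arr S" "Dom S (\<pi> l) = X" "Cod S (\<pi> l) = Z l"
  using assms splits by (auto simp: splits_P_def)

lemma proj_P_split:
  assumes "l \<in> Zr r" "k mod int r = l"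
  shows "proj_P A k \<cdot> \<iota> l = \<iota> l" "\<pi> l \<cdot> proj_P A k = \<pi> l"
proof -
  have P: "proj_P A k = \<iota> l \<cdot> \<pi> l" and i: "\<pi> l \<cdot> \<iota> l = \<one>(Z l)"
    using splits assms proj_P_mod[of k] by (auto simp: splits_P_def)
  show "proj_P A k \<cdot> \<iota> l = \<iota> l" "\<pi> l \<cdot> proj_P A k = \<pi> l"
    using assms(1) by (simp_all add: P i comp_rule[OF i])
qed

lemma state_sum_pants:
  assumes "a \<in> Zr r" "b \<in> Zr r"
    and "D = nine_gon r [0, 1, 2] (\<lambda>j. [a - 1, b - 1, 1 - (a + b)] ! j) [3, 4] [5]"
  shows "\<exists>V. vertex_choice D V \<and>
    state_sum A \<iota> \<pi> [a, b] [(a + b) mod int r] D V = \<pi> ((a + b) mod int r) \<cdot> m \<cdot> (\<iota> a \<otimes> \<iota> b)"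
proof -
  note s = sum_L_pants[OF nak_order, of a b, folded assms(3)]
  let ?c = "(a + b) mod int r"
  have c: "?c \<in> Zr r" by (rule Zr_mod)
  have "\<pi> ?c \<cdot> (proj_P A (a + b) \<cdot> m \<cdot> (proj_P A a \<otimes> proj_P A b)) \<cdot> (\<iota> a \<otimes> \<iota> b)
    = (\<pi> ?c \<cdot> proj_P A (a + b)) \<cdot> m \<cdot> ((proj_P A a \<cdot> \<iota> a) \<otimes> (proj_P A b \<cdot> \<iota> b))"
    using assms(1,2) c by (simp add: interchange)
  also have "\<dots> = \<pi> ?c \<cdot> m \<cdot> (\<iota> a \<otimes> \<iota> b)"
    using assms(1,2) c by (simp add: proj_P_split Zr_mod)
  finally show ?thesis
    using s assms(1,2) c by (intro exI[of _ "\<lambda>v. if v = 2 then (1, Lft) else (0, Lft)"]) (simp add: state_sum_def)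
qed

lemma state_sum_copants:
  assumes "a \<in> Zr r" "b \<in> Zr r"
    and "D = nine_gon r [2, 1, 0] (\<lambda>j. [1 - a, 1 - b, (a + b - 2) - 1] ! j) [5] [3, 4]"
  shows "\<exists>V. vertex_choice D V \<and>
    state_sum A \<iota> \<pi> [(a + b - 2) mod int r] [a, b] D V = (\<pi> a \<otimes> \<pi> b) \<cdot> Com A \<cdot> L \<cdot> \<iota> ((a + b - 2) mod int r)"
proof -
  note s = sum_L_copants[OF nak_order, of a b, folded assms(3)]
  let ?c = "(a + b - 2) mod int r"
  have c: "?c \<in> Zr r" by (rule Zr_mod)
  have "(\<pi> a \<otimes> \<pi> b) \<cdot> ((proj_P A a \<otimes> proj_P A b) \<cdot> Com A \<cdot> L \<cdot> proj_P A (a + b - 2)) \<cdot> \<iota> ?c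
    = ((\<pi> a \<cdot> proj_P A a) \<otimes> (\<pi> b \<cdot> proj_P A b)) \<cdot> Com A \<cdot> L \<cdot> (proj_P A (a + b - 2) \<cdot> \<iota> ?c)"
    using assms(1,2) c by (simp add: interchange3)
  also have "\<dots> = (\<pi> a \<otimes> \<pi> b) \<cdot> Com A \<cdot> L \<cdot> \<iota> ?c"
    using assms(1,2) c by (simp add: proj_P_split Zr_mod)
  finally show ?thesis
    using s assms(1,2) c by (intro exI[of _ "\<lambda>v. (2, Lft)"]) (simp add: state_sum_def)
qed

lemma state_sum_disc_out:
  assumes "0 \<in> Zr r"
  shows "state_sum A \<iota> \<pi> [] [0] (one_gon s [] [0]) V = \<pi> 0 \<cdot> Eta A"
  using assms by (simp add: state_sum_def sum_L_disc_out[OF refl])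

lemma state_sum_disc_in:
  shows "state_sum A \<iota> \<pi> [2 mod int r] [] (one_gon s [0] []) (\<lambda>v. (0, Lft)) = Eps A \<cdot> T \<cdot> \<iota> (2 mod int r)"
  using Zr_mod(2)[of 2 r] by (simp add: state_sum_def sum_L_disc_in[OF refl])

end

section \<open>The covering groups\<close>

lemma linear_complex:
  assumes "linear g"
  shows "g z = Re z *\<^sub>R g 1 + Im z *\<^sub>R g \<i>"
proof -
  have "g z = g (Re z *\<^sub>R 1 + Im z *\<^sub>R \<i>)" by (rule arg_cong[of _ _ g]) (simp add: complex_eq_iff)
  then show ?thesis using assms by (simp add: linear_add linear_scale)
qed

text \<open>\<open>Im (cnj a * b)\<close> is the determinant of the pair of vectors
  \<open>a\<close>, \<open>b\<close>, which a linear map multiplies by its own determinant.\<close>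

lemma linear_det:
  assumes "linear g"
  shows "Im (cnj (g a) * g b) = Im (cnj (g 1) * g \<i>) * Im (cnj a * b)"
  by (simp add: linear_complex[OF assms, of a] linear_complex[OF assms, of b]) algebra

lemma GLp_det:
  assumes "g \<in> GLp"
  shows "Im (cnj (g a) * g b) > 0 \<longleftrightarrow> Im (cnj a * b) > 0"
proof -
  have d: "Im (cnj (g 1) * g \<i>) > 0" "linear g" using assms by (auto simp: GLp_def)
  show ?thesis
    unfolding linear_det[OF d(2), of a b] using d(1) by (metis zero_less_mult_pos mult_pos_pos)
qed

lemma GLp_linear: "g \<in> GLp \<Longrightarrow> linear g"
  by (simp add: GLp_def)

lemma GLp_nonzero:
  assumes "g \<in> GLp" "z \<noteq> 0"
  shows "g z \<noteq> 0"
proof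
  assume "g z = 0"
  moreover have "Im (cnj z * (\<i> * z)) > 0"
    using assms(2) by (simp add: complex_eq_iff) (metis not_sum_squares_lt_zero sum_squares_gt_zero_iff)
  ultimately show False using GLp_det[OF assms(1), of z "\<i> * z"] by simp
qed

lemma GLp_comp: "g \<in> GLp \<Longrightarrow> h \<in> GLp \<Longrightarrow> g \<circ> h \<in> GLp"
  using GLp_det[of g "h 1" "h \<i>"] by (auto simp: GLp_def linear_compose)

lemma GLp_id: "id \<in> GLp"
  by (auto simp: GLp_def linear_id)

lemma GLp_mult:
  assumes "z \<noteq> 0"
  shows "(\<lambda>w. z * w) \<in> GLp"
proof -
  have "Im (cnj (z * 1) * (z * \<i>)) = (cmod z)\<^sup>2"
    unfolding cmod_power2 by (simp add: power2_eq_square)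
  moreover have "(cmod z)\<^sup>2 > 0" using assms by simp
  ultimately have "Im (cnj (z * 1) * (z * \<i>)) > 0" by linarith
  then show ?thesis unfolding GLp_def mem_Collect_eq by (intro conjI linear_times)
qed

lemma GLp_inject: "g \<in> GLp \<Longrightarrow> g a = g b \<Longrightarrow> a = b"
  using GLp_nonzero[of g "a - b"] by (auto simp: linear_diff[OF GLp_linear])

text \<open>Cramer's rule. The explicit formula makes the inverse visibly continuous in
  \<open>g\<close>, as \<open>local_lift\<close> requires.\<close>

definition gl_inv :: "(complex \<Rightarrow> complex) \<Rightarrow> complex \<Rightarrow> complex" where
  "gl_inv g z = (let d = Im (cnj (g 1) * g \<i>) in
     Complex (Im (cnj z * g \<i>) / d) (Im (cnj (g 1) * z) / d))"

lemma gl_inv: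
  assumes "g \<in> GLp"
  shows "gl_inv g (g z) = z" "g (gl_inv g z) = z" "gl_inv g \<in> GLp"
proof -
  let ?d = "Im (cnj (g 1) * g \<i>)"
  have d: "?d > 0" and l: "linear g" using assms by (auto simp: GLp_def)
  have 1: "gl_inv g (g z) = z" for z
    using d linear_det[OF l, of z \<i>] linear_det[OF l, of 1 z]
    by (simp add: gl_inv_def Let_def complex_eq_iff)
  show "gl_inv g (g z) = z" by (rule 1)
  have lin: "linear (gl_inv g)"
    by (rule linearI) (simp_all add: gl_inv_def Let_def complex_eq_iff algebra_simps add_divide_distrib diff_divide_distrib)
  have "inj g" using GLp_inject[OF assms] by (auto intro: injI)
  then have "surj g" by (rule linear_inj_imp_surj[OF l])
  then have 2: "g (gl_inv g z) = z" for z by (metis 1 surjD)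
  show "g (gl_inv g z) = z" by (rule 2)
  have "Im (cnj (g (gl_inv g 1)) * g (gl_inv g \<i>)) > 0" by (simp add: 2)
  then show "gl_inv g \<in> GLp" using lin by (simp only: GLp_det[OF assms]) (simp add: GLp_def)
qed

subsection \<open>Lifts to angles\<close>

lemma cis_eq_iff: "cis a = cis b \<longleftrightarrow> (\<exists>n::int. a = b + 2 * pi * of_int n)"
proof -
  have "cis a = cis b \<longleftrightarrow> sin a = sin b \<and> cos a = cos b" by (auto simp: complex_eq_iff)
  then show ?thesis by (auto simp: sin_cos_eq_iff algebra_simps)
qed

lemma cis_eq_1_iff: "cis a = 1 \<longleftrightarrow> (\<exists>n::int. a = 2 * pi * of_int n)"
  using cis_eq_iff[of a 0] by simp

lemma angle_lift_cis:
  assumes "angle_lift g G" "g \<in> GLp"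
  shows "cis (G t) = g (cis t) / of_real (cmod (g (cis t)))"
  using assms GLp_nonzero[of g "cis t"] by (auto simp: angle_lift_def field_simps)

text \<open>\<open>g (cis t)\<close> has no zero on the contractible line, so it has a continuous
  logarithm, whose imaginary part is a lift; a multiple of 2 pi adjusts the value at 0.\<close>

lemma angle_lift_exists:
  assumes "g \<in> GLp" "g 1 = of_real (cmod (g 1)) * cis \<theta>"
  obtains G where "angle_lift g G" "G 0 = \<theta>"
proof -
  have bl: "bounded_linear g"
    using GLp_linear[OF assms(1)] by (simp add: linear_conv_bounded_linear)
  have "continuous_on UNIV (\<lambda>t. g (cis t))"
    by (intro bounded_linear.continuous_on[OF bl] continuous_intros)
  moreover have "contractible (UNIV :: real set)" by (simp add: convex_imp_contractible)
  moreover have "g (cis t) \<noteq> 0" for t by (rule GLp_nonzero[OF assms(1)]) auto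
  ultimately obtain l where l: "continuous_on UNIV l" "\<And>t. g (cis t) = exp (l t)"
    using continuous_logarithm_on_contractible[of UNIV "\<lambda>t. g (cis t)"] by auto
  have *: "g (cis t) = of_real (cmod (g (cis t))) * cis (Im (l t))" for t
    unfolding l(2) norm_exp_eq_Re by (rule exp_eq_polar)
  have "cis (Im (l 0)) = cis \<theta>"
    using *[of 0] assms GLp_nonzero[OF assms(1), of 1] by (metis cis_zero mult_left_cancel norm_eq_zero of_real_eq_0_iff zero_neq_one)
  then obtain n where n: "Im (l 0) = \<theta> + 2 * pi * of_int n" using cis_eq_iff by blast
  have "cis (Im (l t) - 2 * pi * of_int n) = cis (Im (l t))" for t
    unfolding cis_eq_iff by (rule exI[of _ "- n"]) simp
  then have "angle_lift g (\<lambda>t. Im (l t) - 2 * pi * of_int n)"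
    unfolding angle_lift_def using l(1) *
    by (auto intro!: continuous_intros)
  then show thesis by (rule that) (simp add: n)
qed

lemma polar_exists: "\<exists>\<theta>. z = of_real (cmod z) * cis \<theta>"
  by (metis rcis_cmod_Arg rcis_def)

text \<open>The difference of two lifts is continuous with values in the discrete set of multiples
  of 2 pi.\<close>

lemma angle_lift_unique:
  assumes "g \<in> GLp" "angle_lift g G" "angle_lift g H"
  obtains n :: int where "\<And>t. H t = G t + 2 * pi * of_int n"
proof -
  have "\<exists>n::int. H t = G t + 2 * pi * of_int n" for t
    using angle_lift_cis[OF assms(2,1)] angle_lift_cis[OF assms(3,1)] cis_eq_iff by metis
  then obtain n :: "real \<Rightarrow> int" where n: "\<And>t. H t = G t + 2 * pi * of_int (n t)" by metis
  have "(\<lambda>t. H t - G t) constant_on UNIV"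
  proof (rule continuous_discrete_range_constant)
    show "continuous_on UNIV (\<lambda>t. H t - G t)"
      using assms by (auto simp: angle_lift_def intro!: continuous_intros)
    fix x :: real
    show "\<exists>e>0. \<forall>y. y \<in> UNIV \<and> H y - G y \<noteq> H x - G x \<longrightarrow> e \<le> norm (H y - G y - (H x - G x))"
    proof (intro exI[of _ "2 * pi"] conjI allI impI)
      fix y assume "y \<in> UNIV \<and> H y - G y \<noteq> H x - G x"
      then have "n y \<noteq> n x" using n by auto
      then have "1 \<le> \<bar>of_int (n y - n x) :: real\<bar>" by linarith
      then have "2 * pi * 1 \<le> 2 * pi * \<bar>of_int (n y - n x)\<bar>" by (intro mult_left_mono) auto
      also have "\<dots> = norm (H y - G y - (H x - G x))"
      proof -
        have e: "H y - G y - (H x - G x) = 2 * pi * of_int (n y - n x)"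
          using n[of y] n[of x] by (simp add: algebra_simps)
        show ?thesis unfolding e by (simp add: abs_mult)
      qed
      finally show "2 * pi \<le> norm (H y - G y - (H x - G x))" by simp
    qed simp
  qed auto
  then obtain d where d: "\<And>t. H t - G t = d" by (auto simp: constant_on_def)
  have "H t = G t + 2 * pi * of_int (n 0)" for t using n[of 0] d[of 0] d[of t] by simp
  then show thesis by (rule that)
qed

lemma angle_lift_shift:
  assumes "angle_lift g G"
  shows "angle_lift g (\<lambda>t. G t + 2 * pi * of_int n)"
proof -
  have "cis (G t + 2 * pi * of_int n) = cis (G t)" for t
    unfolding cis_eq_iff by blast
  then show ?thesis using assms by (auto simp: angle_lift_def intro!: continuous_intros)
qed

text \<open>Preservation of the orientation enters here: the lift of \<open>g\<close> increases by less than a half-turn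
  while the direction makes less than a half-turn.\<close>

lemma angle_lift_pi:
  assumes g: "g \<in> GLp" and G: "angle_lift g G"
  shows "G (t + pi) = G t + pi"
proof -
  have cont: "continuous_on UNIV G" using G by (simp add: angle_lift_def)
  have "cis (G (t + pi)) = cis (G t + pi)"
  proof -
    have "cis (t + pi) = - cis t" by (simp add: complex_eq_iff)
    then show ?thesis
      by (simp add: angle_lift_cis[OF G g] linear_neg[OF GLp_linear[OF g]] flip: cis_mult)
  qed
  then obtain n where n: "G (t + pi) = G t + pi + 2 * pi * of_int n" using cis_eq_iff by blast
  have pos: "sin (G (t + s) - G t) > 0" if "0 < s" "s < pi" for s
  proof -
    have "Im (cnj (cis t) * cis (t + s)) = sin s"
    proof -
      have "cnj (cis t) * cis (t + s) = cis s" by (simp add: cis_cnj cis_mult)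
      then show ?thesis by simp
    qed
    then have "Im (cnj (g (cis t)) * g (cis (t + s))) > 0"
      using sin_gt_zero[OF that] by (simp only: GLp_det[OF g])
    moreover have "cnj (g (cis t)) * g (cis (t + s)) =
        of_real (cmod (g (cis t)) * cmod (g (cis (t + s)))) * cis (G (t + s) - G t)"
    proof -
      have "g (cis t) = of_real (cmod (g (cis t))) * cis (G t)"
        "g (cis (t + s)) = of_real (cmod (g (cis (t + s)))) * cis (G (t + s))"
        using G by (auto simp: angle_lift_def)
      then have "cnj (g (cis t)) * g (cis (t + s)) =
        cnj (of_real (cmod (g (cis t))) * cis (G t)) * (of_real (cmod (g (cis (t + s)))) * cis (G (t + s)))"
        by metis
      also have "\<dots> = of_real (cmod (g (cis t)) * cmod (g (cis (t + s)))) * (cis (- G t) * cis (G (t + s)))"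
        by (simp add: cis_cnj)
      finally show ?thesis by (simp add: cis_mult)
    qed
    ultimately have "0 < Im (of_real (cmod (g (cis t)) * cmod (g (cis (t + s)))) * cis (G (t + s) - G t))"
      by metis
    then have "0 < (cmod (g (cis t)) * cmod (g (cis (t + s)))) * sin (G (t + s) - G t)"
      by (simp del: of_real_mult)
    then show ?thesis
      by (metis mult_nonneg_nonpos norm_ge_zero mult_nonneg_nonneg not_less)
  qed
  have isc: "isCont (\<lambda>s. G (t + s) - G t) x" for x
  proof -
    have "isCont G (t + x)" using cont by (simp add: continuous_on_eq_continuous_at)
    then have "isCont (\<lambda>s. G (t + s)) x" by (intro isCont_o2[of x "\<lambda>s. t + s" G]) auto
    then show ?thesis by (intro isCont_diff) auto
  qed
  \<comment> \<open>The increment starts at 0 and has positive sine for arguments in (0, pi), so by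
    the intermediate value theorem it can leave [0, pi] neither downwards nor upwards.\<close>
  have bound: "0 \<le> G (t + s) - G t \<and> G (t + s) - G t \<le> pi" if st: "0 < s" "s < pi" for s
  proof -
    let ?D = "\<lambda>s. G (t + s) - G t"
    have c: "\<forall>x. 0 \<le> x \<and> x \<le> s \<longrightarrow> isCont ?D x"
      using isc by blast
    have "\<not> ?D s < 0"
    proof
      assume neg: "?D s < 0"
      \<comment> \<open>A value in \<open>[- pi / 2, 0)\<close>, attained on the way down, where the
        sine is negative.\<close>
      define y where "y = max (?D s) (- pi / 2)"
      have "y < 0" "?D s \<le> y" "- pi / 2 \<le> y" using neg by (auto simp: y_def)
      then obtain x where x: "0 \<le> x" "x \<le> s" "?D x = y"
        using IVT2[of ?D s y 0] c less_imp_le[OF st(1)] by auto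
      have "x > 0" using x \<open>y < 0\<close> by (cases "x = 0") auto
      then have "sin y > 0" using pos[of x] x st by simp
      moreover have "sin y < 0" using \<open>y < 0\<close> \<open>- pi / 2 \<le> y\<close> pi_gt_zero sin_gt_zero[of "- y"] by simp
      ultimately show False by simp
    qed
    moreover have "\<not> ?D s > pi"
    proof
      assume "?D s > pi"
      then obtain x where x: "0 \<le> x" "x \<le> s" "?D x = pi"
        using IVT[of ?D 0 pi s] c less_imp_le[OF st(1)] by auto
      then have "x > 0" by (cases "x = 0") auto
      then show False using pos[of x] x st by simp
    qed
    ultimately show ?thesis by simp
  qed
  have lim: "((\<lambda>s. G (t + s) - G t) \<longlongrightarrow> G (t + pi) - G t) (at_left pi)"
    using isc[of pi] by (simp add: isCont_def filterlim_at_split)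
  have ev: "\<forall>\<^sub>F s in at_left pi. 0 < s \<and> s < pi"
    using eventually_at_left_real[of 0 pi] by (auto elim: eventually_mono)
  have "0 \<le> G (t + pi) - G t"
    by (rule tendsto_lowerbound[OF lim]) (use ev bound in \<open>auto elim: eventually_mono\<close>)
  moreover have "G (t + pi) - G t \<le> pi"
    by (rule tendsto_upperbound[OF lim]) (use ev bound in \<open>auto elim: eventually_mono\<close>)
  \<comment> \<open>The increment over pi is an odd multiple of pi between 0 and pi, hence pi
    itself.\<close>
  ultimately have "0 \<le> pi * (1 + 2 * of_int n)" "pi * (1 + 2 * of_int n) \<le> pi * 1"
    using n by (auto simp: algebra_simps)
  then have "0 \<le> 1 + 2 * (of_int n :: real)" "1 + 2 * (of_int n :: real) \<le> 1"
    using pi_gt_zero by (auto simp: zero_le_mult_iff) 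
  then have "n = 0" by linarith
  then show ?thesis using n by simp
qed

lemma angle_lift_int_pi:
  assumes "g \<in> GLp" "angle_lift g G"
  shows "G (t + pi * of_int k) = G t + pi * of_int k"
proof (induction k rule: int_induct[where k = 0])
  case (step1 i)
  then show ?case using angle_lift_pi[OF assms, of "t + pi * of_int i"] by (simp add: algebra_simps)
next
  case (step2 i)
  then show ?case using angle_lift_pi[OF assms, of "t + pi * of_int (i - 1)"] by (simp add: algebra_simps)
qed simp

lemma angle_lift_comp:
  assumes g: "g \<in> GLp" "angle_lift g G" and h: "angle_lift h H"
  shows "angle_lift (g \<circ> h) (G \<circ> H)"
  unfolding angle_lift_def
proof (intro conjI allI)
  show "continuous_on UNIV (G \<circ> H)"
    using assms unfolding angle_lift_def
    by (intro continuous_on_compose) (auto intro: continuous_on_subset[of UNIV G])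
  fix t
  let ?a = "cmod (h (cis t))"
  have "h (cis t) = ?a *\<^sub>R cis (H t)" using h by (auto simp: angle_lift_def scaleR_conv_of_real)
  then have e: "g (h (cis t)) = ?a *\<^sub>R g (cis (H t))"
    by (metis linear_scale[OF GLp_linear[OF g(1)]])
  have "g (cis (H t)) = of_real (cmod (g (cis (H t)))) * cis (G (H t))"
    using g by (auto simp: angle_lift_def)
  then show "(g \<circ> h) (cis t) = complex_of_real (cmod ((g \<circ> h) (cis t))) * cis ((G \<circ> H) t)"
    by (simp add: e scaleR_conv_of_real norm_mult)
qed

subsection \<open>Elements of the covering group\<close>

definition lift_class :: "nat \<Rightarrow> (real \<Rightarrow> real) \<Rightarrow> (real \<Rightarrow> real) set" where
  "lift_class r G = {(\<lambda>t. G t + 2 * pi * real r * of_int k) | k. True}"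

lemma GLt_iff: "a \<in> GLt r \<longleftrightarrow> (\<exists>g G. a = (g, lift_class r G) \<and> g \<in> GLp \<and> angle_lift g G)"
  by (auto simp: GLt_def lift_class_def)

lemma GLtE:
  assumes "a \<in> GLt r"
  obtains G where "fst a \<in> GLp" "angle_lift (fst a) G" "snd a = lift_class r G"
  using assms unfolding GLt_iff by auto

lemma GLt_lift:
  assumes "a \<in> GLt r" "G \<in> snd a"
  shows "fst a \<in> GLp" "angle_lift (fst a) G" "snd a = lift_class r G" "a = (fst a, lift_class r G)"
proof -
  obtain H where H: "fst a \<in> GLp" "angle_lift (fst a) H" "snd a = lift_class r H"
    using assms(1) by (rule GLtE)
  then obtain k where k: "G = (\<lambda>t. H t + 2 * pi * real r * of_int k)"
    using assms(2) by (auto simp: lift_class_def)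
  show "fst a \<in> GLp" by fact
  show "angle_lift (fst a) G"
    using angle_lift_shift[OF H(2), of "int r * k"] by (simp add: k mult.assoc)
  show 1: "snd a = lift_class r G"
    unfolding H(3) k lift_class_def
  proof (safe, goal_cases)
    case (1 x n)
    show ?case by (rule exI[of _ "n - k"]) (auto simp: algebra_simps)
  next
    case (2 x n)
    show ?case by (rule exI[of _ "n + k"]) (auto simp: algebra_simps)
  qed
  show "a = (fst a, lift_class r G)" by (simp flip: 1)
qed

lemma lift_class_self: "G \<in> lift_class r G"
  by (auto simp: lift_class_def intro: exI[of _ 0])

lemma lift_class_shift: "(\<lambda>t. G t + 2 * pi * real r * of_int k) \<in> lift_class r G"
  by (auto simp: lift_class_def)

text \<open>A lift commutes with the translation by 2 pi r, so composing all representatives of two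
  classes yields a single class, represented by the composite.\<close>

lemma gl_mult_class:
  assumes "g \<in> GLp" "angle_lift g G"
  shows "gl_mult (g, lift_class r G) (h, lift_class r H) = (g \<circ> h, lift_class r (G \<circ> H))"
proof -
  have *: "G (x + 2 * pi * real r * of_int k) = G x + 2 * pi * real r * of_int k" for x k
    using angle_lift_int_pi[OF assms, of x "2 * int r * k"] by (simp add: mult_ac)
  have "{G' \<circ> H' | G' H'. G' \<in> lift_class r G \<and> H' \<in> lift_class r H} = lift_class r (G \<circ> H)"
  proof (intro equalityI subsetI)
    fix F assume "F \<in> {G' \<circ> H' | G' H'. G' \<in> lift_class r G \<and> H' \<in> lift_class r H}"
    then obtain k l where F: "F = (\<lambda>t. G (H t + 2 * pi * real r * of_int l) + 2 * pi * real r * of_int k)"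
      by (auto simp: lift_class_def o_def)
    show "F \<in> lift_class r (G \<circ> H)" unfolding lift_class_def F *
      by (rule CollectI, rule exI[of _ "k + l"]) (auto simp: algebra_simps)
  next
    fix F assume "F \<in> lift_class r (G \<circ> H)"
    then obtain k where F: "F = (\<lambda>t. G t + 2 * pi * real r * of_int k) \<circ> H"
      by (auto simp: lift_class_def o_def)
    then show "F \<in> {G' \<circ> H' | G' H'. G' \<in> lift_class r G \<and> H' \<in> lift_class r H}"
      using lift_class_shift lift_class_self by blast
  qed
  then show ?thesis by (simp add: gl_mult_def)
qed

lemma gl_mult_GLt:
  assumes "a \<in> GLt r" "b \<in> GLt r"
  shows "gl_mult a b \<in> GLt r"
proof -
  obtain G where G: "fst a \<in> GLp" "angle_lift (fst a) G" "snd a = lift_class r G" using assms(1) by (rule GLtE)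
  obtain H where H: "fst b \<in> GLp" "angle_lift (fst b) H" "snd b = lift_class r H" using assms(2) by (rule GLtE)
  have "gl_mult a b = (fst a \<circ> fst b, lift_class r (G \<circ> H))"
    using gl_mult_class[OF G(1,2), of r "fst b" H] G(3) H(3) by (metis prod.collapse)
  then show ?thesis unfolding GLt_iff using GLp_comp[OF G(1) H(1)] angle_lift_comp[OF G(1,2) H(2)] by blast
qed

text \<open>A path in the cover over the rotations, starting at the unit. The angle is a real
  number: \<open>rot r (2 * pi)\<close> generates the fibre over the identity.\<close>

definition rot :: "nat \<Rightarrow> real \<Rightarrow> glt" where
  "rot r \<theta> = ((\<lambda>w. cis \<theta> * w), lift_class r (\<lambda>t. t + \<theta>))"

lemma angle_lift_cis_mult: "angle_lift (\<lambda>w. cis \<theta> * w) (\<lambda>t. t + \<theta>)"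
  by (auto simp: angle_lift_def norm_mult cis_mult add.commute intro!: continuous_intros)

lemma rot_GLt: "rot r \<theta> \<in> GLt r"
  unfolding GLt_iff rot_def using GLp_mult[of "cis \<theta>"] angle_lift_cis_mult by (metis cis_neq_zero)

lemma gl_one_eq: "gl_one r = (id, lift_class r (\<lambda>t. t))"
  by (simp add: gl_one_def lift_class_def)

lemma rot_0: "rot r 0 = gl_one r"
  by (simp add: rot_def gl_one_eq fun_eq_iff)

lemma gl_one_GLt: "gl_one r \<in> GLt r"
  using rot_GLt[of r 0] by (simp add: rot_0)

lemma rot_mult: "gl_mult (rot r a) (rot r b) = rot r (a + b)"
  unfolding rot_def using gl_mult_class[OF GLp_mult[of "cis a"] angle_lift_cis_mult, of r]
  by (simp add: o_def cis_mult add_ac flip: mult.assoc)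

text \<open>A lift of the quotient of the two matrices is correct up to a multiple of 2 pi. The
  correction can be made inside the composite, as lifts commute with these translations.\<close>

lemma GLt_divide:
  assumes "a \<in> GLt r" "b \<in> GLt r"
  obtains k where "k \<in> GLt r" "gl_mult a k = b"
proof -
  obtain G where G: "fst a \<in> GLp" "angle_lift (fst a) G" "snd a = lift_class r G" using assms(1) by (rule GLtE)
  obtain H where H: "fst b \<in> GLp" "angle_lift (fst b) H" "snd b = lift_class r H" using assms(2) by (rule GLtE)
  let ?m = "gl_inv (fst a) \<circ> fst b"
  have m: "?m \<in> GLp" by (intro GLp_comp gl_inv G H)
  obtain \<theta> where "?m 1 = of_real (cmod (?m 1)) * cis \<theta>" using polar_exists by blast
  then obtain K where K: "angle_lift ?m K" using angle_lift_exists[OF m] by blast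
  have am: "fst a \<circ> ?m = fst b" by (auto simp: fun_eq_iff gl_inv G)
  obtain n where n: "\<And>t. H t = (G \<circ> K) t + 2 * pi * of_int n"
    using angle_lift_unique[OF H(1) angle_lift_comp[OF G(1,2) K, unfolded am] H(2)] by blast
  define K' where "K' = (\<lambda>t. K t + 2 * pi * of_int n)"
  have "G \<circ> K' = H"
    using n angle_lift_int_pi[OF G(1,2), of _ "2 * n"] by (auto simp: fun_eq_iff K'_def mult_ac)
  then have "gl_mult (fst a, lift_class r G) (?m, lift_class r K') = (fst b, lift_class r H)"
    by (simp add: gl_mult_class[OF G(1,2)] am)
  moreover have "(?m, lift_class r K') \<in> GLt r"
    unfolding GLt_iff K'_def using m angle_lift_shift[OF K] by blast
  ultimately show thesis using that G(3) H(3) by (metis prod.collapse)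
qed

text \<open>The \<open>THE\<close> in \<open>gl_angle\<close> is well defined: representatives
  differ by multiples of 2 pi r, which vanish for \<open>r = 0\<close> and are full turns after
  division by \<open>r\<close> otherwise.\<close>

lemma gl_angle_class:
  "gl_angle r (g, lift_class r G) = (if r = 0 then of_real (G 0) else cis (G 0 / real r))"
proof (cases "r = 0")
  case True
  have "gl_angle r (g, lift_class r G) = of_real (G 0)"
    unfolding gl_angle_def by (rule the_equality) (auto simp: True lift_class_def)
  then show ?thesis by (simp add: True)
next
  case False
  have *: "cis ((G 0 + 2 * pi * real r * of_int k) / real r) = cis (G 0 / real r)" for k :: int
    unfolding cis_eq_iff using False by (intro exI[of _ k]) (simp add: field_simps)
  have "gl_angle r (g, lift_class r G) = cis (G 0 / real r)"
    unfolding gl_angle_def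
  proof (rule the_equality)
    show "\<exists>F\<in>snd (g, lift_class r G). cis (G 0 / real r) = (if r = 0 then of_real (F 0) else cis (F 0 / real r))"
      using lift_class_self[of G r] False by auto
  next
    fix z assume "\<exists>F\<in>snd (g, lift_class r G). z = (if r = 0 then of_real (F 0) else cis (F 0 / real r))"
    then show "z = cis (G 0 / real r)" using False * by (auto simp: lift_class_def)
  qed
  then show ?thesis by (simp add: False)
qed

lemma topspace_GLt [simp]: "topspace (GLt_top r) = GLt r"
  by (simp add: GLt_top_def topspace_pullback_topology)

lemma continuous_map_GLt:
  assumes "f ` topspace T \<subseteq> GLt r"
    and "continuous_map T euclidean (\<lambda>x. fst (f x) 1)" "continuous_map T euclidean (\<lambda>x. fst (f x) \<i>)"
    and "continuous_map T euclidean (\<lambda>x. gl_angle r (f x))"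
  shows "continuous_map T (GLt_top r) f"
  unfolding GLt_top_def
proof (rule continuous_map_pullback')
  show "topspace T \<subseteq> f -` GLt r" using assms(1) by auto
  have "continuous_map T (prod_topology euclidean (prod_topology euclidean euclidean))
     (\<lambda>x. (fst (f x) 1, fst (f x) \<i>, gl_angle r (f x)))"
    using assms unfolding continuous_map_paired by auto
  then show "continuous_map T euclidean ((\<lambda>a. (fst a 1, fst a \<i>, gl_angle r a)) \<circ> f)"
    by (simp add: o_def euclidean_product_topology)
qed

lemma continuous_map_gl_angle: "continuous_map (GLt_top r) euclidean (gl_angle r)"
proof -
  have "continuous_map (GLt_top r) euclidean ((\<lambda>p. snd (snd p)) \<circ> (\<lambda>a. (fst a 1, fst a \<i>, gl_angle r a)))"
    unfolding GLt_top_def by (rule continuous_map_pullback) (simp, intro continuous_intros)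
  then show ?thesis by (simp add: o_def)
qed

lemma continuous_map_rot:
  assumes "continuous_map T euclideanreal \<theta>"
  shows "continuous_map T (GLt_top r) (\<lambda>x. rot r (\<theta> x))"
proof (rule continuous_map_GLt)
  have *: "continuous_map T euclidean (F \<circ> \<theta>)" if "continuous_on UNIV F" for F :: "real \<Rightarrow> complex"
    by (rule continuous_map_compose[OF assms]) (use that in auto)
  show "continuous_map T euclidean (\<lambda>x. fst (rot r (\<theta> x)) 1)"
    using *[of cis] by (simp add: rot_def o_def continuous_intros)
  show "continuous_map T euclidean (\<lambda>x. fst (rot r (\<theta> x)) \<i>)"
    using *[of "\<lambda>t. cis t * \<i>"] by (simp add: rot_def o_def continuous_intros)
  show "continuous_map T euclidean (\<lambda>x. gl_angle r (rot r (\<theta> x)))"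
  proof (cases "r = 0")
    case True
    then show ?thesis using *[of of_real] by (simp add: rot_def gl_angle_class o_def continuous_intros)
  next
    case False
    then show ?thesis using *[of "\<lambda>t. cis (t / real r)"] by (simp add: rot_def gl_angle_class o_def continuous_intros)
  qed
qed (use rot_GLt in auto)

section \<open>Sections of the spin structure\<close>

lemma continuous_on_locally:
  fixes C :: "'a::t2_space set"
  assumes "\<And>x. x \<in> C \<Longrightarrow> \<exists>V. openin (top_of_set C) V \<and> x \<in> V \<and> continuous_on V f"
  shows "continuous_on C f"
  unfolding continuous_on_eq_continuous_within
proof
  fix x assume "x \<in> C"
  then obtain V where V: "openin (top_of_set C) V" "x \<in> V" "continuous_on V f" using assms by blast
  then obtain O' where O: "open O'" "V = C \<inter> O'" by (auto simp: openin_open)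
  have "at x within V = at x within C"
    unfolding O(2) using O(1) V(2) O(2) by (intro at_within_nhd[of x O']) auto
  then show "continuous (at x within C) f"
    using V(2,3) by (metis continuous_on_eq_continuous_within)
qed

locale rspin =
  fixes r :: nat and \<Sigma> :: "('p, 'q, 'z) rspin_surface_scheme"
  assumes surface: "compact_surface \<Sigma>" and spin: "rspin_structure r \<Sigma>"
begin

lemma principal: "principal_bundle r \<Sigma>"
  using spin by (simp add: rspin_structure_def)

lemma pr_continuous: "continuous_map (ptop \<Sigma>) (stop \<Sigma>) (pr \<Sigma>)"
  using principal by (simp add: principal_bundle_def)

lemma pr_points: "q \<in> total \<Sigma> \<Longrightarrow> pr \<Sigma> q \<in> points \<Sigma>"
  using pr_continuous by (auto simp: continuous_map_def)

lemma act_continuous: "continuous_map (prod_topology (ptop \<Sigma>) (GLt_top r)) (ptop \<Sigma>) (\<lambda>(q, g). act \<Sigma> q g)"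
  using principal by (simp add: principal_bundle_def)

lemma act_total: "q \<in> total \<Sigma> \<Longrightarrow> g \<in> GLt r \<Longrightarrow> act \<Sigma> q g \<in> total \<Sigma>"
  using act_continuous by (force simp: continuous_map_def)

lemma act_simps:
  assumes "q \<in> total \<Sigma>"
  shows "act \<Sigma> q (gl_one r) = q" "g \<in> GLt r \<Longrightarrow> pr \<Sigma> (act \<Sigma> q g) = pr \<Sigma> q"
    "g \<in> GLt r \<Longrightarrow> h \<in> GLt r \<Longrightarrow> act \<Sigma> (act \<Sigma> q g) h = act \<Sigma> q (gl_mult g h)"
  using principal assms by (auto simp: principal_bundle_def)

lemma act_map_continuous:
  assumes "continuous_map T (ptop \<Sigma>) \<sigma>" "continuous_map T (GLt_top r) g"
  shows "continuous_map T (ptop \<Sigma>) (\<lambda>x. act \<Sigma> (\<sigma> x) (g x))"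
proof -
  have "continuous_map T (prod_topology (ptop \<Sigma>) (GLt_top r)) (\<lambda>x. (\<sigma> x, g x))"
    using assms by (simp add: continuous_map_paired)
  from continuous_map_compose[OF this act_continuous] show ?thesis by (simp add: o_def)
qed

lemma frm_frames: "q \<in> total \<Sigma> \<Longrightarrow> frm \<Sigma> q \<in> frames \<Sigma> (pr \<Sigma> q)"
  using spin by (simp add: rspin_structure_def)

lemma frm_act:
  "q \<in> total \<Sigma> \<Longrightarrow> g \<in> GLt r \<Longrightarrow> c \<in> atlas \<Sigma> \<Longrightarrow> pr \<Sigma> q \<in> fst c \<Longrightarrow>
    frm \<Sigma> (act \<Sigma> q g) c = frm \<Sigma> q c \<circ> fst g"
  using spin by (simp add: rspin_structure_def)

lemma frm_continuous:
  "c \<in> atlas \<Sigma> \<Longrightarrow> continuous_map (subtopology (ptop \<Sigma>) {q \<in> total \<Sigma>. pr \<Sigma> q \<in> fst c}) euclidean (\<lambda>q. frm \<Sigma> q c v)"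
  using spin by (simp add: rspin_structure_def)

lemma frm_GLp: "q \<in> total \<Sigma> \<Longrightarrow> c \<in> atlas \<Sigma> \<Longrightarrow> pr \<Sigma> q \<in> fst c \<Longrightarrow> frm \<Sigma> q c \<in> GLp"
  using frm_frames by (auto simp: frames_def)

lemma chart_exists: "x \<in> points \<Sigma> \<Longrightarrow> \<exists>c\<in>atlas \<Sigma>. x \<in> fst c"
  using surface by (auto simp: compact_surface_def)

text \<open>\<open>a\<close> is the second component of the inverse of a local trivialisation over \<open>U\<close>, and \<open>s\<close> is its unit section.\<close>

definition trivialises :: "'p set \<Rightarrow> ('q \<Rightarrow> glt) \<Rightarrow> ('p \<Rightarrow> 'q) \<Rightarrow> bool" where
  "trivialises U a s \<longleftrightarrow> openin (stop \<Sigma>) U \<and>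
    continuous_map (subtopology (ptop \<Sigma>) {q \<in> total \<Sigma>. pr \<Sigma> q \<in> U}) (GLt_top r) a \<and>
    (\<forall>q\<in>total \<Sigma>. pr \<Sigma> q \<in> U \<longrightarrow> a q \<in> GLt r \<and> (\<forall>h\<in>GLt r. a (act \<Sigma> q h) = gl_mult (a q) h) \<and>
      (\<forall>q'\<in>total \<Sigma>. pr \<Sigma> q' = pr \<Sigma> q \<and> a q = a q' \<longrightarrow> q = q')) \<and>
    continuous_map (subtopology (stop \<Sigma>) U) (ptop \<Sigma>) s \<and> (\<forall>y\<in>U. s y \<in> total \<Sigma> \<and> pr \<Sigma> (s y) = y)"

lemma local_triv:
  assumes "x \<in> points \<Sigma>"
  obtains U a s where "x \<in> U" "trivialises U a s"
proof -
  have "\<forall>x\<in>points \<Sigma>. \<exists>U \<psi>. openin (stop \<Sigma>) U \<and> x \<in> U \<and>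
        homeomorphic_map (prod_topology (subtopology (stop \<Sigma>) U) (GLt_top r))
          (subtopology (ptop \<Sigma>) {q \<in> total \<Sigma>. pr \<Sigma> q \<in> U}) \<psi> \<and>
        (\<forall>y\<in>U. \<forall>g\<in>GLt r. pr \<Sigma> (\<psi> (y, g)) = y \<and>
           (\<forall>h\<in>GLt r. \<psi> (y, gl_mult g h) = act \<Sigma> (\<psi> (y, g)) h))"
    using principal unfolding principal_bundle_def by (elim conjE)
  from bspec[OF this assms] obtain U \<psi> where U: "openin (stop \<Sigma>) U" "x \<in> U" and
    h: "homeomorphic_map (prod_topology (subtopology (stop \<Sigma>) U) (GLt_top r))
          (subtopology (ptop \<Sigma>) {q \<in> total \<Sigma>. pr \<Sigma> q \<in> U}) \<psi>" and
    pm: "\<forall>y\<in>U. \<forall>g\<in>GLt r. pr \<Sigma> (\<psi> (y, g)) = y \<and>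
           (\<forall>h\<in>GLt r. \<psi> (y, gl_mult g h) = act \<Sigma> (\<psi> (y, g)) h)"
    by (elim exE conjE)
  have p: "\<And>y g. y \<in> U \<Longrightarrow> g \<in> GLt r \<Longrightarrow> pr \<Sigma> (\<psi> (y, g)) = y"
    and m: "\<And>y g h. y \<in> U \<Longrightarrow> g \<in> GLt r \<Longrightarrow> h \<in> GLt r \<Longrightarrow> \<psi> (y, gl_mult g h) = act \<Sigma> (\<psi> (y, g)) h"
    using pm by simp_all
  let ?P = "prod_topology (subtopology (stop \<Sigma>) U) (GLt_top r)"
  let ?Q = "subtopology (ptop \<Sigma>) {q \<in> total \<Sigma>. pr \<Sigma> q \<in> U}"
  have tP: "topspace ?P = U \<times> GLt r" using openin_subset[OF U(1)] by auto
  have tQ: "topspace ?Q = {q \<in> total \<Sigma>. pr \<Sigma> q \<in> U}" by auto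
  obtain i where i: "homeomorphic_maps ?P ?Q \<psi> i" using h homeomorphic_map_maps by blast
  have ci: "continuous_map ?Q ?P i" and cp: "continuous_map ?P ?Q \<psi>"
    and ip: "\<And>z. z \<in> U \<times> GLt r \<Longrightarrow> i (\<psi> z) = z"
    and pi: "\<And>q. q \<in> total \<Sigma> \<Longrightarrow> pr \<Sigma> q \<in> U \<Longrightarrow> \<psi> (i q) = q"
    using i unfolding homeomorphic_maps_def tP tQ by blast+
  have iq: "i q \<in> U \<times> GLt r" if "q \<in> total \<Sigma>" "pr \<Sigma> q \<in> U" for q
    using ci that tP tQ unfolding continuous_map_def by blast
  have i_eq: "i q = (pr \<Sigma> q, snd (i q))" if "q \<in> total \<Sigma>" "pr \<Sigma> q \<in> U" for q
    using iq[OF that] pi[OF that] p[of "fst (i q)" "snd (i q)"] by (auto simp: mem_Times_iff prod_eq_iff)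
  have "trivialises U (snd \<circ> i) (\<lambda>y. \<psi> (y, gl_one r))"
    unfolding trivialises_def
  proof (intro conjI ballI impI)
    show "openin (stop \<Sigma>) U" by fact
    show "continuous_map ?Q (GLt_top r) (snd \<circ> i)"
      by (rule continuous_map_compose[OF ci continuous_map_snd])
  next
    fix q assume q: "q \<in> total \<Sigma>" "pr \<Sigma> q \<in> U"
    show 1: "(snd \<circ> i) q \<in> GLt r" using iq[OF q] by auto
    fix h assume h: "h \<in> GLt r"
    have "act \<Sigma> q h = \<psi> (pr \<Sigma> q, gl_mult (snd (i q)) h)"
      using m[OF q(2) _ h, of "snd (i q)"] 1 pi[OF q] i_eq[OF q] by (metis comp_apply)
    then have "i (act \<Sigma> q h) = (pr \<Sigma> q, gl_mult (snd (i q)) h)"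
      using ip q(2) gl_mult_GLt[OF 1 h] by simp
    then show "(snd \<circ> i) (act \<Sigma> q h) = gl_mult ((snd \<circ> i) q) h" by simp
  next
    fix q q' assume q: "q \<in> total \<Sigma>" "pr \<Sigma> q \<in> U" "q' \<in> total \<Sigma>" "pr \<Sigma> q' = pr \<Sigma> q \<and> (snd \<circ> i) q = (snd \<circ> i) q'"
    then have "i q = i q'" using i_eq[of q] i_eq[of q'] by (metis comp_apply)
    then show "q = q'" using pi q by metis
  next
    have "continuous_map (subtopology (stop \<Sigma>) U) ?P (\<lambda>y. (y, gl_one r))"
      using gl_one_GLt[of r] by (simp add: continuous_map_paired)
    from continuous_map_compose[OF this cp]
    show "continuous_map (subtopology (stop \<Sigma>) U) (ptop \<Sigma>) (\<lambda>y. \<psi> (y, gl_one r))"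
      by (auto simp: o_def intro: continuous_map_into_fulltopology)
  next
    fix y assume "y \<in> U"
    then have z: "(y, gl_one r) \<in> topspace ?P" unfolding tP using gl_one_GLt by auto
    then have "\<psi> (y, gl_one r) \<in> topspace ?Q" using cp unfolding continuous_map_def by blast
    then show "\<psi> (y, gl_one r) \<in> total \<Sigma>" "pr \<Sigma> (\<psi> (y, gl_one r)) = y"
      using p[OF \<open>y \<in> U\<close> gl_one_GLt] by auto
  qed
  then show thesis by (rule that[OF U(2)])
qed

text \<open>In a local trivialisation the fibre is the covering group acting on itself by
  multiplication.\<close>

lemma act_transitive:
  assumes "q \<in> total \<Sigma>" "q' \<in> total \<Sigma>" "pr \<Sigma> q' = pr \<Sigma> q"
  obtains k where "k \<in> GLt r" "q' = act \<Sigma> q k"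
proof -
  obtain U a s where U: "pr \<Sigma> q \<in> U" and t: "trivialises U a s"
    by (rule local_triv[OF pr_points[OF assms(1)]])
  have Uo: "openin (stop \<Sigma>) U" and a: "continuous_map (subtopology (ptop \<Sigma>) {q \<in> total \<Sigma>. pr \<Sigma> q \<in> U}) (GLt_top r) a"
    "\<And>q. q \<in> total \<Sigma> \<Longrightarrow> pr \<Sigma> q \<in> U \<Longrightarrow> a q \<in> GLt r"
    "\<And>q h. q \<in> total \<Sigma> \<Longrightarrow> pr \<Sigma> q \<in> U \<Longrightarrow> h \<in> GLt r \<Longrightarrow> a (act \<Sigma> q h) = gl_mult (a q) h"
    "\<And>q q'. q \<in> total \<Sigma> \<Longrightarrow> q' \<in> total \<Sigma> \<Longrightarrow> pr \<Sigma> q \<in> U \<Longrightarrow> pr \<Sigma> q' = pr \<Sigma> q \<Longrightarrow> a q = a q' \<Longrightarrow> q = q'"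
    using t by (simp_all add: trivialises_def)
  have "a q \<in> GLt r" "a q' \<in> GLt r" using U a(2) assms by auto
  then obtain k where k: "k \<in> GLt r" "gl_mult (a q) k = a q'" by (metis GLt_divide)
  have "act \<Sigma> q k = q'"
    by (rule a(4)) (use assms U a(3) k act_total act_simps in auto)
  then show thesis using that k by blast
qed

text \<open>Lifts of linear maps commute with the translation by \<open>\<pi>\<close>, so in a trivialisation the multiple of \<open>\<pi>\<close> is
  the difference of two continuous angles.\<close>

lemma index_constant:
  fixes C :: "'a::t2_space set"
  assumes C: "connected C"
    and T: "continuous_map (top_of_set C) (ptop \<Sigma>) T" and T': "continuous_map (top_of_set C) (ptop \<Sigma>) T'"
    and k: "\<And>x. x \<in> C \<Longrightarrow> \<exists>k\<in>GLt r. T' x = act \<Sigma> (T x) k \<and> (\<exists>K\<in>snd k. \<exists>j::int. K 0 = pi * of_int j)"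
  obtains j :: int where
    "\<And>x. x \<in> C \<Longrightarrow> \<exists>k\<in>GLt r. T' x = act \<Sigma> (T x) k \<and> (\<exists>K\<in>snd k. K 0 = pi * of_int j)"
proof (cases "C = {}")
  case False
  obtain k K and j :: "'a \<Rightarrow> int" where kk: "\<And>x. x \<in> C \<Longrightarrow> k x \<in> GLt r" "\<And>x. x \<in> C \<Longrightarrow> T' x = act \<Sigma> (T x) (k x)"
    "\<And>x. x \<in> C \<Longrightarrow> K x \<in> snd (k x)" "\<And>x. x \<in> C \<Longrightarrow> K x 0 = pi * of_int (j x)"
    using k by metis
  \<comment> \<open>\<open>j x\<close> matters only modulo \<open>2 * r\<close>. This encodes its
    class in the coordinate of \<open>gl_angle\<close>: a real number for \<open>r = 0\<close> and a
    root of unity otherwise.\<close>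
  define D :: "'a \<Rightarrow> complex" where
    "D x = (if r = 0 then of_real (pi * of_int (j x)) else cis (pi * of_int (j x) / real r))" for x
  have tot: "T x \<in> total \<Sigma>" "T' x \<in> total \<Sigma>" if "x \<in> C" for x
    using T T' that by (auto simp: continuous_map_def)
  have "continuous_on C D"
  proof (rule continuous_on_locally)
    fix x assume x: "x \<in> C"
  obtain U a s where U: "pr \<Sigma> (T x) \<in> U" and t: "trivialises U a s"
    by (rule local_triv[OF pr_points[OF tot(1)[OF x]]])
  have Uo: "openin (stop \<Sigma>) U" and a: "continuous_map (subtopology (ptop \<Sigma>) {q \<in> total \<Sigma>. pr \<Sigma> q \<in> U}) (GLt_top r) a"
    "\<And>q. q \<in> total \<Sigma> \<Longrightarrow> pr \<Sigma> q \<in> U \<Longrightarrow> a q \<in> GLt r"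
    "\<And>q h. q \<in> total \<Sigma> \<Longrightarrow> pr \<Sigma> q \<in> U \<Longrightarrow> h \<in> GLt r \<Longrightarrow> a (act \<Sigma> q h) = gl_mult (a q) h"
    "\<And>q q'. q \<in> total \<Sigma> \<Longrightarrow> q' \<in> total \<Sigma> \<Longrightarrow> pr \<Sigma> q \<in> U \<Longrightarrow> pr \<Sigma> q' = pr \<Sigma> q \<Longrightarrow> a q = a q' \<Longrightarrow> q = q'"
    using t by (simp_all add: trivialises_def)
    define V where "V = {y \<in> C. pr \<Sigma> (T y) \<in> U}"
    have V: "openin (top_of_set C) V"
      using openin_continuous_map_preimage[OF continuous_map_compose[OF T pr_continuous] Uo]
      by (simp add: V_def)
    have angle: "continuous_on V (\<lambda>y. gl_angle r (a (F y)))"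
      if F: "continuous_map (top_of_set C) (ptop \<Sigma>) F" "\<And>y. y \<in> V \<Longrightarrow> pr \<Sigma> (F y) \<in> U" for F
    proof -
      have "continuous_map (subtopology (top_of_set C) V) (ptop \<Sigma>) F"
        by (rule continuous_map_from_subtopology[OF F(1)])
      moreover have "subtopology (top_of_set C) V = top_of_set V"
      proof -
        have "C \<inter> V = V" by (auto simp: V_def)
        then show ?thesis by (simp add: subtopology_subtopology)
      qed
      ultimately have "continuous_map (top_of_set V) (subtopology (ptop \<Sigma>) {q \<in> total \<Sigma>. pr \<Sigma> q \<in> U}) F"
        using F(2) by (intro continuous_map_into_subtopology) (auto dest!: continuous_map_funspace)
      from continuous_map_compose[OF continuous_map_compose[OF this a(1)] continuous_map_gl_angle]
      show ?thesis by (simp add: o_def)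
    qed
    have pr': "pr \<Sigma> (T' y) \<in> U" if "y \<in> V" for y
      using that kk tot act_simps(2) by (auto simp: V_def)
    note cT = angle[OF T] and cT' = angle[OF T' pr']
    have rel: "gl_angle r (a (T' y)) = (if r = 0 then gl_angle r (a (T y)) + D y else gl_angle r (a (T y)) * D y)
        \<and> (r \<noteq> 0 \<longrightarrow> gl_angle r (a (T y)) \<noteq> 0)" if y: "y \<in> V" for y
    proof -
      have y': "y \<in> C" "pr \<Sigma> (T y) \<in> U" using y by (auto simp: V_def)
      have aT: "a (T y) \<in> GLt r" using a(2) y' tot by auto
      obtain G where G: "fst (a (T y)) \<in> GLp" "angle_lift (fst (a (T y))) G" "snd (a (T y)) = lift_class r G"
        using aT by (rule GLtE)
      note ky = GLt_lift[OF kk(1)[OF y'(1)] kk(3)[OF y'(1)]]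
      have "a (T' y) = gl_mult (a (T y)) (k y)" using a(3) y' kk tot by auto
      also have "\<dots> = gl_mult (fst (a (T y)), lift_class r G) (fst (k y), lift_class r (K y))"
        using ky(4) G(3) by (metis prod.collapse)
      also have "\<dots> = (fst (a (T y)) \<circ> fst (k y), lift_class r (G \<circ> K y))"
        by (rule gl_mult_class[OF G(1,2)])
      finally have "gl_angle r (a (T' y)) = (if r = 0 then of_real ((G \<circ> K y) 0) else cis ((G \<circ> K y) 0 / real r))"
        by (simp add: gl_angle_class)
      moreover have "(G \<circ> K y) 0 = G 0 + pi * of_int (j y)"
        using angle_lift_int_pi[OF G(1,2), of 0] kk(4)[OF y'(1)] by simp
      moreover have "gl_angle r (a (T y)) = (if r = 0 then of_real (G 0) else cis (G 0 / real r))"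
        using gl_angle_class[of r "fst (a (T y))" G] G(3) by (metis prod.collapse)
      ultimately show ?thesis by (cases "r = 0") (simp_all add: D_def cis_mult add_divide_distrib)
    qed
    show "\<exists>V. openin (top_of_set C) V \<and> x \<in> V \<and> continuous_on V D"
    proof (intro exI conjI)
      show "openin (top_of_set C) V" by fact
      show "x \<in> V" using x U by (simp add: V_def)
      show "continuous_on V D"
      proof (cases "r = 0")
        case True
        have "continuous_on V (\<lambda>y. gl_angle r (a (T' y)) - gl_angle r (a (T y)))"
          by (intro continuous_intros cT cT') (auto simp: V_def)
        then show ?thesis by (rule continuous_on_eq) (use rel True in auto)
      next
        case False
        have "continuous_on V (\<lambda>y. gl_angle r (a (T' y)) / gl_angle r (a (T y)))"
          by (intro continuous_intros cT cT') (use rel False in \<open>auto simp: V_def\<close>)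
        then show ?thesis by (rule continuous_on_eq) (use rel False in auto)
      qed
    qed
  qed
  then have "D constant_on C"
  proof (cases "r = 0")
    case True
    assume c: "continuous_on C D"
    show ?thesis
    proof (rule continuous_discrete_range_constant[OF C c])
      fix x assume x: "x \<in> C"
      show "\<exists>e>0. \<forall>y. y \<in> C \<and> D y \<noteq> D x \<longrightarrow> e \<le> norm (D y - D x)"
      proof (intro exI[of _ pi] conjI allI impI)
        fix y assume "y \<in> C \<and> D y \<noteq> D x"
        then have "j y \<noteq> j x" by (metis D_def)
        then have "1 \<le> \<bar>of_int (j y - j x) :: real\<bar>" by linarith
        then have "pi * 1 \<le> pi * \<bar>of_int (j y - j x)\<bar>" by (intro mult_left_mono) auto
        also have "\<dots> = norm (complex_of_real (pi * of_int (j y - j x)))"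
          unfolding norm_of_real by (simp add: abs_mult)
        also have "complex_of_real (pi * of_int (j y - j x)) = D y - D x"
          by (simp add: D_def True algebra_simps)
        finally show "pi \<le> norm (D y - D x)" by simp
      qed simp
    qed
  next
    case False
    assume c: "continuous_on C D"
    show ?thesis
    proof (rule continuous_finite_range_constant[OF C c])
      \<comment> \<open>Reducing \<open>j x\<close> modulo \<open>2 * r\<close> leaves finitely many
        values, and a continuous function with finite range is constant on a connected set.\<close>
      have "D ` C \<subseteq> (\<lambda>i. cis (pi * of_int i / real r)) ` {0..<2 * int r}"
      proof
        fix z assume "z \<in> D ` C"
        then obtain x where z: "z = cis (pi * of_int (j x) / real r)" using False by (auto simp: D_def)
        let ?i = "j x mod (2 * int r)"
        have "j x = ?i + 2 * int r * (j x div (2 * int r))" by simp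
        then have "real_of_int (j x) = real_of_int (?i + 2 * int r * (j x div (2 * int r)))" by (rule arg_cong)
        then have "real_of_int (j x) = of_int ?i + 2 * real r * of_int (j x div (2 * int r))"
          by (simp only: of_int_add of_int_mult of_int_numeral of_int_of_nat_eq)
        then have "pi * of_int (j x) / real r = pi * of_int ?i / real r + 2 * pi * of_int (j x div (2 * int r))"
          using False by (simp add: field_simps)
        then have "z = cis (pi * of_int ?i / real r)" unfolding z cis_eq_iff by blast
        moreover have "?i \<in> {0..<2 * int r}" using False by simp
        ultimately show "z \<in> (\<lambda>i. cis (pi * of_int i / real r)) ` {0..<2 * int r}" by blast
      qed
      then show "finite (D ` C)" by (rule finite_subset) simp
    qed
  qed
  then obtain d where d: "\<And>x. x \<in> C \<Longrightarrow> D x = d" by (auto simp: constant_on_def)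
  obtain x0 where x0: "x0 \<in> C" using False by blast
  have "\<exists>k\<in>GLt r. T' x = act \<Sigma> (T x) k \<and> (\<exists>K\<in>snd k. K 0 = pi * of_int (j x0))" if x: "x \<in> C" for x
  proof -
    \<comment> \<open>Equal values of \<open>D\<close> mean equal multiples of pi modulo 2 pi r, and
      \<open>K x\<close> may be shifted by such an amount within its class.\<close>
    have "\<exists>n. pi * of_int (j x) = pi * of_int (j x0) + 2 * pi * real r * of_int n"
    proof (cases "r = 0")
      case True
      then show ?thesis using d[OF x] d[OF x0] by (auto simp: D_def)
    next
      case False
      then have "cis (pi * of_int (j x) / real r) = cis (pi * of_int (j x0) / real r)"
        using d[OF x] d[OF x0] by (auto simp: D_def)
      then show ?thesis unfolding cis_eq_iff using False by (auto simp: field_simps)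
    qed
    then obtain n where n: "pi * of_int (j x) = pi * of_int (j x0) + 2 * pi * real r * of_int n" by blast
    have "(\<lambda>t. K x t + 2 * pi * real r * of_int (- n)) \<in> snd (k x)"
      using lift_class_shift[where G = "K x" and k = "- n"] GLt_lift(3)[OF kk(1)[OF x] kk(3)[OF x]] by simp
    moreover have "K x 0 + 2 * pi * real r * of_int (- n) = pi * of_int (j x0)"
      using kk(4)[OF x] n by simp
    ultimately show ?thesis using kk(1,2)[OF x] by (metis (mono_tags, lifting))
  qed
  then show thesis by (rule that)
qed (use that in auto)

end

section \<open>Lifting the frame of a disc\<close>

abbreviation "disc \<equiv> cball 0 1 :: complex set"

text \<open>Boundary points of the disc are included, so the uniqueness for open sets does not
  apply. On the segment from \<open>w\<close> to a point \<open>v\<close> of the disc both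
  differentials restrict to one-variable derivatives, and with \<open>v\<close> equal to 0, 1 and
  \<i> the vectors \<open>v - w\<close> span the plane.\<close>

lemma differential_unique:
  fixes F :: "complex \<Rightarrow> complex"
  assumes J: "(F has_derivative J) (at w within disc)" and J': "(F has_derivative J') (at w within disc)"
    and w: "w \<in> disc"
  shows "J = J'"
proof -
  let ?L = "\<lambda>h. J h - J' h"
  have L: "((\<lambda>z. 0) has_derivative ?L) (at w within disc)"
    using has_derivative_diff[OF J J'] by simp
  then have lin: "linear ?L" by (rule has_derivative_linear)
  have 0: "?L (v - w) = 0" if v: "v \<in> disc" for v
  proof -
    let ?g = "\<lambda>t::real. w + t *\<^sub>R (v - w)"
    have sub: "?g ` {0..1} \<subseteq> disc"
    proof
      fix z assume "z \<in> ?g ` {0..1}"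
      then obtain t where "t \<in> {0..1}" "z = w + t *\<^sub>R (v - w)" by blast
      then have "z = (1 - t) *\<^sub>R w + t *\<^sub>R v" "0 \<le> t" "t \<le> 1" by (auto simp: algebra_simps)
      then show "z \<in> disc" using convexD_alt[OF convex_cball w v, of t] by simp
    qed
    have "(?g has_derivative (\<lambda>t. t *\<^sub>R (v - w))) (at 0 within {0..1})"
      by (auto intro!: derivative_eq_intros)
    moreover have "((\<lambda>z. 0) has_derivative ?L) (at (?g 0) within ?g ` {0..1})"
      using has_derivative_subset[OF L sub] by simp
    ultimately have "((\<lambda>t. 0) has_derivative (\<lambda>t. ?L (t *\<^sub>R (v - w)))) (at 0 within {0..1::real})"
      by (rule has_derivative_in_compose)
    then have "((\<lambda>t. 0) has_vector_derivative ?L (v - w)) (at 0 within {0..1::real})"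
      using linear_scale[OF lin] by (simp add: has_vector_derivative_def)
    moreover have "((\<lambda>t. 0 :: complex) has_vector_derivative 0) (at 0 within {0..1::real})" by simp
    moreover have "at (0::real) within {0..1} \<noteq> bot"
      by (simp add: at_within_Icc_at_right)
    ultimately show ?thesis by (metis vector_derivative_unique_within)
  qed
  have "?L w = 0" using 0[of 0] linear_neg[OF lin, of w] by simp
  then have "?L v = 0" if "v \<in> disc" for v
    using 0[OF that] linear_diff[OF lin, of v w] by simp
  then have "?L 1 = 0" "?L \<i> = 0" by auto
  then have "?L h = 0" for h using linear_complex[OF lin, of h] by simp
  then show ?thesis by (auto simp: fun_eq_iff)
qed

lemma within_openin:
  assumes "openin (top_of_set D) V" "x \<in> V"
  shows "at x within V = at x within D"
proof -
  obtain O' where O: "open O'" "V = D \<inter> O'" using assms(1) by (auto simp: openin_open)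
  show ?thesis unfolding O(2) using O(1) assms(2) O(2) by (intro at_within_nhd[of x O']) auto
qed

locale disc_frame = rspin r \<Sigma> for r :: nat and \<Sigma> :: "('p, 'q, 'z) rspin_surface_scheme" +
  fixes f :: "complex \<Rightarrow> 'p"
  assumes immersion: "immersion_on \<Sigma> disc f"
begin

lemma f_continuous: "continuous_map (top_of_set disc) (stop \<Sigma>) f"
  using immersion by (simp add: immersion_on_def)

lemma f_points: "w \<in> disc \<Longrightarrow> f w \<in> points \<Sigma>"
  using continuous_map_funspace[OF f_continuous] by auto

lemma differential_exists:
  "w \<in> disc \<Longrightarrow> c \<in> atlas \<Sigma> \<Longrightarrow> f w \<in> fst c \<Longrightarrow> \<exists>J\<in>GLp. differential_in disc f w c J"
  using immersion by (auto simp: immersion_on_def)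

lemma differential_GLp:
  assumes "w \<in> disc" "c \<in> atlas \<Sigma>" "f w \<in> fst c" "differential_in disc f w c J"
  shows "J \<in> GLp"
  using differential_exists[OF assms(1-3)] differential_unique assms(1,4) unfolding differential_in_def by metis

lemma chart_open: "c \<in> atlas \<Sigma> \<Longrightarrow> openin (stop \<Sigma>) (fst c)"
  using surface by (auto simp: compact_surface_def)

lemma chart_inj: "c \<in> atlas \<Sigma> \<Longrightarrow> inj_on (snd c) (fst c)"
proof -
  assume c: "c \<in> atlas \<Sigma>"
  then have "homeomorphic_map (subtopology (stop \<Sigma>) (fst c)) (top_of_set (snd c ` fst c)) (snd c)"
    using surface by (auto simp: compact_surface_def)
  then have "inj_on (snd c) (topspace (subtopology (stop \<Sigma>) (fst c)))"
    by (rule homeomorphic_imp_injective_map)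
  then show ?thesis using openin_subset[OF chart_open[OF c]] by (simp add: Int_absorb1)
qed

definition compatible :: "complex \<Rightarrow> 'q \<Rightarrow> bool" where
  "compatible w q \<longleftrightarrow> q \<in> total \<Sigma> \<and> pr \<Sigma> q = f w \<and>
     (\<forall>c\<in>atlas \<Sigma>. \<forall>J. f w \<in> fst c \<and> differential_in disc f w c J \<longrightarrow> frm \<Sigma> q c = J)"

text \<open>By the chain rule a change of charts transforms the differential of \<open>f\<close> in
  the same way as the coordinates of a frame.\<close>

lemma compatible_one_chart:
  assumes w: "w \<in> disc" and q: "q \<in> total \<Sigma>" "pr \<Sigma> q = f w"
    and c: "c \<in> atlas \<Sigma>" "f w \<in> fst c" "differential_in disc f w c (frm \<Sigma> q c)"
  shows "compatible w q"
  unfolding compatible_def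
proof (intro conjI ballI allI impI)
  fix d J assume d: "d \<in> atlas \<Sigma>" and J: "f w \<in> fst d \<and> differential_in disc f w d J"
  have "snd c (f w) \<in> overlap c d" using c J by (auto simp: overlap_def)
  then obtain Jt where Jt: "(transition c d has_derivative Jt) (at (snd c (f w)) within overlap c d)"
    using surface c(1) d unfolding compact_surface_def by blast
  have eq: "frm \<Sigma> q d = Jt \<circ> frm \<Sigma> q c"
  proof -
    have "\<forall>c\<in>atlas \<Sigma>. \<forall>d\<in>atlas \<Sigma>. \<forall>J. pr \<Sigma> q \<in> fst c \<inter> fst d \<and>
        (transition c d has_derivative J) (at (snd c (pr \<Sigma> q)) within overlap c d) \<longrightarrow> frm \<Sigma> q d = J \<circ> frm \<Sigma> q c"
      using frm_frames[OF q(1)] unfolding frames_def mem_Collect_eq by (elim conjE)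
    from this[rule_format, OF c(1) d, of Jt] show ?thesis using q(2) c(2) J Jt by simp
  qed
  let ?V = "{z \<in> disc. f z \<in> fst c \<inter> fst d}"
  have V: "openin (top_of_set disc) ?V"
    using openin_continuous_map_preimage[OF f_continuous openin_Int[OF chart_open[OF c(1)] chart_open[OF d]]] by simp
  have wV: "w \<in> ?V" using w c J by auto
  have "((snd c \<circ> f) has_derivative frm \<Sigma> q c) (at w within ?V)"
    using c(3) within_openin[OF V wV] by (simp add: differential_in_def)
  moreover have "(transition c d has_derivative Jt) (at ((snd c \<circ> f) w) within (snd c \<circ> f) ` ?V)"
    using has_derivative_subset[OF Jt, of "(snd c \<circ> f) ` ?V"] by (auto simp: overlap_def)
  ultimately have "((\<lambda>z. transition c d ((snd c \<circ> f) z)) has_derivative (\<lambda>h. Jt (frm \<Sigma> q c h))) (at w within ?V)"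
    by (rule has_derivative_in_compose)
  then have "((snd d \<circ> f) has_derivative (\<lambda>h. Jt (frm \<Sigma> q c h))) (at w within ?V)"
    by (rule has_derivative_transform[OF wV, rotated])
      (auto simp: transition_def inv_into_f_f[OF chart_inj[OF c(1)]])
  then have "((snd d \<circ> f) has_derivative frm \<Sigma> q d) (at w within disc)"
    using within_openin[OF V wV] by (simp add: eq o_def)
  then show "frm \<Sigma> q d = J"
    using J differential_unique w unfolding differential_in_def by blast
qed (use q in auto)

definition framed :: "complex set \<Rightarrow> (complex \<Rightarrow> 'q) \<Rightarrow> bool" where
  "framed K \<sigma> \<longleftrightarrow> continuous_map (top_of_set K) (ptop \<Sigma>) \<sigma> \<and> (\<forall>w\<in>K. compatible w (\<sigma> w))"

lemma framed_subset: "framed K \<sigma> \<Longrightarrow> L \<subseteq> K \<Longrightarrow> framed L \<sigma>"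
  unfolding framed_def using continuous_map_from_subtopology_mono[of euclidean K "ptop \<Sigma>" \<sigma> L] by auto

lemma compatible_act:
  assumes "compatible w q" "k \<in> GLt r" "fst k = id"
  shows "compatible w (act \<Sigma> q k)"
  using assms frm_act[of q k] act_total[of q k] act_simps(2)[of q k] unfolding compatible_def by auto

lemma compatible_same_frame:
  assumes w: "w \<in> disc" and q: "compatible w q" "compatible w (act \<Sigma> q k)" and k: "k \<in> GLt r"
  shows "fst k = id"
proof -
  obtain c where c: "c \<in> atlas \<Sigma>" "f w \<in> fst c" using chart_exists[OF f_points[OF w]] by blast
  obtain J where J: "J \<in> GLp" "differential_in disc f w c J" using differential_exists[OF w c] by blast
  have "frm \<Sigma> q c = J" "frm \<Sigma> (act \<Sigma> q k) c = J" using q c J unfolding compatible_def by blast+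
  moreover have "frm \<Sigma> (act \<Sigma> q k) c = frm \<Sigma> q c \<circ> fst k"
    using frm_act[OF _ k c(1)] q(1) c(2) by (simp add: compatible_def)
  ultimately have "J (fst k z) = J z" for z by (metis comp_apply)
  then show ?thesis using GLp_inject[OF J(1)] by (auto simp: fun_eq_iff)
qed

text \<open>Two lifts of the same frame differ at each point by an element over the identity, which
  is the translation by some 2 pi n; \<open>index_constant\<close> makes it independent of the
  point.\<close>

lemma framed_unique:
  assumes C: "connected C" "C \<subseteq> disc" and f: "framed C \<sigma>" "framed C \<sigma>'"
  obtains k where "k \<in> GLt r" "fst k = id" "\<And>w. w \<in> C \<Longrightarrow> \<sigma>' w = act \<Sigma> (\<sigma> w) k"
proof (cases "C = {}")
  case True
  then show thesis using that[of "gl_one r"] gl_one_GLt by (simp add: gl_one_eq)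
next
  case False
  have id_lift: "angle_lift id (\<lambda>t. t)" by (auto simp: angle_lift_def)
  have cont: "continuous_map (top_of_set C) (ptop \<Sigma>) \<sigma>" "continuous_map (top_of_set C) (ptop \<Sigma>) \<sigma>'"
    and comp: "\<And>w. w \<in> C \<Longrightarrow> compatible w (\<sigma> w)" "\<And>w. w \<in> C \<Longrightarrow> compatible w (\<sigma>' w)"
    using f by (auto simp: framed_def)
  have "\<exists>k\<in>GLt r. \<sigma>' w = act \<Sigma> (\<sigma> w) k \<and> (\<exists>K\<in>snd k. \<exists>j::int. K 0 = pi * of_int j)" if w: "w \<in> C" for w
  proof -
    obtain k where k: "k \<in> GLt r" "\<sigma>' w = act \<Sigma> (\<sigma> w) k"
      using act_transitive[of "\<sigma> w" "\<sigma>' w"] comp[OF w] by (auto simp: compatible_def)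
    have id: "fst k = id" using compatible_same_frame[of w "\<sigma> w" k] k comp[OF w] w C(2) by auto
    obtain K where K: "angle_lift id K" "snd k = lift_class r K"
      using GLtE[OF k(1)] id by metis
    obtain n :: int where "\<And>t. K t = t + 2 * pi * of_int n"
      using angle_lift_unique[OF GLp_id id_lift K(1)] by blast
    then have "K 0 = pi * of_int (2 * n)" by simp
    then show ?thesis using k K lift_class_self by metis
  qed
  then obtain j :: int where
    j: "\<And>w. w \<in> C \<Longrightarrow> \<exists>k\<in>GLt r. \<sigma>' w = act \<Sigma> (\<sigma> w) k \<and> (\<exists>K\<in>snd k. K 0 = pi * of_int j)"
    using index_constant[OF C(1) cont] by metis
  define k0 :: glt where "k0 = (id, lift_class r (\<lambda>t. t + pi * of_int j))"
  have k0: "\<sigma>' w = act \<Sigma> (\<sigma> w) k0 \<and> k0 \<in> GLt r" if w: "w \<in> C" for w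
  proof -
    obtain k K where k: "k \<in> GLt r" "\<sigma>' w = act \<Sigma> (\<sigma> w) k" "K \<in> snd k" "K 0 = pi * of_int j"
      using j[OF w] by blast
    have id: "fst k = id" using compatible_same_frame[of w "\<sigma> w" k] k comp[OF w] w C(2) by auto
    note K = GLt_lift[OF k(1,3), unfolded id]
    obtain n :: int where n: "\<And>t. K t = t + 2 * pi * of_int n"
      using angle_lift_unique[OF GLp_id id_lift K(2)] by blast
    then have "K = (\<lambda>t. t + pi * of_int j)" using k(4) by (auto simp: fun_eq_iff)
    then have "k = k0" using K(4) by (simp add: k0_def)
    then show ?thesis using k by simp
  qed
  show thesis by (rule that[of k0]) (use k0 False in \<open>auto simp: k0_def\<close>)
qed

text \<open>On the connected seam the two lifts differ by a single deck transformation, and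
  correcting the second lift by it makes them agree there.\<close>

lemma framed_glue:
  fixes p :: "complex \<Rightarrow> real"
  assumes p: "continuous_on UNIV p" and C: "connected (disc \<inter> B \<inter> {w. p w = t})"
    and 1: "framed (disc \<inter> B \<inter> {w. p w \<le> t}) \<sigma>" and 2: "framed (disc \<inter> B \<inter> {w. t \<le> p w}) \<sigma>'"
  shows "\<exists>\<sigma>. framed (disc \<inter> B) \<sigma>"
proof -
  let ?X = "top_of_set (disc \<inter> B)"
  have sub: "disc \<inter> B \<inter> {w. p w = t} \<subseteq> disc \<inter> B \<inter> {w. p w \<le> t}"
    "disc \<inter> B \<inter> {w. p w = t} \<subseteq> disc \<inter> B \<inter> {w. t \<le> p w}" by auto
  obtain k where k: "k \<in> GLt r" "fst k = id"
    "\<And>w. w \<in> disc \<inter> B \<inter> {w. p w = t} \<Longrightarrow> \<sigma> w = act \<Sigma> (\<sigma>' w) k"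
    using framed_unique[OF C _ framed_subset[OF 2 sub(2)] framed_subset[OF 1 sub(1)]] by auto
  have "continuous_map ?X (ptop \<Sigma>) (\<lambda>w. if p w \<le> t then \<sigma> w else act \<Sigma> (\<sigma>' w) k)"
  proof (rule continuous_map_cases_le)
    show "continuous_map ?X euclideanreal p" using continuous_on_subset[OF p] by auto
    show "continuous_map ?X euclideanreal (\<lambda>w. t)" by simp
    have e: "{w \<in> topspace ?X. p w \<le> t} = disc \<inter> B \<inter> {w. p w \<le> t}" "{w \<in> topspace ?X. t \<le> p w} = disc \<inter> B \<inter> {w. t \<le> p w}"
      by auto
    show "continuous_map (subtopology ?X {w \<in> topspace ?X. p w \<le> t}) (ptop \<Sigma>) \<sigma>"
      using 1 unfolding e framed_def by (simp add: subtopology_subtopology Int_assoc[symmetric])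
    have "continuous_map (subtopology ?X {w \<in> topspace ?X. t \<le> p w}) (ptop \<Sigma>) \<sigma>'"
      using 2 unfolding e framed_def by (simp add: subtopology_subtopology Int_assoc[symmetric])
    then show "continuous_map (subtopology ?X {w \<in> topspace ?X. t \<le> p w}) (ptop \<Sigma>) (\<lambda>w. act \<Sigma> (\<sigma>' w) k)"
      by (rule act_map_continuous) (use k(1) in simp)
    show "\<sigma> w = act \<Sigma> (\<sigma>' w) k" if "w \<in> topspace ?X" "p w = t" for w using k(3) that by auto
  qed
  moreover have "compatible w (if p w \<le> t then \<sigma> w else act \<Sigma> (\<sigma>' w) k)" if "w \<in> disc \<inter> B" for w
    using that 1 2 k compatible_act by (auto simp: framed_def)
  ultimately show ?thesis unfolding framed_def by blast
qed

text \<open>A local section \<open>s\<close> of the bundle has frames that differ from the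
  differential of \<open>f\<close> by matrices \<open>M w\<close> depending continuously on
  \<open>w\<close>. To act on \<open>s\<close> by elements of the cover over \<open>M w\<close>, a
  continuous choice of the angle of \<open>M w 1\<close> is needed.\<close>

lemma local_lift:
  assumes w0: "w0 \<in> disc"
  shows "\<exists>O' \<sigma>. open O' \<and> w0 \<in> O' \<and> framed (disc \<inter> O') \<sigma>"
proof -
  obtain c where c: "c \<in> atlas \<Sigma>" "f w0 \<in> fst c" using chart_exists[OF f_points[OF w0]] by blast
  obtain U a s where U: "f w0 \<in> U" and t: "trivialises U a s"
    by (rule local_triv[OF f_points[OF w0]])
  have Uo: "openin (stop \<Sigma>) U" and s: "continuous_map (subtopology (stop \<Sigma>) U) (ptop \<Sigma>) s"
    "\<And>y. y \<in> U \<Longrightarrow> s y \<in> total \<Sigma> \<and> pr \<Sigma> (s y) = y"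
    using t by (simp_all add: trivialises_def)
  let ?M = "{z \<in> disc. f z \<in> fst c}"
  have "smooth_in ?M (snd c \<circ> f)"
    using immersion c by (auto simp: immersion_on_def)
  then have "\<exists>V F. open V \<and> w0 \<in> V \<and> (\<forall>k. Ck_on k V F) \<and> (\<forall>w\<in>V \<inter> ?M. F w = (snd c \<circ> f) w)"
    unfolding smooth_in_def by (rule bspec) (use w0 c in simp)
  then obtain V F where V: "open V" "w0 \<in> V" and F: "\<forall>k. Ck_on k V F" "\<forall>w\<in>V \<inter> ?M. F w = (snd c \<circ> f) w"
    by (elim exE conjE)
  have "Ck_on (Suc 0) V F" using F(1) by blast
  then obtain fx fy where fxy: "continuous_on V fx" "continuous_on V fy"
    "\<And>z. z \<in> V \<Longrightarrow> (F has_derivative (\<lambda>h. Re h *\<^sub>R fx z + Im h *\<^sub>R fy z)) (at z)"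
    by auto
  define J where "J w = (\<lambda>h. Re h *\<^sub>R fx w + Im h *\<^sub>R fy w)" for w
  let ?W = "{w \<in> disc. f w \<in> U \<inter> fst c}"
  have "openin (top_of_set disc) ?W"
    using openin_continuous_map_preimage[OF f_continuous openin_Int[OF Uo chart_open[OF c(1)]]] by simp
  then obtain O1 where O1: "open O1" "?W = disc \<inter> O1" by (auto simp: openin_open)
  define O2 where "O2 = O1 \<inter> V"
  have O2: "open O2" "w0 \<in> O2" using O1 V w0 c U unfolding O2_def by auto
  have in2: "f w \<in> U" "f w \<in> fst c" "w \<in> V" "w \<in> disc" if "w \<in> disc \<inter> O2" for w
  proof -
    have "w \<in> ?W" "w \<in> V" using that unfolding O1(2) O2_def by blast+
    then show "f w \<in> U" "f w \<in> fst c" "w \<in> V" "w \<in> disc" by auto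
  qed
  have diffJ: "differential_in disc f w c (J w)" if w: "w \<in> disc \<inter> O2" for w
  proof -
    have "(F has_derivative J w) (at w within disc \<inter> O2)"
      using fxy(3)[OF in2(3)[OF w]] by (auto simp: J_def intro: has_derivative_at_withinI)
    then have "((snd c \<circ> f) has_derivative J w) (at w within disc \<inter> O2)"
      by (rule has_derivative_transform[OF w, rotated]) (use F(2) in2 in auto)
    moreover have "openin (top_of_set disc) (disc \<inter> O2)" using O2 by blast
    ultimately show ?thesis using within_openin[OF _ w] by (simp add: differential_in_def)
  qed
  have JG: "J w \<in> GLp" if "w \<in> disc \<inter> O2" for w
    using differential_GLp[OF _ c(1) _ diffJ] in2 that by blast
  define Fs where "Fs w = frm \<Sigma> (s (f w)) c" for w
  have FG: "Fs w \<in> GLp" if "w \<in> disc \<inter> O2" for w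
    unfolding Fs_def using s(2) in2[OF that] by (intro frm_GLp) (auto simp: c)
  have f2: "continuous_map (top_of_set (disc \<inter> O2)) (subtopology (stop \<Sigma>) U) f"
    by (rule continuous_map_into_subtopology)
      (use continuous_map_from_subtopology_mono[OF f_continuous, of "disc \<inter> O2"] in2 in auto)
  have sf: "continuous_map (top_of_set (disc \<inter> O2)) (ptop \<Sigma>) (\<lambda>w. s (f w))"
    using continuous_map_compose[OF f2 s(1)] by (simp add: o_def)
  have Fs_cont: "continuous_on (disc \<inter> O2) (\<lambda>w. Fs w v)" for v
  proof -
    have "continuous_map (top_of_set (disc \<inter> O2)) (subtopology (ptop \<Sigma>) {q \<in> total \<Sigma>. pr \<Sigma> q \<in> fst c}) (\<lambda>w. s (f w))"
      by (rule continuous_map_into_subtopology[OF sf]) (use s(2) in2 in auto)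
    from continuous_map_compose[OF this frm_continuous[OF c(1), of v]] show ?thesis
      by (simp add: o_def Fs_def)
  qed
  have J_cont: "continuous_on (disc \<inter> O2) (\<lambda>w. J w v)" for v
    unfolding J_def by (intro continuous_intros continuous_on_subset[OF fxy(1)] continuous_on_subset[OF fxy(2)])
      (use in2 in auto)
  define M where "M w = gl_inv (Fs w) \<circ> J w" for w
  have MG: "M w \<in> GLp" if "w \<in> disc \<inter> O2" for w
    unfolding M_def by (intro GLp_comp gl_inv FG JG that)
  have FM: "Fs w \<circ> M w = J w" if "w \<in> disc \<inter> O2" for w
    using gl_inv(2)[OF FG[OF that]] by (simp add: M_def fun_eq_iff)
  have M_cont: "continuous_on (disc \<inter> O2) (\<lambda>w. M w v)" for v
  proof -
    have "Im (cnj (Fs w 1) * Fs w \<i>) \<noteq> 0" if "w \<in> disc \<inter> O2" for w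
      using FG[OF that] unfolding GLp_def by (metis (mono_tags, lifting) less_irrefl mem_Collect_eq)
    then show ?thesis
      unfolding M_def gl_inv_def Let_def o_def by (intro continuous_intros Fs_cont J_cont) auto
  qed
  have w02: "w0 \<in> disc \<inter> O2" using w0 O2 by blast
  \<comment> \<open>Division by the value at \<open>w0\<close> brings the function close to 1, where
    the principal logarithm is continuous; \<open>\<theta>0\<close> restores the angle at
    \<open>w0\<close>.\<close>
  define \<rho> where "\<rho> w = M w 1 / M w0 1" for w
  have M0: "M w 1 \<noteq> 0" if "w \<in> disc \<inter> O2" for w using GLp_nonzero[OF MG[OF that]] by auto
  have \<rho>_cont: "continuous_on (disc \<inter> O2) \<rho>"
    unfolding \<rho>_def by (intro continuous_intros M_cont) (use M0[OF w02] in auto)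
  have "\<rho> w0 = 1" using M0[OF w02] by (simp add: \<rho>_def)
  then obtain \<delta> where \<delta>: "\<delta> > 0" "\<And>w. w \<in> disc \<inter> O2 \<Longrightarrow> dist w w0 < \<delta> \<Longrightarrow> dist (\<rho> w) 1 < 1"
    using \<rho>_cont w02 unfolding continuous_on_iff by (metis zero_less_one)
  define O' where "O' = O2 \<inter> ball w0 \<delta>"
  have O': "open O'" "w0 \<in> O'" "disc \<inter> O' \<subseteq> disc \<inter> O2" using O2 \<delta> by (auto simp: O'_def)
  have \<rho>_pos: "\<rho> w \<notin> \<real>\<^sub>\<le>\<^sub>0" if "w \<in> disc \<inter> O'" for w
  proof -
    have "dist (\<rho> w) 1 < 1" using \<delta>(2)[of w] that by (auto simp: O'_def dist_commute)
    moreover have "\<bar>Re (\<rho> w - 1)\<bar> \<le> cmod (\<rho> w - 1)" by (rule abs_Re_le_cmod)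
    ultimately have "Re (\<rho> w) > 0" by (simp add: dist_norm)
    then show ?thesis by (auto simp: complex_nonpos_Reals_iff)
  qed
  obtain \<theta>0 where \<theta>0: "M w0 1 = of_real (cmod (M w0 1)) * cis \<theta>0" using polar_exists by blast
  define \<theta> where "\<theta> w = \<theta>0 + Im (Ln (\<rho> w))" for w
  have \<theta>_cont: "continuous_on (disc \<inter> O') \<theta>"
    unfolding \<theta>_def by (intro continuous_intros continuous_on_subset[OF \<rho>_cont] O'(3)) (use \<rho>_pos in auto)
  have M\<theta>: "M w 1 = of_real (cmod (M w 1)) * cis (\<theta> w)" if w: "w \<in> disc \<inter> O'" for w
  proof -
    have "\<rho> w \<noteq> 0" using \<rho>_pos[OF w] by auto
    then have \<rho>: "\<rho> w = of_real (cmod (\<rho> w)) * cis (Im (Ln (\<rho> w)))"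
      using exp_eq_polar[of "Ln (\<rho> w)"] norm_exp_eq_Re[of "Ln (\<rho> w)"] by (simp add: exp_Ln)
    have e: "M w 1 = M w0 1 * \<rho> w" using M0[OF w02] by (simp add: \<rho>_def)
    then have n: "cmod (M w 1) = cmod (M w0 1) * cmod (\<rho> w)" by (simp add: norm_mult)
    have "M w 1 = (of_real (cmod (M w0 1)) * cis \<theta>0) * (of_real (cmod (\<rho> w)) * cis (Im (Ln (\<rho> w))))"
      using e \<theta>0 \<rho> by metis
    also have "\<dots> = of_real (cmod (M w 1)) * (cis \<theta>0 * cis (Im (Ln (\<rho> w))))" by (simp add: n)
    finally show ?thesis by (simp add: \<theta>_def cis_mult)
  qed
  have "\<exists>G. angle_lift (M w) G \<and> G 0 = \<theta> w" if "w \<in> disc \<inter> O'" for w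
    using angle_lift_exists[OF MG M\<theta>] that O'(3) by blast
  then obtain G where G: "\<And>w. w \<in> disc \<inter> O' \<Longrightarrow> angle_lift (M w) (G w)" "\<And>w. w \<in> disc \<inter> O' \<Longrightarrow> G w 0 = \<theta> w"
    by metis
  define g where "g w = (M w, lift_class r (G w))" for w
  have gG: "g w \<in> GLt r" if "w \<in> disc \<inter> O'" for w
    unfolding GLt_iff g_def using MG G(1) that O'(3) by blast
  have "continuous_map (top_of_set (disc \<inter> O')) (GLt_top r) g"
  proof (rule continuous_map_GLt)
    show "g ` topspace (top_of_set (disc \<inter> O')) \<subseteq> GLt r" using gG by auto
    show "continuous_map (top_of_set (disc \<inter> O')) euclidean (\<lambda>w. fst (g w) 1)"
      "continuous_map (top_of_set (disc \<inter> O')) euclidean (\<lambda>w. fst (g w) \<i>)"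
      using continuous_on_subset[OF M_cont O'(3)] by (auto simp: g_def)
    have "continuous_on (disc \<inter> O') (\<lambda>w. gl_angle r (g w))"
    proof (cases "r = 0")
      case True
      have "continuous_on (disc \<inter> O') (\<lambda>w. complex_of_real (\<theta> w))" by (intro continuous_intros \<theta>_cont)
      then show ?thesis by (rule continuous_on_eq) (auto simp: g_def gl_angle_class True G(2))
    next
      case False
      have "continuous_on (disc \<inter> O') (\<lambda>w. cis (\<theta> w / real r))" by (intro continuous_intros \<theta>_cont) (use False in auto)
      then show ?thesis by (rule continuous_on_eq) (use False in \<open>auto simp: g_def gl_angle_class G(2)\<close>)
    qed
    then show "continuous_map (top_of_set (disc \<inter> O')) euclidean (\<lambda>w. gl_angle r (g w))" by simp
  qed
  then have "continuous_map (top_of_set (disc \<inter> O')) (ptop \<Sigma>) (\<lambda>w. act \<Sigma> (s (f w)) (g w))"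
    by (rule act_map_continuous[OF continuous_map_from_subtopology_mono[OF sf O'(3)]])
  moreover have "compatible w (act \<Sigma> (s (f w)) (g w))" if w: "w \<in> disc \<inter> O'" for w
  proof (rule compatible_one_chart)
    have w2: "w \<in> disc \<inter> O2" using w O'(3) by blast
    note in2 = in2[OF w2]
    show "w \<in> disc" "c \<in> atlas \<Sigma>" "f w \<in> fst c" using in2 c by auto
    show "act \<Sigma> (s (f w)) (g w) \<in> total \<Sigma>" "pr \<Sigma> (act \<Sigma> (s (f w)) (g w)) = f w"
      using act_total act_simps(2) s(2) in2 gG[OF w] by auto
    have "frm \<Sigma> (act \<Sigma> (s (f w)) (g w)) c = Fs w \<circ> M w"
      using frm_act[OF _ gG[OF w] c(1), of "s (f w)"] s(2) in2 by (simp add: Fs_def g_def)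
    then show "differential_in disc f w c (frm \<Sigma> (act \<Sigma> (s (f w)) (g w)) c)"
      using FM[OF w2] diffJ[OF w2] by simp
  qed
  ultimately show ?thesis unfolding framed_def using O' by blast
qed

text \<open>The disc meets boxes and the seams between them in convex, hence connected sets, so
  lifts on adjacent boxes glue. A box with sides below e/2 lies in a ball of radius e, where e is a
  Lebesgue number of the cover by local lifts. Bisection in the imaginary direction gives vertical
  strips, and in the real direction the whole disc.\<close>

lemma global_lift: "\<exists>\<sigma>. framed disc \<sigma>"
proof -
  define box where "box a b x y = {w. a \<le> Re w \<and> Re w \<le> b \<and> x \<le> Im w \<and> Im w \<le> y}" for a b x y
  define L where "L B \<longleftrightarrow> (\<exists>\<sigma>. framed (disc \<inter> B) \<sigma>)" for B
  have L_mono: "L B'" if "L B" "disc \<inter> B' \<subseteq> disc \<inter> B" for B B'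
    using that framed_subset unfolding L_def by blast
  have conv: "connected (disc \<inter> box a b x y)" for a b x y
  proof (rule convex_connected, rule convex_Int)
    have "box a b x y = {w. Re w \<ge> a} \<inter> {w. Re w \<le> b} \<inter> {w. Im w \<ge> x} \<inter> {w. Im w \<le> y}" by (auto simp: box_def)
    then show "convex (box a b x y)"
      using convex_halfspace_Re_ge convex_halfspace_Re_le convex_halfspace_Im_ge convex_halfspace_Im_le
      by (simp add: convex_Int)
  qed auto
  let ?G = "{O'. open O' \<and> (\<exists>\<sigma>. framed (disc \<inter> O') \<sigma>)}"
  obtain e where e: "0 < e" "\<And>x. x \<in> disc \<Longrightarrow> \<exists>G\<in>?G. ball x e \<subseteq> G"
  proof (rule Heine_Borel_lemma)
    show "compact disc" by simp
    show "disc \<subseteq> \<Union>?G" using local_lift by blast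
  qed auto
  have small: "L (box a b x y)" if ab: "b - a < e / 2" "y - x < e / 2" for a b x y
  proof (cases "disc \<inter> box a b x y = {}")
    case True
    then show ?thesis by (simp add: L_def framed_def continuous_map_def)
  next
    case False
    then obtain w where w: "w \<in> disc" "w \<in> box a b x y" by blast
    obtain G where G: "G \<in> ?G" "ball w e \<subseteq> G" using e(2)[OF w(1)] by blast
    have "box a b x y \<subseteq> ball w e"
    proof
      fix z assume z: "z \<in> box a b x y"
      have "cmod (w - z) \<le> \<bar>Re (w - z)\<bar> + \<bar>Im (w - z)\<bar>" by (rule cmod_le)
      also have "\<dots> < e / 2 + e / 2"
      proof -
        have "\<bar>Re w - Re z\<bar> \<le> b - a" "\<bar>Im w - Im z\<bar> \<le> y - x"
          using w(2) z by (auto simp: box_def)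
        then show ?thesis using ab by simp
      qed
      finally show "z \<in> ball w e" by (simp add: dist_norm)
    qed
    then have "disc \<inter> box a b x y \<subseteq> disc \<inter> G" using G(2) by blast
    moreover have "L G" using G(1) by (simp add: L_def)
    ultimately show ?thesis by (rule L_mono[rotated])
  qed
  have ReIm: "continuous_on UNIV Re" "continuous_on UNIV Im"
    using continuous_on_Re[OF continuous_on_id] continuous_on_Im[OF continuous_on_id] by auto
  have strip: "L (box a b (-1) 1)" if ab: "b - a < e / 2" for a b
  proof (rule Bolzano[where P = "\<lambda>x y. L (box a b x y)"])
    fix x y z :: real assume *: "L (box a b x y)" "L (box a b y z)" "x \<le> y" "y \<le> z"
    have "disc \<inter> box a b x z \<inter> {w. Im w \<le> y} = disc \<inter> box a b x y"
      "disc \<inter> box a b x z \<inter> {w. y \<le> Im w} = disc \<inter> box a b y z"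
      "disc \<inter> box a b x z \<inter> {w. Im w = y} = disc \<inter> box a b y y"
      using *(3,4) by (auto simp: box_def)
    then show "L (box a b x z)"
      using framed_glue[of Im "box a b x z" y] conv ReIm *(1,2) unfolding L_def by auto
  next
    fix x :: real
    show "\<exists>d>0. \<forall>u v. u \<le> x \<and> x \<le> v \<and> v - u < d \<longrightarrow> L (box a b u v)"
      using small[OF ab] e(1) by (intro exI[of _ "e / 2"]) auto
  qed simp
  have "L (box (-1) 1 (-1) 1)"
  proof (rule Bolzano[where P = "\<lambda>a b. L (box a b (-1) 1)"])
    fix x y z :: real assume *: "L (box x y (-1) 1)" "L (box y z (-1) 1)" "x \<le> y" "y \<le> z"
    have "disc \<inter> box x z (-1) 1 \<inter> {w. Re w \<le> y} = disc \<inter> box x y (-1) 1"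
      "disc \<inter> box x z (-1) 1 \<inter> {w. y \<le> Re w} = disc \<inter> box y z (-1) 1"
      "disc \<inter> box x z (-1) 1 \<inter> {w. Re w = y} = disc \<inter> box y y (-1) 1"
      using *(3,4) by (auto simp: box_def)
    then show "L (box x z (-1) 1)"
      using framed_glue[of Re "box x z (-1) 1" y] conv ReIm *(1,2) unfolding L_def by auto
  next
    fix x :: real
    show "\<exists>d>0. \<forall>u v. u \<le> x \<and> x \<le> v \<and> v - u < d \<longrightarrow> L (box u v (-1) 1)"
      using strip e(1) by (intro exI[of _ "e / 2"]) auto
  qed simp
  moreover have "w \<in> box (-1) 1 (-1) 1" if "w \<in> disc" for w
    using that abs_Re_le_cmod[of w] abs_Im_le_cmod[of w] by (auto simp: box_def)
  then have "disc \<inter> box (-1) 1 (-1) 1 = disc" by blast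
  ultimately show ?thesis by (simp add: L_def)
qed

end

section \<open>The boundary of the disc\<close>

text \<open>An inward pointing vector \<open>n\<close> makes \<open>\<i> n\<close> a tangent vector which, in a half-plane chart, points in the
  negative direction of the real axis.\<close>

lemma (in rspin) boundary_differential:
  assumes c: "c \<in> atlas \<Sigma>" and F: "immersion_on \<Sigma> M F" and p: "p \<in> M" "F p \<in> fst c" "Im (snd c (F p)) = 0"
    and J: "J \<in> GLp" "differential_in M F p c J"
    and circ: "\<And>s. p * cis s \<in> M" and n: "n = p \<or> n = - p" "n \<noteq> 0" and \<delta>: "\<delta> > 0" "\<And>s. 0 \<le> s \<Longrightarrow> s < \<delta> \<Longrightarrow> p + s *\<^sub>R n \<in> M"
  obtains \<rho> where "\<rho> > 0" "J (\<i> * n) = - complex_of_real \<rho>"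
proof -
  let ?h = "\<lambda>z. Im (snd c (F z))"
  have co: "openin (stop \<Sigma>) (fst c)" and "openin (top_of_set halfplane) (snd c ` fst c)"
    using surface c unfolding compact_surface_def by blast+
  then have half: "snd c ` fst c \<subseteq> halfplane" by (simp add: openin_imp_subset)
  have Fc: "continuous_map (top_of_set M) (stop \<Sigma>) F" using F by (simp add: immersion_on_def)
  have "openin (top_of_set M) {z \<in> M. F z \<in> fst c}"
    using openin_continuous_map_preimage[OF Fc co] by simp
  then obtain \<epsilon> where \<epsilon>: "\<epsilon> > 0" "\<And>z. z \<in> M \<Longrightarrow> dist z p < \<epsilon> \<Longrightarrow> F z \<in> fst c"
    using p unfolding openin_euclidean_subtopology_iff by (auto simp: subset_eq)
  have nonneg: "?h z \<ge> 0" if "z \<in> M" "dist z p < \<epsilon>" for z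
    using \<epsilon>(2)[OF that] half by (auto simp: halfplane_def)
  have lin: "linear J" by (rule GLp_linear[OF J(1)])
  have deriv: "((\<lambda>s. ?h (g s)) has_real_derivative Im (J v)) (at 0 within A)"
    if g: "(g has_vector_derivative v) (at 0 within A)" "g ` A \<subseteq> M" "g 0 = p" for g :: "real \<Rightarrow> complex" and v A
  proof -
    have "(g has_derivative (\<lambda>s. s *\<^sub>R v)) (at 0 within A)" using g(1) by (simp add: has_vector_derivative_def)
    moreover have "((snd c \<circ> F) has_derivative J) (at (g 0) within g ` A)"
      using J(2) g(2,3) unfolding differential_in_def by (auto intro: has_derivative_subset)
    ultimately have "((\<lambda>s. (snd c \<circ> F) (g s)) has_derivative (\<lambda>s. J (s *\<^sub>R v))) (at 0 within A)"
      by (rule has_derivative_in_compose)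
    then have "((\<lambda>s. Im ((snd c \<circ> F) (g s))) has_derivative (\<lambda>s. Im (J (s *\<^sub>R v)))) (at 0 within A)"
      by (rule has_derivative_Im)
    then show ?thesis
      using linear_scale[OF lin] by (simp add: has_field_derivative_def mult.commute[of _ "Im (J v)"] o_def)
  qed
  \<comment> \<open>Along the circle the height in the chart is nonnegative and vanishes at
    \<open>p\<close>, so it has a minimum there.\<close>
  have tangential: "Im (J (\<i> * p)) = 0"
  proof -
    have v: "((\<lambda>s. p * cis s) has_vector_derivative \<i> * p) (at 0)"
    proof -
      have "((\<lambda>z. p * exp (\<i> * z)) has_field_derivative \<i> * p) (at (of_real 0))"
        by (auto intro!: derivative_eq_intros)
      from has_vector_derivative_real_field[OF this, of UNIV] show ?thesis
        by (simp add: cis_conv_exp)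
    qed
    then have d: "((\<lambda>s. ?h (p * cis s)) has_real_derivative Im (J (\<i> * p))) (at 0)"
      by (rule deriv) (use circ in auto)
    have "isCont (\<lambda>s. p * cis s) 0" by (rule has_vector_derivative_continuous[OF v])
    then obtain d' where d': "d' > 0" "\<And>s. dist s 0 < d' \<Longrightarrow> dist (p * cis s) (p * cis 0) < \<epsilon>"
      using \<epsilon>(1) unfolding continuous_at_eps_delta by blast
    have "\<forall>y. \<bar>0 - y\<bar> < d' \<longrightarrow> ?h (p * cis 0) \<le> ?h (p * cis y)"
      using nonneg circ d' p(3) by (auto simp: dist_norm)
    then show ?thesis using DERIV_local_min[OF d d'(1)] by blast
  qed
  \<comment> \<open>Into the domain only a one-sided derivative is available: the height cannot
    decrease.\<close>
  have radial: "Im (J n) \<ge> 0"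
  proof (rule ccontr)
    assume "\<not> Im (J n) \<ge> 0"
    then have neg: "Im (J n) < 0" by simp
    have "((\<lambda>s. p + s *\<^sub>R n) has_vector_derivative n) (at 0 within {0..<\<delta>})"
      unfolding has_vector_derivative_def by (auto intro!: derivative_eq_intros)
    then have d: "((\<lambda>s. ?h (p + s *\<^sub>R n)) has_real_derivative Im (J n)) (at 0 within {0..<\<delta>})"
      by (rule deriv) (use \<delta> in auto)
    obtain d' where d': "d' > 0" "\<And>s. s > 0 \<Longrightarrow> 0 + s \<in> {0..<\<delta>} \<Longrightarrow> s < d' \<Longrightarrow> ?h (p + (0 + s) *\<^sub>R n) < ?h (p + 0 *\<^sub>R n)"
      using has_real_derivative_neg_dec_right[OF d neg] by blast
    define s where "s = min (min (\<delta> / 2) (d' / 2)) (\<epsilon> / (2 * cmod n))"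
    have s: "s > 0" "s < \<delta>" "s < d'" "s \<le> \<epsilon> / (2 * cmod n)" using \<delta>(1) d'(1) \<epsilon>(1) n(2) by (auto simp: s_def)
    have "s * cmod n \<le> \<epsilon> / 2" using s(4) n(2) by (simp add: field_simps)
    then have "dist (p + s *\<^sub>R n) p < \<epsilon>" using s(1) \<epsilon>(1) by (simp add: dist_norm)
    then have "?h (p + s *\<^sub>R n) \<ge> 0" using nonneg \<delta>(2) s by simp
    moreover have "?h (p + s *\<^sub>R n) < 0" using d'(2)[of s] s p(3) by simp
    ultimately show False by simp
  qed
  have "Im (J (\<i> * n)) = 0"
    using n(1) tangential linear_neg[OF lin, of "\<i> * p"] by auto
  then have Jin: "J (\<i> * n) = of_real (Re (J (\<i> * n)))"
    by (simp add: complex_eq_iff)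
  \<comment> \<open>\<open>J n\<close> has nonnegative height and \<open>J (\<i> * n)\<close> is
    real; the positive determinant then forces the latter to be negative.\<close>
  have "Im (cnj (J n) * J (\<i> * n)) > 0"
  proof -
    have "Im (cnj n * (\<i> * n)) = (cmod n)\<^sup>2" unfolding cmod_power2 by (simp add: power2_eq_square)
    moreover have "(cmod n)\<^sup>2 > 0" using n(2) by simp
    ultimately show ?thesis using GLp_det[OF J(1), of n "\<i> * n"] by metis
  qed
  then have "- Im (J n) * Re (J (\<i> * n)) > 0" by (subst (asm) Jin) simp
  then have "Re (J (\<i> * n)) < 0" using radial by (simp add: mult_less_0_iff zero_less_mult_iff)
  then show thesis using that[of "- Re (J (\<i> * n))"] Jin by simp
qed

lemma gl_mult_rot:
  "gl_mult (rot r a) (h, lift_class r H) = ((\<lambda>w. cis a * w) \<circ> h, lift_class r ((\<lambda>t. t + a) \<circ> H))"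
  unfolding rot_def by (rule gl_mult_class[OF GLp_mult angle_lift_cis_mult]) simp

text \<open>The vector \<open>\<epsilon> z\<close> points into the collar \<open>U\<close> at \<open>z\<close>: \<open>\<epsilon> = 1\<close> for ingoing and \<open>\<epsilon> = -1\<close> for
  outgoing collars.\<close>

locale disc_collar = disc_frame r \<Sigma> f
  for r :: nat and \<Sigma> :: "('p, 'q, 'z) rspin_surface_scheme" and f +
  fixes U :: "complex set" and \<kappa> :: int and \<phi> :: "complex \<Rightarrow> 'p" and \<Phi> :: "glt \<times> complex \<Rightarrow> 'q"
    and \<sigma> :: "complex \<Rightarrow> 'q" and \<epsilon> :: real and \<beta> :: real
  assumes f_homeo: "homeomorphic_map (top_of_set disc) (stop \<Sigma>) f"
    and f_boundary: "f ` sphere 0 1 = surface_boundary \<Sigma>"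
    and \<sigma>: "framed disc \<sigma>"
    and collar: "parametrised_collar r \<Sigma> U \<kappa> \<phi> \<Phi>" and sphere_collar: "sphere 0 1 \<subseteq> U"
    and \<phi>_boundary: "\<phi> ` sphere 0 1 = surface_boundary \<Sigma>"
    and \<epsilon>: "\<epsilon> = 1 \<or> \<epsilon> = - 1" "cis \<beta> = \<i> * of_real \<epsilon>"
    and inward: "\<And>z. z \<in> sphere 0 1 \<Longrightarrow> \<exists>\<delta>>0. \<forall>s. 0 \<le> s \<and> s < \<delta> \<longrightarrow> z + s *\<^sub>R (of_real \<epsilon> * z) \<in> U"
begin

lemma collar_facts:
  "immersion_on \<Sigma> U \<phi>" "continuous_map (top_of_set U) (stop \<Sigma>) \<phi>" "inj_on \<phi> U"
  "continuous_map (prod_topology (GLt_top r) (top_of_set U)) (ptop \<Sigma>) \<Phi>"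
proof -
  show 1: "immersion_on \<Sigma> U \<phi>" and "continuous_map (prod_topology (GLt_top r) (top_of_set U)) (ptop \<Sigma>) \<Phi>"
    using collar by (auto simp: parametrised_collar_def)
  show "continuous_map (top_of_set U) (stop \<Sigma>) \<phi>" using 1 by (simp add: immersion_on_def)
  have "embedding_map (top_of_set U) (stop \<Sigma>) \<phi>" using collar by (simp add: parametrised_collar_def)
  then show "inj_on \<phi> U"
    unfolding embedding_map_def by (auto dest: homeomorphic_imp_injective_map)
qed

lemma lift_facts:
  assumes "z \<in> U"
  shows "\<Phi> (gl_one r, z) \<in> total \<Sigma>" "pr \<Sigma> (\<Phi> (gl_one r, z)) = \<phi> z"
    "c \<in> atlas \<Sigma> \<Longrightarrow> \<phi> z \<in> fst c \<Longrightarrow> differential_in U \<phi> z c J \<Longrightarrow>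
      frm \<Sigma> (\<Phi> (gl_one r, z)) c = J \<circ> (\<lambda>w. z powi \<kappa> * w)"
proof -
  have "(gl_one r, z) \<in> topspace (prod_topology (GLt_top r) (top_of_set U))"
    using assms gl_one_GLt by simp
  then show "\<Phi> (gl_one r, z) \<in> total \<Sigma>"
    using continuous_map_funspace[OF collar_facts(4)] by blast
  have *: "\<forall>z\<in>U. \<forall>g\<in>GLt r. pr \<Sigma> (\<Phi> (g, z)) = \<phi> z \<and>
        (\<forall>h\<in>GLt r. \<Phi> (gl_mult g h, z) = act \<Sigma> (\<Phi> (g, z)) h) \<and>
        (\<forall>c\<in>atlas \<Sigma>. \<forall>J. \<phi> z \<in> fst c \<and> differential_in U \<phi> z c J \<longrightarrow>
           frm \<Sigma> (\<Phi> (g, z)) c = J \<circ> (\<lambda>w. z powi \<kappa> * w) \<circ> fst g)"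
    using collar unfolding parametrised_collar_def by (elim conjE)
  note * = bspec[OF bspec[OF * assms] gl_one_GLt]
  show "pr \<Sigma> (\<Phi> (gl_one r, z)) = \<phi> z" using * by simp
  show "frm \<Sigma> (\<Phi> (gl_one r, z)) c = J \<circ> (\<lambda>w. z powi \<kappa> * w)"
    if "c \<in> atlas \<Sigma>" "\<phi> z \<in> fst c" "differential_in U \<phi> z c J"
    using * that by (simp add: gl_one_eq)
qed

text \<open>Inward is \<open>- w\<close> on the disc and \<open>\<epsilon> * z\<close> on the
  collar. By \<open>boundary_differential\<close> both chart differentials send \<i> times the
  inward vector to a negative real number, so the two images are positive multiples of each other.
  This compares the tangent of the collar with the reversed tangent of the disc.\<close>

lemma boundary_angle:
  assumes x: "\<phi> (cis \<alpha>) = f (cis u)" and k: "k \<in> GLt r" "\<Phi> (gl_one r, cis \<alpha>) = act \<Sigma> (\<sigma> (cis u)) k" "K \<in> snd k"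
  shows "cis (K (\<beta> + (1 - of_int \<kappa>) * \<alpha>)) = cis (u + pi / 2 + pi)"
proof -
  let ?z = "cis \<alpha>" and ?w = "cis u"
  let ?\<theta>' = "\<beta> + (1 - of_int \<kappa>) * \<alpha>"
  have z: "?z \<in> sphere 0 1" "?z \<in> U" using sphere_collar by auto
  have w: "?w \<in> disc" by simp
  have "f ?w \<in> surface_boundary \<Sigma>" using f_boundary by (metis imageI mem_sphere_0 norm_cis)
  then obtain c where c: "c \<in> atlas \<Sigma>" "f ?w \<in> fst c" "Im (snd c (f ?w)) = 0"
    by (auto simp: surface_boundary_def)
  obtain J where J: "J \<in> GLp" "differential_in disc f ?w c J" using differential_exists[OF w c(1,2)] by blast
  obtain J' where J': "J' \<in> GLp" "differential_in U \<phi> ?z c J'"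
    using collar_facts(1) c z(2) x unfolding immersion_on_def by metis
  obtain \<rho> where \<rho>: "\<rho> > 0" "J (\<i> * - ?w) = - of_real \<rho>"
  proof (rule boundary_differential[OF c(1) immersion w c(2,3) J, of "- ?w" 1])
    fix s :: real assume s: "0 \<le> s" "s < 1"
    have "?w + s *\<^sub>R - ?w = (1 - s) *\<^sub>R ?w" by (simp add: algebra_simps)
    then show "?w + s *\<^sub>R - ?w \<in> disc" using s by simp
  qed (auto simp: norm_mult)
  obtain \<rho>' where \<rho>': "\<rho>' > 0" "J' (\<i> * (of_real \<epsilon> * ?z)) = - of_real \<rho>'"
  proof -
    obtain \<delta> where \<delta>: "\<delta> > 0" "\<And>s. 0 \<le> s \<Longrightarrow> s < \<delta> \<Longrightarrow> ?z + s *\<^sub>R (of_real \<epsilon> * ?z) \<in> U"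
      using inward[OF z(1)] by blast
    have circ: "?z * cis s \<in> U" for s using sphere_collar by (auto simp: norm_mult)
    have c': "\<phi> ?z \<in> fst c" "Im (snd c (\<phi> ?z)) = 0" using c x by auto
    have n: "of_real \<epsilon> * ?z = ?z \<or> of_real \<epsilon> * ?z = - ?z" "of_real \<epsilon> * ?z \<noteq> 0" using \<epsilon>(1) by auto
    show thesis
      by (rule boundary_differential[OF c(1) collar_facts(1) z(2) c' J' circ n \<delta>]) (auto intro: that)
  qed
  have comp: "compatible ?w (\<sigma> ?w)" using \<sigma> w by (simp add: framed_def)
  then have s: "\<sigma> ?w \<in> total \<Sigma>" "pr \<Sigma> (\<sigma> ?w) = f ?w" "frm \<Sigma> (\<sigma> ?w) c = J"
    using c J unfolding compatible_def by blast+
  have "J' \<circ> (\<lambda>v. ?z powi \<kappa> * v) = J \<circ> fst k"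
    using lift_facts(3)[OF z(2) c(1) _ J'(2)] frm_act[OF s(1) k(1) c(1)] k(2) s c x by simp
  then have "J (fst k (cis ?\<theta>')) = J' (?z powi \<kappa> * cis ?\<theta>')" by (metis comp_apply)
  \<comment> \<open>The frame of the collar is turned by \<kappa> times \<alpha>, which the summand
    (1 - \<kappa>) \<alpha> completes to \<alpha>.\<close>
  also have "?z powi \<kappa> * cis ?\<theta>' = cis \<beta> * ?z"
    by (simp add: cis_power_int cis_mult algebra_simps)
  also have "cis \<beta> * ?z = \<i> * (of_real \<epsilon> * ?z)" using \<epsilon>(2) by simp
  also have "J' \<dots> = (\<rho>' / \<rho>) *\<^sub>R J (\<i> * - ?w)" using \<rho> \<rho>' by (simp add: scaleR_conv_of_real)
  also have "\<dots> = J ((\<rho>' / \<rho>) *\<^sub>R (\<i> * - ?w))" by (simp only: linear_scale[OF GLp_linear[OF J(1)]])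
  finally have "fst k (cis ?\<theta>') = (\<rho>' / \<rho>) *\<^sub>R (\<i> * - ?w)" using GLp_inject[OF J(1)] by blast
  also have "\<i> * - ?w = cis (u + pi / 2 + pi)"
  proof -
    have "cis (u + pi / 2 + pi) = cis u * cis (pi / 2) * cis pi" by (simp only: cis_mult)
    then show ?thesis by simp
  qed
  finally have e: "fst k (cis ?\<theta>') = of_real (\<rho>' / \<rho>) * cis (u + pi / 2 + pi)"
    by (simp add: scaleR_conv_of_real)
  note K = GLt_lift[OF k(1,3)]
  have "cmod (fst k (cis ?\<theta>')) = \<rho>' / \<rho>" unfolding e norm_mult norm_of_real using \<rho>(1) \<rho>'(1) by simp
  then have "cis (K ?\<theta>') = (of_real (\<rho>' / \<rho>) * cis (u + pi / 2 + pi)) / of_real (\<rho>' / \<rho>)"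
    using angle_lift_cis[OF K(2,1), of ?\<theta>'] e by metis
  then show ?thesis using \<rho>(1) \<rho>'(1) by simp
qed

text \<open>Rotating the section of the face by \<open>u + pi / 2\<close> and that of the collar by
  its own angle aligns both with the boundary, in opposite directions. The rotated sections are
  continuous along the arc and differ by an odd multiple of pi, which \<open>index_constant\<close>
  makes constant; written as (2 s + 1) pi it yields the edge index s.\<close>

lemma boundary_index_exists:
  assumes \<alpha>0: "\<phi> (cis \<alpha>0) = f 1"
  obtains s where "s \<in> Zr r"
    "\<And>t \<alpha>. t \<in> {0<..<1} \<Longrightarrow> \<alpha> \<in> {\<alpha>0<..<\<alpha>0 + 2 * pi} \<Longrightarrow> \<phi> (cis \<alpha>) = f (cis (2 * pi * t)) \<Longrightarrow>
      transition_index r \<Sigma> s (\<sigma> (cis (2 * pi * t))) (2 * pi * t + pi / 2)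
        (\<Phi> (gl_one r, cis \<alpha>)) (\<beta> + (1 - of_int \<kappa>) * \<alpha>)"
proof -
  let ?I = "{\<alpha>0<..<\<alpha>0 + 2 * pi}"
  let ?\<theta>' = "\<lambda>\<alpha>. \<beta> + (1 - of_int \<kappa>) * \<alpha>"
  obtain g where g: "homeomorphic_maps (top_of_set disc) (stop \<Sigma>) f g"
    using f_homeo homeomorphic_map_maps by blast
  have g_cont: "continuous_map (stop \<Sigma>) (top_of_set disc) g" and gf: "\<And>w. w \<in> disc \<Longrightarrow> g (f w) = w"
    using g unfolding homeomorphic_maps_def by auto
  define W where "W \<alpha> = g (\<phi> (cis \<alpha>))" for \<alpha>
  have W: "W \<alpha> \<in> sphere 0 1" "f (W \<alpha>) = \<phi> (cis \<alpha>)" for \<alpha>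
  proof -
    have "\<phi> (cis \<alpha>) \<in> f ` sphere 0 1" using \<phi>_boundary f_boundary by (metis imageI mem_sphere_0 norm_cis)
    then obtain v where v: "v \<in> sphere 0 1" "\<phi> (cis \<alpha>) = f v" by blast
    then have "W \<alpha> = v" using gf[of v] by (simp add: W_def)
    then show "W \<alpha> \<in> sphere 0 1" "f (W \<alpha>) = \<phi> (cis \<alpha>)" using v by auto
  qed
  have cis_U: "cis \<alpha> \<in> U" for \<alpha> using sphere_collar by auto
  \<comment> \<open>The vertex at \<open>\<alpha>0\<close> is the point sent to 1, so on the open
    interval \<open>W\<close> avoids the cut of \<open>Arg2pi\<close>.\<close>
  have W1: "W \<alpha> \<notin> \<real>\<^sub>\<ge>\<^sub>0" if \<alpha>: "\<alpha> \<in> ?I" for \<alpha>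
  proof
    assume "W \<alpha> \<in> \<real>\<^sub>\<ge>\<^sub>0"
    then obtain x where x: "W \<alpha> = of_real x" "x \<ge> 0" by (auto elim: nonneg_Reals_cases)
    then have "W \<alpha> = 1" using W(1)[of \<alpha>] by simp
    then have "\<phi> (cis \<alpha>) = \<phi> (cis \<alpha>0)" using W(2)[of \<alpha>] \<alpha>0 by simp
    then have "cis \<alpha> = cis \<alpha>0" using inj_onD[OF collar_facts(3)] cis_U by blast
    then obtain n :: int where n: "\<alpha> = \<alpha>0 + 2 * pi * of_int n" using cis_eq_iff by blast
    then have "0 < 2 * pi * of_int n" "2 * pi * of_int n < 2 * pi * 1" using \<alpha> by auto
    then have "0 < (of_int n :: real)" "(of_int n :: real) < 1"
      using pi_gt_zero by (simp_all add: zero_less_mult_iff)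
    then show False by simp
  qed
  have W_cont: "continuous_map (top_of_set ?I) (top_of_set disc) W"
  proof -
    have "continuous_map (top_of_set ?I) (top_of_set U) cis"
      by (rule continuous_map_into_subtopology) (use cis_U in \<open>auto intro!: continuous_intros\<close>)
    from continuous_map_compose[OF continuous_map_compose[OF this collar_facts(2)] g_cont]
    show ?thesis by (simp add: o_def W_def[abs_def])
  qed
  define u where "u \<alpha> = Arg2pi (W \<alpha>)" for \<alpha>
  have u_cis: "cis (u \<alpha>) = W \<alpha>" for \<alpha>
    using Arg2pi_eq[of "W \<alpha>"] W(1)[of \<alpha>] by (simp add: u_def cis_conv_exp)
  have u_cont: "continuous_map (top_of_set ?I) euclideanreal u"
  proof -
    have "continuous_on ?I W" using W_cont by (simp add: continuous_map_in_subtopology)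
    moreover have "continuous_on (W ` ?I) Arg2pi"
      using W1 continuous_at_Arg2pi by (intro continuous_at_imp_continuous_on) auto
    ultimately show ?thesis using continuous_on_compose by (auto simp: u_def[abs_def] o_def)
  qed
  have cont1: "continuous_map (top_of_set ?I) (ptop \<Sigma>) (\<lambda>\<alpha>. \<sigma> (W \<alpha>))"
  proof -
    have "continuous_map (top_of_set disc) (ptop \<Sigma>) \<sigma>" using \<sigma> by (simp add: framed_def)
    from continuous_map_compose[OF W_cont this] show ?thesis by (simp add: o_def)
  qed
  have cont2: "continuous_map (top_of_set ?I) (ptop \<Sigma>) (\<lambda>\<alpha>. \<Phi> (gl_one r, cis \<alpha>))"
  proof -
    have "continuous_map (top_of_set ?I) (prod_topology (GLt_top r) (top_of_set U)) (\<lambda>\<alpha>. (gl_one r, cis \<alpha>))"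
      unfolding continuous_map_paired using gl_one_GLt[of r] cis_U
      by (auto simp: continuous_map_in_subtopology intro!: continuous_intros)
    from continuous_map_compose[OF this collar_facts(4)] show ?thesis by (simp add: o_def)
  qed
  define T where "T \<alpha> = act \<Sigma> (\<sigma> (W \<alpha>)) (rot r (u \<alpha> + pi / 2))" for \<alpha>
  define T' where "T' \<alpha> = act \<Sigma> (\<Phi> (gl_one r, cis \<alpha>)) (rot r (?\<theta>' \<alpha>))" for \<alpha>
  have T_cont: "continuous_map (top_of_set ?I) (ptop \<Sigma>) T"
    unfolding T_def[abs_def] using u_cont
    by (intro act_map_continuous cont1 continuous_map_rot) (auto intro!: continuous_intros)
  have T'_cont: "continuous_map (top_of_set ?I) (ptop \<Sigma>) T'"
    unfolding T'_def[abs_def] by (intro act_map_continuous cont2 continuous_map_rot) (auto intro!: continuous_intros)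
  have q: "\<sigma> (W \<alpha>) \<in> total \<Sigma>" "pr \<Sigma> (\<sigma> (W \<alpha>)) = \<phi> (cis \<alpha>)" for \<alpha>
    using \<sigma> W[of \<alpha>] by (auto simp: framed_def compatible_def)
  note q' = lift_facts(1,2)[OF cis_U]
  have unrot: "act \<Sigma> (act \<Sigma> q (rot r a)) (rot r (- a)) = q" if "q \<in> total \<Sigma>" for q a
    using that act_simps(1,3) rot_GLt by (simp add: rot_mult rot_0)
  have "\<exists>k\<in>GLt r. T' \<alpha> = act \<Sigma> (T \<alpha>) k \<and> (\<exists>K\<in>snd k. \<exists>j::int. K 0 = pi * of_int j)" for \<alpha>
  proof -
    let ?\<theta> = "u \<alpha> + pi / 2"
    obtain k where k: "k \<in> GLt r" "\<Phi> (gl_one r, cis \<alpha>) = act \<Sigma> (\<sigma> (W \<alpha>)) k"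
      by (rule act_transitive[OF q(1) q'(1)]) (use q(2) q'(2) in simp)
    obtain K where K: "angle_lift (fst k) K" "snd k = lift_class r K" "fst k \<in> GLp"
      using GLtE[OF k(1)] by metis
    let ?k2 = "gl_mult k (rot r (?\<theta>' \<alpha>))"
    let ?k3 = "gl_mult (rot r (- ?\<theta>)) ?k2"
    have k2: "?k2 \<in> GLt r" "?k2 = (fst k \<circ> (\<lambda>w. cis (?\<theta>' \<alpha>) * w), lift_class r (K \<circ> (\<lambda>t. t + ?\<theta>' \<alpha>)))"
      using gl_mult_GLt[OF k(1) rot_GLt] gl_mult_class[OF K(3,1), of r] K(2) by (auto simp: rot_def) (metis prod.collapse)+
    have k3: "?k3 \<in> GLt r" by (rule gl_mult_GLt[OF rot_GLt k2(1)])
    have "snd ?k3 = lift_class r ((\<lambda>t. t + - ?\<theta>) \<circ> (K \<circ> (\<lambda>t. t + ?\<theta>' \<alpha>)))"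
      unfolding k2(2) gl_mult_rot snd_conv ..
    then have K3: "(\<lambda>t. t + - ?\<theta>) \<circ> (K \<circ> (\<lambda>t. t + ?\<theta>' \<alpha>)) \<in> snd ?k3" using lift_class_self by metis
    have "act \<Sigma> (T \<alpha>) ?k3 = act \<Sigma> (act \<Sigma> (T \<alpha>) (rot r (- ?\<theta>))) ?k2"
      using act_simps(3)[of "T \<alpha>" "rot r (- ?\<theta>)" ?k2] act_total[OF q(1) rot_GLt] rot_GLt k2(1) by (simp add: T_def)
    also have "\<dots> = act \<Sigma> (\<sigma> (W \<alpha>)) ?k2" unfolding T_def unrot[OF q(1)] ..
    also have "\<dots> = T' \<alpha>" using act_simps(3)[OF q(1) k(1) rot_GLt] k(2) by (simp add: T'_def)
    finally have T'_eq: "T' \<alpha> = act \<Sigma> (T \<alpha>) ?k3" ..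
    have "cis (K (?\<theta>' \<alpha>)) = cis (u \<alpha> + pi / 2 + pi)"
      by (rule boundary_angle[OF _ k(1)]) (use W(2)[of \<alpha>] k(2) K(2) lift_class_self in \<open>auto simp: u_cis\<close>)
    then obtain n :: int where n: "K (?\<theta>' \<alpha>) = ?\<theta> + pi + 2 * pi * of_int n" using cis_eq_iff by blast
    have "((\<lambda>t. t + - ?\<theta>) \<circ> (K \<circ> (\<lambda>t. t + ?\<theta>' \<alpha>))) 0 = pi * of_int (1 + 2 * n)"
      using n by (simp add: algebra_simps)
    then show ?thesis using T'_eq k3 K3 by metis
  qed
  then obtain j :: int where
    j: "\<And>\<alpha>. \<alpha> \<in> ?I \<Longrightarrow> \<exists>k\<in>GLt r. T' \<alpha> = act \<Sigma> (T \<alpha>) k \<and> (\<exists>K\<in>snd k. K 0 = pi * of_int j)"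
    using index_constant[OF _ T_cont T'_cont] by (metis connected_Ioo)
  \<comment> \<open>The rotations are undone. \<open>index_constant\<close> returns some multiple
    \<open>j\<close> without its parity, so \<open>boundary_angle\<close> is used a second time to
    see that \<open>j\<close> is odd.\<close>
  have main: "\<exists>k\<in>GLt r. \<Phi> (gl_one r, cis \<alpha>) = act \<Sigma> (\<sigma> (W \<alpha>)) k \<and>
      (\<exists>G\<in>snd k. G (?\<theta>' \<alpha>) = u \<alpha> + pi / 2 + pi * of_int j) \<and> odd j" if \<alpha>: "\<alpha> \<in> ?I" for \<alpha>
  proof -
    let ?\<theta> = "u \<alpha> + pi / 2"
    obtain k K where k: "k \<in> GLt r" "T' \<alpha> = act \<Sigma> (T \<alpha>) k" "K \<in> snd k" "K 0 = pi * of_int j"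
      using j[OF \<alpha>] by blast
    note K = GLt_lift[OF k(1,3)]
    let ?k2 = "gl_mult k (rot r (- ?\<theta>' \<alpha>))"
    let ?k3 = "gl_mult (rot r ?\<theta>) ?k2"
    have k2: "?k2 \<in> GLt r" "?k2 = (fst k \<circ> (\<lambda>w. cis (- ?\<theta>' \<alpha>) * w), lift_class r (K \<circ> (\<lambda>t. t + - ?\<theta>' \<alpha>)))"
      using gl_mult_GLt[OF k(1) rot_GLt] gl_mult_class[OF K(1,2), of r] K(3) by (auto simp: rot_def) (metis prod.collapse)+
    have k3: "?k3 \<in> GLt r" by (rule gl_mult_GLt[OF rot_GLt k2(1)])
    have "snd ?k3 = lift_class r ((\<lambda>t. t + ?\<theta>) \<circ> (K \<circ> (\<lambda>t. t + - ?\<theta>' \<alpha>)))"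
      unfolding k2(2) gl_mult_rot snd_conv ..
    then have K3: "(\<lambda>t. t + ?\<theta>) \<circ> (K \<circ> (\<lambda>t. t + - ?\<theta>' \<alpha>)) \<in> snd ?k3" using lift_class_self by metis
    have Tt: "T \<alpha> \<in> total \<Sigma>" unfolding T_def by (rule act_total[OF q(1) rot_GLt])
    have "\<Phi> (gl_one r, cis \<alpha>) = act \<Sigma> (T' \<alpha>) (rot r (- ?\<theta>' \<alpha>))" unfolding T'_def unrot[OF q'(1)] ..
    also have "\<dots> = act \<Sigma> (T \<alpha>) ?k2" unfolding k(2) by (rule act_simps(3)[OF Tt k(1) rot_GLt])
    also have "\<dots> = act \<Sigma> (\<sigma> (W \<alpha>)) ?k3" unfolding T_def by (rule act_simps(3)[OF q(1) rot_GLt k2(1)])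
    finally have e: "\<Phi> (gl_one r, cis \<alpha>) = act \<Sigma> (\<sigma> (W \<alpha>)) ?k3" .
    let ?G = "(\<lambda>t. t + ?\<theta>) \<circ> (K \<circ> (\<lambda>t. t + - ?\<theta>' \<alpha>))"
    have G: "?G (?\<theta>' \<alpha>) = ?\<theta> + pi * of_int j" using k(4) by simp
    have "cis (?G (?\<theta>' \<alpha>)) = cis (u \<alpha> + pi / 2 + pi)"
      by (rule boundary_angle[OF _ k3 _ K3]) (use W(2)[of \<alpha>] e in \<open>auto simp: u_cis\<close>)
    then obtain n :: int where "?\<theta> + pi * of_int j = ?\<theta> + pi + 2 * pi * of_int n"
      unfolding G cis_eq_iff by auto
    then have "pi * of_int j = pi * of_int (1 + 2 * n)" by (simp add: algebra_simps)
    then have "of_int j = (of_int (1 + 2 * n) :: real)" using pi_gt_zero by simp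
    then have "j = 1 + 2 * n" by linarith
    then have "odd j" by simp
    then show ?thesis using k3 e K3 G by metis
  qed
  define s where "s = (j - 1) div 2"
  have jodd: "j = 2 * s + 1"
  proof -
    have "\<alpha>0 + pi \<in> ?I" using pi_gt_zero by auto
    then have "odd j" using main by blast
    then show ?thesis unfolding s_def by presburger
  qed
  show thesis
  proof (rule that[of "s mod int r"])
    show "s mod int r \<in> Zr r" by (auto simp: Zr_def)
    fix t \<alpha> assume t: "t \<in> {0<..<1}" and \<alpha>: "\<alpha> \<in> ?I" and e: "\<phi> (cis \<alpha>) = f (cis (2 * pi * t))"
    have Wt: "W \<alpha> = cis (2 * pi * t)" unfolding W_def e by (rule gf) simp
    have ut: "u \<alpha> = 2 * pi * t"
      unfolding u_def by (rule Arg2pi_unique[of 1]) (use t in \<open>auto simp: Wt cis_conv_exp\<close>)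
    obtain k G where k: "k \<in> GLt r" "\<Phi> (gl_one r, cis \<alpha>) = act \<Sigma> (\<sigma> (W \<alpha>)) k" "G \<in> snd k"
      "G (?\<theta>' \<alpha>) = u \<alpha> + pi / 2 + pi * of_int j" using main[OF \<alpha>] by blast
    \<comment> \<open>Replacing \<open>s\<close> by its residue changes the angle by a multiple of 2
      pi r, which stays within the class of lifts.\<close>
    have G': "(\<lambda>x. G x + 2 * pi * real r * of_int (- (s div int r))) \<in> snd k"
      using lift_class_shift[where G = G and k = "- (s div int r)"] GLt_lift(3)[OF k(1,3)] by simp
    have "s = s mod int r + int r * (s div int r)" by simp
    then have "real_of_int s = real_of_int (s mod int r + int r * (s div int r))" by (rule arg_cong)
    then have sr: "real_of_int s = of_int (s mod int r) + real r * of_int (s div int r)"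
      by (simp only: of_int_add of_int_mult of_int_of_nat_eq)
    have "G (?\<theta>' \<alpha>) + 2 * pi * real r * of_int (- (s div int r))
        = 2 * pi * t + pi / 2 + (2 * of_int (s mod int r) + 1) * pi"
      unfolding k(4) ut jodd using sr by (simp add: algebra_simps)
    then show "transition_index r \<Sigma> (s mod int r) (\<sigma> (cis (2 * pi * t))) (2 * pi * t + pi / 2)
        (\<Phi> (gl_one r, cis \<alpha>)) (?\<theta>' \<alpha>)"
      unfolding transition_index_def using k(1,2) G' Wt by (metis (mono_tags, lifting))
  qed
qed

end

section \<open>The disc is presented by the 1-gon\<close>

lemma smooth_in_subset:
  assumes "smooth_in M f" "N \<subseteq> M"
  shows "smooth_in N f"
  unfolding smooth_in_def
proof
  fix z assume "z \<in> N"
  then have "\<exists>U F. open U \<and> z \<in> U \<and> (\<forall>k. Ck_on k U F) \<and> (\<forall>w\<in>U \<inter> M. F w = f w)"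
    using assms by (auto simp: smooth_in_def)
  then obtain U F where "open U" "z \<in> U" "\<forall>k. Ck_on k U F" "\<forall>w\<in>U \<inter> M. F w = f w"
    by (elim exE conjE)
  moreover from this(4) have "\<forall>w\<in>U \<inter> N. F w = f w" using assms(2) by blast
  ultimately show "\<exists>U F. open U \<and> z \<in> U \<and> (\<forall>k. Ck_on k U F) \<and> (\<forall>w\<in>U \<inter> N. F w = f w)"
    by (intro exI conjI)
qed

lemma immersion_on_subset:
  assumes "immersion_on \<Sigma> M f" "N \<subseteq> M"
  shows "immersion_on \<Sigma> N f"
  unfolding immersion_on_def
proof (intro conjI ballI impI)
  show "continuous_map (top_of_set N) (stop \<Sigma>) f"
    using assms continuous_map_from_subtopology_mono unfolding immersion_on_def by blast
  fix c assume c: "c \<in> atlas \<Sigma>"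
  have "smooth_in {z \<in> M. f z \<in> fst c} (snd c \<circ> f)" using assms(1) c by (simp add: immersion_on_def)
  then show "smooth_in {z \<in> N. f z \<in> fst c} (snd c \<circ> f)" by (rule smooth_in_subset) (use assms(2) in auto)
  fix z assume z: "z \<in> N" "f z \<in> fst c"
  then obtain J where "J \<in> GLp" "differential_in M f z c J"
    using assms c unfolding immersion_on_def by blast
  then show "\<exists>J\<in>GLp. differential_in N f z c J"
    using has_derivative_subset[OF _ assms(2)] unfolding differential_in_def by blast
qed

lemma polygon_1: "polygon 1 = disc - {1}"
  by (auto simp: polygon_def poly_angle_def)

text \<open>Without its corner the polygon is relatively open in the disc, so differentials within
  the two sets agree.\<close>

lemma (in disc_frame) face_trivialisation_framed:
  assumes "framed disc \<sigma>"
  shows "face_trivialisation \<Sigma> 1 f \<sigma>"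
  unfolding face_trivialisation_def polygon_1
proof (intro conjI ballI allI impI)
  show "continuous_map (top_of_set (disc - {1})) (ptop \<Sigma>) \<sigma>"
    using assms by (auto simp: framed_def intro: continuous_map_from_subtopology_mono)
  fix w assume w: "w \<in> disc - {1}"
  then have comp: "compatible w (\<sigma> w)" using assms by (simp add: framed_def)
  then show "pr \<Sigma> (\<sigma> w) = f w" by (simp add: compatible_def)
  fix c J assume c: "c \<in> atlas \<Sigma>" "f w \<in> fst c \<and> differential_in (disc - {1}) f w c J"
  have "openin (top_of_set disc) (disc - {1})"
    by (metis Diff_eq openin_open_Int open_Compl closed_singleton)
  from within_openin[OF this w] have "differential_in disc f w c J"
    using c by (simp add: differential_in_def)
  then show "frm \<Sigma> (\<sigma> w) c = J" using comp c by (simp add: compatible_def)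
qed

lemma polar_decomposition_disc:
  assumes "w \<in> sphere (0 :: complex) 1" "w \<noteq> 1"
  obtains t where "t \<in> {0<..<1}" "w = cis (2 * pi * t)"
proof -
  have e: "w = cis (Arg2pi w)" using Arg2pi_eq[of w] assms(1) by (simp add: cis_conv_exp)
  have "Arg2pi w \<noteq> 0" using e assms(2) by auto
  then have "0 < Arg2pi w" "Arg2pi w < 2 * pi" using Arg2pi[of w] by auto
  then show thesis by (intro that[of "Arg2pi w / (2 * pi)"]) (use e in auto)
qed

lemma disc_cells_bij:
  assumes "bij_betw f disc P"
  shows "bij_betw (case_sum (\<lambda>v. f 1) (case_sum (\<lambda>(e, t). f (cis (2 * pi * t))) (\<lambda>(k, w). f w)))
      ({..<1 :: nat} <+> (({..<1 :: nat} \<times> {0<..<1}) <+> ({..<1 :: nat} \<times> ball 0 1))) P"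
proof -
  let ?A = "{..<1 :: nat} <+> (({..<1 :: nat} \<times> {0<..<1}) <+> ({..<1 :: nat} \<times> ball 0 1)) ::
    (nat + (nat \<times> real) + (nat \<times> complex)) set"
  let ?g = "case_sum (\<lambda>v. 1) (case_sum (\<lambda>(e, t). cis (2 * pi * t)) (\<lambda>(k, w). w)) ::
    nat + (nat \<times> real) + (nat \<times> complex) \<Rightarrow> complex"
  have ne1: "cis (2 * pi * t) \<noteq> 1" if "0 < t" "t < 1" for t
  proof
    assume "cis (2 * pi * t) = 1"
    then obtain n :: int where "2 * pi * t = 2 * pi * of_int n" unfolding cis_eq_1_iff by blast
    then have "t = of_int n" by simp
    then show False using that by simp
  qed
  have inj: "s = t" if h: "cis (2 * pi * s) = cis (2 * pi * t)" "0 < s" "s < 1" "0 < t" "t < 1" for s t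
  proof -
    obtain n :: int where "2 * pi * s = 2 * pi * t + 2 * pi * of_int n"
      using cis_eq_iff[THEN iffD1, OF h(1)] by blast
    then have "2 * pi * s = 2 * pi * (t + of_int n)" by (simp add: algebra_simps)
    then have "s = t + of_int n" by simp
    moreover then have "n = 0" using h by linarith
    ultimately show ?thesis by simp
  qed
  have nb: "cis a \<notin> ball 0 1" "(1 :: complex) \<notin> ball 0 1" for a by auto
  have "bij_betw ?g ?A disc"
    unfolding bij_betw_def
  proof
    show "inj_on ?g ?A"
    proof (rule inj_onI)
      fix x y assume xy: "x \<in> ?A" "y \<in> ?A" "?g x = ?g y"
      have cell: "z = Inl 0 \<or> (\<exists>t. z = Inr (Inl (0, t)) \<and> 0 < t \<and> t < 1) \<or> (\<exists>w. z = Inr (Inr (0, w)) \<and> w \<in> ball 0 1)"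
        if "z \<in> ?A" for z using that by (auto simp: Plus_def)
      show "x = y"
        using cell[OF xy(1)] cell[OF xy(2)] xy(3) by (elim disjE exE conjE) (auto simp: ne1 ne1[symmetric] dest: inj)
    qed
    show "?g ` ?A = disc"
    proof
      show "disc \<subseteq> ?g ` ?A"
      proof
        fix w :: complex assume w: "w \<in> disc"
        consider "w = 1" | "w \<in> sphere 0 1" "w \<noteq> 1" | "w \<in> ball 0 1" using w by force
        then show "w \<in> ?g ` ?A"
        proof cases
          case 1
          then show ?thesis by (intro image_eqI[of _ _ "Inl 0"]) auto
        next
          case 2
          then obtain t where "t \<in> {0<..<1}" "w = cis (2 * pi * t)" by (rule polar_decomposition_disc)
          then show ?thesis by (intro image_eqI[of _ _ "Inr (Inl (0, t))"]) auto
        next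
          case 3
          then show ?thesis by (intro image_eqI[of _ _ "Inr (Inr (0, w))"]) auto
        qed
      qed
    qed (auto simp: Plus_def)
  qed
  then have "bij_betw (f \<circ> ?g) ?A P" by (rule bij_betw_trans) (rule assms)
  moreover have "f \<circ> ?g = case_sum (\<lambda>v. f 1) (case_sum (\<lambda>(e, t). f (cis (2 * pi * t))) (\<lambda>(k, w). f w))"
    by (auto simp: fun_eq_iff split: sum.split)
  ultimately show ?thesis by metis
qed

text \<open>The component is ingoing if \<open>b\<close> is true.\<close>

lemma disc_presented:
  fixes \<Sigma> :: "('p, 'q) bordism" and b :: bool
  assumes bord: "rspin_bordism r \<Sigma>" and disc: "is_disc \<Sigma>"
    and ins: "ins \<Sigma> = (if b then [2 mod int r] else [])" and outs: "outs \<Sigma> = (if b then [] else [0])"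
  shows "\<exists>s. presented_by r \<Sigma> (one_gon s (if b then [0] else []) (if b then [] else [0]))"
proof -
  obtain f where f: "homeomorphic_map (top_of_set disc) (stop \<Sigma>) f" "immersion_on \<Sigma> disc f"
    "f ` sphere 0 1 = surface_boundary \<Sigma>"
    using disc by (auto simp: is_disc_def)
  interpret disc_frame r \<Sigma> f
    by unfold_locales (use bord f in \<open>auto simp: rspin_bordism_def\<close>)
  obtain \<sigma> where \<sigma>: "framed disc \<sigma>" using global_lift by blast
  define \<kappa> where "\<kappa> = (if b then 2 mod int r else 0)"
  define \<phi> where "\<phi> = (if b then phi_in \<Sigma> 0 else phi_out \<Sigma> 0)"
  define \<Phi> where "\<Phi> = (if b then lphi_in \<Sigma> 0 else lphi_out \<Sigma> 0)"
  \<comment> \<open>The two constants of \<open>presented_by\<close>. In both cases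
    \<open>cis \<beta>\<close> is \<i> times the inward sign \<open>\<epsilon>\<close>.\<close>
  define \<beta> where "\<beta> = (if b then pi / 2 else 3 * pi / 2)"
  define \<epsilon> :: real where "\<epsilon> = (if b then 1 else - 1)"
  have circ: "circles \<Sigma> = [\<phi> ` sphere 0 1]" by (auto simp: circles_def ins outs \<phi>_def)
  have \<phi>_boundary: "\<phi> ` sphere 0 1 = surface_boundary \<Sigma>"
    using bord by (simp add: rspin_bordism_def circ)
  obtain U V where U: "open V" "sphere 0 1 \<subseteq> V" "0 \<notin> V"
    "U = (if b then {z \<in> V. cmod z \<ge> 1} else {z \<in> V. cmod z \<le> 1})" "parametrised_collar r \<Sigma> U \<kappa> \<phi> \<Phi>"
  proof (cases b)
    case True
    then have "\<exists>U. ingoing_collar U \<and> parametrised_collar r \<Sigma> U \<kappa> \<phi> \<Phi>"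
      using bord by (simp add: rspin_bordism_def ins \<kappa>_def \<phi>_def \<Phi>_def)
    then show thesis using that True by (auto simp: ingoing_collar_def)
  next
    case False
    then have "\<exists>U. outgoing_collar U \<and> parametrised_collar r \<Sigma> U \<kappa> \<phi> \<Phi>"
      using bord by (simp add: rspin_bordism_def outs \<kappa>_def \<phi>_def \<Phi>_def)
    then show thesis using that False by (auto simp: outgoing_collar_def)
  qed
  interpret disc_collar r \<Sigma> f U \<kappa> \<phi> \<Phi> \<sigma> \<epsilon> \<beta>
  proof
    show "sphere 0 1 \<subseteq> U" using U(2,4) by auto
    show "\<epsilon> = 1 \<or> \<epsilon> = - 1" by (simp add: \<epsilon>_def)
    have "3 * pi / 2 = pi / 2 + pi" by simp
    then have "cis (3 * pi / 2) = cis (pi / 2) * cis pi" by (simp only: cis_mult)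
    then have "cis (3 * pi / 2) = - \<i>" by simp
    then show "cis \<beta> = \<i> * of_real \<epsilon>" by (simp add: \<beta>_def \<epsilon>_def)
    fix z :: complex assume z: "z \<in> sphere 0 1"
    then obtain d where d: "d > 0" "ball z d \<subseteq> V" using U(1,2) by (meson open_contains_ball subsetD)
    show "\<exists>\<delta>>0. \<forall>s. 0 \<le> s \<and> s < \<delta> \<longrightarrow> z + s *\<^sub>R (of_real \<epsilon> * z) \<in> U"
    proof (intro exI[of _ "min d 1"] conjI allI impI)
      fix s assume s: "0 \<le> s \<and> s < min d 1"
      have e: "z + s *\<^sub>R (of_real \<epsilon> * z) = (1 + s * \<epsilon>) *\<^sub>R z" by (simp add: algebra_simps scaleR_conv_of_real)
      have "dist z (z + s *\<^sub>R (of_real \<epsilon> * z)) = s"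
        using s z by (simp add: dist_norm norm_mult \<epsilon>_def)
      then have "z + s *\<^sub>R (of_real \<epsilon> * z) \<in> V" using d s by auto
      moreover have "cmod (z + s *\<^sub>R (of_real \<epsilon> * z)) = 1 + s * \<epsilon>"
        unfolding e using s z by (simp add: \<epsilon>_def)
      ultimately show "z + s *\<^sub>R (of_real \<epsilon> * z) \<in> U"
        using s unfolding U(4) by (cases b) (simp_all add: \<epsilon>_def)
    qed (use d in auto)
  qed (use f \<sigma> U(5) \<phi>_boundary in auto)
  obtain \<alpha>0 where \<alpha>0: "\<phi> (cis \<alpha>0) = f 1"
  proof -
    have "f 1 \<in> \<phi> ` sphere 0 1" unfolding \<phi>_boundary f(3)[symmetric] by simp
    then obtain z where z: "z \<in> sphere 0 1" "f 1 = \<phi> z" by blast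
    then have "z = cis (Arg2pi z)" using Arg2pi_eq[of z] by (simp add: cis_conv_exp)
    then show thesis using that z by metis
  qed
  obtain s where s: "s \<in> Zr r"
    "\<And>t \<alpha>. t \<in> {0<..<1} \<Longrightarrow> \<alpha> \<in> {\<alpha>0<..<\<alpha>0 + 2 * pi} \<Longrightarrow> \<phi> (cis \<alpha>) = f (cis (2 * pi * t)) \<Longrightarrow>
      transition_index r \<Sigma> s (\<sigma> (cis (2 * pi * t))) (2 * pi * t + pi / 2)
        (\<Phi> (gl_one r, cis \<alpha>)) (\<beta> + (1 - of_int \<kappa>) * \<alpha>)"
    using boundary_index_exists[OF \<alpha>0] by blast
  let ?bi = "if b then [0] else []" and ?bo = "if b then [] else [0]"
  let ?D = "one_gon s ?bi ?bo"
  define \<gamma> :: "nat \<Rightarrow> real \<Rightarrow> 'p" where "\<gamma> = (\<lambda>e t. f (cis (2 * pi * t)))"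
  \<comment> \<open>The only side of the 1-gon lies to the left of its edge, so only that case of
    the index condition occurs, with \<open>\<alpha>0\<close> the parameter of the vertex.\<close>
  have bi: "boundary_index r \<Sigma> ?D (\<lambda>k. \<sigma>) \<gamma> 0 \<kappa> \<beta> \<phi> \<Phi>"
    unfolding boundary_index_def
    by (rule exI[of _ \<alpha>0]) (use \<alpha>0 s(2) in \<open>auto simp: \<gamma>_def poly_angle_def Let_def\<close>)
  have circle: "(\<lambda>t. cis (2 * pi * t)) ` {0..1} = sphere 0 1"
  proof
    show "sphere 0 1 \<subseteq> (\<lambda>t. cis (2 * pi * t)) ` {0..1}"
    proof
      fix w :: complex assume w: "w \<in> sphere 0 1"
      show "w \<in> (\<lambda>t. cis (2 * pi * t)) ` {0..1}"
      proof (cases "w = 1")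
        case True
        then show ?thesis by (intro image_eqI[of _ _ 0]) auto
      next
        case False
        then obtain t where "t \<in> {0<..<1}" "w = cis (2 * pi * t)" using w by (metis polar_decomposition_disc)
        then show ?thesis by auto
      qed
    qed
  qed auto
  have \<gamma>_image: "\<gamma> e ` {0..1} = \<phi> ` sphere 0 1" for e
  proof -
    have "\<gamma> e ` {0..1} = f ` ((\<lambda>t. cis (2 * pi * t)) ` {0..1})" by (simp add: \<gamma>_def image_image)
    then show ?thesis unfolding circle f(3) \<phi>_boundary .
  qed
  have "inj_on f disc" "f ` disc = points \<Sigma>"
    using homeomorphic_imp_injective_map[OF f(1)] homeomorphic_imp_surjective_map[OF f(1)] by auto
  then have bij: "bij_betw f disc (points \<Sigma>)" by (simp add: bij_betw_def)
  have "decomposes \<Sigma> ?D (\<lambda>k. f) \<gamma> (\<lambda>v. f 1)"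
    unfolding decomposes_def
  proof (intro conjI allI impI)
    show "bij_betw (case_sum (\<lambda>v. f 1) (case_sum (\<lambda>(e, t). \<gamma> e t) (\<lambda>(k, w). f w)))
      ({..<nvt ?D} <+> (({..<ned ?D} \<times> {0<..<1}) <+> ({..<nfc ?D} \<times> ball 0 1))) (points \<Sigma>)"
      using disc_cells_bij[OF bij] by (simp add: \<gamma>_def)
    show "immersion_on \<Sigma> (polygon (nsd ?D k)) f" for k
      unfolding one_gon_simps polygon_1 by (rule immersion_on_subset[OF f(2)]) auto
    show "continuous_map (top_of_set disc) (stop \<Sigma>) f" by (rule f_continuous)
    show "\<gamma> (bin ?D ! i) ` {0..1} = phi_in \<Sigma> i ` sphere 0 1" if "i < length (bin ?D)" for i
      using that \<gamma>_image by (auto simp: \<phi>_def split: if_splits)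
    show "\<gamma> (bout ?D ! i) ` {0..1} = phi_out \<Sigma> i ` sphere 0 1" if "i < length (bout ?D)" for i
      using that \<gamma>_image by (auto simp: \<phi>_def split: if_splits)
  qed (auto simp: ins outs \<gamma>_def poly_angle_def)
  moreover have "marked_decomposition r ?D" by (rule one_gon_marked[OF s(1)]) simp
  moreover have "admissible r ?D (ins \<Sigma>) (outs \<Sigma>)" by (rule one_gon_admissible) (auto simp: ins outs)
  ultimately have "presented_by r \<Sigma> ?D"
    unfolding presented_by_def
    by (intro conjI exI[of _ "\<lambda>k. f"] exI[of _ \<gamma>] exI[of _ "\<lambda>v. f 1"] exI[of _ "\<lambda>k. \<sigma>"])
      (use face_trivialisation_framed[OF \<sigma>] bi in \<open>auto simp: ins outs \<kappa>_def \<phi>_def \<Phi>_def \<beta>_def split: if_splits\<close>)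
  then show ?thesis by blast
qed

section \<open>Comparison of the graded center with the values of the theory\<close>

theorem proposition3p10:
  fixes r :: nat
    and S :: "('o, 'm) smc"
    and A :: "('o, 'm) frob"
    and Z :: "int \<Rightarrow> 'o" and \<iota> \<pi> :: "int \<Rightarrow> 'm"
    and Zo :: "int list \<Rightarrow> 'o" and Zm :: "('p, 'q) bordism \<Rightarrow> 'm"
    and S12 S21 :: "int \<Rightarrow> int \<Rightarrow> ('p, 'q) bordism" and S10 S01 :: "('p, 'q) bordism"
    and B :: "('o, 'm) frob" and inc :: "int \<Rightarrow> 'm"
  assumes "smc_data.strict_symmetric_monoidal S" "smc_data.additive S"
    and "smc_data.idempotent_complete S"
    and "r = 0 \<longrightarrow> smc_data.distributive_countable_sums S"
    and "smc_data.frobenius_algebra S A"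
    and "\<exists>u. smc_data.inverse_element S A (smc_data.window S A) u"
    and "smc_data.npow S (Car A) (smc_data.nakayama S A) r = Idn S (Car A)"
    and "smc_data.splits_P S r A Z \<iota> \<pi>"
    and "smc_data.state_sum_theory S r A Z \<iota> \<pi> Zo Zm"
    and "\<forall>a\<in>Zr r. \<forall>b\<in>Zr r. is_S12 r a b (S12 a b)" "is_S10 r S10"
    and "\<forall>a\<in>Zr r. \<forall>b\<in>Zr r. is_S21 r a b (S21 a b)" "is_S01 r S01"
  shows "(smc_data.graded_center_algebra S r A Z \<iota> \<pi> B inc \<longleftrightarrow>
            smc_data.graded_algebra S r (\<lambda>a. Zo [a]) (\<lambda>a b. Zm (S12 a b)) (Zm S10) B inc) \<and>
         (r > 0 \<longrightarrow>
           (smc_data.graded_center_algebra S r A Z \<iota> \<pi> B inc \<and>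
            smc_data.graded_center_coalgebra S r A Z \<iota> \<pi> B inc \<longleftrightarrow>
            smc_data.graded_algebra S r (\<lambda>a. Zo [a]) (\<lambda>a b. Zm (S12 a b)) (Zm S10) B inc \<and>
            smc_data.graded_coalgebra S r (\<lambda>a. Zo [a]) (\<lambda>a b. Zm (S21 a b)) (Zm S01) B inc))"
proof -
  interpret split_frobenius S A r Z \<iota> \<pi>
    by unfold_locales (use assms in auto)
  have Zm: "Zm \<Sigma> = state_sum A \<iota> \<pi> (ins \<Sigma>) (outs \<Sigma>) D V"
    if "rspin_bordism r \<Sigma>" "presented_by r \<Sigma> D" "vertex_choice D V" for \<Sigma> :: "('p, 'q) bordism" and D V
    using assms(9) that by (simp add: state_sum_theory_def)
  have Zo: "Zo [a] = Z a" if "a \<in> Zr r" for a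
    using assms(9) that by (simp add: state_sum_theory_def)
  have S12: "Zm (S12 a b) = \<pi> ((a + b) mod int r) \<cdot>\<^bsub>S\<^esub> Mul A \<cdot>\<^bsub>S\<^esub> (\<iota> a \<otimes>\<^bsub>S\<^esub> \<iota> b)" if ab: "a \<in> Zr r" "b \<in> Zr r" for a b
  proof -
    have s: "is_S12 r a b (S12 a b)" using assms(10) ab by blast
    obtain V where V: "vertex_choice (nine_gon r [0, 1, 2] (\<lambda>j. [a - 1, b - 1, 1 - (a + b)] ! j) [3, 4] [5]) V"
      "state_sum A \<iota> \<pi> [a, b] [(a + b) mod int r] (nine_gon r [0, 1, 2] (\<lambda>j. [a - 1, b - 1, 1 - (a + b)] ! j) [3, 4] [5]) V
        = \<pi> ((a + b) mod int r) \<cdot>\<^bsub>S\<^esub> Mul A \<cdot>\<^bsub>S\<^esub> (\<iota> a \<otimes>\<^bsub>S\<^esub> \<iota> b)"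
      using state_sum_pants[OF ab refl] by blast
    show ?thesis using Zm[OF _ _ V(1), of "S12 a b"] s V(2) unfolding is_S12_def by metis
  qed
  have S21: "Zm (S21 a b) = (\<pi> a \<otimes>\<^bsub>S\<^esub> \<pi> b) \<cdot>\<^bsub>S\<^esub> Com A \<cdot>\<^bsub>S\<^esub> lmul A (window A) \<cdot>\<^bsub>S\<^esub> \<iota> ((a + b - 2) mod int r)"
    if ab: "a \<in> Zr r" "b \<in> Zr r" for a b
  proof -
    have s: "is_S21 r a b (S21 a b)" using assms(12) ab by blast
    obtain V where V: "vertex_choice (nine_gon r [2, 1, 0] (\<lambda>j. [1 - a, 1 - b, (a + b - 2) - 1] ! j) [5] [3, 4]) V"
      "state_sum A \<iota> \<pi> [(a + b - 2) mod int r] [a, b] (nine_gon r [2, 1, 0] (\<lambda>j. [1 - a, 1 - b, (a + b - 2) - 1] ! j) [5] [3, 4]) V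
        = (\<pi> a \<otimes>\<^bsub>S\<^esub> \<pi> b) \<cdot>\<^bsub>S\<^esub> Com A \<cdot>\<^bsub>S\<^esub> lmul A (window A) \<cdot>\<^bsub>S\<^esub> \<iota> ((a + b - 2) mod int r)"
      using state_sum_copants[OF ab refl] by blast
    show ?thesis using Zm[OF _ _ V(1), of "S21 a b"] s V(2) unfolding is_S21_def by metis
  qed
  have zero: "0 \<in> Zr r" using Zr_mod(2)[of 0 r] by simp
  have S10: "Zm S10 = \<pi> 0 \<cdot>\<^bsub>S\<^esub> Eta A"
  proof -
    have s: "rspin_bordism r S10" "is_disc S10" "ins S10 = []" "outs S10 = [0]"
      using assms(11) by (auto simp: is_S10_def)
    obtain k where "presented_by r S10 (one_gon k [] [0])"
      using disc_presented[OF s(1,2), of False] s(3,4) by auto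
    from Zm[OF s(1) this one_gon_vertex_choice] show ?thesis
      by (simp add: s(3,4) state_sum_disc_out[OF zero])
  qed
  have S01: "Zm S01 = Eps A \<cdot>\<^bsub>S\<^esub> lmul A (window_inv A) \<cdot>\<^bsub>S\<^esub> \<iota> (2 mod int r)"
  proof -
    have s: "rspin_bordism r S01" "is_disc S01" "ins S01 = [2 mod int r]" "outs S01 = []"
      using assms(13) by (auto simp: is_S01_def)
    obtain k where "presented_by r S01 (one_gon k [0] [])"
      using disc_presented[OF s(1,2), of True] s(3,4) by auto
    from Zm[OF s(1) this one_gon_vertex_choice] show ?thesis
      by (simp add: s(3,4) state_sum_disc_in)
  qed
  \<comment> \<open>Both conditions look at the components only at indices in \<open>Zr r\<close>,
    where the values of the theory have just been computed, so they agree for every \<open>B\<close>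
    and \<open>inc\<close>.\<close>
  have alg: "graded_center_algebra r A Z \<iota> \<pi> B inc \<longleftrightarrow>
      graded_algebra r (\<lambda>a. Zo [a]) (\<lambda>a b. Zm (S12 a b)) (Zm S10) B inc"
    unfolding graded_center_algebra_def graded_algebra_def direct_sum_def
    by (simp add: Zo S12 S10 cong: ball_cong)
  have coalg: "graded_center_coalgebra r A Z \<iota> \<pi> B inc \<longleftrightarrow>
      graded_coalgebra r (\<lambda>a. Zo [a]) (\<lambda>a b. Zm (S21 a b)) (Zm S01) B inc" if "r > 0"
  proof -
    have int_Zr: "int i \<in> Zr r" if "i < r" for i
      using Zr_mod(2)[of "int i" r] that by simp
    \<comment> \<open>The value at \<open>S21 a b\<close> is known for indices in
      \<open>Zr r\<close>, so the summands are compared one by one: \<open>a\<close> runs through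
      \<open>0..<r\<close>, and \<open>b\<close> is a residue.\<close>
    have maps: "map (\<lambda>a. let b = (k + 2 - a) mod int r in (inc a \<otimes>\<^bsub>S\<^esub> inc b) \<cdot>\<^bsub>S\<^esub>
          (\<pi> a \<otimes>\<^bsub>S\<^esub> \<pi> b) \<cdot>\<^bsub>S\<^esub> Com A \<cdot>\<^bsub>S\<^esub> lmul A (window A) \<cdot>\<^bsub>S\<^esub> \<iota> ((a + b - 2) mod int r)) (map int [0..<r])
      = map (\<lambda>a. let b = (k + 2 - a) mod int r in (inc a \<otimes>\<^bsub>S\<^esub> inc b) \<cdot>\<^bsub>S\<^esub> Zm (S21 a b)) (map int [0..<r])" for k
      by (rule map_cong[OF refl]) (auto simp: Let_def S21 int_Zr Zr_mod(2))
    show ?thesis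
      unfolding graded_center_coalgebra_def graded_coalgebra_def maps
      by (simp add: Zo S01 cong: ball_cong)
  qed
  show ?thesis using alg coalg by blast
qed

end
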